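(* Let $n \geq 4$ and $\frac{2n}{n-1} \leq p < n$. Then for every $u \in W^{1,p}(\mathbb{H}^n)$, \[ \int_{\mathbb{B}^n} |\nabla_g u|_g^p \, dV - \left(\frac{n-1}{p}\right)^p \int_{\mathbb{B}^n} |u|^p \, dV \;\geq\; S(n,p)^p \left(\int_{\mathbb{B}^n} |u|^{\frac{np}{n-p}} \, dV\right)^{\frac{n-p}{n}}. \] Moreover, equality holds if and only if $u \equiv 0$.
   Context: $\mathbb{H}^n$ denotes the hyperbolic space in the Poincaré ball model: the unit ball $\mathbb{B}^n \subset \mathbb{R}^n$ with metric $g(x) = \frac{4}{(1-|x|^2)^2}\sum_{i=1}^n dx_i^2$. Its volume element is $dV = \left(\frac{2}{1-|x|^2}\right)^n dx$. The hyperbolic gradient is $\nabla_g = \left(\frac{1-|x|^2}{2}\right)^2 \nabla$, and $|\nabla_g u|_g = \sqrt{g(\nabla_g u, \nabla_g u)} = \frac{1-|x|^2}{2}|\nabla u|$. $W^{1,p}(\mathbb{H}^n)$ is the completion of $C_0^\infty(\mathbb{B}^n)$ under the norm $\left(\int_{\mathbb{B}^n} |\nabla_g u|_g^p\,dV + \int_{\mathbb{B}^n}|u|^p\,dV\right)^{1/p}$. For $1<p<n$, $S(n,p)$ is the sharp (largest) constant in the Euclidean Sobolev inequality $S(n,p)\|u\|_{L^{np/(n-p)}(\mathbb{R}^n)} \leq \|\nabla u\|_{L^p(\mathbb{R}^n)}$ for all $u \in C_0^\infty(\mathbb{R}^n)$. Explicitly, \[ S(n,p) = \left[\frac{1}{n}\left(\frac{n(p-1)}{n-p}\right)^{1-\frac1p}\left(\frac{\Gamma(n)}{\Gamma(\frac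 np)\Gamma(n+1-\frac np)\sigma_n}\right)^{\frac1n}\right]^{-1}, \] where $\sigma_n$ is the volume of the unit ball in $\mathbb{R}^n$. *)

theory Defs
  imports "HOL-Analysis.Analysis"
begin

definition hyp_vol :: "('n::finite) itself \<Rightarrow> (real^'n) measure" where
  "hyp_vol _ = density lebesgue
     (\<lambda>x. indicator (ball 0 1) x * ennreal ((2 / (1 - (norm x)\<^sup>2)) ^ CARD('n)))"

fun iter_partial :: "'n list \<Rightarrow> (real^'n::finite \<Rightarrow> real) \<Rightarrow> (real^'n \<Rightarrow> real)" where
  "iter_partial [] f = f"
| "iter_partial (i # is) f = (\<lambda>x. frechet_derivative (iter_partial is f) (at x) (axis i 1))"

definition smooth_fun :: "(real^'n::finite \<Rightarrow> real) \<Rightarrow> bool" where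
  "smooth_fun f \<longleftrightarrow> (\<forall>is x. iter_partial is f differentiable (at x))"

definition test_fun :: "(real^'n::finite \<Rightarrow> real) \<Rightarrow> bool" where
  "test_fun f \<longleftrightarrow> smooth_fun f \<and> compact (closure {x. f x \<noteq> 0})
      \<and> closure {x. f x \<noteq> 0} \<subseteq> ball 0 1"

definition egrad :: "(real^'n::finite \<Rightarrow> real) \<Rightarrow> real^'n \<Rightarrow> real^'n" where
  "egrad f x = (\<chi> i. frechet_derivative f (at x) (axis i 1))"

definition hyp_grad_norm :: "(real^'n::finite \<Rightarrow> real^'n) \<Rightarrow> real^'n \<Rightarrow> real" where
  "hyp_grad_norm G x = (1 - (norm x)\<^sup>2) / 2 * norm (G x)"

text \<open>W^{1,p}(H^n) as the completion of C_0^infinity(B^n) under the norm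
  (int |nabla_g u|_g^p dV + int |u|^p dV)^(1/p): an element is represented by a pair
  (u, G) of measurable functions (G is the Euclidean weak gradient of u) that is the limit
  of a sequence of test functions in this norm.\<close>
definition W1p :: "real \<Rightarrow> ((real^'n::finite \<Rightarrow> real) \<times> (real^'n \<Rightarrow> real^'n)) set" where
  "W1p p = {(u, G). u \<in> borel_measurable lebesgue \<and> G \<in> borel_measurable lebesgue \<and>
     (\<exists>\<phi> :: nat \<Rightarrow> real^'n \<Rightarrow> real. (\<forall>k. test_fun (\<phi> k)) \<and>
        (\<lambda>k. \<integral>\<^sup>+x. ennreal (\<bar>\<phi> k x - u x\<bar> powr p) \<partial>hyp_vol TYPE('n)) \<longlonglongrightarrow> 0 \<and>
        (\<lambda>k. \<integral>\<^sup>+x. ennreal (hyp_grad_norm (\<lambda>y. egrad (\<phi> k) y - G y) x powr p)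
                \<partial>hyp_vol TYPE('n)) \<longlonglongrightarrow> 0)}"

text \<open>The sharp Euclidean Sobolev constant S(n,p); sigma_n = volume of the unit ball.\<close>
definition sobolev_const :: "nat \<Rightarrow> real \<Rightarrow> real" where
  "sobolev_const n p = inverse
     (1 / real n * (real n * (p - 1) / (real n - p)) powr (1 - 1 / p)
      * (Gamma (real n) / (Gamma (real n / p) * Gamma (real n + 1 - real n / p)
          * unit_ball_vol (real n))) powr (1 / real n))"

end

theory Submission
  imports Defs "HOL-Real_Asymp.Real_Asymp"
begin

text \<open>
  The Cayley map turns the ball into the half-space with the measure \<open>dz / z\<^sub>1 ^ n\<close>. The
  Brunn--Minkowski inequality and a one-dimensional transport along the height coordinate show that a set of
  hyperbolic volume \<open>V\<close> has at least the perimeter of a geodesic ball of that volume, and the perimeter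
  profile \<open>A\<close> of geodesic balls satisfies \<open>A(V) powr p \<ge> P(V) powr p + ((n - 1) * V) powr p\<close>,
  where \<open>P\<close> is the Euclidean profile; this is where \<open>2 * n / (n - 1) \<le> p\<close> is needed. The coarea inequality and
  Hoelder's inequality for pairs split the gradient energy into two one-dimensional problems: the Euclidean
  one is Bliss' inequality with the constant \<open>S(n,p)\<close>, the other one is Hardy's inequality with the constant
  \<open>((n - 1) / p) powr p\<close>. The first is solved by transporting the level sets onto an Aubin--Talenti bubble.
  Perturbing the optimal weight in Hardy's inequality gains a positive remainder, which excludes equality; the
  result passes to the completion by Fatou's lemma.
\<close>

text \<open>Functions are not symmetrized, and the coarea formula enters as an inequality only. For
  a weight \<open>a\<close> depending on the level, Young's inequality
  \<open>p * (a powr (p - 1) * g) \<le> g powr p + (p - 1) * a powr p\<close> and coarea bound the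
  energy from below by an integral over levels of \<open>a powr (p - 1)\<close> against the
  perimeter profile. As the profile dominates the \<open>l^p\<close> norm of the pair formed by the
  Euclidean profile and \<open>(n - 1) * V\<close>, the weight can be the \<open>l^p\<close> norm of
  two weights chosen independently: each meets its own one-dimensional problem, and no constant is
  lost. The exponent \<open>2 * n / (n - 1)\<close> is the one at which the power of the Euclidean
  profile is quadratic in \<open>V\<close>; there the profile inequality follows by repeated
  differentiation, and larger exponents follow because \<open>l^p\<close> norms decrease in
  \<open>p\<close>. Strictness for single test functions would disappear in the limit, hence a
  remainder in integral form. Elements of the completion are pairs \<open>(u, G)\<close>, so
  equality for \<open>u = 0\<close> needs in addition that the gradient is closable:
  \<open>u = 0\<close> must force \<open>G = 0\<close>.\<close>

section \<open>Layer cake formula and Brunn-Minkowski inequality\<close>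

text \<open>Fubini on the region under the graph. The kernel \<open>k\<close> later turns a weight
  on the levels into an integral of its primitive, evaluated at the function.\<close>

lemma nn_integral_layer_cake:
  fixes f :: "'a \<Rightarrow> real" and k :: "real \<Rightarrow> ennreal"
  assumes "sigma_finite_measure M" and f[measurable]: "f \<in> borel_measurable M"
    and k[measurable]: "k \<in> borel_measurable borel"
  shows "(\<integral>\<^sup>+x. (\<integral>\<^sup>+t. k t * indicator {0..<f x} t \<partial>lborel) \<partial>M)
       = (\<integral>\<^sup>+t. k t * indicator {0..} t * emeasure M {x\<in>space M. t < f x} \<partial>lborel)"
proof -
  interpret M: sigma_finite_measure M by fact
  interpret pair_sigma_finite lborel M ..
  have [simp]: "indicator {0..<f x} t = (indicator {0..} t * indicator {x\<in>space M. t < f x} x :: ennreal)"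
    if "x \<in> space M" for x t
    using that by (auto simp: indicator_def)
  have "(\<integral>\<^sup>+x. (\<integral>\<^sup>+t. k t * indicator {0..<f x} t \<partial>lborel) \<partial>M)
     = (\<integral>\<^sup>+x. (\<integral>\<^sup>+t. k t * indicator {0..} t * indicator {x\<in>space M. t < f x} x \<partial>lborel) \<partial>M)"
    by (intro nn_integral_cong) (simp add: mult.assoc)
  also have "\<dots> = (\<integral>\<^sup>+x. (\<integral>\<^sup>+t. k t * indicator {0..} t * (if t < f x then 1 else 0) \<partial>lborel) \<partial>M)"
    by (intro nn_integral_cong) (auto simp: indicator_def)
  also have "\<dots> = (\<integral>\<^sup>+t. (\<integral>\<^sup>+x. k t * indicator {0..} t * (if t < f x then 1 else 0) \<partial>M) \<partial>lborel)"
    by (rule Fubini') measurable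
  also have "\<dots> = (\<integral>\<^sup>+t. (\<integral>\<^sup>+x. k t * indicator {0..} t * indicator {x\<in>space M. t < f x} x \<partial>M) \<partial>lborel)"
    by (intro nn_integral_cong) (auto simp: indicator_def)
  also have "\<dots> = (\<integral>\<^sup>+t. k t * indicator {0..} t * emeasure M {x\<in>space M. t < f x} \<partial>lborel)"
    by (intro nn_integral_cong, subst nn_integral_cmult_indicator) auto
  finally show ?thesis .
qed

lemma nn_integral_eq_superlevel:
  fixes f :: "'a \<Rightarrow> real"
  assumes "sigma_finite_measure M" "f \<in> borel_measurable M" "\<And>x. 0 \<le> f x"
  shows "(\<integral>\<^sup>+x. ennreal (f x) \<partial>M) = (\<integral>\<^sup>+t. indicator {0..} t * emeasure M {x\<in>space M. t < f x} \<partial>lborel)"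
proof -
  have "(\<integral>\<^sup>+t. 1 * indicator {0..<f x} t \<partial>lborel) = ennreal (f x)" for x
    using assms(3)[of x] by simp
  with nn_integral_layer_cake[OF assms(1,2), of "\<lambda>_. 1"] show ?thesis by simp
qed

lemma emeasure_lborel_translate:
  fixes A :: "real set"
  assumes [measurable]: "A \<in> sets borel"
  shows "emeasure lborel {x. x - c \<in> A} = emeasure lborel A"
proof -
  have "emeasure lborel A = emeasure (distr lborel borel ((+) (-c))) A"
    by (simp add: lborel_distr_plus)
  also have "\<dots> = emeasure lborel ((+) (-c) -` A \<inter> space lborel)"
    by (rule emeasure_distr) auto
  also have "(+) (-c) -` A \<inter> space lborel = {x. x - c \<in> A}" by auto
  finally show ?thesis ..
qed

text \<open>Translating \<open>K\<close> by the least point of \<open>L\<close>, and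
  \<open>L\<close> by the greatest point of \<open>K\<close>, puts both into the sum set; the two
  translates can meet only at \<open>a + b\<close>, which is a null set.\<close>

lemma brunn_minkowski_real_compact:
  fixes K L C :: "real set"
  assumes "compact K" "compact L" "K \<noteq> {}" "L \<noteq> {}" and C: "C \<in> sets borel"
    and sum: "\<And>x y. x \<in> K \<Longrightarrow> y \<in> L \<Longrightarrow> x + y \<in> C"
  shows "emeasure lborel K + emeasure lborel L \<le> emeasure lborel C"
proof -
  obtain a where a: "a \<in> K" "\<And>x. x \<in> K \<Longrightarrow> x \<le> a"
    using compact_attains_sup[OF assms(1,3)] by blast
  obtain b where b: "b \<in> L" "\<And>y. y \<in> L \<Longrightarrow> b \<le> y"
    using compact_attains_inf[OF assms(2,4)] by blast
  have [measurable]: "K \<in> sets borel" "L \<in> sets borel" using assms(1,2) by (auto intro: borel_compact)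
  define K' where "K' = {x. x - b \<in> K}"
  define L' where "L' = {x. x - a \<in> L}"
  have [measurable]: "K' \<in> sets borel" "L' \<in> sets borel" unfolding K'_def L'_def by measurable
  have "emeasure lborel K + emeasure lborel L = emeasure lborel K' + emeasure lborel L'"
    unfolding K'_def L'_def by (simp add: emeasure_lborel_translate)
  also have "emeasure lborel L' = emeasure lborel (L' - {a + b})"
    by (rule emeasure_Diff_null_set[symmetric]) auto
  also have "emeasure lborel K' + \<dots> = emeasure lborel (K' \<union> (L' - {a + b}))"
  proof (rule plus_emeasure)
    show "K' \<inter> (L' - {a + b}) = {}"
    proof -
      have "x = a + b" if "x - b \<in> K" "x - a \<in> L" for x using a(2)[OF that(1)] b(2)[OF that(2)] by simp
      thus ?thesis unfolding K'_def L'_def by auto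
    qed
  qed auto
  also have "\<dots> \<le> emeasure lborel C"
  proof (rule emeasure_mono)
    show "K' \<union> (L' - {a + b}) \<subseteq> C"
      unfolding K'_def L'_def using sum[OF _ b(1)] sum[OF a(1)] by (auto, metis diff_add_cancel, metis add.commute diff_add_cancel)
  qed (use C in auto)
  finally show ?thesis .
qed

text \<open>Regularity by compact sets is taken for the finite measure obtained by restricting
  Lebesgue measure to \<open>A\<close>; on subsets of \<open>A\<close> the two measures
  agree.\<close>

lemma emeasure_lborel_inner_compact:
  fixes A :: "real set"
  assumes [measurable]: "A \<in> sets borel" and fin: "emeasure lborel A < \<infinity>"
  shows "emeasure lborel A = (SUP K \<in> {K. K \<subseteq> A \<and> compact K}. emeasure lborel K)"
proof -
  define M where "M = density lborel (indicator A)"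
  have M: "emeasure M B = emeasure lborel (A \<inter> B)" if "B \<in> sets borel" for B
  proof -
    have "emeasure M B = (\<integral>\<^sup>+x. indicator (A \<inter> B) x \<partial>lborel)"
      using that unfolding M_def by (simp add: emeasure_density indicator_inter_arith)
    thus ?thesis using that by simp
  qed
  have s: "sets M = sets borel" by (simp add: M_def)
  have "emeasure M A = (SUP K \<in> {K. K \<subseteq> A \<and> compact K}. emeasure M K)"
    by (rule inner_regular) (use s fin M in \<open>auto simp: sets_eq_imp_space_eq[OF s]\<close>)
  also have "\<dots> = (SUP K \<in> {K. K \<subseteq> A \<and> compact K}. emeasure lborel K)"
    by (intro SUP_cong refl) (auto simp: M borel_compact Int_absorb1)
  finally show ?thesis using M[of A] by simp
qed

lemma brunn_minkowski_real:
  fixes A B C :: "real set"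
  assumes A: "A \<in> sets borel" "emeasure lborel A < \<infinity>" "A \<noteq> {}"
    and B: "B \<in> sets borel" "emeasure lborel B < \<infinity>" "B \<noteq> {}"
    and C: "C \<in> sets borel" and sum: "\<And>x y. x \<in> A \<Longrightarrow> y \<in> B \<Longrightarrow> x + y \<in> C"
  shows "emeasure lborel A + emeasure lborel B \<le> emeasure lborel C"
proof -
  obtain a b where ab: "a \<in> A" "b \<in> B" using A B by auto
  have *: "emeasure lborel K + emeasure lborel L \<le> emeasure lborel C"
    if "K \<subseteq> A" "compact K" "L \<subseteq> B" "compact L" for K L
  proof -
    \<comment> \<open>One point of each set is adjoined because the compact version needs nonempty
      sets, while the suprema below run over all compact subsets, the empty one included.\<close>
    have "emeasure lborel K + emeasure lborel L \<le> emeasure lborel (insert a K) + emeasure lborel (insert b L)"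
      using that by (intro add_mono emeasure_mono) (auto intro!: borel_compact compact_insert)
    also have "\<dots> \<le> emeasure lborel C"
      using that ab sum C by (intro brunn_minkowski_real_compact) (auto intro!: compact_insert)
    finally show ?thesis .
  qed
  have "emeasure lborel A + emeasure lborel B
     = (SUP K \<in> {K. K \<subseteq> A \<and> compact K}. SUP L \<in> {L. L \<subseteq> B \<and> compact L}. emeasure lborel K + emeasure lborel L)"
    unfolding emeasure_lborel_inner_compact[OF A(1,2)] emeasure_lborel_inner_compact[OF B(1,2)]
    by (subst ennreal_SUP_add_right[symmetric], force, subst ennreal_SUP_add_left[symmetric], force, simp)
  also have "\<dots> \<le> emeasure lborel C" by (intro SUP_least) (auto intro: *)
  finally show ?thesis .
qed

text \<open>The largest \<open>c\<close> in
  \<open>c * x powr (1 - \<theta>) * y powr \<theta> \<le> x + y\<close>, attained when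
  \<open>x\<close> and \<open>y\<close> are in the ratio of \<open>1 - \<theta>\<close> to
  \<open>\<theta>\<close>. It appears because sums \<open>x + y\<close> are used in place of the
  convex combinations of the usual Prekopa-Leindler inequality.\<close>

definition pl_const :: "real \<Rightarrow> real" where
  "pl_const \<theta> = (1 / (1 - \<theta>)) powr (1 - \<theta>) * (1 / \<theta>) powr \<theta>"

lemma pl_const_pos: "0 < \<theta> \<Longrightarrow> \<theta> < 1 \<Longrightarrow> pl_const \<theta> > 0"
  by (simp add: pl_const_def)

lemma pl_const_young:
  assumes "0 < \<theta>" "\<theta> < 1" "0 \<le> x" "0 \<le> y"
  shows "pl_const \<theta> * x powr (1 - \<theta>) * y powr \<theta> \<le> x + y"
proof (cases "x > 0 \<and> y > 0")
  case True
  have "(x / (1 - \<theta>)) powr (1 - \<theta>) * (y / \<theta>) powr \<theta> \<le> (1 - \<theta>) * (x / (1 - \<theta>)) + \<theta> * (y / \<theta>)"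
    using assms True by (intro Youngs_inequality_0) auto
  also have "\<dots> = x + y" using assms by simp
  also have "(x / (1 - \<theta>)) powr (1 - \<theta>) * (y / \<theta>) powr \<theta> = pl_const \<theta> * x powr (1 - \<theta>) * y powr \<theta>"
    using assms True unfolding pl_const_def by (simp add: powr_divide mult_ac)
  finally show ?thesis .
next
  case False
  hence "x = 0 \<or> y = 0" using assms by linarith
  thus ?thesis using assms by auto
qed

text \<open>Dividing by the suprema makes every level set of \<open>f / F\<close> and
  \<open>g / G\<close> at a level in \<open>{0..<1}\<close> nonempty, so one-dimensional
  Brunn-Minkowski applies level by level and gives an additive bound, namely the integrals of
  \<open>f / F\<close> and \<open>g / G\<close> add up to at most that of \<open>k\<close>. The
  weighted arithmetic-geometric mean then makes the bound multiplicative.\<close>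

lemma prekopa_leindler_real:
  fixes f g :: "real \<Rightarrow> real" and h :: "real \<Rightarrow> ennreal"
  assumes [measurable]: "f \<in> borel_measurable borel" "g \<in> borel_measurable borel" "h \<in> borel_measurable borel"
    and \<theta>: "0 < \<theta>" "\<theta> < 1"
    and f: "\<And>x. 0 \<le> f x" "\<And>x. f x \<le> N" "\<And>x. f x \<noteq> 0 \<Longrightarrow> \<bar>x\<bar> \<le> N"
    and g: "\<And>x. 0 \<le> g x" "\<And>x. g x \<le> N" "\<And>x. g x \<noteq> 0 \<Longrightarrow> \<bar>x\<bar> \<le> N"
    and h: "\<And>x y. ennreal (f x powr (1 - \<theta>) * g y powr \<theta>) \<le> h (x + y)"
  shows "ennreal (pl_const \<theta> * enn2real (\<integral>\<^sup>+x. f x \<partial>lborel) powr (1 - \<theta>) * enn2real (\<integral>\<^sup>+x. g x \<partial>lborel) powr \<theta>)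
      \<le> (\<integral>\<^sup>+x. h x \<partial>lborel)"
proof -
  define F where "F = Sup (range f)"
  define G where "G = Sup (range g)"
  have bdd: "bdd_above (range f)" "bdd_above (range g)" using f(2) g(2) by (auto intro!: bdd_aboveI)
  have fF: "f x \<le> F" for x unfolding F_def by (intro cSup_upper bdd) auto
  have gG: "g x \<le> G" for x unfolding G_def by (intro cSup_upper bdd) auto
  have F0: "0 \<le> F" "0 \<le> G" using fF[of 0] gG[of 0] f(1)[of 0] g(1)[of 0] by linarith+
  show ?thesis
  proof (cases "F = 0 \<or> G = 0")
    case True
    hence "(\<forall>x. f x = 0) \<or> (\<forall>x. g x = 0)" using fF gG f(1) g(1) by (metis order_antisym)
    thus ?thesis using \<theta> by auto
  next
    case False
    hence FG: "0 < F" "0 < G" using F0 by auto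
    define S where "S = F powr (1 - \<theta>) * G powr \<theta>"
    have S: "S > 0" using FG by (simp add: S_def)
    \<comment> \<open>\<open>h\<close> may be infinite. Cutting it at \<open>S\<close>, which bounds
      the left side of the hypothesis, loses nothing and leaves a real function.\<close>
    have minS: "ennreal (enn2real (min (h x) (ennreal S))) = min (h x) (ennreal S)" for x
      by (intro ennreal_enn2real min.strict_coboundedI2) simp
    define k where "k x = enn2real (min (h x) (ennreal S)) / S" for x
    have k[measurable]: "k \<in> borel_measurable borel" unfolding k_def by measurable
    have k0: "0 \<le> k x" for x using S by (simp add: k_def)
    have fin: "emeasure lborel {x. t < f x / F} < \<infinity>" "emeasure lborel {x. t < g x / G} < \<infinity>" if "0 \<le> t" for t
    proof -
      have *: "{x. t < f x / F} \<subseteq> {-N..N}" "{x. t < g x / G} \<subseteq> {-N..N}"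
      proof -
        have "\<bar>x\<bar> \<le> N" if "t < f x / F" for x using that \<open>0 \<le> t\<close> f(3)[of x] by (cases "f x = 0") auto
        moreover have "\<bar>x\<bar> \<le> N" if "t < g x / G" for x using that \<open>0 \<le> t\<close> g(3)[of x] by (cases "g x = 0") auto
        ultimately show "{x. t < f x / F} \<subseteq> {-N..N}" "{x. t < g x / G} \<subseteq> {-N..N}"
          by (auto simp: abs_le_iff) (metis minus_le_iff)+
      qed
      have "emeasure lborel {-N..N} < \<infinity>" by (simp add: emeasure_lborel_Icc_eq)
      thus "emeasure lborel {x. t < f x / F} < \<infinity>" "emeasure lborel {x. t < g x / G} < \<infinity>"
        using emeasure_mono[OF *(1), of lborel] emeasure_mono[OF *(2), of lborel] by (auto simp: le_less_trans)
    qed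
    have lev: "indicator {0..} t * emeasure lborel {x\<in>space lborel. t < f x / F}
        + indicator {0..} t * emeasure lborel {x\<in>space lborel. t < g x / G}
        \<le> indicator {0..} t * emeasure lborel {x\<in>space lborel. t < k x}" for t :: real
    proof (cases "0 \<le> t \<and> t < 1")
      case True
      have "\<exists>x. t * F < f x" using True FG less_cSup_iff[OF _ bdd(1), of "t * F"] by (auto simp: F_def[symmetric])
      then have ne1: "{x. t < f x / F} \<noteq> {}" using FG by (auto simp: field_simps)
      have "\<exists>x. t * G < g x" using True FG less_cSup_iff[OF _ bdd(2), of "t * G"] by (auto simp: G_def[symmetric])
      then have ne2: "{x. t < g x / G} \<noteq> {}" using FG by (auto simp: field_simps)
      have "emeasure lborel {x. t < f x / F} + emeasure lborel {x. t < g x / G} \<le> emeasure lborel {x. t < k x}"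
      proof (rule brunn_minkowski_real)
        fix x y assume "x \<in> {x. t < f x / F}" "y \<in> {x. t < g x / G}"
        hence xy: "t * F < f x" "t * G < g y" using FG by (auto simp: field_simps)
        have "(t * F) powr (1 - \<theta>) * (t * G) powr \<theta> < f x powr (1 - \<theta>) * g y powr \<theta>"
          using xy True FG \<theta> by (intro mult_strict_mono' powr_less_mono2) auto
        also have "(t * F) powr (1 - \<theta>) * (t * G) powr \<theta> = t * S"
          using True FG \<theta> by (cases "t = 0") (auto simp: S_def powr_mult powr_add[symmetric] mult_ac
              powr_diff)
        finally have 1: "t * S < f x powr (1 - \<theta>) * g y powr \<theta>" .
        have "ennreal (t * S) < h (x + y)"
        proof -
          have "ennreal (t * S) < ennreal (f x powr (1 - \<theta>) * g y powr \<theta>)"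
            using 1 True S by (intro ennreal_lessI) (auto intro: le_less_trans[rotated])
          also have "\<dots> \<le> h (x + y)" by (rule h)
          finally show ?thesis .
        qed
        moreover have "ennreal (t * S) < ennreal S" using True S by (intro ennreal_lessI) auto
        ultimately have "ennreal (t * S) < min (h (x + y)) (ennreal S)" by simp
        hence "t * S < enn2real (min (h (x + y)) (ennreal S))"
          using True S minS[of "x + y"] by (subst ennreal_less_iff[symmetric]) auto
        thus "x + y \<in> {x. t < k x}" using S by (simp add: k_def field_simps)
      qed (use True fin ne1 ne2 in auto)
      thus ?thesis using True by simp
    next
      case False
      have "f x / F \<le> 1" "g x / G \<le> 1" for x using fF gG FG by (auto simp: field_simps)
      then have "\<not> (t < f x / F)" "\<not> (t < g x / G)" if "0 \<le> t" for x
        using False that by (metis less_le_trans linorder_not_less)+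
      thus ?thesis by (cases "0 \<le> t") auto
    qed
    have "(\<integral>\<^sup>+x. ennreal (f x / F) \<partial>lborel) + (\<integral>\<^sup>+x. ennreal (g x / G) \<partial>lborel) \<le> (\<integral>\<^sup>+x. ennreal (k x) \<partial>lborel)"
    proof -
      have 1: "(\<integral>\<^sup>+x. ennreal (f x / F) \<partial>lborel) = (\<integral>\<^sup>+t. indicator {0..} t * emeasure lborel {x\<in>space lborel. t < f x / F} \<partial>lborel)"
        using FG f(1) by (intro nn_integral_eq_superlevel lborel.sigma_finite_measure_axioms) auto
      have 2: "(\<integral>\<^sup>+x. ennreal (g x / G) \<partial>lborel) = (\<integral>\<^sup>+t. indicator {0..} t * emeasure lborel {x\<in>space lborel. t < g x / G} \<partial>lborel)"
        using FG g(1) by (intro nn_integral_eq_superlevel lborel.sigma_finite_measure_axioms) auto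
      have 3: "(\<integral>\<^sup>+x. ennreal (k x) \<partial>lborel) = (\<integral>\<^sup>+t. indicator {0..} t * emeasure lborel {x\<in>space lborel. t < k x} \<partial>lborel)"
        using k0 by (intro nn_integral_eq_superlevel lborel.sigma_finite_measure_axioms) auto
      have 4: "(\<lambda>t. indicator {0..} t * emeasure lborel {x\<in>space lborel. t < q x}) \<in> borel_measurable borel"
        if [measurable]: "q \<in> borel_measurable borel" for q :: "real \<Rightarrow> real"
        by measurable
      show ?thesis unfolding 1 2 3 by (subst nn_integral_add[symmetric]) (use 4 lev in \<open>auto intro!: nn_integral_mono\<close>)
    qed
    hence "ennreal S * ((\<integral>\<^sup>+x. ennreal (f x / F) \<partial>lborel) + (\<integral>\<^sup>+x. ennreal (g x / G) \<partial>lborel))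
        \<le> ennreal S * (\<integral>\<^sup>+x. ennreal (k x) \<partial>lborel)" by (intro mult_left_mono) auto
    also have "\<dots> = (\<integral>\<^sup>+x. ennreal (S * k x) \<partial>lborel)"
      using S k0 by (subst nn_integral_cmult[symmetric]) (auto simp: ennreal_mult)
    also have "\<dots> \<le> (\<integral>\<^sup>+x. h x \<partial>lborel)"
    proof (intro nn_integral_mono)
      fix x
      have "ennreal (S * k x) = min (h x) (ennreal S)" using S minS by (simp add: k_def)
      thus "ennreal (S * k x) \<le> h x" by simp
    qed
    finally have 1: "ennreal S * ((\<integral>\<^sup>+x. ennreal (f x / F) \<partial>lborel) + (\<integral>\<^sup>+x. ennreal (g x / G) \<partial>lborel))
        \<le> (\<integral>\<^sup>+x. h x \<partial>lborel)" .
    have ff: "(\<integral>\<^sup>+x. ennreal (f x) \<partial>lborel) < \<infinity>" "(\<integral>\<^sup>+x. ennreal (g x) \<partial>lborel) < \<infinity>"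
    proof -
      have *: "(\<integral>\<^sup>+x. ennreal N * indicator {-N..N} x \<partial>lborel) < \<infinity>"
        by (subst nn_integral_cmult_indicator) (auto simp: ennreal_mult_less_top emeasure_lborel_Icc_eq)
      have "(\<integral>\<^sup>+x. ennreal (f x) \<partial>lborel) \<le> (\<integral>\<^sup>+x. ennreal N * indicator {-N..N} x \<partial>lborel)"
        using f by (intro nn_integral_mono) (force simp: indicator_def abs_le_iff intro!: ennreal_leI)
      moreover have "(\<integral>\<^sup>+x. ennreal (g x) \<partial>lborel) \<le> (\<integral>\<^sup>+x. ennreal N * indicator {-N..N} x \<partial>lborel)"
        using g by (intro nn_integral_mono) (force simp: indicator_def abs_le_iff intro!: ennreal_leI)
      ultimately show "(\<integral>\<^sup>+x. ennreal (f x) \<partial>lborel) < \<infinity>" "(\<integral>\<^sup>+x. ennreal (g x) \<partial>lborel) < \<infinity>"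
        using * by (auto simp: le_less_trans)
    qed
    define I where "I = enn2real (\<integral>\<^sup>+x. f x \<partial>lborel)"
    define J where "J = enn2real (\<integral>\<^sup>+x. g x \<partial>lborel)"
    have I: "(\<integral>\<^sup>+x. f x \<partial>lborel) = ennreal I" "0 \<le> I" using ff by (auto simp: I_def)
    have J: "(\<integral>\<^sup>+x. g x \<partial>lborel) = ennreal J" "0 \<le> J" using ff by (auto simp: J_def)
    have "(\<integral>\<^sup>+x. ennreal (f x / F) \<partial>lborel) = ennreal (I / F)"
      using FG I f(1) by (simp add: divide_inverse ennreal_mult nn_integral_multc)
    moreover have "(\<integral>\<^sup>+x. ennreal (g x / G) \<partial>lborel) = ennreal (J / G)"
      using FG J g(1) by (simp add: divide_inverse ennreal_mult nn_integral_multc)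
    ultimately have 2: "ennreal (S * (I / F + J / G)) \<le> (\<integral>\<^sup>+x. h x \<partial>lborel)"
      using 1 S I J FG by (simp add: ennreal_mult ennreal_plus)
    have "pl_const \<theta> * (I / F) powr (1 - \<theta>) * (J / G) powr \<theta> \<le> I / F + J / G"
      using \<theta> I J FG by (intro pl_const_young) auto
    hence "S * (pl_const \<theta> * (I / F) powr (1 - \<theta>) * (J / G) powr \<theta>) \<le> S * (I / F + J / G)"
      using S by (intro mult_left_mono) auto
    also have "S * (pl_const \<theta> * (I / F) powr (1 - \<theta>) * (J / G) powr \<theta>) = pl_const \<theta> * I powr (1 - \<theta>) * J powr \<theta>"
      using FG I J by (simp add: S_def powr_divide)
    finally have "ennreal (pl_const \<theta> * I powr (1 - \<theta>) * J powr \<theta>) \<le> ennreal (S * (I / F + J / G))"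
      by (rule ennreal_leI)
    with 2 show ?thesis unfolding I_def J_def by (rule order_trans[rotated])
  qed
qed

text \<open>The factor \<open>c\<close> collects the constants of the coordinates already integrated
  in the induction on the dimension.\<close>

lemma prekopa_leindler_real_const:
  fixes f g :: "real \<Rightarrow> real" and h :: "real \<Rightarrow> ennreal"
  assumes [measurable]: "f \<in> borel_measurable borel" "g \<in> borel_measurable borel" "h \<in> borel_measurable borel"
    and \<theta>: "0 < \<theta>" "\<theta> < 1" and c: "0 < c"
    and f: "\<And>x. 0 \<le> f x" "\<And>x. f x \<le> N" "\<And>x. f x \<noteq> 0 \<Longrightarrow> \<bar>x\<bar> \<le> N"
    and g: "\<And>x. 0 \<le> g x" "\<And>x. g x \<le> N" "\<And>x. g x \<noteq> 0 \<Longrightarrow> \<bar>x\<bar> \<le> N"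
    and h: "\<And>x y. ennreal (c * f x powr (1 - \<theta>) * g y powr \<theta>) \<le> h (x + y)"
  shows "ennreal (pl_const \<theta> * c * enn2real (\<integral>\<^sup>+x. f x \<partial>lborel) powr (1 - \<theta>) * enn2real (\<integral>\<^sup>+x. g x \<partial>lborel) powr \<theta>)
      \<le> (\<integral>\<^sup>+x. h x \<partial>lborel)"
proof -
  have "ennreal (pl_const \<theta> * enn2real (\<integral>\<^sup>+x. f x \<partial>lborel) powr (1 - \<theta>) * enn2real (\<integral>\<^sup>+x. g x \<partial>lborel) powr \<theta>)
      \<le> (\<integral>\<^sup>+x. ennreal (1 / c) * h x \<partial>lborel)"
  proof (rule prekopa_leindler_real[OF _ _ _ \<theta> f g])
    fix x y
    have "ennreal (1 / c) * ennreal (c * f x powr (1 - \<theta>) * g y powr \<theta>) \<le> ennreal (1 / c) * h (x + y)"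
      by (intro mult_left_mono h) auto
    also have "ennreal (1 / c) * ennreal (c * f x powr (1 - \<theta>) * g y powr \<theta>) = ennreal (f x powr (1 - \<theta>) * g y powr \<theta>)"
      using c by (subst ennreal_mult[symmetric]) auto
    finally show "ennreal (f x powr (1 - \<theta>) * g y powr \<theta>) \<le> ennreal (1 / c) * h (x + y)" .
  qed auto
  hence "ennreal c * ennreal (pl_const \<theta> * enn2real (\<integral>\<^sup>+x. f x \<partial>lborel) powr (1 - \<theta>) * enn2real (\<integral>\<^sup>+x. g x \<partial>lborel) powr \<theta>)
      \<le> ennreal c * (\<integral>\<^sup>+x. ennreal (1 / c) * h x \<partial>lborel)" by (rule mult_left_mono) auto
  also have "\<dots> = (\<integral>\<^sup>+x. ennreal c * (ennreal (1 / c) * h x) \<partial>lborel)" by (rule nn_integral_cmult[symmetric]) simp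
  also have "(\<lambda>x. ennreal c * (ennreal (1 / c) * h x)) = h"
  proof
    fix x
    have "ennreal c * ennreal (1 / c) = 1" using c by (subst ennreal_mult[symmetric]) auto
    thus "ennreal c * (ennreal (1 / c) * h x) = h x" by (metis mult.assoc mult_1)
  qed
  also have "ennreal c * ennreal (pl_const \<theta> * enn2real (\<integral>\<^sup>+x. f x \<partial>lborel) powr (1 - \<theta>) * enn2real (\<integral>\<^sup>+x. g x \<partial>lborel) powr \<theta>)
    = ennreal (pl_const \<theta> * c * enn2real (\<integral>\<^sup>+x. f x \<partial>lborel) powr (1 - \<theta>) * enn2real (\<integral>\<^sup>+x. g x \<partial>lborel) powr \<theta>)"
    using c by (subst ennreal_mult'[symmetric]) (auto simp: mult_ac)
  finally show ?thesis .
qed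

text \<open>Fixing one coordinate and integrating the others turns the hypothesis into the same
  hypothesis for the section integrals \<open>F\<close>, \<open>G\<close>, \<open>H\<close>, with
  the extra factor \<open>pl_const \<theta> ^ card I\<close>; the one-dimensional inequality
  finishes. The common bound \<open>N\<close> on values and supports keeps the section integrals
  finite, so that they are again bounded real functions.\<close>

lemma prekopa_leindler_PiM:
  fixes f g :: "('i \<Rightarrow> real) \<Rightarrow> real" and h :: "('i \<Rightarrow> real) \<Rightarrow> ennreal"
  assumes "finite I" and \<theta>: "0 < \<theta>" "\<theta> < 1"
    and "f \<in> borel_measurable (PiM I (\<lambda>_. lborel))" "g \<in> borel_measurable (PiM I (\<lambda>_. lborel))"
        "h \<in> borel_measurable (PiM I (\<lambda>_. lborel))"
    and "\<And>x. 0 \<le> f x" "\<And>x. f x \<le> N" "\<And>x i. x \<in> space (PiM I (\<lambda>_. lborel)) \<Longrightarrow> i \<in> I \<Longrightarrow> f x \<noteq> 0 \<Longrightarrow> \<bar>x i\<bar> \<le> N"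
    and "\<And>x. 0 \<le> g x" "\<And>x. g x \<le> N" "\<And>x i. x \<in> space (PiM I (\<lambda>_. lborel)) \<Longrightarrow> i \<in> I \<Longrightarrow> g x \<noteq> 0 \<Longrightarrow> \<bar>x i\<bar> \<le> N"
    and "\<And>x y. x \<in> space (PiM I (\<lambda>_. lborel)) \<Longrightarrow> y \<in> space (PiM I (\<lambda>_. lborel)) \<Longrightarrow>
            ennreal (f x powr (1 - \<theta>) * g y powr \<theta>) \<le> h (\<lambda>i\<in>I. x i + y i)"
  shows "ennreal (pl_const \<theta> ^ card I * enn2real (\<integral>\<^sup>+x. f x \<partial>PiM I (\<lambda>_. lborel)) powr (1 - \<theta>)
            * enn2real (\<integral>\<^sup>+x. g x \<partial>PiM I (\<lambda>_. lborel)) powr \<theta>)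
      \<le> (\<integral>\<^sup>+x. h x \<partial>PiM I (\<lambda>_. lborel))"
  using assms(1,4-)
proof (induction I arbitrary: f g h rule: finite_induct)
  case empty
  interpret product_sigma_finite "\<lambda>_::'i. lborel :: real measure" by standard
  have "ennreal (f (\<lambda>_. undefined) powr (1 - \<theta>) * g (\<lambda>_. undefined) powr \<theta>) \<le> h (\<lambda>_. undefined)"
    using empty(10)[of "\<lambda>_. undefined" "\<lambda>_. undefined"] by (simp add: space_PiM restrict_def)
  thus ?case using empty(4,7) by (simp add: PiM_empty nn_integral_count_space_finite)
next
  case (insert i I)
  interpret P: product_sigma_finite "\<lambda>_::'i. lborel :: real measure" by standard
  let ?P = "PiM I (\<lambda>_::'i. lborel :: real measure)"
  let ?Q = "PiM (insert i I) (\<lambda>_::'i. lborel :: real measure)"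
  note [measurable] = insert.prems(1-3)
  have upd: "x(i := s) \<in> space ?Q" if "x \<in> space ?P" for x s
    using that insert.hyps by (auto simp: space_PiM PiE_def extensional_def)
  have N0: "0 \<le> N" using insert.prems(4,5) order_trans by blast
  \<comment> \<open>Bound for a section integral: height \<open>N\<close> times the volume of the
    cube of side \<open>2 * N\<close>.\<close>
  define W where "W = N * (2 * N) ^ card I"
  have W0: "0 \<le> W" using N0 by (simp add: W_def)
  have bnd: "(\<integral>\<^sup>+x. ennreal (k (x(i := s))) \<partial>?P) \<le> ennreal W"
    if "k \<in> borel_measurable ?Q" and kN: "\<And>x. k x \<le> N" and kS: "\<And>x j. x \<in> space ?Q \<Longrightarrow> j \<in> insert i I \<Longrightarrow> k x \<noteq> 0 \<Longrightarrow> \<bar>x j\<bar> \<le> N" for k s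
  proof -
    have "(\<integral>\<^sup>+x. ennreal (k (x(i := s))) \<partial>?P) \<le> (\<integral>\<^sup>+x. ennreal N * indicator (PiE I (\<lambda>_. {-N..N})) x \<partial>?P)"
    proof (intro nn_integral_mono)
      fix x assume x: "x \<in> space ?P"
      show "ennreal (k (x(i := s))) \<le> ennreal N * indicator (PiE I (\<lambda>_. {-N..N})) x"
      proof (cases "k (x(i := s)) = 0")
        case False
        have "x j \<in> {-N..N}" if "j \<in> I" for j
          using kS[OF upd[OF x], of j s] that False insert.hyps by (auto simp: abs_le_iff split: if_splits)
        hence "x \<in> PiE I (\<lambda>_. {-N..N})" using x by (auto simp: space_PiM PiE_def)
        thus ?thesis using kN by (auto intro: ennreal_leI)
      qed auto
    qed
    also have "\<dots> = ennreal N * emeasure ?P (PiE I (\<lambda>_. {-N..N}))"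
      by (rule nn_integral_cmult_indicator) (use insert.hyps in \<open>auto intro!: sets_PiM_I_finite\<close>)
    also have "emeasure ?P (PiE I (\<lambda>_. {-N..N})) = ennreal ((2 * N) ^ card I)"
      using insert.hyps N0 by (subst P.emeasure_PiM) (auto simp: ennreal_power)
    also have "ennreal N * ennreal ((2 * N) ^ card I) = ennreal W" using N0 by (simp add: W_def ennreal_mult)
    finally show ?thesis .
  qed
  define F where "F s = enn2real (\<integral>\<^sup>+x. f (x(i := s)) \<partial>?P)" for s
  define G where "G s = enn2real (\<integral>\<^sup>+x. g (x(i := s)) \<partial>?P)" for s
  define H where "H s = (\<integral>\<^sup>+x. h (x(i := s)) \<partial>?P)" for s
  have bf: "(\<integral>\<^sup>+x. ennreal (f (x(i := s))) \<partial>?P) \<le> ennreal W" and bg: "(\<integral>\<^sup>+x. ennreal (g (x(i := s))) \<partial>?P) \<le> ennreal W" for s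
    using insert.prems by (auto intro!: bnd)
  have FW: "F s \<le> W" and GW: "G s \<le> W" for s
    unfolding F_def G_def using enn2real_mono[OF bf] enn2real_mono[OF bg] W0 by (auto simp: enn2real_ennreal)
  have eF: "(\<integral>\<^sup>+x. f (x(i := s)) \<partial>?P) = ennreal (F s)" and eG: "(\<integral>\<^sup>+x. g (x(i := s)) \<partial>?P) = ennreal (G s)" for s
    unfolding F_def G_def
    by (rule ennreal_enn2real[symmetric, OF le_less_trans[OF bf ennreal_less_top]]
             ennreal_enn2real[symmetric, OF le_less_trans[OF bg ennreal_less_top]])+
  have updm: "(\<lambda>(s, x). x(i := s)) \<in> measurable (lborel \<Otimes>\<^sub>M ?P) ?Q"
    using measurable_compose[OF measurable_pair_swap' measurable_add_dim[of i I "\<lambda>_. lborel"]]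
    by (simp add: split_beta' comp_def)
  have m1: "(\<lambda>s. \<integral>\<^sup>+x. ennreal (f (x(i := s))) \<partial>?P) \<in> borel_measurable borel"
    and m2: "(\<lambda>s. \<integral>\<^sup>+x. ennreal (g (x(i := s))) \<partial>?P) \<in> borel_measurable borel"
    and m3: "(\<lambda>s. \<integral>\<^sup>+x. h (x(i := s)) \<partial>?P) \<in> borel_measurable borel"
  proof -
    interpret sigma_finite_measure ?P by (rule P.sigma_finite) (use insert in auto)
    have *: "(\<lambda>s. \<integral>\<^sup>+x. k (x(i := s)) \<partial>?P) \<in> borel_measurable borel" if k: "k \<in> borel_measurable ?Q" for k :: "_ \<Rightarrow> ennreal"
    proof -
      have m: "(\<lambda>z. k ((snd z)(i := fst z))) \<in> borel_measurable (lborel \<Otimes>\<^sub>M ?P)"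
        using measurable_compose[OF updm k] by (simp add: split_beta')
      from borel_measurable_nn_integral_fst[OF m] show ?thesis by (simp only: fst_conv snd_conv measurable_lborel2)
    qed
    show "(\<lambda>s. \<integral>\<^sup>+x. ennreal (f (x(i := s))) \<partial>?P) \<in> borel_measurable borel" by (rule *[of "\<lambda>x. ennreal (f x)"]) simp
    show "(\<lambda>s. \<integral>\<^sup>+x. ennreal (g (x(i := s))) \<partial>?P) \<in> borel_measurable borel" by (rule *[of "\<lambda>x. ennreal (g x)"]) simp
    show "(\<lambda>s. \<integral>\<^sup>+x. h (x(i := s)) \<partial>?P) \<in> borel_measurable borel" by (rule *) simp
  qed
  have [measurable]: "F \<in> borel_measurable borel" "G \<in> borel_measurable borel" "H \<in> borel_measurable borel"
    unfolding F_def G_def H_def using m1 m2 m3 by measurable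
  have sec[measurable]: "(\<lambda>x. x(i := s)) \<in> measurable ?P ?Q" for s
    by (intro measurable_fun_upd[where J=I]) auto
  have key: "ennreal (pl_const \<theta> ^ card I * F s powr (1 - \<theta>) * G t powr \<theta>) \<le> H (s + t)" for s t
    unfolding F_def G_def H_def
  proof (rule insert.IH[of "\<lambda>x. f (x(i := s))" "\<lambda>x. g (x(i := t))" "\<lambda>x. h (x(i := s + t))"])
    show "\<bar>x j\<bar> \<le> N" if "x \<in> space ?P" "j \<in> I" "f (x(i := s)) \<noteq> 0" for x j
      using insert.prems(6)[OF upd[OF that(1)] _ that(3), of j] that insert.hyps by (auto split: if_splits)
    show "\<bar>x j\<bar> \<le> N" if "x \<in> space ?P" "j \<in> I" "g (x(i := t)) \<noteq> 0" for x j
      using insert.prems(9)[OF upd[OF that(1)] _ that(3), of j] that insert.hyps by (auto split: if_splits)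
    show "(\<lambda>x. f (x(i := s))) \<in> borel_measurable ?P" by (rule measurable_compose[OF sec insert.prems(1)])
    show "(\<lambda>x. g (x(i := t))) \<in> borel_measurable ?P" by (rule measurable_compose[OF sec insert.prems(2)])
    show "(\<lambda>x. h (x(i := s + t))) \<in> borel_measurable ?P" by (rule measurable_compose[OF sec insert.prems(3)])
    fix x y assume xy: "x \<in> space ?P" "y \<in> space ?P"
    have e: "(\<lambda>j\<in>insert i I. (x(i := s)) j + (y(i := t)) j) = (\<lambda>j\<in>I. x j + y j)(i := s + t)"
      by (auto simp: fun_eq_iff restrict_def)
    from insert.prems(10)[OF upd[OF xy(1)] upd[OF xy(2)], of s t]
    show "ennreal (f (x(i := s)) powr (1 - \<theta>) * g (y(i := t)) powr \<theta>) \<le> h ((\<lambda>i\<in>I. x i + y i)(i := s + t))"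
      unfolding e .
  qed (rule insert.prems)+
  have sf: "\<bar>s\<bar> \<le> max N W" if "F s \<noteq> 0" for s
  proof -
    have "\<exists>x\<in>space ?P. f (x(i := s)) \<noteq> 0"
    proof (rule ccontr)
      assume "\<not> ?thesis"
      hence "(\<integral>\<^sup>+x. f (x(i := s)) \<partial>?P) = (\<integral>\<^sup>+x. 0 \<partial>?P)" by (intro nn_integral_cong) auto
      thus False using that by (simp add: F_def)
    qed
    then obtain x where x: "x \<in> space ?P" "f (x(i := s)) \<noteq> 0" by blast
    show ?thesis using insert.prems(6)[OF upd[OF x(1)] _ x(2), of i] by simp
  qed
  have sg: "\<bar>s\<bar> \<le> max N W" if "G s \<noteq> 0" for s
  proof -
    have "\<exists>x\<in>space ?P. g (x(i := s)) \<noteq> 0"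
    proof (rule ccontr)
      assume "\<not> ?thesis"
      hence "(\<integral>\<^sup>+x. g (x(i := s)) \<partial>?P) = (\<integral>\<^sup>+x. 0 \<partial>?P)" by (intro nn_integral_cong) auto
      thus False using that by (simp add: G_def)
    qed
    then obtain x where x: "x \<in> space ?P" "g (x(i := s)) \<noteq> 0" by blast
    show ?thesis using insert.prems(9)[OF upd[OF x(1)] _ x(2), of i] by simp
  qed
  have "ennreal (pl_const \<theta> * pl_const \<theta> ^ card I * enn2real (\<integral>\<^sup>+x. F x \<partial>lborel) powr (1 - \<theta>)
         * enn2real (\<integral>\<^sup>+x. G x \<partial>lborel) powr \<theta>) \<le> (\<integral>\<^sup>+x. H x \<partial>lborel)"
  proof (rule prekopa_leindler_real_const[OF _ _ _ \<theta>, where N="max N W"])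
    show "0 \<le> F s" "0 \<le> G s" for s by (simp_all add: F_def G_def)
    show "F s \<le> max N W" "G s \<le> max N W" for s using FW[of s] GW[of s] by simp_all
  qed (fact key sf sg | use pl_const_pos[OF \<theta>] in simp)+
  also have "(\<integral>\<^sup>+x. F x \<partial>lborel) = (\<integral>\<^sup>+x. f x \<partial>?Q)"
    unfolding eF[symmetric] using insert.hyps by (subst P.product_nn_integral_insert_rev) auto
  also have "(\<integral>\<^sup>+x. G x \<partial>lborel) = (\<integral>\<^sup>+x. g x \<partial>?Q)"
    unfolding eG[symmetric] using insert.hyps by (subst P.product_nn_integral_insert_rev) auto
  also have "(\<integral>\<^sup>+x. H x \<partial>lborel) = (\<integral>\<^sup>+x. h x \<partial>?Q)"
    unfolding H_def using insert.hyps by (subst P.product_nn_integral_insert_rev) auto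
  finally show ?case using insert.hyps by simp
qed

text \<open>Prekopa-Leindler for the indicators of \<open>A\<close> and of a ball. The parameter
  \<open>\<theta>\<close> is free; with \<open>X\<close> and \<open>Y\<close> the
  \<open>m\<close>-th roots of the two volumes, \<open>\<theta> = Y / (X + Y)\<close> makes the
  constant exact: \<open>pl_const \<theta> * X powr (1 - \<theta>) * Y powr \<theta> = X +
  Y\<close>.\<close>

lemma brunn_minkowski_ball_PiM:
  fixes A C :: "('i \<Rightarrow> real) set"
  assumes "finite I" "I \<noteq> {}"
    and A[measurable]: "A \<in> sets (PiM I (\<lambda>_. lborel))" and C[measurable]: "C \<in> sets (PiM I (\<lambda>_. lborel))"
    and bdd: "\<And>x i. x \<in> A \<Longrightarrow> i \<in> I \<Longrightarrow> \<bar>x i\<bar> \<le> N"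
    and a: "emeasure (PiM I (\<lambda>_. lborel)) A = ennreal a" "0 < a" and r: "0 < r"
    and sum: "\<And>x w. x \<in> A \<Longrightarrow> w \<in> space (PiM I (\<lambda>_. lborel)) \<Longrightarrow> sqrt (\<Sum>i\<in>I. (w i)\<^sup>2) \<le> r \<Longrightarrow> (\<lambda>i\<in>I. x i + w i) \<in> C"
  shows "ennreal ((a powr (1 / card I) + unit_ball_vol (card I) powr (1 / card I) * r) ^ card I)
     \<le> emeasure (PiM I (\<lambda>_. lborel)) C"
proof -
  let ?P = "PiM I (\<lambda>_::'i. lborel :: real measure)"
  define m where "m = card I"
  have m: "m > 0" using assms by (simp add: m_def card_gt_0_iff)
  define D where "D = {f. sqrt (\<Sum>i\<in>I. (f i)\<^sup>2) \<le> r} \<inter> space ?P"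
  have [measurable]: "D \<in> sets ?P" unfolding D_def using assms(1) by measurable
  define d where "d = unit_ball_vol m * r ^ m"
  have d: "emeasure ?P D = ennreal d" unfolding D_def d_def m_def by (rule emeasure_cball_aux) fact+
  have d0: "d > 0" using r by (simp add: d_def)
  define X where "X = a powr (1 / m)"
  define Y where "Y = d powr (1 / m)"
  have XY: "X > 0" "Y > 0" using a d0 by (auto simp: X_def Y_def)
  have Xm: "X ^ m = a" "Y ^ m = d" using a d0 m by (auto simp: X_def Y_def powr_realpow[symmetric] powr_powr)
  have Y: "Y = unit_ball_vol m powr (1 / m) * r"
    using r m by (simp add: Y_def d_def powr_mult powr_realpow[symmetric] powr_powr)
  define \<theta> where "\<theta> = Y / (X + Y)"
  have \<theta>: "0 < \<theta>" "\<theta> < 1" using XY by (auto simp: \<theta>_def)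
  have AP: "A \<subseteq> space ?P" using sets.sets_into_space[OF A] .
  have iA: "enn2real (\<integral>\<^sup>+x. ennreal (indicator A x) \<partial>?P) = a" using a by (simp add: ennreal_indicator)
  have iD: "enn2real (\<integral>\<^sup>+x. ennreal (indicator D x) \<partial>?P) = d" using d d0 by (simp add: ennreal_indicator)
  have "ennreal (pl_const \<theta> ^ m * enn2real (\<integral>\<^sup>+x. ennreal (indicator A x) \<partial>?P) powr (1 - \<theta>)
     * enn2real (\<integral>\<^sup>+x. ennreal (indicator D x) \<partial>?P) powr \<theta>) \<le> (\<integral>\<^sup>+x. indicator C x \<partial>?P)"
    unfolding m_def
  proof (rule prekopa_leindler_PiM[OF assms(1) \<theta>, where N = "max 1 (max N r)"])
    fix x i assume *: "i \<in> I" "indicator D x \<noteq> (0::real)"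
    hence "(x i)\<^sup>2 \<le> (\<Sum>i\<in>I. (x i)\<^sup>2)" using assms(1) by (intro member_le_sum) auto
    hence "\<bar>x i\<bar> \<le> sqrt (\<Sum>i\<in>I. (x i)\<^sup>2)" using real_le_rsqrt by (metis abs_le_square_iff power2_abs real_sqrt_abs real_sqrt_le_iff)
    also have "\<dots> \<le> r" using * by (auto simp: indicator_def D_def split: if_splits)
    finally show "\<bar>x i\<bar> \<le> max 1 (max N r)" by simp
  next
    fix x y assume "x \<in> space ?P" "y \<in> space ?P"
    show "ennreal (indicator A x powr (1 - \<theta>) * indicator D y powr \<theta>) \<le> indicator C (\<lambda>i\<in>I. x i + y i)"
      using sum[of x y] by (auto simp: indicator_def D_def)
  next
    fix x i assume "i \<in> I" "indicator A x \<noteq> (0::real)"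
    thus "\<bar>x i\<bar> \<le> max 1 (max N r)" using bdd[of x i] by (auto simp: indicator_def split: if_splits)
  qed (auto simp: indicator_def)
  also have "(\<integral>\<^sup>+x. indicator C x \<partial>?P) = emeasure ?P C" by simp
  also have "pl_const \<theta> ^ m * enn2real (\<integral>\<^sup>+x. ennreal (indicator A x) \<partial>?P) powr (1 - \<theta>)
     * enn2real (\<integral>\<^sup>+x. ennreal (indicator D x) \<partial>?P) powr \<theta> = (X + Y) ^ m"
  proof -
    have 1: "a powr (1 - \<theta>) = (X powr (1 - \<theta>)) ^ m" "d powr \<theta> = (Y powr \<theta>) ^ m"
      using XY by (simp_all add: Xm[symmetric] powr_realpow[symmetric] powr_powr mult_ac)
    have "1 - \<theta> = X / (X + Y)" using XY by (simp add: \<theta>_def field_simps)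
    hence "pl_const \<theta> = ((X + Y) / X) powr (1 - \<theta>) * ((X + Y) / Y) powr \<theta>" by (simp add: pl_const_def \<theta>_def)
    also have "\<dots> = (X + Y) powr (1 - \<theta>) * (X + Y) powr \<theta> / (X powr (1 - \<theta>) * Y powr \<theta>)"
      using XY by (simp add: powr_divide)
    also have "(X + Y) powr (1 - \<theta>) * (X + Y) powr \<theta> = X + Y" using XY by (simp add: powr_add[symmetric])
    finally have "pl_const \<theta> * X powr (1 - \<theta>) * Y powr \<theta> = X + Y" using XY by simp
    thus ?thesis unfolding iA iD 1 by (simp add: power_mult_distrib[symmetric] mult_ac)
  qed
  finally show ?thesis unfolding X_def Y m_def .
qed

section \<open>Volume and area of geodesic balls\<close>

text \<open>In the half-space a geodesic ball is, up to dilation, a Euclidean unit ball centred at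
  height \<open>\<mu> > 1\<close>, where \<open>\<mu>\<close> is the hyperbolic cotangent of the
  geodesic radius. Its slice at height \<open>z + \<mu>\<close> is a ball of radius
  \<open>sqrt (1 - z\<^sup>2)\<close>, so for \<open>a = (n - 1) / 2\<close> and
  \<open>k = - n\<close> the integral is the hyperbolic volume divided by the volume of the unit
  ball of dimension \<open>n - 1\<close>. For \<open>k = 0\<close> it does not depend on
  \<open>\<mu>\<close>; the argument 2 in \<open>prof a 0 2\<close> is a placeholder.\<close>

definition prof :: "real \<Rightarrow> real \<Rightarrow> real \<Rightarrow> real" where
  "prof a k \<mu> = integral {-1..1} (\<lambda>z. (1 - z\<^sup>2) powr a * (z + \<mu>) powr k)"

lemma prof_continuous_on:
  fixes a k \<mu> :: real
  assumes "0 < a" "1 < \<mu>"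
  shows "continuous_on {-1..1} (\<lambda>z. (1 - z\<^sup>2) powr a * (z + \<mu>) powr k)"
proof (rule continuous_on_mult)
  show "continuous_on {-1..1} (\<lambda>z::real. (1 - z\<^sup>2) powr a)"
    by (rule continuous_on_powr') (use assms in \<open>auto intro!: continuous_intros simp: abs_square_le_1 abs_le_iff\<close>)
  show "continuous_on {-1..1} (\<lambda>z. (z + \<mu>) powr k)"
    by (rule continuous_on_powr') (use assms in \<open>auto intro!: continuous_intros\<close>)
qed

lemma prof_integrable:
  fixes a k \<mu> :: real
  assumes "0 < a" "1 < \<mu>"
  shows "(\<lambda>z. (1 - z\<^sup>2) powr a * (z + \<mu>) powr k) integrable_on {-1..1}"
  by (rule integrable_continuous_interval[OF prof_continuous_on[OF assms]])

lemma prof_deriv: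
  assumes "0 < a" "1 < \<mu>"
  shows "(prof a k has_real_derivative k * prof a (k - 1) \<mu>) (at \<mu>)"
proof -
  have "((\<lambda>\<mu>. integral (cbox (-1) 1) (\<lambda>z. (1 - z\<^sup>2) powr a * (z + \<mu>) powr k))
     has_field_derivative integral (cbox (-1) 1) (\<lambda>z. (1 - z\<^sup>2) powr a * (k * (z + \<mu>) powr (k - 1)))) (at \<mu> within {1<..})"
  proof (rule leibniz_rule_field_derivative)
    show "((\<lambda>\<mu>. (1 - z\<^sup>2) powr a * (z + \<mu>) powr k) has_field_derivative (1 - z\<^sup>2) powr a * (k * (z + x) powr (k - 1))) (at x within {1<..})"
      if "x \<in> {1<..}" "z \<in> cbox (-1) 1" for x z :: real
      using that by (auto intro!: derivative_eq_intros)
    show "(\<lambda>z. (1 - z\<^sup>2) powr a * (z + x) powr k) integrable_on cbox (-1) 1" if "x \<in> {1<..}" for x :: real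
      using prof_integrable[OF assms(1), of x k] that by simp
    show "continuous_on ({1<..} \<times> cbox (-1) 1) (\<lambda>(x, t). (1 - t\<^sup>2) powr a * (k * (t + x) powr (k - 1)))"
      unfolding split_beta
    proof (rule continuous_on_mult[OF _ continuous_on_mult])
      show "continuous_on ({1<..} \<times> cbox (-1) 1) (\<lambda>z::real \<times> real. (1 - (snd z)\<^sup>2) powr a)"
        by (rule continuous_on_powr') (use assms in \<open>auto intro!: continuous_intros simp: abs_square_le_1 abs_le_iff\<close>)
      show "continuous_on ({1<..} \<times> cbox (-1) 1) (\<lambda>z::real \<times> real. (snd z + fst z) powr (k - 1))"
        by (rule continuous_on_powr') (use assms in \<open>auto intro!: continuous_intros\<close>)
    qed (intro continuous_intros)
  qed (use assms in auto)
  moreover have "at \<mu> within {1<..} = at \<mu>" using assms by (intro at_within_open) auto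
  moreover have "(\<lambda>z. (1 - z\<^sup>2) powr a * (k * (z + \<mu>) powr (k - 1))) = (\<lambda>z. k * ((1 - z\<^sup>2) powr a * (z + \<mu>) powr (k - 1)))"
    by (auto simp: mult_ac)
  ultimately show ?thesis unfolding prof_def by simp
qed

text \<open>Crude, but exact to leading order as \<open>\<mu>\<close> grows; this fixes constants of
  integration at infinity.\<close>

lemma prof_mono_bounds:
  assumes "0 < a" "1 < \<mu>" "k \<le> 0"
  shows "(\<mu> + 1) powr k * prof a 0 2 \<le> prof a k \<mu>" "prof a k \<mu> \<le> (\<mu> - 1) powr k * prof a 0 2"
proof -
  have 0: "(\<lambda>z. (1 - z\<^sup>2) powr a * (z + 2) powr 0) integrable_on {-1..1}" using prof_integrable[of a 2 0] assms by simp
  have "(\<mu> + 1) powr k * prof a 0 2 = integral {-1..1} (\<lambda>z. (\<mu> + 1) powr k * ((1 - z\<^sup>2) powr a * (z + 2) powr 0))"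
    unfolding prof_def by simp
  also have "\<dots> \<le> prof a k \<mu>" unfolding prof_def
  proof (rule integral_le)
    fix z :: real assume z: "z \<in> {-1..1}"
    have "(\<mu> + 1) powr k \<le> (z + \<mu>) powr k" using z assms by (intro powr_mono2') auto
    thus "(\<mu> + 1) powr k * ((1 - z\<^sup>2) powr a * (z + 2) powr 0) \<le> (1 - z\<^sup>2) powr a * (z + \<mu>) powr k"
      using z by (auto simp: mult.commute[of _ "(1 - z\<^sup>2) powr a"] intro!: mult_left_mono)
  qed (use 0 prof_integrable assms in \<open>auto intro!: integrable_on_mult_right\<close>)
  finally show "(\<mu> + 1) powr k * prof a 0 2 \<le> prof a k \<mu>" .
  have "prof a k \<mu> \<le> integral {-1..1} (\<lambda>z. (\<mu> - 1) powr k * ((1 - z\<^sup>2) powr a * (z + 2) powr 0))"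
    unfolding prof_def
  proof (rule integral_le)
    fix z :: real assume z: "z \<in> {-1..1}"
    have "(z + \<mu>) powr k \<le> (\<mu> - 1) powr k" using z assms by (intro powr_mono2') auto
    thus "(1 - z\<^sup>2) powr a * (z + \<mu>) powr k \<le> (\<mu> - 1) powr k * ((1 - z\<^sup>2) powr a * (z + 2) powr 0)"
      using z by (auto simp: mult.commute[of _ "(1 - z\<^sup>2) powr a"] intro!: mult_left_mono)
  qed (use 0 prof_integrable assms in \<open>auto intro!: integrable_on_mult_right\<close>)
  also have "\<dots> = (\<mu> - 1) powr k * prof a 0 2" unfolding prof_def by simp
  finally show "prof a k \<mu> \<le> (\<mu> - 1) powr k * prof a 0 2" .
qed

lemma prof_pos:
  assumes "0 < a" "1 < \<mu>"
  shows "0 < prof a k \<mu>"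
proof -
  have "0 < integral {-1..1} (\<lambda>z. (1 - z\<^sup>2) powr a * (z + \<mu>) powr k)"
  proof (rule ccontr)
    assume "\<not> ?thesis"
    moreover have "0 \<le> integral {-1..1} (\<lambda>z. (1 - z\<^sup>2) powr a * (z + \<mu>) powr k)"
      by (intro integral_nonneg prof_integrable assms) auto
    ultimately have "integral {-1..1} (\<lambda>z. (1 - z\<^sup>2) powr a * (z + \<mu>) powr k) = 0" by simp
    hence "((\<lambda>z. (1 - z\<^sup>2) powr a * (z + \<mu>) powr k) has_integral 0) (cbox (-1) 1)"
      using prof_integrable[OF assms] by (simp add: has_integral_integrable_integral)
    from has_integral_0_cbox_imp_0[OF _ _ this, of 0] prof_continuous_on[OF assms] assms show False by auto
  qed
  thus ?thesis by (simp add: prof_def)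
qed

text \<open>Integration by parts:
  \<open>(1 - z\<^sup>2) powr (a + 1) * (z + \<mu>) powr (- n)\<close> vanishes at both ends, and
  for \<open>n = 2 * a + 1\<close> its derivative is a combination of just the three
  integrands.\<close>

lemma prof_recurrence:
  assumes "0 < a" "1 < \<mu>" "n = 2 * a + 1"
  shows "n * (\<mu>\<^sup>2 - 1) * prof a (-n - 1) \<mu> = prof a (1 - n) \<mu> + 2 * a * \<mu> * prof a (-n) \<mu>"
proof -
  let ?A = "\<lambda>z. (1 - z\<^sup>2) powr (a + 1) * (z + \<mu>) powr (-n)"
  let ?w = "\<lambda>z::real. (1 - z\<^sup>2) powr a"
  have "((\<lambda>z. n * (\<mu>\<^sup>2 - 1) * (?w z * (z + \<mu>) powr (-n - 1)) - 2 * a * \<mu> * (?w z * (z + \<mu>) powr (-n))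
      - ?w z * (z + \<mu>) powr (1 - n)) has_integral ?A 1 - ?A (-1)) {-1..1}"
  proof (rule fundamental_theorem_of_calculus_interior)
    show "continuous_on {-1..1} ?A" using assms prof_continuous_on[of "a + 1" \<mu>] by simp
    fix z :: real assume z: "z \<in> {-1<..<1}"
    hence z2: "z\<^sup>2 < 1" by (simp add: abs_square_less_1 abs_less_iff)
    define t where "t = z + \<mu>"
    have t: "t > 0" using z assms by (simp add: t_def)
    have D: "(?A has_real_derivative
        (a + 1) * (1 - z\<^sup>2) powr a * (- 2 * z) * t powr (-n) + (1 - z\<^sup>2) powr (a + 1) * (- n * t powr (-n - 1))) (at z)"
      using z2 t unfolding t_def by (auto intro!: derivative_eq_intros)
    have e1: "(1 - z\<^sup>2) powr (a + 1) = ?w z * (1 - z\<^sup>2)" using z2 by (simp add: powr_add)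
    have e2: "t powr (-n) = t powr (-n - 1) * t" using t by (simp add: powr_diff)
    have e3: "t powr (1 - n) = t powr (-n - 1) * t\<^sup>2"
    proof -
      have "t powr (1 - n) = t powr ((-n - 1) + 2)" by simp
      also have "\<dots> = t powr (-n - 1) * t powr 2" by (rule powr_add)
      finally show ?thesis using t by simp
    qed
    have e4: "(a + 1) * w * (- 2 * z) * (T * t) + w * (1 - z\<^sup>2) * (- n * T)
       = n * (\<mu>\<^sup>2 - 1) * (w * T) - 2 * a * \<mu> * (w * (T * t)) - w * (T * t\<^sup>2)" for w T :: real
      unfolding t_def assms(3) by algebra
    have "(a + 1) * (1 - z\<^sup>2) powr a * (- 2 * z) * t powr (-n) + (1 - z\<^sup>2) powr (a + 1) * (- n * t powr (-n - 1))
      = n * (\<mu>\<^sup>2 - 1) * (?w z * t powr (-n - 1)) - 2 * a * \<mu> * (?w z * t powr (-n)) - ?w z * t powr (1 - n)"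
      unfolding e1 e2 e3 by (rule e4)
    from DERIV_cong[OF D this] show "(?A has_vector_derivative n * (\<mu>\<^sup>2 - 1) * (?w z * (z + \<mu>) powr (-n - 1)) - 2 * a * \<mu> * (?w z * (z + \<mu>) powr (-n))
      - ?w z * (z + \<mu>) powr (1 - n)) (at z)"
      unfolding has_real_derivative_iff_has_vector_derivative[symmetric] t_def .
  qed auto
  moreover have "((\<lambda>z. n * (\<mu>\<^sup>2 - 1) * (?w z * (z + \<mu>) powr (-n - 1)) - 2 * a * \<mu> * (?w z * (z + \<mu>) powr (-n))
      - ?w z * (z + \<mu>) powr (1 - n)) has_integral
      n * (\<mu>\<^sup>2 - 1) * prof a (-n - 1) \<mu> - 2 * a * \<mu> * prof a (-n) \<mu> - prof a (1 - n) \<mu>) {-1..1}"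
    unfolding prof_def using prof_integrable[OF assms(1,2)]
    by (intro has_integral_diff has_integral_mult_right) (auto simp: has_integral_integrable_integral)
  ultimately have "n * (\<mu>\<^sup>2 - 1) * prof a (-n - 1) \<mu> - 2 * a * \<mu> * prof a (-n) \<mu> - prof a (1 - n) \<mu> = ?A 1 - ?A (-1)"
    using has_integral_unique by blast
  thus ?thesis using assms by simp
qed

text \<open>Up to the volume of the unit ball of dimension \<open>n - 1\<close>, this is the area of
  the geodesic sphere. It is written as a first variation of volume: for
  \<open>n = 2 * a + 1\<close> it is the integral of \<open>z + n * \<mu>\<close> against the
  density of \<open>prof a (- n) \<mu>\<close>.\<close>

definition profE :: "real \<Rightarrow> real \<Rightarrow> real" where
  "profE a \<mu> = prof a (- 2 * a) \<mu> + 2 * a * \<mu> * prof a (- 2 * a - 1) \<mu>"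

text \<open>With \<open>\<mu>\<close> the hyperbolic cotangent of the radius, this says that area is
  the derivative of volume.\<close>

lemma prof_volume_deriv:
  assumes "0 < a" "1 < \<mu>"
  shows "(prof a (- 2 * a - 1) has_real_derivative - profE a \<mu> / (\<mu>\<^sup>2 - 1)) (at \<mu>)"
proof -
  have "\<mu>\<^sup>2 - 1 > 0" using assms by simp
  moreover have "(2 * a + 1) * (\<mu>\<^sup>2 - 1) * prof a (- (2 * a + 1) - 1) \<mu> = profE a \<mu>"
    using prof_recurrence[OF assms refl] by (simp add: profE_def)
  moreover have "- (2 * a + 1) - 1 = - 2 * a - 1 - 1" by simp
  ultimately have "(2 * a + 1) * (\<mu>\<^sup>2 - 1) * prof a (- 2 * a - 1 - 1) \<mu> = profE a \<mu>" "\<mu>\<^sup>2 - 1 > 0" by metis+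
  hence "- profE a \<mu> / (\<mu>\<^sup>2 - 1) = (- 2 * a - 1) * prof a (- 2 * a - 1 - 1) \<mu>"
    by (simp only: eq_divide_eq divide_eq_eq) (simp add: algebra_simps)
  thus ?thesis using prof_deriv[OF assms, of "- 2 * a - 1"] by simp
qed

lemma profE_deriv:
  assumes "0 < a" "1 < \<mu>"
  shows "(profE a has_real_derivative - 2 * a * \<mu> * profE a \<mu> / (\<mu>\<^sup>2 - 1)) (at \<mu>)"
proof -
  have "(profE a has_real_derivative - 2 * a * prof a (- 2 * a - 1) \<mu> + (2 * a * prof a (- 2 * a - 1) \<mu> +
      2 * a * \<mu> * (- profE a \<mu> / (\<mu>\<^sup>2 - 1)))) (at \<mu>)"
    unfolding profE_def[abs_def]
    by (rule derivative_eq_intros prof_deriv[OF assms] prof_volume_deriv[OF assms] refl)+ (simp add: profE_def)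
  thus ?thesis by (simp add: field_simps)
qed

text \<open>By the derivative formula \<open>profE a \<mu> * (\<mu>\<^sup>2 - 1) powr a\<close> is
  constant, and its limit at infinity identifies the constant. This is the area law of geodesic
  spheres, since \<open>(\<mu>\<^sup>2 - 1) powr (- 1 / 2)\<close> is the hyperbolic sine of the
  radius.\<close>

lemma profE_eq:
  assumes a: "0 < a" and \<mu>: "1 < \<mu>"
  shows "profE a \<mu> = (2 * a + 1) * prof a 0 2 * (\<mu>\<^sup>2 - 1) powr (-a)"
proof -
  define K where "K \<mu> = profE a \<mu> * (\<mu>\<^sup>2 - 1) powr a" for \<mu>
  have pos: "x\<^sup>2 - 1 > 0" if "x > 1" for x :: real using that by simp
  have "(K has_real_derivative 0) (at x)" if "x > 1" for x
  proof -
    have "(K has_real_derivative - 2 * a * x * profE a x / (x\<^sup>2 - 1) * (x\<^sup>2 - 1) powr a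
        + profE a x * (a * (x\<^sup>2 - 1) powr (a - 1) * (2 * x))) (at x)"
      unfolding K_def[abs_def] using pos[OF that]
      by (auto intro!: derivative_eq_intros profE_deriv[OF a that])
    thus ?thesis using pos[OF that] by (simp add: powr_diff)
  qed
  hence "\<exists>c. \<forall>x\<in>{1<..}. K x = c"
    by (intro has_field_derivative_zero_constant) (auto intro: DERIV_subset)
  then obtain c where c: "\<And>x. x > 1 \<Longrightarrow> K x = c" by auto
  let ?I = "prof a 0 2"
  have "c = (2 * a + 1) * ?I"
  proof (rule tendsto_unique)
    show "(K \<longlongrightarrow> c) at_top"
      by (rule tendsto_eventually) (rule eventually_mono[OF eventually_gt_at_top[of 1]], rule c)
    show "(K \<longlongrightarrow> (2 * a + 1) * ?I) at_top"
    proof (rule tendsto_sandwich)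
      show "\<forall>\<^sub>F x in at_top. ((x + 1) powr (- 2 * a) + 2 * a * x * (x + 1) powr (- 2 * a - 1)) * (x\<^sup>2 - 1) powr a * ?I \<le> K x"
        using eventually_gt_at_top[of 1]
      proof eventually_elim
        case (elim x)
        have "(x + 1) powr (- 2 * a) * ?I + 2 * a * x * ((x + 1) powr (- 2 * a - 1) * ?I) \<le> profE a x"
          unfolding profE_def using a elim by (intro add_mono mult_left_mono prof_mono_bounds) auto
        hence "((x + 1) powr (- 2 * a) * ?I + 2 * a * x * ((x + 1) powr (- 2 * a - 1) * ?I)) * (x\<^sup>2 - 1) powr a \<le> K x"
          unfolding K_def by (intro mult_right_mono) auto
        thus ?case by (simp add: algebra_simps)
      qed
      show "\<forall>\<^sub>F x in at_top. K x \<le> ((x - 1) powr (- 2 * a) + 2 * a * x * (x - 1) powr (- 2 * a - 1)) * (x\<^sup>2 - 1) powr a * ?I"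
        using eventually_gt_at_top[of 1]
      proof eventually_elim
        case (elim x)
        have "profE a x \<le> (x - 1) powr (- 2 * a) * ?I + 2 * a * x * ((x - 1) powr (- 2 * a - 1) * ?I)"
          unfolding profE_def using a elim by (intro add_mono mult_left_mono prof_mono_bounds) auto
        hence "K x \<le> ((x - 1) powr (- 2 * a) * ?I + 2 * a * x * ((x - 1) powr (- 2 * a - 1) * ?I)) * (x\<^sup>2 - 1) powr a"
          unfolding K_def by (intro mult_right_mono) auto
        thus ?case by (simp add: algebra_simps)
      qed
      have "((\<lambda>x. ((x + 1) powr (- 2 * a) + 2 * a * x * (x + 1) powr (- 2 * a - 1)) * (x\<^sup>2 - 1) powr a) \<longlongrightarrow> 2 * a + 1) at_top"
        using a by real_asymp
      thus "((\<lambda>x. ((x + 1) powr (- 2 * a) + 2 * a * x * (x + 1) powr (- 2 * a - 1)) * (x\<^sup>2 - 1) powr a * ?I) \<longlongrightarrow> (2 * a + 1) * ?I) at_top"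
        by (intro tendsto_intros)
      have "((\<lambda>x. ((x - 1) powr (- 2 * a) + 2 * a * x * (x - 1) powr (- 2 * a - 1)) * (x\<^sup>2 - 1) powr a) \<longlongrightarrow> 2 * a + 1) at_top"
        using a by real_asymp
      thus "((\<lambda>x. ((x - 1) powr (- 2 * a) + 2 * a * x * (x - 1) powr (- 2 * a - 1)) * (x\<^sup>2 - 1) powr a * ?I) \<longlongrightarrow> (2 * a + 1) * ?I) at_top"
        by (intro tendsto_intros)
    qed
  qed auto
  with c[OF \<mu>] pos[OF \<mu>] show ?thesis by (simp add: K_def powr_minus field_simps)
qed

text \<open>Used with \<open>\<mu>\<close> tending to infinity, where geodesic balls shrink to
  points and all quantities vanish.\<close>

lemma nonneg_if_deriv_nonpos_tendsto_0:
  fixes f f' :: "real \<Rightarrow> real"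
  assumes "\<And>x. x > c \<Longrightarrow> (f has_real_derivative f' x) (at x)" "\<And>x. x > c \<Longrightarrow> f' x \<le> 0"
    and "(f \<longlongrightarrow> 0) at_top" "x > c"
  shows "0 \<le> f x"
proof (rule tendsto_upperbound[OF assms(3)])
  show "\<forall>\<^sub>F y in at_top. f y \<le> f x"
    using eventually_ge_at_top[of x]
  proof eventually_elim
    case (elim y)
    show ?case
    proof (rule DERIV_nonpos_imp_nonincreasing[OF elim])
      fix t assume "x \<le> t"
      hence "t > c" using assms(4) by simp
      thus "\<exists>y. (f has_real_derivative y) (at t) \<and> y \<le> 0" using assms(1,2) by blast
    qed
  qed
qed simp

text \<open>Monotonicity of the \<open>l^p\<close> norms of a pair: both entries are at most
  \<open>z\<close>, so raising the exponent from \<open>q\<close> to \<open>p\<close> multiplies the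
  left side by at most \<open>z powr (p - q)\<close>.\<close>

lemma powr_add_le_mono_exponent:
  fixes x y z p q :: real
  assumes "0 \<le> x" "0 \<le> y" "0 \<le> z" "0 < q" "q \<le> p" "x powr q + y powr q \<le> z powr q"
  shows "x powr p + y powr p \<le> z powr p"
proof -
  have *: "w powr p \<le> w powr q * z powr (p - q)" if "0 \<le> w" "w powr q \<le> z powr q" for w
  proof -
    have "w \<le> z" using that assms powr_less_mono2 by (metis linorder_not_less)
    hence "w powr (p - q) \<le> z powr (p - q)" using that assms by (intro powr_mono2) auto
    hence "w powr q * w powr (p - q) \<le> w powr q * z powr (p - q)" by (intro mult_left_mono) auto
    thus ?thesis using that by (simp add: powr_add[symmetric])
  qed
  have "x powr p + y powr p \<le> x powr q * z powr (p - q) + y powr q * z powr (p - q)"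
    by (intro add_mono *) (use assms powr_ge_zero[of x q] powr_ge_zero[of y q] in linarith)+
  also have "\<dots> = (x powr q + y powr q) * z powr (p - q)" by (simp add: algebra_simps)
  also have "\<dots> \<le> z powr q * z powr (p - q)" by (intro mult_right_mono assms) auto
  also have "\<dots> = z powr p" by (simp add: powr_add[symmetric])
  finally show ?thesis .
qed

text \<open>With \<open>\<rho>\<close> the geodesic radius, \<open>v\<close> is the integral of the
  power \<open>n - 1\<close> of \<open>sinh\<close> up to \<open>\<rho>\<close>, and the right side
  is \<open>sinh \<rho>\<close> to the power \<open>2 * n\<close>. All terms vanish as
  \<open>\<mu>\<close> tends to infinity, so it suffices to compare derivatives, and this is done
  three times: the derivative of the main difference is nonpositive by inequality 2, that of
  inequality 2 by inequality 1, and that of inequality 1 by inspection.\<close>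

lemma prof_isoperimetric:
  fixes a \<mu> :: real
  assumes a: "0 < a" and \<mu>: "1 < \<mu>"
  defines "n \<equiv> 2 * a + 1"
  defines "v \<equiv> \<lambda>\<mu>. prof a (- n) \<mu> / (n * prof a 0 2)"
  shows "(n * v \<mu>)\<^sup>2 + (2 * a * v \<mu>) powr (n / a) \<le> (\<mu>\<^sup>2 - 1) powr (- n)"
proof -
  let ?I = "prof a 0 2"
  have I: "?I > 0" using prof_pos[OF a] by simp
  have n: "n > 0" using a by (simp add: n_def)
  have pos: "x\<^sup>2 - 1 > 0" if "x > 1" for x :: real using that by simp
  have v0: "v x > 0" if "x > 1" for x using prof_pos[OF a that] n I by (simp add: v_def)
  have dv: "(v has_real_derivative - ((x\<^sup>2 - 1) powr (- a - 1))) (at x)" if "x > 1" for x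
  proof -
    have "(v has_real_derivative - profE a x / (x\<^sup>2 - 1) / (n * ?I)) (at x)"
      unfolding v_def using prof_volume_deriv[OF a that] by (intro DERIV_cdivide) (simp add: n_def)
    moreover have "- profE a x / (x\<^sup>2 - 1) / (n * ?I) = - ((x\<^sup>2 - 1) powr (- a - 1))"
      using pos[OF that] n I unfolding profE_eq[OF a that] n_def[symmetric]
      by (simp add: powr_diff powr_minus field_simps)
    ultimately show ?thesis by simp
  qed
  have vlim: "(v \<longlongrightarrow> 0) at_top"
  proof (rule tendsto_sandwich)
    show "\<forall>\<^sub>F x in at_top. 0 \<le> v x" using eventually_gt_at_top[of 1] by eventually_elim (use v0 in force)
    show "\<forall>\<^sub>F x in at_top. v x \<le> (x - 1) powr (-n) / n" using eventually_gt_at_top[of 1]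
    proof eventually_elim
      case (elim x)
      thus ?case using prof_mono_bounds(2)[OF a elim, of "-n"] n I by (simp add: v_def field_simps)
    qed
    show "((\<lambda>x. (x - 1) powr (-n) / n) \<longlongrightarrow> 0) at_top" using n by real_asymp
  qed auto
  have vlim': "((\<lambda>x. (2 * a * v x) powr e) \<longlongrightarrow> 0) at_top" if "e > 0" for e
  proof -
    have nn: "0 \<le> 2 * a * v x" if "1 < x" for x using v0[OF that] a by simp
    have "((\<lambda>x. (2 * a * v x) powr e) \<longlongrightarrow> (2 * a * 0) powr e) at_top"
      by (rule tendsto_powr2[OF tendsto_mult_left[OF vlim] tendsto_const eventually_mono[OF eventually_gt_at_top[of 1] nn] that])
    thus ?thesis using that by simp
  qed
  \<comment> \<open>For geodesic balls: \<open>n - 1\<close> times the volume is at most the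
    area.\<close>
  have 1: "2 * a * v x \<le> (x\<^sup>2 - 1) powr (-a)" if "x > 1" for x
  proof -
    have "0 \<le> (x\<^sup>2 - 1) powr (-a) - 2 * a * v x"
    proof (rule nonneg_if_deriv_nonpos_tendsto_0[OF _ _ _ that])
      fix y :: real assume y: "y > 1"
      show "((\<lambda>x. (x\<^sup>2 - 1) powr (-a) - 2 * a * v x) has_real_derivative
         2 * a * (1 - y) * (y\<^sup>2 - 1) powr (- a - 1)) (at y)"
        using pos[OF y] by (auto intro!: derivative_eq_intros dv[OF y] simp: algebra_simps)
      show "2 * a * (1 - y) * (y\<^sup>2 - 1) powr (- a - 1) \<le> 0"
        using y a by (intro mult_nonpos_nonneg mult_nonneg_nonpos) auto
    next
      have "((\<lambda>x. (x\<^sup>2 - 1) powr (-a)) \<longlongrightarrow> 0) at_top" using a by real_asymp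
      thus "((\<lambda>x. (x\<^sup>2 - 1) powr (-a) - 2 * a * v x) \<longlongrightarrow> 0) at_top"
        using tendsto_diff[OF _ tendsto_mult_left[OF vlim, of "2 * a"]] by fastforce
    qed
    thus ?thesis by simp
  qed
  have 2: "n * v x + (2 * a * v x) powr ((a + 1) / a) \<le> x * (x\<^sup>2 - 1) powr (- a - 1)" if "x > 1" for x
  proof -
    have "0 \<le> x * (x\<^sup>2 - 1) powr (- a - 1) - n * v x - (2 * a * v x) powr ((a + 1) / a)"
    proof (rule nonneg_if_deriv_nonpos_tendsto_0[OF _ _ _ that])
      fix y :: real assume y: "y > 1"
      define w where "w = (y\<^sup>2 - 1) powr (- a - 1)"
      have w2: "(y\<^sup>2 - 1) powr (- a - 1 - 1) = w / (y\<^sup>2 - 1)" unfolding w_def powr_diff[of "y\<^sup>2 - 1" "- a - 1" 1] using pos[OF y] by simp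
      have e: "(a + 1) / a - 1 = 1 / a" using a by (simp add: field_simps)
      have e2: "((a + 1) / a) * (2 * a) = 2 * (a + 1)" using a by simp
      show "((\<lambda>x. x * (x\<^sup>2 - 1) powr (- a - 1) - n * v x - (2 * a * v x) powr ((a + 1) / a)) has_real_derivative
         2 * (a + 1) * w * ((2 * a * v y) powr (1 / a) - 1 / (y\<^sup>2 - 1))) (at y)"
      proof (rule DERIV_cong)
        show "((\<lambda>x. x * (x\<^sup>2 - 1) powr (- a - 1) - n * v x - (2 * a * v x) powr ((a + 1) / a)) has_real_derivative
           (w + y * ((- a - 1) * (w / (y\<^sup>2 - 1)) * (2 * y))) - n * (- w)
            - ((a + 1) / a) * (2 * a * v y) powr (1 / a) * (2 * a * (- w))) (at y)"
          using pos[OF y] v0[OF y] a unfolding w2[symmetric] e[symmetric] unfolding w_def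
          by (auto intro!: derivative_eq_intros dv[OF y])
        have *: "y * y / (y\<^sup>2 - 1) = 1 + 1 / (y\<^sup>2 - 1)" using pos[OF y] by (simp add: field_simps power2_eq_square)
        have "(w + y * ((- a - 1) * (w / (y\<^sup>2 - 1)) * (2 * y))) - n * (- w)
            - ((a + 1) / a) * (2 * a * v y) powr (1 / a) * (2 * a * (- w))
          = w + n * w - 2 * (a + 1) * w * (y * y / (y\<^sup>2 - 1)) + ((a + 1) / a) * (2 * a) * w * (2 * a * v y) powr (1 / a)"
        proof -
          have "y * ((- a - 1) * (w / (y\<^sup>2 - 1)) * (2 * y)) = - 2 * (a + 1) * w * (y * y / (y\<^sup>2 - 1))"
            by (simp only: times_divide_eq_right times_divide_eq_left) (simp add: algebra_simps)
          moreover have "(w + A) - n * (- w) - c * X * (2 * a * (- w)) = w + n * w + A + c * (2 * a) * w * X" for A c X :: real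
            by (simp add: algebra_simps)
          ultimately show ?thesis by (simp only: minus_mult_left diff_conv_add_uminus)
        qed
        also have "\<dots> = 2 * (a + 1) * w * ((2 * a * v y) powr (1 / a) - 1 / (y\<^sup>2 - 1))"
          unfolding e2 * n_def by (simp add: algebra_simps)
        finally show "(w + y * ((- a - 1) * (w / (y\<^sup>2 - 1)) * (2 * y))) - n * (- w)
            - ((a + 1) / a) * (2 * a * v y) powr (1 / a) * (2 * a * (- w))
          = 2 * (a + 1) * w * ((2 * a * v y) powr (1 / a) - 1 / (y\<^sup>2 - 1))" .
      qed
      have "(2 * a * v y) powr (1 / a) \<le> ((y\<^sup>2 - 1) powr (-a)) powr (1 / a)"
        using 1[OF y] a v0[OF y] by (intro powr_mono2) auto
      also have "\<dots> = 1 / (y\<^sup>2 - 1)" unfolding powr_powr using pos[OF y] a by (simp add: powr_minus_divide)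
      finally show "2 * (a + 1) * w * ((2 * a * v y) powr (1 / a) - 1 / (y\<^sup>2 - 1)) \<le> 0"
        using a by (intro mult_nonneg_nonpos) (auto simp: w_def)
    next
      have l1: "((\<lambda>x. x * (x\<^sup>2 - 1) powr (- a - 1)) \<longlongrightarrow> 0) at_top" using a by real_asymp
      show "((\<lambda>x. x * (x\<^sup>2 - 1) powr (- a - 1) - n * v x - (2 * a * v x) powr ((a + 1) / a)) \<longlongrightarrow> 0) at_top"
        using tendsto_diff[OF tendsto_diff[OF l1 tendsto_mult_left[OF vlim, of n]] vlim'[of "(a + 1) / a"]] a by simp
    qed
    thus ?thesis by simp
  qed
  have "0 \<le> (\<mu>\<^sup>2 - 1) powr (- n) - (n * v \<mu>)\<^sup>2 - (2 * a * v \<mu>) powr (n / a)"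
  proof (rule nonneg_if_deriv_nonpos_tendsto_0[OF _ _ _ \<mu>])
    fix y :: real assume y: "y > 1"
    define w where "w = (y\<^sup>2 - 1) powr (- a - 1)"
    have w2: "(y\<^sup>2 - 1) powr (- n - 1) = w * (y\<^sup>2 - 1) powr (- a - 1)"
    proof -
      have "- n - 1 = (- a - 1) + (- a - 1)" by (simp add: n_def)
      thus ?thesis unfolding w_def by (simp only: powr_add)
    qed
    have e: "n / a - 1 = (a + 1) / a" using a by (simp add: field_simps n_def)
    show "((\<lambda>x. (x\<^sup>2 - 1) powr (- n) - (n * v x)\<^sup>2 - (2 * a * v x) powr (n / a)) has_real_derivative
       - 2 * n * w * (y * (y\<^sup>2 - 1) powr (- a - 1) - n * v y - (2 * a * v y) powr ((a + 1) / a))) (at y)"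
    proof (rule DERIV_cong)
      show "((\<lambda>x. (x\<^sup>2 - 1) powr (- n) - (n * v x)\<^sup>2 - (2 * a * v x) powr (n / a)) has_real_derivative
         - n * (w * (y\<^sup>2 - 1) powr (- a - 1)) * (2 * y) - 2 * (n * v y) * (n * (- w))
           - (n / a) * (2 * a * v y) powr ((a + 1) / a) * (2 * a * (- w))) (at y)"
        using pos[OF y] v0[OF y] a unfolding w2[symmetric] e[symmetric] unfolding w_def
        by (auto intro!: derivative_eq_intros dv[OF y])
      show "- n * (w * (y\<^sup>2 - 1) powr (- a - 1)) * (2 * y) - 2 * (n * v y) * (n * (- w))
           - (n / a) * (2 * a * v y) powr ((a + 1) / a) * (2 * a * (- w))
         = - 2 * n * w * (y * (y\<^sup>2 - 1) powr (- a - 1) - n * v y - (2 * a * v y) powr ((a + 1) / a))"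
        using a by (simp add: algebra_simps)
    qed
    show "- 2 * n * w * (y * (y\<^sup>2 - 1) powr (- a - 1) - n * v y - (2 * a * v y) powr ((a + 1) / a)) \<le> 0"
      using 2[OF y] n by (intro mult_nonpos_nonneg) (auto simp: w_def)
  next
    have l1: "((\<lambda>x. (x\<^sup>2 - 1) powr (- n)) \<longlongrightarrow> 0) at_top" using n by real_asymp
    show "((\<lambda>x. (x\<^sup>2 - 1) powr (- n) - (n * v x)\<^sup>2 - (2 * a * v x) powr (n / a)) \<longlongrightarrow> 0) at_top"
      using tendsto_diff[OF tendsto_diff[OF l1 tendsto_power[OF tendsto_mult_left[OF vlim, of n], of 2]] vlim'[of "n / a"]] a n by simp
  qed
  thus ?thesis by simp
qed

text \<open>Intermediate values. Near \<open>\<mu> = 1\<close> the volume is unbounded because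
  \<open>profE\<close> is, and \<open>z + \<mu> \<le> \<mu> + 1\<close> bounds
  \<open>profE a \<mu>\<close> by \<open>n * \<mu> + 1\<close> times the volume; at infinity the
  volume tends to 0.\<close>

lemma prof_volume_surj:
  assumes a: "0 < a" and V: "0 < V"
  shows "\<exists>\<mu>>1. prof a (- 2 * a - 1) \<mu> = V"
proof -
  let ?I = "prof a 0 2" and ?B = "prof a (- 2 * a - 1)"
  define n where "n = 2 * a + 1"
  have n: "n > 0" using a by (simp add: n_def)
  have I: "?I > 0" using prof_pos[OF a] by simp
  have up: "n * ?I * (\<mu>\<^sup>2 - 1) powr (-a) / (n * \<mu> + 1) \<le> ?B \<mu>" if \<mu>: "\<mu> > 1" for \<mu>
  proof -
    have "prof a (- 2 * a) \<mu> \<le> integral {-1..1} (\<lambda>z. (\<mu> + 1) * ((1 - z\<^sup>2) powr a * (z + \<mu>) powr (- 2 * a - 1)))"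
      unfolding prof_def
    proof (rule integral_le)
      fix z :: real assume z: "z \<in> {-1..1}"
      have "(z + \<mu>) powr (- 2 * a) = (z + \<mu>) * (z + \<mu>) powr (- 2 * a - 1)" using z \<mu> by (simp add: powr_diff)
      also have "\<dots> \<le> (\<mu> + 1) * (z + \<mu>) powr (- 2 * a - 1)" using z by (intro mult_right_mono) auto
      finally have "(1 - z\<^sup>2) powr a * (z + \<mu>) powr (- 2 * a) \<le> (1 - z\<^sup>2) powr a * ((\<mu> + 1) * (z + \<mu>) powr (- 2 * a - 1))"
        by (intro mult_left_mono) auto
      thus "(1 - z\<^sup>2) powr a * (z + \<mu>) powr (- 2 * a) \<le> (\<mu> + 1) * ((1 - z\<^sup>2) powr a * (z + \<mu>) powr (- 2 * a - 1))"
        by (simp add: mult_ac)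
    qed (use prof_integrable[OF a \<mu>] in \<open>auto intro!: integrable_on_mult_right\<close>)
    also have "\<dots> = (\<mu> + 1) * ?B \<mu>" unfolding prof_def by simp
    finally have "profE a \<mu> \<le> (n * \<mu> + 1) * ?B \<mu>" by (simp add: profE_def n_def algebra_simps)
    moreover have "n * \<mu> + 1 > 0" using n \<mu> by (simp add: add_pos_pos)
    ultimately show ?thesis using profE_eq[OF a \<mu>] by (simp only: pos_divide_le_eq n_def) (simp add: mult_ac)
  qed
  have "filterlim (\<lambda>\<mu>. n * ?I * (\<mu>\<^sup>2 - 1) powr (-a) / (n * \<mu> + 1)) at_top (at_right 1)"
    using n I a by real_asymp
  hence "\<forall>\<^sub>F \<mu> in at_right 1. V \<le> n * ?I * (\<mu>\<^sup>2 - 1) powr (-a) / (n * \<mu> + 1) \<and> \<mu> > 1 \<and> \<mu> < 2"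
    using eventually_at_right_less[of 1] eventually_at_right_real[of 1 2]
    by (auto simp: filterlim_at_top eventually_conj_iff elim: eventually_mono)
  then obtain \<mu>1 where m1: "\<mu>1 > 1" "V \<le> ?B \<mu>1" using eventually_happens'[OF trivial_limit_at_right_real[of 1]]
    by (metis (no_types, lifting) order_trans up)
  have "((\<lambda>\<mu>. (\<mu> - 1) powr (- n) * ?I) \<longlongrightarrow> 0) at_top" using n by real_asymp
  hence "\<forall>\<^sub>F \<mu> in at_top. (\<mu> - 1) powr (- n) * ?I < V \<and> \<mu> > \<mu>1"
    using V by (intro eventually_conj eventually_gt_at_top order_tendstoD)
  then obtain \<mu>2 where m2: "\<mu>2 > \<mu>1" "(\<mu>2 - 1) powr (- n) * ?I < V" using eventually_happens'[OF trivial_limit_at_top_linorder] by blast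
  hence "?B \<mu>2 \<le> V" using prof_mono_bounds(2)[OF a, of \<mu>2 "- n"] m1 n by (simp add: n_def)
  moreover have "isCont ?B \<mu>" if "\<mu> > 1" for \<mu> using prof_volume_deriv[OF a that] by (rule DERIV_isCont)
  ultimately obtain \<mu> where "\<mu>1 \<le> \<mu>" "?B \<mu> = V"
    using IVT2[of ?B \<mu>2 V \<mu>1] m1 m2 by (force intro: less_le_trans)
  thus ?thesis using m1(1) by (intro exI[of _ \<mu>]) auto
qed

text \<open>At the exponent \<open>n / a\<close>, which is \<open>2 * n / (n - 1)\<close>, the
  Euclidean term is a multiple of \<open>V powr 2\<close>, and factoring out
  \<open>(n * \<sigma>) powr (n / a)\<close> leaves exactly \<open>prof_isoperimetric\<close>.
  Larger \<open>p\<close> follow by monotonicity in the exponent.\<close>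

lemma hyperbolic_profile:
  fixes a \<omega> V p :: real
  assumes a: "0 < a" and \<omega>: "0 < \<omega>" and V: "0 < V"
  defines "n \<equiv> 2 * a + 1"
  assumes p: "n / a \<le> p"
  obtains \<mu> where "\<mu> > 1" "\<omega> * prof a (- n) \<mu> = V"
    "(n * (\<omega> * prof a 0 2) powr (1 / n) * V powr (2 * a / n)) powr p + (2 * a * V) powr p \<le> (\<omega> * profE a \<mu>) powr p"
proof -
  obtain \<mu> where \<mu>: "\<mu> > 1" and B: "prof a (- n) \<mu> = V / \<omega>"
    using prof_volume_surj[OF a, of "V / \<omega>"] V \<omega> by (auto simp: n_def)
  have n: "n > 0" using a by (simp add: n_def)
  define \<sigma> where "\<sigma> = \<omega> * prof a 0 2"
  have \<sigma>: "\<sigma> > 0" using prof_pos[OF a] \<omega> by (simp add: \<sigma>_def)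
  define v where "v = prof a (- n) \<mu> / (n * prof a 0 2)"
  have v: "V = n * \<sigma> * v" using B \<omega> n prof_pos[OF a, of 2 0] by (simp add: v_def \<sigma>_def)
  have v0: "v > 0" using V n \<sigma> unfolding v by (metis mult_pos_pos zero_less_mult_pos)
  have E: "\<omega> * profE a \<mu> = n * \<sigma> * (\<mu>\<^sup>2 - 1) powr (-a)" by (simp add: profE_eq[OF a \<mu>] n_def \<sigma>_def)
  have pos: "\<mu>\<^sup>2 - 1 > 0" using \<mu> by simp
  have na: "n / a = 1 / a + 2" using a by (simp add: n_def field_simps)
  have "(n * \<sigma> powr (1 / n) * V powr (2 * a / n)) powr (n / a) + (2 * a * V) powr (n / a)
     = (n * \<sigma>) powr (n / a) * ((n * v)\<^sup>2 + (2 * a * v) powr (n / a))"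
  proof -
    have "(n * \<sigma> powr (1 / n) * V powr (2 * a / n)) powr (n / a) = n powr (n / a) * \<sigma> powr (1 / a) * V powr 2"
      using n \<sigma> V a by (simp add: powr_mult powr_powr)
    also have "V powr 2 = n\<^sup>2 * \<sigma>\<^sup>2 * v\<^sup>2" using V by (simp add: v power_mult_distrib)
    also have "n powr (n / a) * \<sigma> powr (1 / a) * (n\<^sup>2 * \<sigma>\<^sup>2 * v\<^sup>2) = n powr (n / a) * \<sigma> powr (n / a) * (n * v)\<^sup>2"
      using \<sigma> by (simp add: na powr_add power_mult_distrib)
    also have "\<dots> = (n * \<sigma>) powr (n / a) * (n * v)\<^sup>2" using n \<sigma> by (simp add: powr_mult)
    finally have 1: "(n * \<sigma> powr (1 / n) * V powr (2 * a / n)) powr (n / a) = (n * \<sigma>) powr (n / a) * (n * v)\<^sup>2" .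
    have "2 * a * V = (n * \<sigma>) * (2 * a * v)" by (simp add: v)
    hence "(2 * a * V) powr (n / a) = (n * \<sigma>) powr (n / a) * (2 * a * v) powr (n / a)"
      using n \<sigma> v0 a by (simp only: powr_mult)
    with 1 show ?thesis by (simp add: algebra_simps)
  qed
  also have "\<dots> \<le> (n * \<sigma>) powr (n / a) * (\<mu>\<^sup>2 - 1) powr (- n)"
    using prof_isoperimetric[OF a \<mu>] by (intro mult_left_mono) (auto simp: v_def n_def)
  also have "\<dots> = (\<omega> * profE a \<mu>) powr (n / a)"
    using n \<sigma> pos a by (simp add: E powr_mult powr_powr)
  finally have "(n * \<sigma> powr (1 / n) * V powr (2 * a / n)) powr p + (2 * a * V) powr p \<le> (\<omega> * profE a \<mu>) powr p"
    by (rule powr_add_le_mono_exponent[rotated -1]) (use n \<sigma> V a p pos in \<open>auto simp: E\<close>)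
  thus ?thesis using that[OF \<mu>] B \<omega> by (simp add: \<sigma>_def)
qed

section \<open>Transport of densities on the line\<close>

lemma nn_integral_has_integral_Icc:
  fixes f :: "real \<Rightarrow> real"
  assumes [measurable]: "f \<in> borel_measurable borel" and nn: "\<And>x. x \<in> {a..b} \<Longrightarrow> 0 \<le> f x"
    and I: "(f has_integral I) {a..b}"
  shows "(\<integral>\<^sup>+x. ennreal (f x) * indicator {a..b} x \<partial>lborel) = ennreal I"
proof -
  have "((\<lambda>x. if x \<in> {a..b} then f x else 0) has_integral I) UNIV" using I by (simp only: has_integral_restrict_UNIV)
  hence "(\<integral>\<^sup>+x. ennreal (if x \<in> {a..b} then f x else 0) \<partial>lborel) = ennreal I"
    using nn by (intro nn_integral_has_integral_lborel) auto
  moreover have "(\<integral>\<^sup>+x. ennreal (if x \<in> {a..b} then f x else 0) \<partial>lborel) = (\<integral>\<^sup>+x. ennreal (f x) * indicator {a..b} x \<partial>lborel)"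
    by (intro nn_integral_cong) (auto simp: indicator_def)
  ultimately show ?thesis by simp
qed

text \<open>A change of variables for primitives that need be neither differentiable nor injective,
  since the densities that come from slices are merely measurable. The image of the density
  \<open>a\<close> under \<open>F\<close> and Lebesgue measure on \<open>{F c..F d}\<close> agree on
  all half-lines, hence as measures.\<close>

lemma nn_integral_subst_primitive:
  fixes F a :: "real \<Rightarrow> real" and f :: "real \<Rightarrow> ennreal"
  assumes cd: "c \<le> d" and a[measurable]: "a \<in> borel_measurable borel" and f[measurable]: "f \<in> borel_measurable borel"
    and F: "continuous_on {c..d} F" and mono: "\<And>x y. c \<le> x \<Longrightarrow> x \<le> y \<Longrightarrow> y \<le> d \<Longrightarrow> F x \<le> F y"
    and prim: "\<And>x y. c \<le> x \<Longrightarrow> x \<le> y \<Longrightarrow> y \<le> d \<Longrightarrow>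
        (\<integral>\<^sup>+t. ennreal (a t) * indicator {x..y} t \<partial>lborel) = ennreal (F y - F x)"
  shows "(\<integral>\<^sup>+y. f (F y) * ennreal (a y) * indicator {c..d} y \<partial>lborel) = (\<integral>\<^sup>+v. f v * indicator {F c..F d} v \<partial>lborel)"
proof -
  define F' where "F' y = F (max c (min d y))" for y
  have F'c: "continuous_on UNIV F'" unfolding F'_def
    by (rule continuous_on_compose2[OF F]) (use cd in \<open>auto intro!: continuous_intros\<close>)
  hence [measurable]: "F' \<in> borel_measurable borel" by (rule borel_measurable_continuous_onI)
  have F'eq: "F' y = F y" if "y \<in> {c..d}" for y
  proof -
    have "max c (min d y) = y" using that by auto
    thus ?thesis by (simp add: F'_def)
  qed
  let ?a = "\<lambda>y. ennreal (a y) * indicator {c..d} y"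
  let ?N1 = "distr (density lborel ?a) borel F'"
  let ?N2 = "density lborel (indicator {F c..F d})"
  have prim': "(\<integral>\<^sup>+t. ennreal (a t) * indicator {x<..d} t \<partial>lborel) = ennreal (F d - F x)" if "c \<le> x" "x \<le> d" for x
  proof -
    have "(\<integral>\<^sup>+t. ennreal (a t) * indicator {x<..d} t \<partial>lborel) = (\<integral>\<^sup>+t. ennreal (a t) * indicator {x..d} t \<partial>lborel)"
      by (rule nn_integral_cong_AE, rule AE_mp[OF AE_lborel_singleton[of x]]) (auto simp: indicator_def)
    thus ?thesis using prim[of x d] that by simp
  qed
  have N2: "emeasure ?N2 {x<..} = emeasure lborel ({F c..F d} \<inter> {x<..})" for x
  proof -
    have "emeasure ?N2 {x<..} = (\<integral>\<^sup>+y. indicator ({F c..F d} \<inter> {x<..}) y \<partial>lborel)"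
      by (simp add: emeasure_density indicator_inter_arith)
    thus ?thesis by simp
  qed
  have eq: "emeasure ?N1 {x<..} = emeasure ?N2 {x<..}" for x
  proof -
    have 1: "emeasure ?N1 {x<..} = (\<integral>\<^sup>+y. ennreal (a y) * indicator {y\<in>{c..d}. x < F y} y \<partial>lborel)"
    proof -
      have "emeasure ?N1 {x<..} = emeasure (density lborel ?a) (F' -` {x<..} \<inter> space (density lborel ?a))"
        by (rule emeasure_distr) auto
      also have "F' -` {x<..} \<inter> space (density lborel ?a) = {y. x < F' y}" by auto
      also have "emeasure (density lborel ?a) {y. x < F' y} = (\<integral>\<^sup>+y. ?a y * indicator {y. x < F' y} y \<partial>lborel)"
        by (rule emeasure_density) auto
      also have "\<dots> = (\<integral>\<^sup>+y. ennreal (a y) * indicator {y\<in>{c..d}. x < F y} y \<partial>lborel)"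
        by (intro nn_integral_cong) (auto simp: indicator_def F'eq)
      finally show ?thesis .
    qed
    consider "x < F c" | "F d \<le> x" | "F c \<le> x" "x < F d" by linarith
    then show ?thesis
    proof cases
      case 1
      have "{y\<in>{c..d}. x < F y} = {c..d}" using mono[of c] 1 by (auto intro: less_le_trans)
      moreover have "{F c..F d} \<inter> {x<..} = {F c..F d}" using 1 by auto
      ultimately show ?thesis unfolding N2 \<open>emeasure ?N1 {x<..} = _\<close> using prim[of c d] mono[of c d] cd by simp
    next
      case 2
      have "{y\<in>{c..d}. x < F y} = {}" using mono[of _ d] 2 by force
      moreover have "{F c..F d} \<inter> {x<..} = {}" using 2 by auto
      ultimately show ?thesis unfolding N2 \<open>emeasure ?N1 {x<..} = _\<close> by simp
    next
      case 3
      \<comment> \<open>The last point where \<open>F\<close> takes the value \<open>x\<close> is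
        sought: beyond it \<open>F\<close> exceeds \<open>x\<close>, even if \<open>F\<close> is
        flat for a while.\<close>
      let ?S = "{y\<in>{c..d}. F y = x}"
      have "?S \<noteq> {}" using IVT'[of F c x d] 3 cd F by auto
      moreover have "closed ?S" by (rule continuous_closed_preimage_constant[OF F]) simp
      then have "compact ?S" by (rule compact_eq_bounded_closed[THEN iffD2, OF conjI, rotated]) (rule bounded_subset[of "{c..d}"], auto)
      ultimately have "\<exists>s\<in>?S. \<forall>t\<in>?S. t \<le> s" by (intro compact_attains_sup)
      then obtain y0 where y0: "y0 \<in> ?S" and y0': "\<forall>t\<in>?S. t \<le> y0" by (rule bexE)
      have s: "{y\<in>{c..d}. x < F y} = {y0<..d}"
      proof (intro set_eqI iffI)
        fix y assume y: "y \<in> {y\<in>{c..d}. x < F y}"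
        have "\<not> y \<le> y0" using mono[of y y0] y y0 by auto
        thus "y \<in> {y0<..d}" using y by auto
      next
        fix y assume y: "y \<in> {y0<..d}"
        hence "x \<le> F y" "y \<in> {c..d}" using mono[of y0 y] y0 by auto
        moreover have "F y \<noteq> x" using y0' y calculation by fastforce
        ultimately show "y \<in> {y\<in>{c..d}. x < F y}" by auto
      qed
      have "{F c..F d} \<inter> {x<..} = {x<..F d}" using 3 by auto
      thus ?thesis unfolding N2 \<open>emeasure ?N1 {x<..} = _\<close> s using prim'[of y0] y0 3 by simp
    qed
  qed
  have "?N1 = ?N2"
  proof (rule measure_eqI_lessThan)
    fix x
    have "emeasure lborel ({F c..F d} \<inter> {x<..}) \<le> emeasure lborel {F c..F d}" by (intro emeasure_mono) auto
    also have "\<dots> < \<infinity>" by (simp add: emeasure_lborel_Icc_eq)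
    finally show "emeasure ?N1 {x<..} < \<infinity>" unfolding eq N2 .
  qed (use eq in auto)
  hence "integral\<^sup>N ?N1 f = integral\<^sup>N ?N2 f" by simp
  also have "integral\<^sup>N ?N1 f = (\<integral>\<^sup>+y. ?a y * f (F' y) \<partial>lborel)"
    by (subst nn_integral_distr, simp, simp, subst nn_integral_density) auto
  also have "\<dots> = (\<integral>\<^sup>+y. f (F y) * ennreal (a y) * indicator {c..d} y \<partial>lborel)"
    by (intro nn_integral_cong) (auto simp: indicator_def F'eq mult_ac)
  also have "integral\<^sup>N ?N2 f = (\<integral>\<^sup>+v. f v * indicator {F c..F d} v \<partial>lborel)"
    by (subst nn_integral_density) (auto simp: mult.commute)
  finally show ?thesis .
qed

text \<open>\<open>\<Theta>\<close> is the quantile function of the density \<open>b\<close>: it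
  carries Lebesgue measure on \<open>{0..V}\<close> to \<open>b\<close>. Clamping the argument to
  \<open>{0..V}\<close> makes it continuous on the whole line with values in
  \<open>{lo..hi}\<close>.\<close>

lemma primitive_inverse:
  fixes b :: "real \<Rightarrow> real"
  assumes lh: "lo < hi" and bc: "continuous_on {lo..hi} b" and b0: "\<And>z. 0 \<le> b z" and bm[measurable]: "b \<in> borel_measurable borel"
    and bpos: "\<And>z. lo < z \<Longrightarrow> z < hi \<Longrightarrow> 0 < b z" and bI: "(b has_integral V) {lo..hi}"
  obtains \<Theta> where "continuous_on UNIV \<Theta>" "\<And>v. \<Theta> v \<in> {lo..hi}" "\<And>v. 0 < v \<Longrightarrow> v < V \<Longrightarrow> lo < \<Theta> v \<and> \<Theta> v < hi"
    "\<And>v. 0 < v \<Longrightarrow> v < V \<Longrightarrow> (\<Theta> has_real_derivative inverse (b (\<Theta> v))) (at v)"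
    "\<And>u v. 0 \<le> u \<Longrightarrow> u \<le> v \<Longrightarrow> v \<le> V \<Longrightarrow> \<Theta> u \<le> \<Theta> v"
    "\<Theta> 0 = lo"
    "\<And>f. f \<in> borel_measurable borel \<Longrightarrow> (\<integral>\<^sup>+v. f (\<Theta> v) * indicator {0..V} v \<partial>lborel) = (\<integral>\<^sup>+z. f z * ennreal (b z) * indicator {lo..hi} z \<partial>lborel)"
proof -
  have bint: "b integrable_on {x..y}" if "lo \<le> x" "y \<le> hi" for x y
    by (rule integrable_subinterval_real[OF has_integral_integrable[OF bI]]) (use that in auto)
  define G where "G z = integral {lo..z} b" for z
  have G0: "G lo = 0" "G hi = V" using bI by (auto simp: G_def integral_unique)
  have Gc: "continuous_on {lo..hi} G" unfolding G_def by (rule indefinite_integral_continuous_1) (rule bint, auto)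
  have GD: "(G has_real_derivative b z) (at z)" if "lo < z" "z < hi" for z
    using integral_has_real_derivative[OF bc, of z] that unfolding G_def by (simp add: at_within_Icc_at)
  have Gdiff: "G y - G x = integral {x..y} b" if "lo \<le> x" "x \<le> y" "y \<le> hi" for x y
    using Henstock_Kurzweil_Integration.integral_combine[of lo x y b] bint[of lo y] that by (simp add: G_def)
  have Gless: "G x < G y" if "lo \<le> x" "x < y" "y \<le> hi" for x y
  proof (rule DERIV_pos_imp_increasing_open[OF that(2)])
    fix z assume "x < z" "z < y"
    thus "\<exists>d. (G has_real_derivative d) (at z) \<and> 0 < d" using GD[of z] bpos[of z] that by auto
  qed (rule continuous_on_subset[OF Gc], use that in auto)
  have Gmono: "G x \<le> G y" if "lo \<le> x" "x \<le> y" "y \<le> hi" for x y using Gless[of x y] that by (cases "x = y") auto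
  have Ginj: "inj_on G {lo..hi}"
  proof (rule inj_onI)
    fix x y assume "x \<in> {lo..hi}" "y \<in> {lo..hi}" "G x = G y"
    thus "x = y" using Gless[of x y] Gless[of y x] by (cases x y rule: linorder_cases) auto
  qed
  have V: "0 < V" using Gless[of lo hi] G0 lh by simp
  have Gim: "G ` {lo..hi} = {0..V}"
  proof (intro equalityI subsetI)
    fix v assume "v \<in> {0..V}"
    thus "v \<in> G ` {lo..hi}" using IVT'[of G lo v hi] Gc G0 lh by auto
  next
    fix v assume "v \<in> G ` {lo..hi}"
    then obtain z where "z \<in> {lo..hi}" "v = G z" by blast
    thus "v \<in> {0..V}" using Gmono[of lo z] Gmono[of z hi] G0 by auto
  qed
  define \<Theta> where "\<Theta> v = the_inv_into {lo..hi} G (max 0 (min V v))" for v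
  have \<Theta>G: "\<Theta> (G z) = z" if "z \<in> {lo..hi}" for z
  proof -
    have "max 0 (min V (G z)) = G z" using that Gmono[of lo z] Gmono[of z hi] G0 by auto
    thus ?thesis using that by (simp add: \<Theta>_def the_inv_into_f_f[OF Ginj])
  qed
  have G\<Theta>: "G (\<Theta> v) = v" if "v \<in> {0..V}" for v
  proof -
    have "max 0 (min V v) = v" using that by auto
    thus ?thesis using that Gim by (simp add: \<Theta>_def f_the_inv_into_f[OF Ginj])
  qed
  have \<Theta>r: "\<Theta> v \<in> {lo..hi}" for v
    unfolding \<Theta>_def by (rule the_inv_into_into[OF Ginj _ order_refl]) (use V Gim in auto)
  have \<Theta>c: "continuous_on UNIV \<Theta>"
  proof -
    have "continuous_on (G ` {lo..hi}) (the_inv_into {lo..hi} G)"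
      by (rule continuous_on_inv[OF Gc]) (auto simp: the_inv_into_f_f[OF Ginj])
    thus ?thesis unfolding \<Theta>_def Gim by (rule continuous_on_compose2) (use V in \<open>auto intro!: continuous_intros\<close>)
  qed
  have \<Theta>m[measurable]: "\<Theta> \<in> borel_measurable borel" by (rule borel_measurable_continuous_onI[OF \<Theta>c])
  have \<Theta>i: "lo < \<Theta> v \<and> \<Theta> v < hi" if "0 < v" "v < V" for v
  proof -
    have "G (\<Theta> v) = v" using G\<Theta> that by simp
    hence "\<Theta> v \<noteq> lo" "\<Theta> v \<noteq> hi" using that G0 by auto
    thus ?thesis using \<Theta>r[of v] by auto
  qed
  have \<Theta>D: "(\<Theta> has_real_derivative inverse (b (\<Theta> v))) (at v)" if v: "0 < v" "v < V" for v
  proof (rule DERIV_inverse_function[where f=G and a=0 and b=V])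
    show "(G has_real_derivative b (\<Theta> v)) (at (\<Theta> v))" using GD \<Theta>i[OF v] by blast
    show "b (\<Theta> v) \<noteq> 0" using bpos[of "\<Theta> v"] \<Theta>i[OF v] by auto
    show "isCont \<Theta> v" using \<Theta>c by (simp add: continuous_on_eq_continuous_at)
  qed (use v G\<Theta> in auto)
  have mono: "\<Theta> u \<le> \<Theta> v" if "0 \<le> u" "u \<le> v" "v \<le> V" for u v
  proof (rule ccontr)
    assume "\<not> \<Theta> u \<le> \<Theta> v"
    hence "G (\<Theta> v) < G (\<Theta> u)" using \<Theta>r[of u] \<Theta>r[of v] by (intro Gless) auto
    thus False using that G\<Theta>[of u] G\<Theta>[of v] by simp
  qed
  have sub: "(\<integral>\<^sup>+v. f (\<Theta> v) * indicator {0..V} v \<partial>lborel) = (\<integral>\<^sup>+z. f z * ennreal (b z) * indicator {lo..hi} z \<partial>lborel)"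
    if [measurable]: "f \<in> borel_measurable borel" for f
  proof -
    have "(\<integral>\<^sup>+v. f (\<Theta> v) * indicator {G lo..G hi} v \<partial>lborel) = (\<integral>\<^sup>+z. f (\<Theta> (G z)) * ennreal (b z) * indicator {lo..hi} z \<partial>lborel)"
    proof (rule nn_integral_subst_primitive[symmetric, where f = "\<lambda>v. f (\<Theta> v)"])
      show "(\<integral>\<^sup>+t. ennreal (b t) * indicator {x..y} t \<partial>lborel) = ennreal (G y - G x)" if "lo \<le> x" "x \<le> y" "y \<le> hi" for x y
        unfolding Gdiff[OF that] using b0 integrable_integral[OF bint[OF that(1,3)]] by (intro nn_integral_has_integral_Icc) auto
    qed (use Gc Gmono lh in auto)
    also have "\<dots> = (\<integral>\<^sup>+z. f z * ennreal (b z) * indicator {lo..hi} z \<partial>lborel)"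
      by (intro nn_integral_cong) (auto simp: indicator_def \<Theta>G)
    finally show ?thesis unfolding G0 .
  qed
  show ?thesis using that[OF \<Theta>c \<Theta>r \<Theta>i \<Theta>D mono _ sub] \<Theta>G[of lo] G0 lh by simp
qed

text \<open>The distribution function of \<open>d\<close> started at \<open>c\<close>. The bound
  \<open>K\<close> makes it Lipschitz, hence continuous, as the substitution rule for primitives
  requires.\<close>

lemma density_primitive:
  fixes d :: "real \<Rightarrow> real"
  assumes d[measurable]: "d \<in> borel_measurable borel" and d0: "\<And>s. 0 \<le> d s" and dK: "\<And>s. d s \<le> K"
    and V: "(\<integral>\<^sup>+s. ennreal (d s) \<partial>lborel) = ennreal V" "0 \<le> V"
  obtains F where "F \<in> borel_measurable borel" "\<And>x y. x \<le> y \<Longrightarrow> F x \<le> F y" "\<And>e. continuous_on {c..e} F"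
    "\<And>x y. c \<le> x \<Longrightarrow> x \<le> y \<Longrightarrow> (\<integral>\<^sup>+t. ennreal (d t) * indicator {x..y} t \<partial>lborel) = ennreal (F y - F x)"
    "F c = 0" "\<And>e. (\<And>s. d s \<noteq> 0 \<Longrightarrow> s \<in> {c..e}) \<Longrightarrow> F e = V"
proof -
  define F where "F y = enn2real (\<integral>\<^sup>+t. ennreal (d t) * indicator {c..y} t \<partial>lborel)" for y
  have Fe: "(\<integral>\<^sup>+t. ennreal (d t) * indicator {c..y} t \<partial>lborel) = ennreal (F y)" for y
  proof -
    have "(\<integral>\<^sup>+t. ennreal (d t) * indicator {c..y} t \<partial>lborel) \<le> (\<integral>\<^sup>+t. ennreal (d t) \<partial>lborel)"
      by (intro nn_integral_mono) (auto simp: indicator_def)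
    also have "\<dots> < top" unfolding V by simp
    finally show ?thesis by (simp add: F_def)
  qed
  have F_nn: "0 \<le> F y" for y by (simp add: F_def)
  have Fmono: "F x \<le> F y" if "x \<le> y" for x y
  proof -
    have "ennreal (F x) \<le> ennreal (F y)" unfolding Fe[symmetric] using that by (intro nn_integral_mono) (auto simp: indicator_def)
    thus ?thesis using F_nn by simp
  qed
  have Fm: "F \<in> borel_measurable borel" by (rule borel_measurable_mono) (simp add: mono_def Fmono)
  have Fprim: "(\<integral>\<^sup>+t. ennreal (d t) * indicator {x..y} t \<partial>lborel) = ennreal (F y - F x)" if "c \<le> x" "x \<le> y" for x y
  proof -
    have "ennreal (F y) = (\<integral>\<^sup>+t. ennreal (d t) * indicator {c..x} t + ennreal (d t) * indicator {x<..y} t \<partial>lborel)"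
      unfolding Fe[symmetric] using that by (intro nn_integral_cong) (auto simp: indicator_def)
    also have "\<dots> = ennreal (F x) + (\<integral>\<^sup>+t. ennreal (d t) * indicator {x<..y} t \<partial>lborel)"
      by (subst nn_integral_add) (auto simp: Fe)
    also have "(\<integral>\<^sup>+t. ennreal (d t) * indicator {x<..y} t \<partial>lborel) = (\<integral>\<^sup>+t. ennreal (d t) * indicator {x..y} t \<partial>lborel)"
      by (rule nn_integral_cong_AE, rule AE_mp[OF AE_lborel_singleton[of x]]) (auto simp: indicator_def)
    finally have e: "ennreal (F y) = ennreal (F x) + (\<integral>\<^sup>+t. ennreal (d t) * indicator {x..y} t \<partial>lborel)" .
    have "ennreal (F y - F x) = ennreal (F y) - ennreal (F x)" using F_nn by (simp add: ennreal_minus)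
    also have "\<dots> = (\<integral>\<^sup>+t. ennreal (d t) * indicator {x..y} t \<partial>lborel)" unfolding e by simp
    finally show ?thesis ..
  qed
  have K0: "0 \<le> K" using d0 dK order_trans by blast
  have Flip: "F y - F x \<le> K * (y - x)" if "c \<le> x" "x \<le> y" for x y
  proof -
    have "ennreal (F y - F x) \<le> (\<integral>\<^sup>+t. ennreal K * indicator {x..y} t \<partial>lborel)"
      unfolding Fprim[OF that, symmetric] by (intro nn_integral_mono mult_right_mono ennreal_leI dK) auto
    also have "\<dots> = ennreal (K * (y - x))"
      using that K0 by (subst nn_integral_cmult_indicator) (auto simp: ennreal_mult)
    finally show ?thesis using that K0 by (simp add: ennreal_le_iff)
  qed
  have Fcont: "continuous_on {c..e} F" for e
  proof (rule lipschitz_on_continuous_on)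
    show "K-lipschitz_on {c..e} F"
    proof (rule lipschitz_onI)
      fix x y assume "x \<in> {c..e}" "y \<in> {c..e}"
      thus "dist (F x) (F y) \<le> K * dist x y"
        using Flip[of x y] Flip[of y x] Fmono[of x y] Fmono[of y x] by (cases "x \<le> y") (auto simp: dist_real_def abs_if)
    qed (use K0 in auto)
  qed
  have Fc: "F c = 0" unfolding F_def using nn_integral_null_set[of "{c..c}" lborel "\<lambda>t. ennreal (d t)"] by (simp add: null_sets_def)
  have Fd: "F e = V" if "\<And>s. d s \<noteq> 0 \<Longrightarrow> s \<in> {c..e}" for e
  proof -
    have "ennreal (F e) = (\<integral>\<^sup>+t. ennreal (d t) \<partial>lborel)" unfolding Fe[symmetric]
      by (intro nn_integral_cong) (use that in \<open>force simp: indicator_def\<close>)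
    thus ?thesis unfolding V using F_nn V by simp
  qed
  show ?thesis by (rule that[OF Fm Fmono Fcont Fprim Fc Fd])
qed

text \<open>Bernoulli at \<open>1 / r\<close>, followed by \<open>1 / r - 1 \<ge> 1 - r\<close>.
  Both are tangent bounds at \<open>r = 1\<close>, so nothing is lost to first order.\<close>

lemma power_inverse_ge_bernoulli:
  fixes r :: real
  assumes "0 < r"
  shows "1 - real m * (r - 1) \<le> (1 / r) ^ m"
proof -
  have 1: "1 + real m * (1 / r - 1) \<le> (1 + (1 / r - 1)) ^ m" by (rule Bernoulli_inequality) (use assms in simp)
  have "0 \<le> (r - 1)\<^sup>2 / r" using assms by simp
  also have "(r - 1)\<^sup>2 / r = (1 / r - 1) + (r - 1)" using assms by (simp add: field_simps power2_eq_square)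
  finally have "real m * (1 - r) \<le> real m * (1 / r - 1)" by (intro mult_left_mono) auto
  with 1 show ?thesis by (simp add: algebra_simps)
qed

text \<open>The pointwise core of the isoperimetric inequality. A height \<open>y\<close> of the set
  is matched with the height \<open>z + \<mu>\<close> of the comparison ball that has the same
  volume below it, and is moved to \<open>y * (1 + \<epsilon> * z)\<close>. Here
  \<open>\<alpha> ^ m\<close> and \<open>\<beta> ^ m\<close> are the slice volumes,
  \<open>(\<alpha> + \<epsilon> * y * \<beta>) ^ m\<close> is the Brunn-Minkowski bound for the
  slice of the neighbourhood, and the last factor on the right is the derivative of the moved
  height. The first order gain \<open>\<epsilon> * (z + n * \<mu>)\<close> does not depend on
  \<open>\<alpha>\<close>, and the quadratic error is explicit.\<close>

lemma transport_jacobian_bound: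
  fixes \<alpha> \<beta> y z \<epsilon> \<mu> :: real
  assumes n: "n = Suc m" and pos: "0 < \<alpha>" "0 < \<beta>" "0 < y" and z: "-1 < z" "z < 1" and \<epsilon>: "0 < \<epsilon>" "\<epsilon> < 1" and \<mu>: "1 < \<mu>"
  shows "\<alpha> ^ m / y ^ n * (1 + \<epsilon> * (z + n * \<mu>) - n\<^sup>2 * (1 + \<mu>) * \<epsilon>\<^sup>2)
     \<le> (\<alpha> + \<epsilon> * y * \<beta>) ^ m / (y * (1 + \<epsilon> * z)) ^ n
        * ((1 + \<epsilon> * z) + \<epsilon> * y * (\<alpha> ^ m / y ^ n) / (\<beta> ^ m / (z + \<mu>) ^ n))"
proof -
  define \<kappa> where "\<kappa> = 1 + \<epsilon> * z"
  define T where "T = z + \<mu>"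
  define q where "q = \<beta> / \<alpha>"
  define l where "l = \<epsilon> * y"
  define X where "X = l * ((\<alpha> ^ m / y ^ n) / (\<beta> ^ m / T ^ n))"
  have T: "0 < T" "T \<le> 1 + \<mu>" using z \<mu> by (auto simp: T_def)
  have ez: "\<bar>\<epsilon> * z\<bar> < 1" using \<epsilon> z by (simp add: abs_mult) (smt (verit) mult_less_cancel_left2 mult_less_cancel_right2)
  have ez2: "\<epsilon> * z \<le> \<epsilon>" using \<epsilon> z by simp
  have \<kappa>: "0 < \<kappa>" "\<kappa> - 1 \<le> \<epsilon>" using ez ez2 by (auto simp: \<kappa>_def)
  have q: "0 < q" using pos by (simp add: q_def)
  have l: "0 < l" using \<epsilon> pos by (simp add: l_def)
  have X0: "0 \<le> X" using l pos T by (simp add: X_def)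
  \<comment> \<open>Arithmetic-geometric mean of \<open>n\<close> terms: \<open>m\<close> copies of
    the relative growth \<open>l * q\<close> of the slice and one stretching \<open>X\<close> of the
    heights. Their product is \<open>(\<epsilon> * T) ^ n\<close>, in which \<open>\<alpha>\<close>
    and \<open>\<beta>\<close> cancel.\<close>
  have amgm: "n * \<epsilon> * T \<le> m * l * q + X"
  proof -
    define r where "r = q / (T / y)"
    have r: "r > 0" using q T pos by (simp add: r_def)
    have "1 - real m * (r - 1) \<le> (1 / r) ^ m" by (rule power_inverse_ge_bernoulli[OF r])
    hence "real n \<le> m * r + (1 / r) ^ m" by (simp add: n algebra_simps)
    hence "(l * (T / y)) * real n \<le> (l * (T / y)) * (m * r + (1 / r) ^ m)" using l T pos by (intro mult_left_mono) auto
    also have "\<dots> = m * l * q + l * ((T / y) * (1 / r) ^ m)" using T pos by (simp add: r_def algebra_simps)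
    also have "(T / y) * (1 / r) ^ m = (\<alpha> ^ m / y ^ n) / (\<beta> ^ m / T ^ n)"
      using pos T by (simp add: r_def q_def n power_divide power_mult_distrib field_simps)
    also have "(l * (T / y)) * real n = n * \<epsilon> * T" using pos by (simp add: l_def)
    finally show ?thesis by (simp add: X_def)
  qed
  have "1 + real m * (l * q) \<le> (1 + l * q) ^ m" by (rule Bernoulli_inequality) (use l q in \<open>simp add: order_trans[of _ 0]\<close>)
  hence "(1 + m * (l * q)) * (\<kappa> + X) \<le> (1 + l * q) ^ m * (\<kappa> + X)" using \<kappa> X0 by (intro mult_right_mono) auto
  \<comment> \<open>The factor \<open>min 1 \<kappa>\<close> covers both signs of \<open>z\<close>,
    since \<open>\<kappa> = 1 + \<epsilon> * z\<close> may lie on either side of 1.\<close>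
  moreover have "\<kappa> + min 1 \<kappa> * (m * l * q + X) \<le> (1 + m * (l * q)) * (\<kappa> + X)"
  proof -
    have "min 1 \<kappa> * (m * l * q) \<le> \<kappa> * (m * l * q)" using l q by (intro mult_right_mono) auto
    moreover have "min 1 \<kappa> * X \<le> 1 * X" using X0 by (intro mult_right_mono) auto
    moreover have "0 \<le> m * l * q * X" using l q X0 by simp
    ultimately show ?thesis by (simp add: algebra_simps)
  qed
  moreover have "min 1 \<kappa> * (n * \<epsilon> * T) \<le> min 1 \<kappa> * (m * l * q + X)" using amgm \<kappa> by (intro mult_left_mono) auto
  ultimately have 1: "\<kappa> + min 1 \<kappa> * (n * \<epsilon> * T) \<le> (1 + l * q) ^ m * (\<kappa> + X)" by linarith
  have 2: "1 - m * (\<epsilon> * z) \<le> (1 / \<kappa>) ^ n * \<kappa>"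
    using power_inverse_ge_bernoulli[OF \<kappa>(1), of m] \<kappa>(1) by (simp add: \<kappa>_def n)
  have 3: "1 - n * \<epsilon> \<le> (1 / \<kappa>) ^ n * min 1 \<kappa>"
  proof (cases "\<kappa> \<le> 1")
    case True
    have "1 \<le> (1 / \<kappa>) ^ m" using True \<kappa> by (intro one_le_power) auto
    moreover have "(1 / \<kappa>) ^ n * \<kappa> = (1 / \<kappa>) ^ m" using \<kappa> by (simp add: n)
    moreover have "0 \<le> real n * \<epsilon>" using \<epsilon> by simp
    ultimately show ?thesis using True by (simp add: min_def)
  next
    case False
    have "real n * (\<kappa> - 1) \<le> real n * \<epsilon>" using \<kappa>(2) by (intro mult_left_mono) auto
    thus ?thesis using power_inverse_ge_bernoulli[OF \<kappa>(1), of n] False by (simp add: min_def)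
  qed
  have "(1 - n * \<epsilon>) * (n * \<epsilon> * T) \<le> (1 / \<kappa>) ^ n * min 1 \<kappa> * (n * \<epsilon> * T)"
    using 3 \<epsilon> T by (intro mult_right_mono) auto
  moreover have "n\<^sup>2 * T * \<epsilon>\<^sup>2 \<le> n\<^sup>2 * (1 + \<mu>) * \<epsilon>\<^sup>2" using T by (intro mult_right_mono mult_left_mono) auto
  moreover have "(1 - m * (\<epsilon> * z)) + (1 - n * \<epsilon>) * (n * \<epsilon> * T) = 1 + \<epsilon> * (z + n * \<mu>) - n\<^sup>2 * T * \<epsilon>\<^sup>2"
    by (simp add: T_def n power2_eq_square algebra_simps)
  ultimately have "1 + \<epsilon> * (z + n * \<mu>) - n\<^sup>2 * (1 + \<mu>) * \<epsilon>\<^sup>2 \<le> (1 / \<kappa>) ^ n * (\<kappa> + min 1 \<kappa> * (n * \<epsilon> * T))"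
    using 2 by (simp add: algebra_simps)
  also have "\<dots> \<le> (1 / \<kappa>) ^ n * ((1 + l * q) ^ m * (\<kappa> + X))" using 1 \<kappa> by (intro mult_left_mono) auto
  finally have "\<alpha> ^ m / y ^ n * (1 + \<epsilon> * (z + n * \<mu>) - n\<^sup>2 * (1 + \<mu>) * \<epsilon>\<^sup>2)
      \<le> \<alpha> ^ m / y ^ n * ((1 / \<kappa>) ^ n * ((1 + l * q) ^ m * (\<kappa> + X)))"
    using pos by (intro mult_left_mono) auto
  also have "\<dots> = (\<alpha> * (1 + l * q)) ^ m / (y * \<kappa>) ^ n * (\<kappa> + X)"
    by (simp add: power_mult_distrib power_divide)
  also have "\<alpha> * (1 + l * q) = \<alpha> + \<epsilon> * y * \<beta>" using pos by (simp add: l_def q_def field_simps)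
  also have "X = \<epsilon> * y * (\<alpha> ^ m / y ^ n) / (\<beta> ^ m / (z + \<mu>) ^ n)" by (simp add: X_def l_def T_def mult.assoc)
  finally show ?thesis by (simp only: \<kappa>_def of_nat_power)
qed

text \<open>\<open>h\<close> stands for the slice volumes of the neighbourhood, \<open>a0\<close>
  for those of the set. The moved height \<open>y * (1 + \<epsilon> * \<Theta> (F y))\<close> need
  not be differentiable in \<open>y\<close>; its logarithm \<open>L y = ln y + N (F y)\<close> is
  used instead, because the two summands have explicit primitives and the substitution rule for
  primitives then applies to \<open>L\<close>.\<close>

lemma transport_1d:
  fixes a0 :: "real \<Rightarrow> real" and h :: "real \<Rightarrow> ennreal" and n m :: nat and \<omega> \<mu> \<epsilon> V M c d :: real
  assumes m: "0 < m" "n = Suc m"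
    and a0[measurable]: "a0 \<in> borel_measurable borel" and a0nn: "\<And>y. 0 \<le> a0 y" and a0M: "\<And>y. a0 y \<le> M"
    and a0s: "\<And>y. a0 y \<noteq> 0 \<Longrightarrow> y \<in> {c..d}" and c: "0 < c" "c \<le> d"
    and V: "(\<integral>\<^sup>+y. ennreal (a0 y / y ^ n) \<partial>lborel) = ennreal V" "0 < V"
    and \<omega>: "0 < \<omega>" and \<mu>: "1 < \<mu>" and B: "\<omega> * prof (m / 2) (- real n) \<mu> = V"
    and \<epsilon>: "0 < \<epsilon>" "\<epsilon> < 1" "n\<^sup>2 * (1 + \<mu>) * \<epsilon>\<^sup>2 \<le> 1"
    and h[measurable]: "h \<in> borel_measurable borel"
    and bound: "\<And>y z. 0 < a0 y \<Longrightarrow> -1 < z \<Longrightarrow> z < 1 \<Longrightarrow>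
        ennreal ((a0 y powr (1 / m) + \<omega> powr (1 / m) * (\<epsilon> * y * sqrt (1 - z\<^sup>2))) ^ m) \<le> h (y * (1 + \<epsilon> * z))"
  shows "ennreal (V + \<epsilon> * (\<omega> * profE (m / 2) \<mu>) - n\<^sup>2 * (1 + \<mu>) * \<epsilon>\<^sup>2 * V)
      \<le> (\<integral>\<^sup>+z. h z * ennreal (1 / z ^ n) * indicator {0<..} z \<partial>lborel)"
proof -
  \<comment> \<open>Slice volumes of the comparison ball, weighted by the hyperbolic
    density.\<close>
  define b where "b z = \<omega> * ((1 - z\<^sup>2) powr (m / 2) * (z + \<mu>) powr (- real n))" for z
  have bm[measurable]: "b \<in> borel_measurable borel" unfolding b_def by measurable
  have m2: "0 < real m / 2" using m by simp
  have bc: "continuous_on {-1..1} b" unfolding b_def by (intro continuous_on_mult_left prof_continuous_on m2 \<mu>)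
  have b0: "0 \<le> b z" for z unfolding b_def using \<omega> by simp
  have bpos: "0 < b z" if "-1 < z" "z < 1" for z
  proof -
    have "z\<^sup>2 < 1" using that by (simp add: abs_square_less_1 abs_less_iff)
    thus ?thesis using that \<omega> \<mu> unfolding b_def by simp
  qed
  have bI: "(b has_integral V) {-1..1}"
    using has_integral_mult_right[OF integrable_integral[OF prof_integrable[OF m2 \<mu>, of "- real n"]], of \<omega>] B
    unfolding b_def prof_def by simp
  obtain \<Theta> where \<Theta>c: "continuous_on UNIV \<Theta>" and \<Theta>r: "\<And>v. \<Theta> v \<in> {-1..1}"
    and \<Theta>i: "\<And>v. 0 < v \<Longrightarrow> v < V \<Longrightarrow> -1 < \<Theta> v \<and> \<Theta> v < 1"
    and \<Theta>D: "\<And>v. 0 < v \<Longrightarrow> v < V \<Longrightarrow> (\<Theta> has_real_derivative inverse (b (\<Theta> v))) (at v)"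
    and \<Theta>sub: "\<And>k. k \<in> borel_measurable borel \<Longrightarrow>
        (\<integral>\<^sup>+v. k (\<Theta> v) * indicator {0..V} v \<partial>lborel) = (\<integral>\<^sup>+z. k z * ennreal (b z) * indicator {-1..1} z \<partial>lborel)"
    by (rule primitive_inverse[OF _ bc b0 bm bpos bI]) auto
  have [measurable]: "\<Theta> \<in> borel_measurable borel" by (rule borel_measurable_continuous_onI[OF \<Theta>c])

  define a where "a y = a0 y / y ^ n" for y
  have am[measurable]: "a \<in> borel_measurable borel" unfolding a_def by measurable
  have a_nn: "0 \<le> a y" for y
    using a0nn[of y] a0s[of y] c by (cases "a0 y = 0") (auto simp: a_def)
  have aM: "a y \<le> M / c ^ n" for y
  proof (cases "a0 y = 0")
    case True
    thus ?thesis using a0nn[of y] a0M[of y] c by (simp add: a_def)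
  next
    case False
    thus ?thesis using a0s[OF False] a0M[of y] a0nn[of y] c unfolding a_def
      by (intro frac_le power_mono) auto
  qed
  obtain F where Fm[measurable]: "F \<in> borel_measurable borel" and Fmono: "\<And>x y. x \<le> y \<Longrightarrow> F x \<le> F y"
    and Fcont: "continuous_on {c..d} F" and Fc: "F c = 0" and Fd: "F d = V"
    and Fprim: "\<And>x y. c \<le> x \<Longrightarrow> x \<le> y \<Longrightarrow> (\<integral>\<^sup>+t. ennreal (a t) * indicator {x..y} t \<partial>lborel) = ennreal (F y - F x)"
  proof (rule density_primitive[OF am a_nn aM, of V c])
    show "(\<integral>\<^sup>+s. ennreal (a s) \<partial>lborel) = ennreal V" using V(1) by (simp add: a_def)
    show "0 \<le> V" using V(2) by simp
  qed (use a0s in \<open>auto simp: a_def\<close>)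
  have Fr: "F y \<in> {0..V}" if "y \<in> {c..d}" for y using Fmono[of c y] Fmono[of y d] Fc Fd that by auto

  define N where "N v = ln (1 + \<epsilon> * \<Theta> v)" for v
  define N' where "N' v = \<epsilon> / ((1 + \<epsilon> * \<Theta> v) * b (\<Theta> v))" for v
  have [measurable]: "N' \<in> borel_measurable borel" unfolding N'_def by measurable
  have kpos: "0 < 1 + \<epsilon> * z" if "z \<in> {-1..1}" for z
  proof -
    have "- \<epsilon> \<le> \<epsilon> * z" using that \<epsilon> mult_left_mono[of "-1" z \<epsilon>] by simp
    thus ?thesis using \<epsilon> by linarith
  qed
  have N'0: "0 \<le> N' v" for v unfolding N'_def using \<epsilon> kpos[OF \<Theta>r[of v]] b0 by simp
  have Nc: "continuous_on {0..V} N" unfolding N_def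
    by (intro continuous_on_ln continuous_intros continuous_on_subset[OF \<Theta>c]) (use kpos[OF \<Theta>r] in \<open>auto simp: less_imp_neq[symmetric]\<close>)
  have Nint: "(N' has_integral (N y - N x)) {x..y}" if "0 \<le> x" "x \<le> y" "y \<le> V" for x y
  proof (rule fundamental_theorem_of_calculus_interior[OF that(2)])
    show "continuous_on {x..y} N" using that by (intro continuous_on_subset[OF Nc]) auto
    fix v assume "v \<in> {x<..<y}"
    hence v: "0 < v" "v < V" using that by auto
    have "(N has_real_derivative N' v) (at v)" unfolding N_def N'_def
      by (rule derivative_eq_intros \<Theta>D[OF v] kpos[OF \<Theta>r] refl)+ (simp add: divide_inverse mult_ac)
    thus "(N has_vector_derivative N' v) (at v)" by (simp add: has_real_derivative_iff_has_vector_derivative)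
  qed
  have Nmono: "N x \<le> N y" if "0 \<le> x" "x \<le> y" "y \<le> V" for x y
    using has_integral_nonneg[OF Nint[OF that]] N'0 by simp
  have Nprim: "(\<integral>\<^sup>+v. ennreal (N' v) * indicator {x..y} v \<partial>lborel) = ennreal (N y - N x)" if "0 \<le> x" "x \<le> y" "y \<le> V" for x y
    using Nint[OF that] N'0 by (intro nn_integral_has_integral_Icc) auto

  define L where "L y = ln y + N (F y)" for y
  define l where "l y = 1 / y + N' (F y) * a y" for y
  have [measurable]: "l \<in> borel_measurable borel" unfolding l_def by measurable
  have Lc: "continuous_on {c..d} L" unfolding L_def
    by (intro continuous_intros continuous_on_compose2[OF Nc Fcont]) (use c Fr in auto)
  have lnprim: "(\<integral>\<^sup>+t. ennreal (1 / t) * indicator {x..y} t \<partial>lborel) = ennreal (ln y - ln x)" if "0 < x" "x \<le> y" for x y :: real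
  proof (rule nn_integral_has_integral_Icc)
    show "((\<lambda>t. 1 / t) has_integral (ln y - ln x)) {x..y}"
      by (rule fundamental_theorem_of_calculus) (use that in \<open>auto intro!: derivative_eq_intros simp: has_real_derivative_iff_has_vector_derivative[symmetric]\<close>)
  qed (use that in auto)
  have Lmono: "L x \<le> L y" if "c \<le> x" "x \<le> y" "y \<le> d" for x y
    unfolding L_def using that c Fr[of x] Fr[of y] Fmono[of x y] by (intro add_mono Nmono) auto
  have Lprim: "(\<integral>\<^sup>+t. ennreal (l t) * indicator {x..y} t \<partial>lborel) = ennreal (L y - L x)" if "c \<le> x" "x \<le> y" "y \<le> d" for x y
  proof -
    have "(\<integral>\<^sup>+t. ennreal (l t) * indicator {x..y} t \<partial>lborel)
       = (\<integral>\<^sup>+t. ennreal (1 / t) * indicator {x..y} t + ennreal (N' (F t)) * ennreal (a t) * indicator {x..y} t \<partial>lborel)"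
    proof (rule nn_integral_cong)
      fix t
      show "ennreal (l t) * indicator {x..y} t = ennreal (1 / t) * indicator {x..y} t + ennreal (N' (F t)) * ennreal (a t) * indicator {x..y} t"
      proof (cases "t \<in> {x..y}")
        case True
        hence "0 < t" using that c by auto
        thus ?thesis using True N'0 a_nn by (simp add: l_def ennreal_plus ennreal_mult)
      qed auto
    qed
    also have "\<dots> = (\<integral>\<^sup>+t. ennreal (1 / t) * indicator {x..y} t \<partial>lborel)
        + (\<integral>\<^sup>+t. ennreal (N' (F t)) * ennreal (a t) * indicator {x..y} t \<partial>lborel)"
      by (rule nn_integral_add) auto
    also have "(\<integral>\<^sup>+t. ennreal (N' (F t)) * ennreal (a t) * indicator {x..y} t \<partial>lborel)
       = (\<integral>\<^sup>+v. ennreal (N' v) * indicator {F x..F y} v \<partial>lborel)"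
      by (rule nn_integral_subst_primitive[of x y a "\<lambda>v. ennreal (N' v)" F])
         (use that Fmono Fprim in \<open>auto intro!: continuous_on_subset[OF Fcont]\<close>)
    also have "\<dots> = ennreal (N (F y) - N (F x))" using that Fr[of x] Fr[of y] Fmono[of x y] by (intro Nprim) auto
    also have "(\<integral>\<^sup>+t. ennreal (1 / t) * indicator {x..y} t \<partial>lborel) = ennreal (ln y - ln x)" using that c by (intro lnprim) auto
    also have "ennreal (ln y - ln x) + ennreal (N (F y) - N (F x)) = ennreal ((ln y - ln x) + (N (F y) - N (F x)))"
      using that c Fr[of x] Fr[of y] Fmono[of x y] by (subst ennreal_plus) (auto intro!: Nmono)
    also have "(ln y - ln x) + (N (F y) - N (F x)) = L y - L x" by (simp add: L_def)
    finally show ?thesis .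
  qed
  \<comment> \<open>Heights are measured by their logarithm \<open>v\<close>: the numerator
    \<open>exp v\<close> is the Jacobian of \<open>exp\<close>, the denominator the hyperbolic
    density.\<close>
  define \<phi> where "\<phi> v = h (exp v) * ennreal (exp v / exp v ^ n)" for v
  have [measurable]: "\<phi> \<in> borel_measurable borel" unfolding \<phi>_def by measurable
  \<comment> \<open>The relative growth of the density at matched heights. The smallness of
    \<open>\<epsilon>\<close> makes it nonnegative, so that it passes through
    \<open>ennreal\<close>.\<close>
  define g where "g z = 1 + \<epsilon> * (z + n * \<mu>) - n\<^sup>2 * (1 + \<mu>) * \<epsilon>\<^sup>2" for z
  have g0: "0 \<le> g z" if "z \<in> {-1..1}" for z
  proof -
    have "1 \<le> real n * \<mu>" using m \<mu> mult_mono[of 1 "real n" 1 \<mu>] by simp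
    hence "0 \<le> \<epsilon> * (z + n * \<mu>)" using that \<epsilon> by (intro mult_nonneg_nonneg) auto
    thus ?thesis using \<epsilon>(3) by (simp add: g_def)
  qed
  have [measurable]: "g \<in> borel_measurable borel" unfolding g_def by measurable
  have Lcd: "L c \<le> L d" using Lmono[of c d] c by simp
  have "(\<integral>\<^sup>+y. (ennreal (g (\<Theta> (F y))) * indicator {0<..<V} (F y)) * ennreal (a y) * indicator {c..d} y \<partial>lborel)
      \<le> (\<integral>\<^sup>+y. \<phi> (L y) * ennreal (l y) * indicator {c..d} y \<partial>lborel)"
  \<comment> \<open>The values \<open>0\<close> and \<open>V\<close> of \<open>F\<close> are left
    out: there \<open>\<Theta>\<close> may reach \<open>-1\<close> or \<open>1\<close>, where the
    comparison slice degenerates to a point. After substitution these are two single points.\<close>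
  proof (rule nn_integral_mono)
    fix y
    show "(ennreal (g (\<Theta> (F y))) * indicator {0<..<V} (F y)) * ennreal (a y) * indicator {c..d} y
        \<le> \<phi> (L y) * ennreal (l y) * indicator {c..d} y"
    proof (cases "y \<in> {c..d} \<and> 0 < F y \<and> F y < V \<and> a0 y \<noteq> 0")
      case True
      define z where "z = \<Theta> (F y)"
      have z: "-1 < z" "z < 1" using \<Theta>i True by (auto simp: z_def)
      have z2: "z\<^sup>2 < 1" using z by (simp add: abs_square_less_1 abs_less_iff)
      have y: "0 < y" using True c by auto
      have a0y: "0 < a0 y" using True a0nn[of y] by auto
      have k: "0 < 1 + \<epsilon> * z" using kpos z by simp
      have eL: "exp (L y) = y * (1 + \<epsilon> * z)" using y k by (simp add: L_def N_def exp_add z_def)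
      define \<alpha> where "\<alpha> = a0 y powr (1 / m)"
      define \<beta> where "\<beta> = \<omega> powr (1 / m) * sqrt (1 - z\<^sup>2)"
      have \<alpha>\<beta>: "0 < \<alpha>" "0 < \<beta>" using a0y \<omega> z2 by (auto simp: \<alpha>_def \<beta>_def)
      have am: "\<alpha> ^ m = a0 y" using a0y m by (simp add: \<alpha>_def powr_realpow[symmetric] powr_powr)
      have "\<beta> ^ m = \<omega> * (1 - z\<^sup>2) powr (m / 2)"
      proof -
        have "(\<omega> powr (1 / m)) ^ m = \<omega>" using \<omega> m by (simp add: powr_realpow[symmetric] powr_powr)
        moreover have "sqrt (1 - z\<^sup>2) ^ m = (1 - z\<^sup>2) powr (m / 2)"
          using z2 by (simp add: powr_half_sqrt[symmetric] powr_realpow[symmetric] powr_powr)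
        ultimately show ?thesis by (simp add: \<beta>_def power_mult_distrib)
      qed
      then have bz: "\<beta> ^ m / (z + \<mu>) ^ n = b z"
      proof -
        have "(z + \<mu>) powr (- real n) = 1 / (z + \<mu>) ^ n" using z \<mu> by (simp only: powr_minus_divide powr_realpow)
        thus ?thesis unfolding b_def \<open>\<beta> ^ m = _\<close> by simp
      qed
      have ly: "l y = (1 / (y * (1 + \<epsilon> * z))) * ((1 + \<epsilon> * z) + \<epsilon> * y * (\<alpha> ^ m / y ^ n) / (\<beta> ^ m / (z + \<mu>) ^ n))"
      proof -
        have "1 / y + \<epsilon> / (K * c) * Y = 1 / (y * K) * (K + \<epsilon> * y * Y / c)" if "0 < K" "0 < c" for K c Y :: real
          using that y by (simp add: field_simps)
        from this[OF k bpos[OF z]] show ?thesis unfolding bz am by (simp only: l_def N'_def z_def[symmetric] a_def)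
      qed
      have l0: "0 \<le> l y" using y N'0 a_nn by (simp add: l_def)
      have "g z * a y \<le> (\<alpha> + \<epsilon> * y * \<beta>) ^ m / (y * (1 + \<epsilon> * z)) ^ n
        * ((1 + \<epsilon> * z) + \<epsilon> * y * (\<alpha> ^ m / y ^ n) / (\<beta> ^ m / (z + \<mu>) ^ n))"
        using transport_jacobian_bound[OF m(2) \<alpha>\<beta> y z \<epsilon>(1,2) \<mu>] by (simp add: g_def a_def am mult.commute)
      also have "\<dots> = (\<alpha> + \<epsilon> * y * \<beta>) ^ m * (exp (L y) / exp (L y) ^ n) * l y"
      proof -
        have "X / W ^ n * Z = X * (W / W ^ n) * (1 / W * Z)" if "0 < W" for X W Z :: real using that by simp
        from this[of "y * (1 + \<epsilon> * z)"] show ?thesis unfolding eL ly using y k by simp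
      qed
      finally have "ennreal (g z * a y) \<le> ennreal ((\<alpha> + \<epsilon> * y * \<beta>) ^ m * (exp (L y) / exp (L y) ^ n) * l y)"
        by (rule ennreal_leI)
      also have "\<dots> = ennreal ((\<alpha> + \<epsilon> * y * \<beta>) ^ m) * ennreal (exp (L y) / exp (L y) ^ n) * ennreal (l y)"
      proof -
        have *: "ennreal (X * Y * Z) = ennreal X * ennreal Y * ennreal Z" if "0 \<le> X" "0 \<le> Y" "0 \<le> Z" for X Y Z :: real
          using that by (simp add: ennreal_mult)
        show ?thesis by (rule *) (use \<alpha>\<beta> y \<epsilon> l0 in auto)
      qed
      also have "\<dots> \<le> h (exp (L y)) * ennreal (exp (L y) / exp (L y) ^ n) * ennreal (l y)"
      proof (intro mult_right_mono)
        show "ennreal ((\<alpha> + \<epsilon> * y * \<beta>) ^ m) \<le> h (exp (L y))"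
          using bound[OF a0y z] unfolding eL \<alpha>_def \<beta>_def by (simp add: mult_ac)
      qed auto
      finally have "ennreal (g z) * ennreal (a y) \<le> \<phi> (L y) * ennreal (l y)"
        using g0[of z] z a_nn by (simp add: ennreal_mult \<phi>_def)
      thus ?thesis using True by (simp add: z_def)
    next
      case False
      thus ?thesis by (auto simp: a_def indicator_def)
    qed
  qed
  also have "\<dots> = (\<integral>\<^sup>+v. \<phi> v * indicator {L c..L d} v \<partial>lborel)"
    by (rule nn_integral_subst_primitive) (use c Lc Lmono Lprim in auto)
  also have "\<dots> = (\<integral>\<^sup>+v. \<phi> v * indicator {ln (exp (L c))..ln (exp (L d))} v \<partial>lborel)" by simp
  also have "\<dots> = (\<integral>\<^sup>+z. \<phi> (ln z) * ennreal (1 / z) * indicator {exp (L c)..exp (L d)} z \<partial>lborel)"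
  proof (rule nn_integral_subst_primitive[symmetric])
    show "continuous_on {exp (L c)..exp (L d)} ln" by (intro continuous_intros) (auto intro: less_le_trans[OF exp_gt_zero] simp: less_imp_neq[symmetric])
    show "ln x \<le> ln y" if "exp (L c) \<le> x" "x \<le> y" for x y :: real
      using that less_le_trans[OF exp_gt_zero that(1)] by simp
    show "(\<integral>\<^sup>+t. ennreal (1 / t) * indicator {x..y} t \<partial>lborel) = ennreal (ln y - ln x)" if "exp (L c) \<le> x" "x \<le> y" for x y :: real
      using that less_le_trans[OF exp_gt_zero that(1)] by (intro lnprim)
  qed (use Lcd in auto)
  also have "\<dots> \<le> (\<integral>\<^sup>+z. h z * ennreal (1 / z ^ n) * indicator {0<..} z \<partial>lborel)"
  proof (rule nn_integral_mono)
    fix z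
    show "\<phi> (ln z) * ennreal (1 / z) * indicator {exp (L c)..exp (L d)} z \<le> h z * ennreal (1 / z ^ n) * indicator {0<..} z"
    proof (cases "z \<in> {exp (L c)..exp (L d)}")
      case True
      hence z: "0 < z" by (auto intro: less_le_trans[OF exp_gt_zero])
      have "ennreal (z / z ^ n) * ennreal (1 / z) = ennreal (1 / z ^ n)" using z by (simp add: ennreal_mult[symmetric])
      thus ?thesis using True z by (simp add: \<phi>_def mult.assoc)
    qed simp
  qed
  finally have 1: "(\<integral>\<^sup>+y. (ennreal (g (\<Theta> (F y))) * indicator {0<..<V} (F y)) * ennreal (a y) * indicator {c..d} y \<partial>lborel)
      \<le> (\<integral>\<^sup>+z. h z * ennreal (1 / z ^ n) * indicator {0<..} z \<partial>lborel)" .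
  have "(\<integral>\<^sup>+y. (ennreal (g (\<Theta> (F y))) * indicator {0<..<V} (F y)) * ennreal (a y) * indicator {c..d} y \<partial>lborel)
     = (\<integral>\<^sup>+v. (ennreal (g (\<Theta> v)) * indicator {0<..<V} v) * indicator {F c..F d} v \<partial>lborel)"
    by (rule nn_integral_subst_primitive) (use c Fcont Fmono Fprim in auto)
  also have "\<dots> = (\<integral>\<^sup>+v. ennreal (g (\<Theta> v)) * indicator {0..V} v \<partial>lborel)"
    unfolding Fc Fd
    by (rule nn_integral_cong_AE, rule AE_mp[OF AE_lborel_singleton[of 0]], rule AE_mp[OF AE_lborel_singleton[of V]])
       (auto simp: indicator_def)
  also have "\<dots> = (\<integral>\<^sup>+z. ennreal (g z) * ennreal (b z) * indicator {-1..1} z \<partial>lborel)"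
    by (rule \<Theta>sub[where k = "\<lambda>z. ennreal (g z)"]) measurable
  also have "\<dots> = (\<integral>\<^sup>+z. ennreal (g z * b z) * indicator {-1..1} z \<partial>lborel)"
    by (intro nn_integral_cong) (auto simp: indicator_def ennreal_mult g0 b0)
  also have "\<dots> = ennreal (V + \<epsilon> * (\<omega> * profE (m / 2) \<mu>) - n\<^sup>2 * (1 + \<mu>) * \<epsilon>\<^sup>2 * V)"
  proof (rule nn_integral_has_integral_Icc)
    let ?w = "\<lambda>z::real. (1 - z\<^sup>2) powr (m / 2)"
    \<comment> \<open>Splitting \<open>z + n * \<mu> = (z + \<mu>) + m * \<mu>\<close> reproduces
      the two terms of \<open>profE\<close>.\<close>
    have "((\<lambda>z. \<epsilon> * \<omega> * (?w z * (z + \<mu>) powr (- real m)) + (1 + \<epsilon> * (m * \<mu>) - n\<^sup>2 * (1 + \<mu>) * \<epsilon>\<^sup>2) * b z)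
       has_integral \<epsilon> * \<omega> * prof (m / 2) (- real m) \<mu> + (1 + \<epsilon> * (m * \<mu>) - n\<^sup>2 * (1 + \<mu>) * \<epsilon>\<^sup>2) * V) {-1..1}"
      unfolding prof_def by (intro has_integral_add has_integral_mult_right bI integrable_integral prof_integrable m2 \<mu>)
    moreover have "\<epsilon> * \<omega> * prof (m / 2) (- real m) \<mu> + (1 + \<epsilon> * (m * \<mu>) - n\<^sup>2 * (1 + \<mu>) * \<epsilon>\<^sup>2) * V
      = V + \<epsilon> * (\<omega> * profE (m / 2) \<mu>) - n\<^sup>2 * (1 + \<mu>) * \<epsilon>\<^sup>2 * V"
    proof -
      have "- 2 * (real m / 2) = - real m" "- real m - 1 = - real n" using m by simp_all
      hence "profE (m / 2) \<mu> = prof (m / 2) (- real m) \<mu> + 2 * (real m / 2) * \<mu> * prof (m / 2) (- real n) \<mu>"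
        by (simp only: profE_def)
      hence "\<omega> * profE (m / 2) \<mu> = \<omega> * prof (m / 2) (- real m) \<mu> + m * \<mu> * V"
        unfolding B[symmetric] by (simp only:) (simp add: algebra_simps)
      thus ?thesis by (simp add: algebra_simps)
    qed
    moreover have "\<epsilon> * \<omega> * (?w z * (z + \<mu>) powr (- real m)) + (1 + \<epsilon> * (m * \<mu>) - n\<^sup>2 * (1 + \<mu>) * \<epsilon>\<^sup>2) * b z = g z * b z"
      if "z \<in> {-1..1}" for z
    proof -
      have "- real m = - real n + 1" using m by simp
      hence "(z + \<mu>) powr (- real m) = (z + \<mu>) powr (- real n) * (z + \<mu>)"
        using that \<mu> by (simp only: powr_add) simp
      hence "\<omega> * (?w z * (z + \<mu>) powr (- real m)) = b z * (z + \<mu>)" by (simp add: b_def)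
      hence "\<epsilon> * \<omega> * (?w z * (z + \<mu>) powr (- real m)) = \<epsilon> * (b z * (z + \<mu>))" by (simp add: mult.assoc)
      thus ?thesis using m by (simp add: g_def algebra_simps)
    qed
    ultimately show "((\<lambda>z. g z * b z) has_integral V + \<epsilon> * (\<omega> * profE (m / 2) \<mu>) - n\<^sup>2 * (1 + \<mu>) * \<epsilon>\<^sup>2 * V) {-1..1}"
      using has_integral_eq by (metis (no_types, lifting))
  qed (use g0 b0 in auto)
  finally show ?thesis using 1 by simp
qed

section \<open>Isoperimetric inequality in the half-space\<close>

definition half_vol :: "'a::euclidean_space \<Rightarrow> 'a measure" where
  "half_vol k = density lborel (\<lambda>x. indicator {x. 0 < x \<bullet> k} x * ennreal (1 / (x \<bullet> k) ^ DIM('a)))"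

text \<open>The horizontal coordinates form a function on the remaining basis vectors, so that
  slices live in the product spaces for which Brunn-Minkowski was proved.\<close>

definition slice_emb :: "'a::euclidean_space \<Rightarrow> real \<Rightarrow> ('a \<Rightarrow> real) \<Rightarrow> 'a" where
  "slice_emb k y x = y *\<^sub>R k + (\<Sum>b\<in>Basis - {k}. x b *\<^sub>R b)"

lemma slice_emb_inner:
  assumes "k \<in> Basis"
  shows "slice_emb k y x \<bullet> k = y" "b \<in> Basis - {k} \<Longrightarrow> slice_emb k y x \<bullet> b = x b"
  using assms by (auto simp: slice_emb_def inner_simps inner_sum_left inner_Basis if_distrib[of "(*) _"] cong: if_cong)

lemma slice_emb_norm:
  fixes k :: "'a::euclidean_space"
  assumes "k \<in> Basis"
  shows "(norm (slice_emb k y x))\<^sup>2 = y\<^sup>2 + (\<Sum>b\<in>Basis - {k}. (x b)\<^sup>2)"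
proof -
  let ?v = "slice_emb k y x"
  have "(norm ?v)\<^sup>2 = (\<Sum>b\<in>Basis. (?v \<bullet> b) * (?v \<bullet> b))"
    by (metis power2_norm_eq_inner euclidean_inner)
  also have "\<dots> = (?v \<bullet> k) * (?v \<bullet> k) + (\<Sum>b\<in>Basis - {k}. (?v \<bullet> b) * (?v \<bullet> b))"
    using assms by (intro sum.remove) auto
  also have "\<dots> = y\<^sup>2 + (\<Sum>b\<in>Basis - {k}. (x b)\<^sup>2)"
    using slice_emb_inner[OF assms] by (simp add: power2_eq_square)
  finally show ?thesis .
qed

lemma slice_emb_measurable[measurable]:
  "(\<lambda>z. slice_emb k (fst z) (snd z)) \<in> borel_measurable (lborel \<Otimes>\<^sub>M PiM (Basis - {k}) (\<lambda>_. lborel))"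
  unfolding slice_emb_def by measurable

lemma slice_emb_measurable'[measurable]:
  "slice_emb k y \<in> borel_measurable (PiM (Basis - {k}) (\<lambda>_. lborel))"
  unfolding slice_emb_def by measurable

lemma nn_integral_lborel_slice:
  fixes k :: "'a::euclidean_space" and f :: "'a \<Rightarrow> ennreal"
  assumes k: "k \<in> Basis" and [measurable]: "f \<in> borel_measurable borel"
  shows "(\<integral>\<^sup>+x. f x \<partial>lborel) = (\<integral>\<^sup>+y. (\<integral>\<^sup>+x. f (slice_emb k y x) \<partial>PiM (Basis - {k}) (\<lambda>_. lborel)) \<partial>lborel)"
proof -
  interpret product_sigma_finite "\<lambda>_::'a. lborel :: real measure" by standard
  let ?J = "Basis - {k}"
  have ins: "Basis = insert k ?J" using k by auto
  have "(\<integral>\<^sup>+x. f x \<partial>lborel) = (\<integral>\<^sup>+x. f x \<partial>distr (PiM Basis (\<lambda>_. lborel)) borel (\<lambda>g. \<Sum>b\<in>Basis. g b *\<^sub>R b))"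
    by (rule arg_cong[where f="\<lambda>M. integral\<^sup>N M f", OF lborel_eq])
  also have "\<dots> = (\<integral>\<^sup>+g. f (\<Sum>b\<in>Basis. g b *\<^sub>R b) \<partial>PiM Basis (\<lambda>_. lborel))"
    by (rule nn_integral_distr) auto
  also have "\<dots> = (\<integral>\<^sup>+g. f (\<Sum>b\<in>insert k ?J. g b *\<^sub>R b) \<partial>PiM (insert k ?J) (\<lambda>_. lborel))" using ins by simp
  also have "\<dots> = (\<integral>\<^sup>+y. (\<integral>\<^sup>+x. f (\<Sum>b\<in>insert k ?J. (x(k := y)) b *\<^sub>R b) \<partial>PiM ?J (\<lambda>_. lborel)) \<partial>lborel)"
    by (rule product_nn_integral_insert_rev) auto
  also have "\<dots> = (\<integral>\<^sup>+y. (\<integral>\<^sup>+x. f (slice_emb k y x) \<partial>PiM ?J (\<lambda>_. lborel)) \<partial>lborel)"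
  proof -
    have "(\<Sum>b\<in>insert k ?J. (x(k := y)) b *\<^sub>R b) = slice_emb k y x" for x :: "'a \<Rightarrow> real" and y
    proof -
      have "(\<Sum>b\<in>?J. (x(k := y)) b *\<^sub>R b) = (\<Sum>b\<in>?J. x b *\<^sub>R b)" by (rule sum.cong) auto
      thus ?thesis by (subst sum.insert) (auto simp: slice_emb_def)
    qed
    thus ?thesis by simp
  qed
  finally show ?thesis .
qed

lemma emeasure_half_vol_slice:
  fixes k :: "'a::euclidean_space"
  assumes k: "k \<in> Basis" and A[measurable]: "A \<in> sets borel"
  defines "P \<equiv> PiM (Basis - {k}) (\<lambda>_. lborel :: real measure)"
  shows "(\<lambda>y. emeasure P {x\<in>space P. slice_emb k y x \<in> A}) \<in> borel_measurable borel"
    and "emeasure (half_vol k) A = (\<integral>\<^sup>+y. emeasure P {x\<in>space P. slice_emb k y x \<in> A} * ennreal (1 / y ^ DIM('a)) * indicator {0<..} y \<partial>lborel)"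
proof -
  interpret product_sigma_finite "\<lambda>_::'a. lborel :: real measure" by standard
  interpret P: sigma_finite_measure P unfolding P_def by (rule sigma_finite) simp
  note [measurable] = slice_emb_measurable'[of k, folded P_def] slice_emb_measurable[of k, folded P_def]
  have e: "emeasure P {x\<in>space P. slice_emb k y x \<in> A} = (\<integral>\<^sup>+x. indicator A (slice_emb k y x) \<partial>P)" for y
  proof -
    have "(\<integral>\<^sup>+x. indicator A (slice_emb k y x) \<partial>P) = (\<integral>\<^sup>+x. indicator {x\<in>space P. slice_emb k y x \<in> A} x \<partial>P)"
      by (intro nn_integral_cong) (auto simp: indicator_def)
    thus ?thesis by simp
  qed
  have m: "(\<lambda>z. indicator A (slice_emb k (fst z) (snd z)) :: ennreal) \<in> borel_measurable (lborel \<Otimes>\<^sub>M P)" by measurable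
  from P.borel_measurable_nn_integral_fst[OF m]
  show "(\<lambda>y. emeasure P {x\<in>space P. slice_emb k y x \<in> A}) \<in> borel_measurable borel"
    unfolding e by (simp only: fst_conv snd_conv measurable_lborel2)
  have "emeasure (half_vol k) A = (\<integral>\<^sup>+x. (indicator {x. 0 < x \<bullet> k} x * ennreal (1 / (x \<bullet> k) ^ DIM('a))) * indicator A x \<partial>lborel)"
    unfolding half_vol_def by (rule emeasure_density) auto
  also have "\<dots> = (\<integral>\<^sup>+y. (\<integral>\<^sup>+x. (indicator {x. 0 < x \<bullet> k} (slice_emb k y x) * ennreal (1 / (slice_emb k y x \<bullet> k) ^ DIM('a)))
      * indicator A (slice_emb k y x) \<partial>P) \<partial>lborel)"
    unfolding P_def by (rule nn_integral_lborel_slice[OF k]) auto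
  also have "\<dots> = (\<integral>\<^sup>+y. (\<integral>\<^sup>+x. (ennreal (1 / y ^ DIM('a)) * indicator {0<..} y) * indicator A (slice_emb k y x) \<partial>P) \<partial>lborel)"
    by (intro nn_integral_cong) (auto simp: slice_emb_inner[OF k] indicator_def)
  also have "\<dots> = (\<integral>\<^sup>+y. (ennreal (1 / y ^ DIM('a)) * indicator {0<..} y) * emeasure P {x\<in>space P. slice_emb k y x \<in> A} \<partial>lborel)"
    unfolding e by (intro nn_integral_cong nn_integral_cmult) auto
  finally show "emeasure (half_vol k) A = (\<integral>\<^sup>+y. emeasure P {x\<in>space P. slice_emb k y x \<in> A} * ennreal (1 / y ^ DIM('a)) * indicator {0<..} y \<partial>lborel)"
    by (simp add: mult_ac)
qed

text \<open>The Euclidean ball of radius \<open>\<epsilon> * (x \<bullet> k)\<close> about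
  \<open>x\<close> is, to first order, the hyperbolic ball of radius \<open>\<epsilon>\<close>. At
  relative height \<open>\<epsilon> * z\<close> it contains a horizontal ball of radius
  \<open>\<epsilon> * y * sqrt (1 - z\<^sup>2)\<close>, so the slice of \<open>C\<close> at height
  \<open>y * (1 + \<epsilon> * z)\<close> contains the sum of the slice of \<open>A\<close> at
  \<open>y\<close> and such a ball, for every \<open>z\<close> in between. This freedom in
  \<open>z\<close> is what \<open>transport_1d\<close> exploits; \<open>\<mu>\<close> is the
  parameter of the geodesic ball with the volume of \<open>A\<close>.\<close>

lemma half_space_isoperimetric:
  fixes k :: "'a::euclidean_space" and A C :: "'a set"
  defines "n \<equiv> DIM('a)"
  defines "m \<equiv> n - 1"
  defines "\<omega> \<equiv> unit_ball_vol (real m)"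
  assumes k: "k \<in> Basis" and n2: "2 \<le> n"
    and A[measurable]: "A \<in> sets borel" "bounded A" and Ac: "\<And>x. x \<in> A \<Longrightarrow> c \<le> x \<bullet> k" and c: "0 < c"
    and V: "emeasure (half_vol k) A = ennreal V" "0 < V"
    and C[measurable]: "C \<in> sets borel"
    and AC: "\<And>x w. x \<in> A \<Longrightarrow> norm w \<le> 1 \<Longrightarrow> x + (\<epsilon> * (x \<bullet> k)) *\<^sub>R w \<in> C"
    and \<mu>: "1 < \<mu>" and B: "\<omega> * prof (m / 2) (- real n) \<mu> = V"
    and \<epsilon>: "0 < \<epsilon>" "\<epsilon> < 1" "n\<^sup>2 * (1 + \<mu>) * \<epsilon>\<^sup>2 \<le> 1"
  shows "ennreal (V + \<epsilon> * (\<omega> * profE (m / 2) \<mu>) - n\<^sup>2 * (1 + \<mu>) * \<epsilon>\<^sup>2 * V) \<le> emeasure (half_vol k) C"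
proof -
  interpret product_sigma_finite "\<lambda>_::'a. lborel :: real measure" by standard
  let ?J = "Basis - {k}"
  define P where "P = PiM ?J (\<lambda>_. lborel :: real measure)"
  note [measurable] = slice_emb_measurable'[of k, folded P_def]
  have cardJ: "card ?J = m" using k by (simp add: m_def n_def)
  have m0: "0 < m" "n = Suc m" using n2 by (auto simp: m_def)
  have J: "finite ?J" "?J \<noteq> {}" using cardJ m0 card_gt_0_iff[of ?J] by simp_all
  obtain N where N: "\<And>x. x \<in> A \<Longrightarrow> norm x \<le> N" and N0: "0 < N" using A(2) unfolding bounded_pos by auto
  define SA where "SA y = {x\<in>space P. slice_emb k y x \<in> A}" for y
  define SC where "SC y = {x\<in>space P. slice_emb k y x \<in> C}" for y
  have SAm[measurable]: "SA y \<in> sets P" "SC y \<in> sets P" for y unfolding SA_def SC_def by measurable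
  have SAb: "\<bar>x b\<bar> \<le> N" if "x \<in> SA y" "b \<in> ?J" for x y b
  proof -
    have "\<bar>slice_emb k y x \<bullet> b\<bar> \<le> norm (slice_emb k y x)" using that by (intro Basis_le_norm) auto
    thus ?thesis using N[of "slice_emb k y x"] that slice_emb_inner(2)[OF k that(2)] by (auto simp: SA_def)
  qed
  have SAfin: "emeasure P (SA y) \<le> ennreal ((2 * N) ^ m)" for y
  proof -
    have "emeasure P (SA y) \<le> emeasure P (PiE ?J (\<lambda>_. {-N..N}))"
    proof (rule emeasure_mono)
      show "SA y \<subseteq> PiE ?J (\<lambda>_. {-N..N})"
      proof
        fix x assume x: "x \<in> SA y"
        hence "x \<in> PiE ?J (\<lambda>_. UNIV)" by (auto simp: SA_def P_def space_PiM)
        moreover have "x b \<in> {-N..N}" if "b \<in> ?J" for b using SAb[OF x that] by (auto simp: abs_le_iff)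
        ultimately show "x \<in> PiE ?J (\<lambda>_. {-N..N})" by (auto simp: PiE_def)
      qed
      show "PiE ?J (\<lambda>_. {-N..N}) \<in> sets P" unfolding P_def by (intro sets_PiM_I_finite) auto
    qed
    also have "\<dots> = ennreal ((2 * N) ^ m)"
      unfolding P_def using N0 cardJ by (subst emeasure_PiM) (auto simp: ennreal_power)
    finally show ?thesis .
  qed
  define a0 where "a0 y = enn2real (emeasure P (SA y))" for y
  have ea0: "emeasure P (SA y) = ennreal (a0 y)" for y
    unfolding a0_def by (rule ennreal_enn2real[symmetric], rule le_less_trans[OF SAfin]) simp
  have sl: "(\<lambda>y. emeasure P (SA y)) \<in> borel_measurable borel" "(\<lambda>y. emeasure P (SC y)) \<in> borel_measurable borel"
    unfolding SA_def SC_def P_def by (rule emeasure_half_vol_slice[OF k], measurable)+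
  have a0m[measurable]: "a0 \<in> borel_measurable borel" unfolding a0_def using sl(1) by measurable
  have a0s: "y \<in> {c..max c N}" if "a0 y \<noteq> 0" for y
  proof -
    have "SA y \<noteq> {}" using that by (auto simp: a0_def)
    then obtain x where x: "slice_emb k y x \<in> A" by (auto simp: SA_def)
    have "\<bar>slice_emb k y x \<bullet> k\<bar> \<le> norm (slice_emb k y x)" using k by (intro Basis_le_norm) auto
    thus ?thesis using Ac[OF x] N[OF x] slice_emb_inner(1)[OF k] by auto
  qed
  have "(\<integral>\<^sup>+y. ennreal (a0 y / y ^ n) \<partial>lborel) = (\<integral>\<^sup>+y. emeasure P (SA y) * ennreal (1 / y ^ n) * indicator {0<..} y \<partial>lborel)"
  proof (rule nn_integral_cong)
    fix y
    show "ennreal (a0 y / y ^ n) = emeasure P (SA y) * ennreal (1 / y ^ n) * indicator {0<..} y"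
    proof (cases "a0 y = 0")
      case True thus ?thesis using ea0[of y] by simp
    next
      case False
      hence "0 < y" using a0s[OF False] c by auto
      thus ?thesis unfolding ea0 by (simp add: ennreal_mult[symmetric] a0_def)
    qed
  qed
  also have "\<dots> = emeasure (half_vol k) A"
    unfolding emeasure_half_vol_slice(2)[OF k A(1)] SA_def P_def n_def ..
  finally have Va: "(\<integral>\<^sup>+y. ennreal (a0 y / y ^ n) \<partial>lborel) = ennreal V" using V by simp
  have \<omega>0: "0 < \<omega>" by (simp add: \<omega>_def)
  have "ennreal (V + \<epsilon> * (\<omega> * profE (m / 2) \<mu>) - n\<^sup>2 * (1 + \<mu>) * \<epsilon>\<^sup>2 * V)
      \<le> (\<integral>\<^sup>+z. emeasure P (SC z) * ennreal (1 / z ^ n) * indicator {0<..} z \<partial>lborel)"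
  proof (rule transport_1d[OF m0 a0m _ _ a0s c _ Va V(2) \<omega>0 \<mu> B \<epsilon> sl(2)])
    show "0 \<le> a0 y" for y by (simp add: a0_def)
    show "a0 y \<le> (2 * N) ^ m" for y
      unfolding a0_def using enn2real_mono[OF SAfin[of y]] N0 by (simp add: enn2real_ennreal)
    fix y z :: real assume a0y: "0 < a0 y" and z: "-1 < z" "z < 1"
    have y: "0 < y" using a0s[of y] a0y c by auto
    have z2: "z\<^sup>2 < 1" using z by (simp add: abs_square_less_1 abs_less_iff)
    have "ennreal ((a0 y powr (1 / card ?J) + unit_ball_vol (card ?J) powr (1 / card ?J) * (\<epsilon> * y * sqrt (1 - z\<^sup>2))) ^ card ?J)
        \<le> emeasure P (SC (y * (1 + \<epsilon> * z)))"
      unfolding P_def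
    proof (rule brunn_minkowski_ball_PiM[OF J, where A = "SA y" and N = N])
      show "SA y \<in> sets (PiM ?J (\<lambda>_. lborel))" "SC (y * (1 + \<epsilon> * z)) \<in> sets (PiM ?J (\<lambda>_. lborel))"
        using SAm unfolding P_def by auto
      show "emeasure (PiM ?J (\<lambda>_. lborel)) (SA y) = ennreal (a0 y)" using ea0[of y] unfolding P_def .
      show "0 < \<epsilon> * y * sqrt (1 - z\<^sup>2)" using \<epsilon> y z2 by simp
      fix x w assume x: "x \<in> SA y" and w: "w \<in> space (PiM ?J (\<lambda>_. lborel :: real measure))" "sqrt (\<Sum>i\<in>?J. (w i)\<^sup>2) \<le> \<epsilon> * y * sqrt (1 - z\<^sup>2)"
      \<comment> \<open>The vector of the unit ball that realizes the vertical shift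
        \<open>z\<close> together with the horizontal shift \<open>w\<close>.\<close>
      define W where "W = slice_emb k z (\<lambda>b. w b / (\<epsilon> * y))"
      have "(\<Sum>i\<in>?J. (w i)\<^sup>2) \<le> (\<epsilon> * y * sqrt (1 - z\<^sup>2))\<^sup>2" using sqrt_le_D[OF w(2)] .
      also have "\<dots> = (\<epsilon> * y)\<^sup>2 * (1 - z\<^sup>2)" using z2 by (simp add: power_mult_distrib)
      finally have "(\<Sum>i\<in>?J. (w i)\<^sup>2) / (\<epsilon> * y)\<^sup>2 \<le> 1 - z\<^sup>2" using \<epsilon> y by (simp add: field_simps)
      hence "(norm W)\<^sup>2 \<le> 1" unfolding W_def slice_emb_norm[OF k] by (simp add: power_divide sum_divide_distrib)
      hence "norm W \<le> 1" by (simp add: power2_le_iff_abs_le abs_square_le_1)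
      hence "slice_emb k y x + (\<epsilon> * (slice_emb k y x \<bullet> k)) *\<^sub>R W \<in> C" using x by (intro AC) (auto simp: SA_def)
      moreover have "slice_emb k y x + (\<epsilon> * (slice_emb k y x \<bullet> k)) *\<^sub>R W = slice_emb k (y * (1 + \<epsilon> * z)) (\<lambda>i\<in>?J. x i + w i)"
      proof -
        have "(\<Sum>b\<in>?J. (\<lambda>i\<in>?J. x i + w i) b *\<^sub>R b) = (\<Sum>b\<in>?J. x b *\<^sub>R b) + (\<Sum>b\<in>?J. w b *\<^sub>R b)"
          by (simp add: sum.distrib[symmetric] scaleR_add_left)
        moreover have "(\<epsilon> * y) *\<^sub>R (\<Sum>b\<in>?J. (w b / (\<epsilon> * y)) *\<^sub>R b) = (\<Sum>b\<in>?J. w b *\<^sub>R b)"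
          using \<epsilon> y by (simp add: scaleR_sum_right)
        ultimately show ?thesis
          unfolding slice_emb_inner(1)[OF k] unfolding slice_emb_def W_def scaleR_add_right
          by (simp add: algebra_simps)
      qed
      ultimately show "(\<lambda>i\<in>?J. x i + w i) \<in> SC (y * (1 + \<epsilon> * z))" by (auto simp: SC_def P_def space_PiM)
    qed (use SAb a0y in auto)
    thus "ennreal ((a0 y powr (1 / m) + \<omega> powr (1 / m) * (\<epsilon> * y * sqrt (1 - z\<^sup>2))) ^ m) \<le> emeasure P (SC (y * (1 + \<epsilon> * z)))"
      unfolding cardJ \<omega>_def .
  qed (assumption, rule max.cobounded1)
  also have "\<dots> = emeasure (half_vol k) C"
    unfolding emeasure_half_vol_slice(2)[OF k C] SC_def P_def n_def ..
  finally show ?thesis by (simp only: of_nat_power)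
qed

text \<open>Slicing the unit ball: the constant \<open>prof (m / 2) 0 2\<close> of the area law is
  what leads from dimension \<open>m\<close> to dimension \<open>Suc m\<close>.\<close>

lemma unit_ball_vol_prof:
  assumes "0 < m"
  shows "unit_ball_vol (real m) * prof (m / 2) 0 2 = unit_ball_vol (real (Suc m))"
proof -
  have c: "continuous_on {-1..1} (\<lambda>z::real. (1 - z\<^sup>2) powr (m / 2) * (z + 2) powr 0)"
    using prof_continuous_on[of "m / 2" 2 0] assms by simp
  have int: "((\<lambda>z. (1 - z\<^sup>2) powr (m / 2) * (z + 2) powr 0) has_integral prof (m / 2) 0 2) {-1..1}"
    unfolding prof_def by (rule integrable_integral[OF integrable_continuous_interval[OF c]])
  have "ennreal (prof (m / 2) 0 2) = (\<integral>\<^sup>+z. ennreal ((1 - z\<^sup>2) powr (m / 2) * (z + 2) powr 0) * indicator {-1..1} z \<partial>lborel)"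
    by (rule nn_integral_has_integral_Icc[symmetric]) (use int in auto)
  also have "\<dots> = (\<integral>\<^sup>+x. ennreal (indicator {-1..1} x * sqrt (1 - x\<^sup>2) ^ m) \<partial>lborel)"
  proof (rule nn_integral_cong)
    fix z :: real
    have "(1 - z\<^sup>2) powr (m / 2) = sqrt (1 - z\<^sup>2) ^ m" if "-1 \<le> z" "z \<le> 1"
    proof (cases "z\<^sup>2 = 1")
      case False
      hence "z\<^sup>2 < 1" using that abs_square_le_1[of z] by (auto simp: abs_le_iff)
      thus ?thesis by (simp add: powr_half_sqrt[symmetric] powr_realpow[symmetric] powr_powr)
    qed (use assms in simp)
    thus "ennreal ((1 - z\<^sup>2) powr (m / 2) * (z + 2) powr 0) * indicator {-1..1} z = ennreal (indicator {-1..1} z * sqrt (1 - z\<^sup>2) ^ m)"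
      by (auto simp: indicator_def)
  qed
  also have "\<dots> = ennreal (Beta (1 / 2) (real m / 2 + 1))" by (rule emeasure_cball_aux_integral)
  finally have "prof (m / 2) 0 2 = Beta (1 / 2) (real m / 2 + 1)"
    using prof_pos[of "m / 2" 2 0] assms by (subst (asm) ennreal_inj) (auto simp: Beta_def intro!: divide_nonneg_nonneg mult_nonneg_nonneg Gamma_real_nonneg)
  thus ?thesis
    by (auto simp: unit_ball_vol_def Beta_def Gamma_eq_zero_iff field_simps
          Gamma_one_half_real powr_half_sqrt [symmetric] powr_add [symmetric])
qed

text \<open>Not the perimeter of a geodesic ball but a lower bound for it: the \<open>l^p\<close>
  norm of the Euclidean profile and of \<open>(n - 1) * V\<close>, a shape that Hoelder's inequality
  for pairs can split.\<close>

definition iso_profile :: "nat \<Rightarrow> real \<Rightarrow> real \<Rightarrow> real" where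
  "iso_profile n p V = ((n * unit_ball_vol (real n) powr (1 / n) * V powr ((real n - 1) / n)) powr p
      + ((real n - 1) * V) powr p) powr (1 / p)"

lemma iso_profile_nonneg: "0 \<le> iso_profile n p V" by (simp add: iso_profile_def)

text \<open>Lower Minkowski content takes the place of perimeter; the sets \<open>C j\<close>
  contain the neighbourhoods of radius \<open>\<epsilon> j\<close>. The quadratic error of
  \<open>half_space_isoperimetric\<close> disappears in the limit. As it depends on
  \<open>\<mu>\<close>, and so on \<open>V\<close>, the bound is a lower limit for each single set,
  without uniformity.\<close>

lemma half_space_neighbourhood_volume:
  fixes k :: "'a::euclidean_space" and A :: "'a set"
  assumes k: "k \<in> Basis" and n2: "2 \<le> DIM('a)"
    and A: "A \<in> sets borel" "bounded A" and Ac: "\<And>x. x \<in> A \<Longrightarrow> c \<le> x \<bullet> k" and c: "0 < c"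
    and V: "emeasure (half_vol k) A = ennreal V" "0 \<le> V"
    and p: "2 * real DIM('a) / (real DIM('a) - 1) \<le> p"
    and C: "\<And>j. C j \<in> sets borel"
    and AC: "\<And>j x w. x \<in> A \<Longrightarrow> norm w \<le> 1 \<Longrightarrow> x + (\<epsilon> j * (x \<bullet> k)) *\<^sub>R w \<in> C j"
    and \<epsilon>: "\<And>j. 0 < \<epsilon> j" "\<And>j. \<epsilon> j < 1" "\<epsilon> \<longlonglongrightarrow> 0"
  shows "ennreal (iso_profile DIM('a) p V) \<le> liminf (\<lambda>j. ennreal (1 / \<epsilon> j) * emeasure (half_vol k) (C j - A))"
proof (cases "V = 0")
  case True
  have "0 < p" using less_le_trans[OF _ p, of 0] n2 by simp
  thus ?thesis using True by (simp add: iso_profile_def)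
next
  case False
  define n where "n = DIM('a)"
  define m where "m = n - 1"
  define \<omega> where "\<omega> = unit_ball_vol (real m)"
  have m: "0 < m" "n = Suc m" "real n = real m + 1" "real n - 1 = real m" using n2 by (auto simp: m_def n_def)
  have \<omega>: "0 < \<omega>" by (simp add: \<omega>_def)
  have na: "2 * (real m / 2) + 1 = real n" using m by simp
  have sig: "\<omega> * prof (m / 2) 0 2 = unit_ball_vol (real n)" unfolding \<omega>_def m(2) by (rule unit_ball_vol_prof[OF m(1)])
  have p': "(2 * (real m / 2) + 1) / (real m / 2) \<le> p" using p m by (simp add: n_def[symmetric] algebra_simps)
  have p0: "0 < p" using less_le_trans[OF _ p, of 0] n2 by simp
  obtain \<mu> where \<mu>: "1 < \<mu>" "\<omega> * prof (m / 2) (- real n) \<mu> = V"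
    "(n * unit_ball_vol (real n) powr (1 / n) * V powr ((real n - 1) / n)) powr p + ((real n - 1) * V) powr p
       \<le> (\<omega> * profE (m / 2) \<mu>) powr p"
    using hyperbolic_profile[of "real m / 2" \<omega> V p] p' \<omega> m V False unfolding na sig m(4) by auto
  define E where "E = \<omega> * profE (m / 2) \<mu>"
  have E0: "0 \<le> E" using profE_eq[of "m / 2" \<mu>] \<mu> m \<omega> prof_pos[of "m / 2" 2 0] by (simp add: E_def)
  have "iso_profile n p V \<le> (E powr p) powr (1 / p)"
    unfolding iso_profile_def E_def using \<mu>(3) p0 by (intro powr_mono2) auto
  hence PhiE: "iso_profile n p V \<le> E" using p0 E0 by (simp add: powr_powr)
  define K where "K = (real n)\<^sup>2 * (1 + \<mu>)"
  have K: "0 < K" using \<mu> m by (simp add: K_def)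
  have "(\<lambda>j. K * (\<epsilon> j)\<^sup>2) \<longlonglongrightarrow> K * 0\<^sup>2" by (intro tendsto_intros \<epsilon>)
  hence ev: "\<forall>\<^sub>F j in sequentially. K * (\<epsilon> j)\<^sup>2 < 1" by (rule order_tendstoD(2)) simp
  have lim: "(\<lambda>j. ennreal (E - K * \<epsilon> j * V)) \<longlonglongrightarrow> ennreal (E - K * 0 * V)"
    by (intro tendsto_ennrealI tendsto_intros \<epsilon>)
  have "ennreal (iso_profile n p V) \<le> ennreal E" using PhiE by (rule ennreal_leI)
  also have "ennreal E = liminf (\<lambda>j. ennreal (E - K * \<epsilon> j * V))" using lim_imp_Liminf[OF _ lim] by simp
  also have "\<dots> \<le> liminf (\<lambda>j. ennreal (1 / \<epsilon> j) * emeasure (half_vol k) (C j - A))"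
  proof (rule Liminf_mono)
    show "\<forall>\<^sub>F j in sequentially. ennreal (E - K * \<epsilon> j * V) \<le> ennreal (1 / \<epsilon> j) * emeasure (half_vol k) (C j - A)"
      using ev
    proof eventually_elim
      case (elim j)
      have s: "sets (half_vol k) = sets borel" by (simp add: half_vol_def)
      have "ennreal (V + \<epsilon> j * E - (real n)\<^sup>2 * (1 + \<mu>) * (\<epsilon> j)\<^sup>2 * V) \<le> emeasure (half_vol k) (C j)"
        unfolding E_def \<omega>_def m_def n_def
        by (rule half_space_isoperimetric[OF k _ A Ac c V(1) _ C AC \<mu>(1)])
           (use n2 V False \<epsilon> \<mu>(2) elim in \<open>auto simp: \<omega>_def m_def n_def K_def\<close>)
      also have "\<dots> \<le> emeasure (half_vol k) ((C j - A) \<union> A)" using A C s by (intro emeasure_mono) auto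
      also have "\<dots> \<le> emeasure (half_vol k) (C j - A) + emeasure (half_vol k) A"
        using A C s by (intro emeasure_subadditive) auto
      finally have 1: "ennreal (V + \<epsilon> j * E - K * (\<epsilon> j)\<^sup>2 * V) \<le> emeasure (half_vol k) (C j - A) + ennreal V"
        using V by (simp add: K_def)
      have "ennreal (\<epsilon> j * (E - K * \<epsilon> j * V)) \<le> emeasure (half_vol k) (C j - A)"
      proof (cases "0 \<le> E - K * \<epsilon> j * V")
        case True
        have e: "V + \<epsilon> j * E - K * (\<epsilon> j)\<^sup>2 * V = V + \<epsilon> j * (E - K * \<epsilon> j * V)" by (simp add: algebra_simps power2_eq_square)
        have "ennreal (V + \<epsilon> j * (E - K * \<epsilon> j * V)) = ennreal V + ennreal (\<epsilon> j * (E - K * \<epsilon> j * V))"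
          by (rule ennreal_plus) (use True \<epsilon>(1)[of j] V in auto)
        hence "ennreal V + ennreal (\<epsilon> j * (E - K * \<epsilon> j * V)) \<le> ennreal V + emeasure (half_vol k) (C j - A)"
          using 1 unfolding e by (simp only: add.commute)
        thus ?thesis unfolding ennreal_add_left_cancel_le by simp
      next
        case False
        hence "\<epsilon> j * (E - K * \<epsilon> j * V) \<le> 0" using \<epsilon>(1)[of j] by (intro mult_nonneg_nonpos) auto
        thus ?thesis by (simp add: ennreal_neg)
      qed
      hence "ennreal (1 / \<epsilon> j) * ennreal (\<epsilon> j * (E - K * \<epsilon> j * V)) \<le> ennreal (1 / \<epsilon> j) * emeasure (half_vol k) (C j - A)"
        by (intro mult_left_mono) auto
      moreover have "ennreal (1 / \<epsilon> j) * ennreal (\<epsilon> j * (E - K * \<epsilon> j * V)) = ennreal (E - K * \<epsilon> j * V)"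
        using \<epsilon>(1)[of j] by (subst ennreal_mult'[symmetric]) auto
      ultimately show ?case by simp
    qed
  qed
  finally show ?thesis unfolding n_def .
qed

section \<open>Coarea inequality for Lipschitz weights\<close>

lemma sigma_finite_half_vol: "sigma_finite_measure (half_vol k)"
  unfolding half_vol_def
  by (subst sigma_finite_measure.sigma_finite_iff_density_finite'[OF lborel.sigma_finite_measure_axioms])
     (auto simp: indicator_def)

lemma half_vol_bounded_finite:
  fixes k :: "'a::euclidean_space"
  assumes c: "0 < c"
  shows "emeasure (half_vol k) {z. c \<le> z \<bullet> k \<and> norm z \<le> R} < \<infinity>"
proof -
  let ?K = "{z. c \<le> z \<bullet> k \<and> norm z \<le> R}"
  have "emeasure (half_vol k) ?K = (\<integral>\<^sup>+x. (indicator {x. 0 < x \<bullet> k} x * ennreal (1 / (x \<bullet> k) ^ DIM('a))) * indicator ?K x \<partial>lborel)"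
    unfolding half_vol_def by (rule emeasure_density) auto
  also have "\<dots> \<le> (\<integral>\<^sup>+x. ennreal (1 / c ^ DIM('a)) * indicator (cball (0::'a) R) x \<partial>lborel)"
  proof (rule nn_integral_mono)
    fix x :: 'a
    have "1 / (x \<bullet> k) ^ DIM('a) \<le> 1 / c ^ DIM('a)" if "c \<le> x \<bullet> k"
      using that c by (intro divide_left_mono power_mono mult_pos_pos zero_less_power) auto
    thus "(indicator {x. 0 < x \<bullet> k} x * ennreal (1 / (x \<bullet> k) ^ DIM('a))) * indicator ?K x
       \<le> ennreal (1 / c ^ DIM('a)) * indicator (cball 0 R) x"
      by (auto simp: indicator_def intro!: ennreal_leI)
  qed
  also have "\<dots> = ennreal (1 / c ^ DIM('a)) * emeasure lborel (cball (0::'a) R)"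
    by (rule nn_integral_cmult_indicator) auto
  also have "\<dots> < \<infinity>"
    using emeasure_bounded_finite[OF bounded_cball, of "0::'a" R] by (simp add: ennreal_mult_less_top)
  finally show ?thesis .
qed

text \<open>The integral over levels of \<open>1 / \<epsilon> j\<close> times the volume of the
  shell \<open>C j t - A t\<close> is evaluated by Fubini: a point \<open>z\<close> lies in the
  shell only for levels \<open>t\<close> between \<open>w z\<close> and
  \<open>w z + \<epsilon> j * (g z + \<eta>)\<close>. Fatou's lemma passes to the lower Minkowski
  content of each superlevel set. On the short interval of levels the Lipschitz property of
  \<open>h\<close> allows \<open>h t\<close> to be replaced by \<open>h (w z)\<close>. The
  hypothesis \<open>grad\<close> bounds increments of \<open>w\<close> at hyperbolic scale by
  \<open>g\<close>, uniformly.\<close>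

lemma coarea_half_space_lipschitz:
  fixes k :: "'a::euclidean_space" and w g :: "'a \<Rightarrow> real" and h :: "real \<Rightarrow> real"
  assumes k: "k \<in> Basis" and n2: "2 \<le> DIM('a)" and p: "2 * real DIM('a) / (real DIM('a) - 1) \<le> p"
    and w: "continuous_on UNIV w" "\<And>x. 0 \<le> w x" and w0: "\<And>x. w x \<noteq> 0 \<Longrightarrow> c \<le> x \<bullet> k \<and> norm x \<le> R" and c: "0 < c"
    and g[measurable]: "g \<in> borel_measurable borel" and g0: "\<And>x. 0 \<le> g x" and gG: "\<And>x. g x \<le> G"
    and grad: "\<And>\<eta>. 0 < \<eta> \<Longrightarrow> \<exists>\<epsilon>0>0. \<forall>\<epsilon> x z. 0 < \<epsilon> \<longrightarrow> \<epsilon> < \<epsilon>0 \<longrightarrow> 0 < x \<bullet> k \<longrightarrow> norm (z - x) \<le> \<epsilon> * (x \<bullet> k)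
         \<longrightarrow> w x - w z \<le> \<epsilon> * (g z + \<eta>)"
    and h[measurable]: "h \<in> borel_measurable borel" and h0: "\<And>t. 0 \<le> h t" and hH: "\<And>t. h t \<le> H"
    and hL: "\<And>s t. \<bar>h s - h t\<bar> \<le> L * \<bar>s - t\<bar>"
  defines "\<nu> \<equiv> \<lambda>t. enn2real (emeasure (half_vol k) {x. t < w x})"
  shows "(\<integral>\<^sup>+t. ennreal (h t) * ennreal (iso_profile DIM('a) p (\<nu> t)) * indicator {0..} t \<partial>lborel)
     \<le> (\<integral>\<^sup>+x. ennreal (h (w x) * g x) \<partial>half_vol k)"
proof -
  interpret S: sigma_finite_measure "half_vol k" by (rule sigma_finite_half_vol)
  have sh[measurable_cong, simp]: "sets (half_vol k) = sets borel" by (simp add: half_vol_def)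
  have sp[simp]: "space (half_vol k) = UNIV" by (simp add: half_vol_def)
  have [measurable]: "w \<in> borel_measurable borel" by (rule borel_measurable_continuous_onI[OF w(1)])
  \<comment> \<open>Any null sequence of positive numbers up to 1/2 serves; the bound keeps all
    neighbourhoods inside one set of finite volume.\<close>
  define \<epsilon> where "\<epsilon> j = 1 / (real j + 3)" for j
  have \<epsilon>: "0 < \<epsilon> j" "\<epsilon> j \<le> 1 / 2" for j by (auto simp: \<epsilon>_def field_simps)
  have \<epsilon>0: "\<epsilon> \<longlonglongrightarrow> 0" unfolding \<epsilon>_def by real_asymp
  \<comment> \<open>For fixed \<open>v\<close>, the inverse of the displacement
    \<open>x + (e * (x \<bullet> k)) *\<^sub>R v\<close>. It exhibits the neighbourhoods of all
    levels as sections of one open set \<open>D j\<close>, which settles joint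
    measurability.\<close>
  define \<psi> where "\<psi> e v z = z - (e * (z \<bullet> k) / (1 + e * (v \<bullet> k))) *\<^sub>R v" for e :: real and v z :: 'a
  have vk: "0 < 1 + \<epsilon> j * (v \<bullet> k)" if "norm v \<le> 1" for v j
  proof -
    have "\<bar>v \<bullet> k\<bar> \<le> 1" using Basis_le_norm[OF k, of v] that by simp
    hence "\<bar>\<epsilon> j * (v \<bullet> k)\<bar> \<le> 1 / 2 * 1" using \<epsilon>[of j] by (simp only: abs_mult) (intro mult_mono, auto)
    thus ?thesis by linarith
  qed
  have \<psi>1: "\<psi> (\<epsilon> j) v (x + (\<epsilon> j * (x \<bullet> k)) *\<^sub>R v) = x" if "norm v \<le> 1" for v x j
  proof -
    have "(x + (\<epsilon> j * (x \<bullet> k)) *\<^sub>R v) \<bullet> k = (x \<bullet> k) * (1 + \<epsilon> j * (v \<bullet> k))" by (simp add: inner_simps algebra_simps)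
    moreover have "1 + \<epsilon> j * (v \<bullet> k) \<noteq> 0" using vk[OF that, of j] by linarith
    ultimately show ?thesis unfolding \<psi>_def by simp
  qed
  have \<psi>2: "norm (z - \<psi> (\<epsilon> j) v z) \<le> \<epsilon> j * (\<psi> (\<epsilon> j) v z \<bullet> k)" if "norm v \<le> 1" "0 < \<psi> (\<epsilon> j) v z \<bullet> k" for v z j
  proof -
    have "\<psi> (\<epsilon> j) v z \<bullet> k = (z \<bullet> k) - \<epsilon> j * (z \<bullet> k) / (1 + \<epsilon> j * (v \<bullet> k)) * (v \<bullet> k)" by (simp add: \<psi>_def inner_simps)
    also have "\<dots> = (z \<bullet> k) / (1 + \<epsilon> j * (v \<bullet> k))"
    proof -
      have "a - e * a / (1 + e * b) * b = a / (1 + e * b)" if "0 < 1 + e * b" for a b e :: real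
        using that less_imp_neq[OF that] by (simp add: field_simps)
      thus ?thesis using vk[OF that(1), of j] by simp
    qed
    finally have e: "\<psi> (\<epsilon> j) v z \<bullet> k = (z \<bullet> k) / (1 + \<epsilon> j * (v \<bullet> k))" .
    have "norm (z - \<psi> (\<epsilon> j) v z) = \<bar>\<epsilon> j * (\<psi> (\<epsilon> j) v z \<bullet> k)\<bar> * norm v" unfolding e by (simp add: \<psi>_def)
    also have "\<dots> \<le> \<bar>\<epsilon> j * (\<psi> (\<epsilon> j) v z \<bullet> k)\<bar> * 1" using that by (intro mult_left_mono) auto
    finally show ?thesis using that \<epsilon>(1)[of j] by simp
  qed
  define D where "D j = (\<Union>v\<in>cball 0 1. {z. fst z < w (\<psi> (\<epsilon> j) v (snd z))})" for j
  have Dopen: "open (D j)" for j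
  proof -
    have "continuous_on UNIV (\<lambda>z::real \<times> 'a. w (\<psi> (\<epsilon> j) v (snd z)))" if "v \<in> cball 0 1" for v
    proof -
      have "1 + \<epsilon> j * (v \<bullet> k) \<noteq> 0" using vk[of v j] that by simp
      thus ?thesis unfolding \<psi>_def by (intro continuous_on_compose2[OF w(1)] continuous_intros) auto
    qed
    thus ?thesis unfolding D_def by (intro open_UN ballI open_Collect_less) (auto intro!: continuous_intros)
  qed
  have Dm: "D j \<in> sets borel" for j using Dopen by simp
  define C where "C j t = {z. (t, z) \<in> D j}" for j t
  have Cm[measurable]: "C j t \<in> sets borel" for j t
  proof -
    have "C j t = (\<lambda>z. (t, z)) -` D j" by (auto simp: C_def)
    moreover have "open ((\<lambda>z. (t, z)) -` D j)" by (rule open_vimage[OF Dopen]) (intro continuous_intros)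
    ultimately show ?thesis by simp
  qed
  have CD: "\<exists>x. norm (z - x) \<le> \<epsilon> j * (x \<bullet> k) \<and> t < w x \<and> c \<le> x \<bullet> k \<and> norm x \<le> R" if z: "z \<in> C j t" and t: "0 \<le> t" for j z t
  proof -
    obtain v where v: "norm v \<le> 1" "t < w (\<psi> (\<epsilon> j) v z)" using z by (auto simp: C_def D_def)
    hence "w (\<psi> (\<epsilon> j) v z) \<noteq> 0" using t by auto
    from w0[OF this] c have "c \<le> \<psi> (\<epsilon> j) v z \<bullet> k" "0 < \<psi> (\<epsilon> j) v z \<bullet> k" "norm (\<psi> (\<epsilon> j) v z) \<le> R" by auto
    thus ?thesis using \<psi>2[OF v(1)] v(2) by blast
  qed
  have AC: "x + (\<epsilon> j * (x \<bullet> k)) *\<^sub>R v \<in> C j t" if "t < w x" "norm v \<le> 1" for x v j t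
    unfolding C_def D_def using that \<psi>1[OF that(2), of j x] by (auto intro!: bexI[of _ v])
  define A where "A t = {x. t < w x}" for t
  have Am[measurable]: "A t \<in> sets borel" for t unfolding A_def by measurable
  have A0: "c \<le> x \<bullet> k" "norm x \<le> R" if "x \<in> A t" "0 \<le> t" for x t using that w0[of x] by (auto simp: A_def)
  \<comment> \<open>Contains all superlevel sets at nonnegative levels and their neighbourhoods, and
    has finite volume.\<close>
  define K where "K = {z. c / 2 \<le> z \<bullet> k \<and> norm z \<le> 2 * R}"
  have Km[measurable]: "K \<in> sets borel" unfolding K_def by measurable
  have Kfin: "emeasure (half_vol k) K < \<infinity>" unfolding K_def by (rule half_vol_bounded_finite) (use c in simp)
  have AK: "A t \<subseteq> K" if "0 \<le> t" for t
  proof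
    fix x assume x: "x \<in> A t"
    have "norm x \<le> 2 * R" using A0[OF x that] norm_ge_zero[of x] by linarith
    thus "x \<in> K" using A0[OF x that] c by (simp add: K_def)
  qed
  have \<nu>: "emeasure (half_vol k) (A t) = ennreal (\<nu> t)" if "0 \<le> t" for t
  proof -
    have "emeasure (half_vol k) (A t) \<le> emeasure (half_vol k) K" using AK[OF that] by (intro emeasure_mono) auto
    hence "emeasure (half_vol k) (A t) < top" using Kfin by (auto simp: le_less_trans)
    thus ?thesis unfolding \<nu>_def A_def by simp
  qed
  have CK: "z \<in> K" if zt: "z \<in> C j t" "0 \<le> t" for j t z
  proof -
    obtain x where x: "norm (z - x) \<le> \<epsilon> j * (x \<bullet> k)" "c \<le> x \<bullet> k" "norm x \<le> R" using CD[OF zt] by blast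
    have "x \<bullet> k \<le> norm x" using Basis_le_norm[OF k, of x] by simp
    have "\<epsilon> j * (x \<bullet> k) \<le> 1 / 2 * (x \<bullet> k)" using \<epsilon>[of j] x c by (intro mult_right_mono) auto
    hence 1: "norm (z - x) \<le> (x \<bullet> k) / 2" using x by simp
    have "\<bar>(z - x) \<bullet> k\<bar> \<le> norm (z - x)" by (rule Basis_le_norm[OF k])
    hence "c / 2 \<le> z \<bullet> k" using 1 x by (simp add: inner_simps)
    moreover have "norm z \<le> norm (z - x) + norm x" using norm_triangle_ineq[of "z - x" x] by simp
    ultimately have "c / 2 \<le> z \<bullet> k" "norm z \<le> 2 * R" using 1 x \<open>x \<bullet> k \<le> norm x\<close> norm_ge_zero[of x] by linarith+
    thus ?thesis by (simp add: K_def)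
  qed
  have jm: "(\<lambda>z. ennreal (h (fst z)) * indicator {0..} (fst z) * ennreal (1 / \<epsilon> j) * (indicator (D j) z * indicator {z. w (snd z) \<le> fst z} z))
      \<in> borel_measurable (lborel \<Otimes>\<^sub>M half_vol k)" for j
  proof -
    have [measurable]: "D j \<in> sets (borel \<Otimes>\<^sub>M borel)" unfolding borel_prod by (rule Dm)
    show ?thesis by measurable
  qed
  interpret pair_sigma_finite lborel "half_vol k" ..
  have fub: "(\<integral>\<^sup>+t. ennreal (h t) * indicator {0..} t * (ennreal (1 / \<epsilon> j) * emeasure (half_vol k) (C j t - A t)) \<partial>lborel)
     = (\<integral>\<^sup>+z. (\<integral>\<^sup>+t. ennreal (h t) * indicator {0..} t * ennreal (1 / \<epsilon> j) * indicator (C j t - A t) z \<partial>lborel) \<partial>half_vol k)" for j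
  proof -
    have i: "indicator (D j) (t, z) * indicator {z. w (snd z) \<le> fst z} (t, z) = (indicator (C j t - A t) z :: ennreal)" for t z
      by (auto simp: C_def A_def indicator_def)
    have "(\<integral>\<^sup>+z. (\<integral>\<^sup>+t. ennreal (h t) * indicator {0..} t * ennreal (1 / \<epsilon> j) * indicator (C j t - A t) z \<partial>lborel) \<partial>half_vol k)
       = (\<integral>\<^sup>+t. (\<integral>\<^sup>+z. ennreal (h t) * indicator {0..} t * ennreal (1 / \<epsilon> j) * indicator (C j t - A t) z \<partial>half_vol k) \<partial>lborel)"
      using Fubini[OF jm[of j]] by (simp only: fst_conv snd_conv i)
    also have "\<dots> = (\<integral>\<^sup>+t. ennreal (h t) * indicator {0..} t * ennreal (1 / \<epsilon> j) * emeasure (half_vol k) (C j t - A t) \<partial>lborel)"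
      by (intro nn_integral_cong nn_integral_cmult_indicator) auto
    finally show ?thesis by (simp add: mult.assoc)
  qed
  have tm: "(\<lambda>t. ennreal (h t) * indicator {0..} t * (ennreal (1 / \<epsilon> j) * emeasure (half_vol k) (C j t - A t))) \<in> borel_measurable lborel" for j
  proof -
    have i: "indicator (D j) (t, z) * indicator {z. w (snd z) \<le> fst z} (t, z) = (indicator (C j t - A t) z :: ennreal)" for t z
      by (auto simp: C_def A_def indicator_def)
    have "(\<lambda>t. \<integral>\<^sup>+z. ennreal (h t) * indicator {0..} t * ennreal (1 / \<epsilon> j) * indicator (C j t - A t) z \<partial>half_vol k) \<in> borel_measurable lborel"
      using S.borel_measurable_nn_integral_fst[OF jm[of j]] by (simp only: fst_conv snd_conv i)
    moreover have "(\<integral>\<^sup>+z. ennreal (h t) * indicator {0..} t * ennreal (1 / \<epsilon> j) * indicator (C j t - A t) z \<partial>half_vol k)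
      = ennreal (h t) * indicator {0..} t * (ennreal (1 / \<epsilon> j) * emeasure (half_vol k) (C j t - A t))" for t
      by (subst nn_integral_cmult_indicator) (auto simp: mult.assoc)
    ultimately show ?thesis by simp
  qed
  have "(\<integral>\<^sup>+t. ennreal (h t) * ennreal (iso_profile DIM('a) p (\<nu> t)) * indicator {0..} t \<partial>lborel)
     \<le> (\<integral>\<^sup>+t. liminf (\<lambda>j. ennreal (h t) * indicator {0..} t * (ennreal (1 / \<epsilon> j) * emeasure (half_vol k) (C j t - A t))) \<partial>lborel)"
  proof (rule nn_integral_mono)
    fix t :: real
    show "ennreal (h t) * ennreal (iso_profile DIM('a) p (\<nu> t)) * indicator {0..} t
       \<le> liminf (\<lambda>j. ennreal (h t) * indicator {0..} t * (ennreal (1 / \<epsilon> j) * emeasure (half_vol k) (C j t - A t)))"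
    proof (cases "0 \<le> t")
      case True
      have "ennreal (iso_profile DIM('a) p (\<nu> t)) \<le> liminf (\<lambda>j. ennreal (1 / \<epsilon> j) * emeasure (half_vol k) (C j t - A t))"
      proof (rule half_space_neighbourhood_volume[OF k n2 Am _ _ c \<nu>[OF True] _ p])
        show "bounded (A t)" using A0(2)[OF _ True] by (auto simp: bounded_iff)
        show "\<epsilon> j < 1" for j using \<epsilon>(2)[of j] by simp
        show "x + (\<epsilon> j * (x \<bullet> k)) *\<^sub>R v \<in> C j t" if "x \<in> A t" "norm v \<le> 1" for x v j using AC that by (simp add: A_def)
      qed (use A0 True \<epsilon> \<epsilon>0 in \<open>auto simp: \<nu>_def\<close>)
      hence "ennreal (h t) * ennreal (iso_profile DIM('a) p (\<nu> t)) \<le> ennreal (h t) * liminf (\<lambda>j. ennreal (1 / \<epsilon> j) * emeasure (half_vol k) (C j t - A t))"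
        by (rule mult_left_mono) simp
      also have "\<dots> = liminf (\<lambda>j. ennreal (h t) * (ennreal (1 / \<epsilon> j) * emeasure (half_vol k) (C j t - A t)))"
        by (rule Liminf_compose_continuous_mono[symmetric, where f = "\<lambda>x. ennreal (h t) * x"])
           (auto intro!: monoI mult_left_mono ennreal_continuous_on_cmult continuous_on_id)
      finally show ?thesis using True by simp
    qed simp
  qed
  also have "\<dots> \<le> liminf (\<lambda>j. \<integral>\<^sup>+t. ennreal (h t) * indicator {0..} t * (ennreal (1 / \<epsilon> j) * emeasure (half_vol k) (C j t - A t)) \<partial>lborel)"
    by (rule nn_integral_liminf) (rule tm)
  also have "\<dots> \<le> (\<integral>\<^sup>+x. ennreal (h (w x) * g x) \<partial>half_vol k)"
  proof (rule ennreal_le_epsilon)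
    fix e :: real assume e: "0 < e"
    define VK where "VK = enn2real (emeasure (half_vol k) K)"
    have VK: "emeasure (half_vol k) K = ennreal VK" "0 \<le> VK" using Kfin by (auto simp: VK_def)
    have H: "0 \<le> H" using h0 hH order_trans by blast
    have G: "0 \<le> G" using g0 gG order_trans by blast
    have L: "0 \<le> L" using hL[of 0 1] by (auto intro: order_trans[OF abs_ge_zero])
    \<comment> \<open>Chosen so that the error caused by \<open>\<eta>\<close> on all of
      \<open>K\<close> is at most \<open>e / 2\<close>; the added 1 guards against
      \<open>H * VK = 0\<close>.\<close>
    define \<eta> where "\<eta> = e / (2 * (H * VK + 1))"
    have \<eta>: "0 < \<eta>" using e H VK by (auto simp: \<eta>_def intro!: divide_pos_pos add_nonneg_pos)
    have \<eta>e: "\<eta> * H * VK \<le> e / 2"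
    proof -
      have "0 < H * VK + 1" using H VK(2) by (simp add: add_nonneg_pos)
      moreover have "e / (2 * a) * a = e / 2" if "0 < a" for a :: real using that by simp
      ultimately have "\<eta> * (H * VK + 1) = e / 2" unfolding \<eta>_def by blast
      thus ?thesis using \<eta> by (simp add: algebra_simps)
    qed
    obtain \<epsilon>0 where e0: "0 < \<epsilon>0" "\<And>\<epsilon> x z. 0 < \<epsilon> \<Longrightarrow> \<epsilon> < \<epsilon>0 \<Longrightarrow> 0 < x \<bullet> k \<Longrightarrow> norm (z - x) \<le> \<epsilon> * (x \<bullet> k) \<Longrightarrow> w x - w z \<le> \<epsilon> * (g z + \<eta>)"
      using grad[OF \<eta>] by blast
    have lim: "(\<lambda>j. (G + \<eta>) * (L * (\<epsilon> j * (G + \<eta>))) * VK) \<longlonglongrightarrow> (G + \<eta>) * (L * (0 * (G + \<eta>))) * VK"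
      by (intro tendsto_intros \<epsilon>0)
    have "\<forall>\<^sub>F j in sequentially. (G + \<eta>) * (L * (\<epsilon> j * (G + \<eta>))) * VK < e / 2"
      using order_tendstoD(2)[OF lim, of "e / 2"] e by simp
    moreover have "\<forall>\<^sub>F j in sequentially. \<epsilon> j < \<epsilon>0" by (rule order_tendstoD(2)[OF \<epsilon>0 e0(1)])
    ultimately have "\<forall>\<^sub>F j in sequentially. (\<integral>\<^sup>+t. ennreal (h t) * indicator {0..} t * (ennreal (1 / \<epsilon> j) * emeasure (half_vol k) (C j t - A t)) \<partial>lborel)
        \<le> (\<integral>\<^sup>+x. ennreal (h (w x) * g x) \<partial>half_vol k) + ennreal e"
    proof eventually_elim
      case (elim j)
      \<comment> \<open>Error density: the first part stems from \<open>\<eta>\<close>, the second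
        from the variation of \<open>h\<close> over the interval of levels.\<close>
      define \<delta> where "\<delta> = \<eta> * H + (G + \<eta>) * (L * (\<epsilon> j * (G + \<eta>)))"
      have \<delta>: "0 \<le> \<delta>" using \<eta> H G L \<epsilon>(1)[of j] by (simp add: \<delta>_def)
      have pt: "(\<integral>\<^sup>+t. ennreal (h t) * indicator {0..} t * ennreal (1 / \<epsilon> j) * indicator (C j t - A t) z \<partial>lborel)
          \<le> ennreal (h (w z) * g z) + ennreal \<delta> * indicator K z" for z
      proof -
        define l where "l = \<epsilon> j * (g z + \<eta>)"
        have l: "0 \<le> l" "l \<le> \<epsilon> j * (G + \<eta>)" using \<epsilon>(1)[of j] g0[of z] gG[of z] \<eta> by (auto simp: l_def intro!: mult_left_mono)
        have "(\<integral>\<^sup>+t. ennreal (h t) * indicator {0..} t * ennreal (1 / \<epsilon> j) * indicator (C j t - A t) z \<partial>lborel)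
          \<le> (\<integral>\<^sup>+t. (ennreal ((h (w z) + L * l) / \<epsilon> j) * indicator K z) * indicator {w z..w z + l} t \<partial>lborel)"
        proof (rule nn_integral_mono)
          fix t
          show "ennreal (h t) * indicator {0..} t * ennreal (1 / \<epsilon> j) * indicator (C j t - A t) z
             \<le> (ennreal ((h (w z) + L * l) / \<epsilon> j) * indicator K z) * indicator {w z..w z + l} t"
          proof (cases "0 \<le> t \<and> z \<in> C j t \<and> z \<notin> A t")
            case True
            then obtain x where x: "norm (z - x) \<le> \<epsilon> j * (x \<bullet> k)" "t < w x" "c \<le> x \<bullet> k" using CD[of z j t] by blast
            have "w x - w z \<le> l" unfolding l_def by (rule e0(2)[OF \<epsilon>(1) elim(2) _ x(1)]) (use x c in auto)
            hence t: "t \<in> {w z..w z + l}" using x True by (auto simp: A_def)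
            have "z \<in> K" using CK True by blast
            moreover have "h t \<le> h (w z) + L * l"
            proof -
              have "h t - h (w z) \<le> L * \<bar>t - w z\<bar>" using hL[of t "w z"] by linarith
              also have "\<dots> \<le> L * l" using t L by (intro mult_left_mono) auto
              finally show ?thesis by simp
            qed
            hence "h t * (1 / \<epsilon> j) \<le> (h (w z) + L * l) / \<epsilon> j" using \<epsilon>(1)[of j] by (simp add: divide_right_mono)
            hence "ennreal (h t) * ennreal (1 / \<epsilon> j) \<le> ennreal ((h (w z) + L * l) / \<epsilon> j)"
              using \<epsilon>(1)[of j] h0[of t] by (subst ennreal_mult[symmetric]) (auto intro!: ennreal_leI)
            ultimately show ?thesis using True t by simp
          qed (auto simp: indicator_def)
        qed
        also have "\<dots> = (ennreal ((h (w z) + L * l) / \<epsilon> j) * indicator K z) * ennreal l"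
          using l by (subst nn_integral_cmult_indicator) auto
        also have "\<dots> = ennreal ((h (w z) + L * l) * (g z + \<eta>)) * indicator K z"
        proof -
          have "ennreal ((h (w z) + L * l) / \<epsilon> j) * ennreal l = ennreal ((h (w z) + L * l) / \<epsilon> j * l)"
            using l h0[of "w z"] L \<epsilon>(1)[of j] by (subst ennreal_mult) auto
          also have "(h (w z) + L * l) / \<epsilon> j * l = (h (w z) + L * l) * (g z + \<eta>)" using \<epsilon>(1)[of j] by (simp add: l_def)
          finally show ?thesis by (cases "z \<in> K") simp_all
        qed
        also have "\<dots> \<le> ennreal (h (w z) * g z + \<delta>) * indicator K z"
        proof (intro mult_right_mono ennreal_leI)
          have "(h (w z) + L * l) * (g z + \<eta>) = h (w z) * g z + (\<eta> * h (w z) + (g z + \<eta>) * (L * l))" by (simp add: algebra_simps)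
          also have "\<dots> \<le> h (w z) * g z + \<delta>"
            unfolding \<delta>_def using hH gG \<eta> l L g0[of z] G by (intro add_left_mono add_mono mult_mono mult_left_mono) auto
          finally show "(h (w z) + L * l) * (g z + \<eta>) \<le> h (w z) * g z + \<delta>" .
        qed simp
        also have "\<dots> \<le> ennreal (h (w z) * g z) + ennreal \<delta> * indicator K z"
          using h0[of "w z"] g0[of z] \<delta> by (auto simp: indicator_def ennreal_plus)
        finally show ?thesis .
      qed
      have "(\<integral>\<^sup>+t. ennreal (h t) * indicator {0..} t * (ennreal (1 / \<epsilon> j) * emeasure (half_vol k) (C j t - A t)) \<partial>lborel)
         \<le> (\<integral>\<^sup>+z. ennreal (h (w z) * g z) + ennreal \<delta> * indicator K z \<partial>half_vol k)"
        unfolding fub by (intro nn_integral_mono pt)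
      also have "\<dots> = (\<integral>\<^sup>+z. ennreal (h (w z) * g z) \<partial>half_vol k) + ennreal \<delta> * ennreal VK"
        unfolding VK(1)[symmetric] by (subst nn_integral_add) (auto simp: nn_integral_cmult_indicator)
      also have "ennreal \<delta> * ennreal VK = ennreal (\<delta> * VK)" using \<delta> VK by (simp add: ennreal_mult)
      also have "(\<integral>\<^sup>+z. ennreal (h (w z) * g z) \<partial>half_vol k) + ennreal (\<delta> * VK) \<le> (\<integral>\<^sup>+z. ennreal (h (w z) * g z) \<partial>half_vol k) + ennreal e"
        using \<eta>e elim(1) by (intro add_left_mono ennreal_leI) (simp add: \<delta>_def distrib_right)
      finally show ?case .
    qed
    thus "liminf (\<lambda>j. \<integral>\<^sup>+t. ennreal (h t) * indicator {0..} t * (ennreal (1 / \<epsilon> j) * emeasure (half_vol k) (C j t - A t)) \<partial>lborel)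
        \<le> (\<integral>\<^sup>+x. ennreal (h (w x) * g x) \<partial>half_vol k) + ennreal e"
      by (intro order_trans[OF Liminf_le_Limsup Limsup_bounded]) auto
  qed
  finally show ?thesis .
qed

section \<open>Bliss' inequality in dual form\<close>

text \<open>The weight \<open>a\<close> comes from transporting the mass \<open>f powr (n p / (n - p))\<close>,
  arranged decreasingly, onto the Aubin--Talenti bubble \<open>(1 + r powr (p / (p - 1))) powr (-n)\<close>; in the variable
  \<open>\<theta> = r powr p' / (1 + r powr p')\<close> the bubble becomes a Beta density.\<close>

lemma bliss_dual:
  fixes M :: "'a measure" and f :: "'a \<Rightarrow> real" and n :: nat and p :: real
  assumes "sigma_finite_measure M" and f[measurable]: "f \<in> borel_measurable M" and f0: "\<And>x. 0 \<le> f x" and fU: "\<And>x. f x \<le> U"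
    and n: "2 \<le> n" and p: "1 < p" "p < n" "1 < n - n / p"
    and fin: "emeasure M {x\<in>space M. 0 < f x} < \<infinity>"
  defines "\<nu> \<equiv> \<lambda>t. enn2real (emeasure M {x\<in>space M. t < f x})"
  defines "ps \<equiv> n * p / (n - p)"
  assumes \<nu>less: "\<And>t. 0 < t \<Longrightarrow> \<nu> t < \<nu> 0"
    and N: "(\<integral>\<^sup>+x. ennreal (f x powr ps) \<partial>M) = ennreal N" "0 < N"
  obtains a :: "real \<Rightarrow> real" where "a \<in> borel_measurable borel" "\<And>t. 0 \<le> a t" "a 0 = 0"
    "(\<integral>\<^sup>+x. ennreal (a (f x) powr p) \<partial>M) < \<infinity>"
    "ennreal ((n * unit_ball_vol n powr (1 / n) * ((n - n / p) * Beta (n - n / p) (n / p)) powr (1 / n)) powr p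
        * (n * (p - 1) / (n - p)) powr (1 - p) * N powr ((n - p) / n))
       + ennreal (p - 1) * (\<integral>\<^sup>+x. ennreal (a (f x) powr p) \<partial>M)
      \<le> ennreal p * (\<integral>\<^sup>+t. ennreal (a t powr (p - 1) * (n * unit_ball_vol n powr (1 / n) * \<nu> t powr ((real n - 1) / n))) * indicator {0<..} t \<partial>lborel)"
proof -
  interpret M: sigma_finite_measure M by fact
  \<comment> \<open>\<open>A = n / p'\<close> for the conjugate exponent \<open>p'\<close>, and
    \<open>B = n / p\<close>: the parameters of the Beta density of the bubble.\<close>
  define A where "A = n - n / p"
  define B where "B = n / p"
  \<comment> \<open>Determined by \<open>q + ps / n = ps\<close>: the \<open>n\<close>-th root of
    the mass density contributes the exponent \<open>ps / n\<close>, and the weight on the levels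
    has to supply the rest.\<close>
  define q where "q = p * (real n - 1) / (n - p)"
  define \<sigma> where "\<sigma> = unit_ball_vol (real n)"
  have \<sigma>: "0 < \<sigma>" by (simp add: \<sigma>_def)
  have n0: "0 < real n" using n by simp
  have A: "1 < A" using p by (simp add: A_def)
  have B: "1 < B" using p by (simp add: B_def)
  have AB: "A + B = n" by (simp add: A_def B_def)
  have q: "0 < q" using p n by (auto simp: q_def intro!: divide_pos_pos mult_pos_pos)
  have ps: "0 < ps" using p n0 by (simp add: ps_def)
  have qps: "q + ps / n = ps"
  proof -
    have "q + ps / n = (p * (real n - 1) + p) / (n - p)" using n0 by (simp add: q_def ps_def add_divide_distrib)
    thus ?thesis by (simp add: ps_def algebra_simps)
  qed
  define Bt where "Bt = Beta A B"
  have Bt: "0 < Bt" using A B by (simp add: Bt_def Beta_def)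

  have \<nu>e: "emeasure M {x\<in>space M. t < f x} = ennreal (\<nu> t)" if "0 \<le> t" for t
  proof -
    have "emeasure M {x\<in>space M. t < f x} \<le> emeasure M {x\<in>space M. 0 < f x}" using that by (intro emeasure_mono) auto
    hence "emeasure M {x\<in>space M. t < f x} < top" using fin by (auto simp: le_less_trans)
    thus ?thesis by (simp add: \<nu>_def)
  qed
  have \<nu>0: "0 \<le> \<nu> t" for t by (simp add: \<nu>_def)
  have \<nu>mono: "\<nu> t \<le> \<nu> s" if "0 \<le> s" "s \<le> t" for s t
  proof -
    have "ennreal (\<nu> t) \<le> ennreal (\<nu> s)" using that by (subst (1 2) \<nu>e[symmetric]) (auto intro!: emeasure_mono)
    thus ?thesis using \<nu>0 by simp
  qed
  have \<nu>U: "\<nu> t = 0" if "U \<le> t" for t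
  proof -
    have e: "{x\<in>space M. t < f x} = {}" using fU that by (auto simp: not_less intro: order_trans)
    show ?thesis unfolding \<nu>_def e by simp
  qed
  have U: "0 \<le> U" using f0 fU order_trans by blast
  \<comment> \<open>Right continuity of \<open>\<nu>\<close>. It makes \<open>t < w s\<close> and
    \<open>s < \<nu> t\<close> equivalent, with strict signs on both sides.\<close>
  have \<nu>rc: "\<exists>t'>t. s < \<nu> t'" if "0 \<le> t" "s < \<nu> t" "0 \<le> s" for s t
  proof (rule ccontr)
    assume neg: "\<not> ?thesis"
    let ?S = "\<lambda>i::nat. {x\<in>space M. t + 1 / (real i + 1) < f x}"
    have "(\<Union>i. ?S i) = {x\<in>space M. t < f x}"
    proof (intro equalityI subsetI)
      fix x assume x: "x \<in> {x\<in>space M. t < f x}"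
      then obtain i where "1 / real (Suc i) < f x - t" using nat_approx_posE[of "f x - t"] by auto
      thus "x \<in> (\<Union>i. ?S i)" using x by (auto simp: algebra_simps intro!: exI[of _ i])
    next
      fix x assume "x \<in> (\<Union>i. ?S i)"
      then obtain i :: nat where "x \<in> space M" "t + 1 / (real i + 1) < f x" by auto
      moreover have "0 < 1 / (real i + 1)" by simp
      ultimately have "t < f x" by linarith
      thus "x \<in> {x\<in>space M. t < f x}" using \<open>x \<in> space M\<close> by simp
    qed
    moreover have "incseq ?S"
    proof (rule incseq_SucI, safe)
      fix i x assume "t + 1 / (real i + 1) < f x"
      moreover have "1 / (real (Suc i) + 1) \<le> 1 / (real i + 1)" by (simp add: field_simps)
      ultimately show "t + 1 / (real (Suc i) + 1) < f x" by simp
    qed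
    moreover have "range ?S \<subseteq> sets M" by auto
    ultimately have "(\<lambda>i. emeasure M (?S i)) \<longlonglongrightarrow> emeasure M {x\<in>space M. t < f x}"
      using Lim_emeasure_incseq[of ?S M] by simp
    moreover have "emeasure M (?S i) \<le> ennreal s" for i
    proof -
      have "t < t + 1 / (real i + 1)" by simp
      hence "\<nu> (t + 1 / (real i + 1)) \<le> s" using neg by (meson not_less)
      thus ?thesis using that by (subst \<nu>e) (auto intro!: ennreal_leI)
    qed
    ultimately have "emeasure M {x\<in>space M. t < f x} \<le> ennreal s" by (intro LIMSEQ_le_const2) auto
    thus False using that \<nu>e[OF that(1)] by simp
  qed

  \<comment> \<open>The generalized inverse of the distribution function; adjoining 0 keeps the set
    nonempty when \<open>s \<ge> \<nu> 0\<close>.\<close>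
  define w where "w s = Sup ({0} \<union> {t. 0 \<le> t \<and> s < \<nu> t})" for s
  have bdd: "bdd_above ({0} \<union> {t. 0 \<le> t \<and> s < \<nu> t})" if "0 \<le> s" for s
  proof (rule bdd_aboveI[of _ U])
    fix x assume "x \<in> {0} \<union> {t. 0 \<le> t \<and> s < \<nu> t}"
    thus "x \<le> U" using U \<nu>U[of x] that by (cases "U \<le> x") auto
  qed
  have w0: "0 \<le> w s" if "0 \<le> s" for s unfolding w_def by (rule cSup_upper[OF _ bdd[OF that]]) simp
  have w_iff: "t < w s \<longleftrightarrow> s < \<nu> t" if s: "0 \<le> s" and t: "0 \<le> t" for s t
  proof
    assume "t < w s"
    then obtain t' where t': "t' \<in> {0} \<union> {t. 0 \<le> t \<and> s < \<nu> t}" "t < t'"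
      unfolding w_def using less_cSup_iff[OF _ bdd[OF s]] by auto
    thus "s < \<nu> t" using \<nu>mono[OF t, of t'] t by auto
  next
    assume "s < \<nu> t"
    then obtain t' where "t < t'" "s < \<nu> t'" using \<nu>rc[OF t _ s] by blast
    moreover have "t' \<le> w s" unfolding w_def by (rule cSup_upper[OF _ bdd[OF s]]) (use calculation t in auto)
    ultimately show "t < w s" by simp
  qed
  define s0 where "s0 = \<nu> 0"
  have s0: "0 < s0" using \<nu>less[of 1] \<nu>0[of 1] by (simp add: s0_def)
  have wpos: "0 < w s \<longleftrightarrow> s < s0" if "0 \<le> s" for s using w_iff[OF that, of 0] by (simp add: s0_def)
  have wU: "w s \<le> U" if "0 \<le> s" for s
    using w_iff[OF that U] \<nu>U[of U] that by (simp add: not_less[symmetric])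
  have wanti: "w y \<le> w x" if "0 \<le> x" "x \<le> y" for x y
  proof (rule ccontr)
    assume "\<not> ?thesis"
    hence "x < \<nu> (w x)" using w_iff[of y "w x"] w0 that by force
    thus False using w_iff[of x "w x"] w0 that by auto
  qed
  define wb where "wb s = (if 0 \<le> s \<and> s < s0 then w s else 0)" for s
  have wb_eq: "wb s = w s" if "0 \<le> s" for s using wpos[OF that] w0[OF that] that by (auto simp: wb_def)
  have wb0: "0 \<le> wb s" for s using w0 by (auto simp: wb_def)
  have wb_set: "{s. x < wb s} = {0..<\<nu> x}" if "0 \<le> x" for x
  proof -
    have wbx: "x < wb s \<longleftrightarrow> 0 \<le> s \<and> s < \<nu> x" for s
    proof (cases "0 \<le> s")
      case True thus ?thesis using w_iff[OF True that] wb_eq by simp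
    qed (use that in \<open>simp add: wb_def\<close>)
    show ?thesis by (rule set_eqI) (simp only: mem_Collect_eq atLeastLessThan_iff wbx)
  qed
  have wbm[measurable]: "wb \<in> borel_measurable borel"
  proof (rule borel_measurable_iff_greater[THEN iffD2], intro allI)
    fix x
    have "{s. x < wb s} = (if 0 \<le> x then {0..<\<nu> x} else UNIV)"
    proof (cases "0 \<le> x")
      case False
      hence "x < wb s" for s using wb0[of s] by linarith
      thus ?thesis using False by auto
    qed (use wb_set in auto)
    thus "{s \<in> space borel. x < wb s} \<in> sets borel" by (auto split: if_splits)
  qed
  text \<open>\<open>wb\<close> is the decreasing rearrangement of \<open>f\<close>.\<close>
  have equi: "(\<integral>\<^sup>+x. k (f x) * indicator {0<..} (f x) \<partial>M) = (\<integral>\<^sup>+s. k (wb s) * indicator {0<..} (wb s) \<partial>lborel)"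
    if [measurable]: "k \<in> borel_measurable borel" for k :: "real \<Rightarrow> ennreal"
  proof -
    \<comment> \<open>Image measures restricted to positive values, since the set where
      \<open>f\<close> vanishes may have infinite measure. They agree on half-lines.\<close>
    let ?N1 = "distr (density M (\<lambda>x. indicator {0<..} (f x))) borel f"
    let ?N2 = "distr (density lborel (\<lambda>s. indicator {0<..} (wb s))) borel wb"
    have 1: "emeasure ?N1 {x<..} = ennreal (\<nu> (max x 0))" for x
    proof -
      have "emeasure ?N1 {x<..} = emeasure (density M (\<lambda>x. indicator {0<..} (f x))) (f -` {x<..} \<inter> space (density M (\<lambda>x. indicator {0<..} (f x))))"
        by (rule emeasure_distr) auto
      also have "\<dots> = (\<integral>\<^sup>+y. indicator {0<..} (f y) * indicator (f -` {x<..} \<inter> space M) y \<partial>M)"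
        by (subst emeasure_density) auto
      also have "\<dots> = (\<integral>\<^sup>+y. indicator {y\<in>space M. max x 0 < f y} y \<partial>M)"
        by (intro nn_integral_cong) (auto simp: indicator_def)
      also have "\<dots> = emeasure M {y\<in>space M. max x 0 < f y}" by simp
      finally show ?thesis using \<nu>e[of "max x 0"] by simp
    qed
    have 2: "emeasure ?N2 {x<..} = ennreal (\<nu> (max x 0))" for x
    proof -
      have "emeasure ?N2 {x<..} = emeasure (density lborel (\<lambda>s. indicator {0<..} (wb s))) (wb -` {x<..} \<inter> space (density lborel (\<lambda>s. indicator {0<..} (wb s))))"
        by (rule emeasure_distr) auto
      also have "\<dots> = (\<integral>\<^sup>+y. indicator {0<..} (wb y) * indicator (wb -` {x<..}) y \<partial>lborel)"
        using measurable_sets_borel[OF wbm, of "{x<..}"] by (subst emeasure_density) auto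
      also have "\<dots> = (\<integral>\<^sup>+y. indicator {y. max x 0 < wb y} y \<partial>lborel)"
        by (intro nn_integral_cong) (auto simp: indicator_def)
      also have "\<dots> = emeasure lborel {0..<\<nu> (max x 0)}" by (subst wb_set) auto
      finally show ?thesis using \<nu>0[of "max x 0"] by simp
    qed
    have "?N1 = ?N2" by (rule measure_eqI_lessThan) (auto simp: 1 2)
    hence "integral\<^sup>N ?N1 k = integral\<^sup>N ?N2 k" by simp
    thus ?thesis by (simp add: nn_integral_distr nn_integral_density mult.commute)
  qed
  have wN: "(\<integral>\<^sup>+s. ennreal (wb s powr ps) \<partial>lborel) = ennreal N"
  proof -
    have "ennreal N = (\<integral>\<^sup>+x. ennreal (f x powr ps) * indicator {0<..} (f x) \<partial>M)"
      unfolding N(1)[symmetric] using f0 by (intro nn_integral_cong) (auto simp: indicator_def not_less order.antisym)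
    also have "\<dots> = (\<integral>\<^sup>+s. ennreal (wb s powr ps) * indicator {0<..} (wb s) \<partial>lborel)" by (rule equi) measurable
    also have "\<dots> = (\<integral>\<^sup>+s. ennreal (wb s powr ps) \<partial>lborel)"
      using wb0 by (intro nn_integral_cong) (auto simp: indicator_def not_less order.antisym)
    finally show ?thesis ..
  qed

  \<comment> \<open>Normalizes the mass of \<open>wb powr ps\<close> to that of the Beta
    density.\<close>
  define \<kappa> where "\<kappa> = Bt / N"
  have \<kappa>: "0 < \<kappa>" using Bt N by (simp add: \<kappa>_def)
  define d where "d s = \<kappa> * wb s powr ps" for s
  have dm[measurable]: "d \<in> borel_measurable borel" unfolding d_def by measurable
  have d0: "0 \<le> d s" for s using \<kappa> by (simp add: d_def)
  have dpos: "0 < d s" if "0 \<le> s" "s < s0" for s using \<kappa> that wpos[of s] wb_eq[of s] by (simp add: d_def)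
  have dU: "d s \<le> \<kappa> * U powr ps" for s
    unfolding d_def using \<kappa> wU wb0 U ps by (intro mult_left_mono powr_mono2) (auto simp: wb_def)
  have dtot: "(\<integral>\<^sup>+s. ennreal (d s) \<partial>lborel) = ennreal Bt"
  proof -
    have "(\<integral>\<^sup>+s. ennreal (d s) \<partial>lborel) = ennreal \<kappa> * (\<integral>\<^sup>+s. ennreal (wb s powr ps) \<partial>lborel)"
      using \<kappa> by (subst nn_integral_cmult[symmetric]) (auto simp: d_def ennreal_mult)
    also have "\<dots> = ennreal Bt" unfolding wN using \<kappa> N by (subst ennreal_mult[symmetric]) (auto simp: \<kappa>_def)
    finally show ?thesis .
  qed
  have Bt0: "0 \<le> Bt" using Bt by simp
  obtain F where Fm[measurable]: "F \<in> borel_measurable borel" and Fmono: "\<And>x y. x \<le> y \<Longrightarrow> F x \<le> F y"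
    and Fcont: "continuous_on {0..s0} F" and F0: "F 0 = 0" and Fs0: "F s0 = Bt"
    and Fprim: "\<And>x y. 0 \<le> x \<Longrightarrow> x \<le> y \<Longrightarrow> (\<integral>\<^sup>+t. ennreal (d t) * indicator {x..y} t \<partial>lborel) = ennreal (F y - F x)"
    by (rule density_primitive[OF dm d0 dU dtot Bt0, of 0]) (use ps in \<open>auto simp: d_def wb_def split: if_splits\<close>)
  \<comment> \<open>Strictness keeps \<open>F\<close> off its end values inside
    \<open>{0..s0}\<close>, hence \<open>\<Theta> (F s)\<close> strictly between 0 and 1.\<close>
  have Fless: "F x < F y" if "0 \<le> x" "x < y" "y \<le> s0" for x y
  proof (rule ccontr)
    assume "\<not> ?thesis"
    hence "F x = F y" using Fmono[of x y] that by simp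
    hence "(\<integral>\<^sup>+t. ennreal (d t) * indicator {x..y} t \<partial>lborel) = 0" using Fprim[of x y] that by simp
    hence "AE t in lborel. ennreal (d t) * indicator {x..y} t = 0" by (subst (asm) nn_integral_0_iff_AE) auto
    hence "AE t in lborel. t \<notin> {x..<y}"
    proof eventually_elim
      case (elim t)
      show ?case using elim dpos[of t] that by (auto simp: indicator_def split: if_splits)
    qed
    hence "emeasure lborel {x..<y} = 0" by (subst (asm) AE_iff_measurable[of "{x..<y}"]) auto
    thus False using that by simp
  qed
  have Fr: "0 \<le> F y" "F y \<le> Bt" if "0 \<le> y" "y \<le> s0" for y using Fmono[of 0 y] Fmono[of y s0] F0 Fs0 that by auto
  have Fi: "0 < F y" "F y < Bt" if "0 < y" "y < s0" for y using Fless[of 0 y] Fless[of y s0] F0 Fs0 that by auto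

  define b where "b z = z powr (A - 1) * (1 - z) powr (B - 1)" for z
  have bm[measurable]: "b \<in> borel_measurable borel" unfolding b_def by measurable
  obtain \<Theta> where \<Theta>c: "continuous_on UNIV \<Theta>" and \<Theta>r: "\<And>v. \<Theta> v \<in> {0..1}"
    and \<Theta>i: "\<And>v. 0 < v \<Longrightarrow> v < Bt \<Longrightarrow> 0 < \<Theta> v \<and> \<Theta> v < 1"
    and \<Theta>D: "\<And>v. 0 < v \<Longrightarrow> v < Bt \<Longrightarrow> (\<Theta> has_real_derivative inverse (b (\<Theta> v))) (at v)"
    and \<Theta>mono: "\<And>u v. 0 \<le> u \<Longrightarrow> u \<le> v \<Longrightarrow> v \<le> Bt \<Longrightarrow> \<Theta> u \<le> \<Theta> v" and \<Theta>0: "\<Theta> 0 = 0"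
    and \<Theta>sub: "\<And>k. k \<in> borel_measurable borel \<Longrightarrow> (\<integral>\<^sup>+v. k (\<Theta> v) * indicator {0..Bt} v \<partial>lborel) = (\<integral>\<^sup>+z. k z * ennreal (b z) * indicator {0..1} z \<partial>lborel)"
  proof (rule primitive_inverse[of 0 1 b Bt])
    show "continuous_on {0..1} b" unfolding b_def
      by (intro continuous_on_mult continuous_on_powr') (use A B in \<open>auto intro!: continuous_intros\<close>)
    show "(b has_integral Bt) {0..1}" unfolding b_def Bt_def using has_integral_Beta_real[of A B] A B by simp
  qed (auto simp: b_def)
  have [measurable]: "\<Theta> \<in> borel_measurable borel" by (rule borel_measurable_continuous_onI[OF \<Theta>c])
  have transp: "(\<integral>\<^sup>+s. k (\<Theta> (F s)) * ennreal (d s) * indicator {0..s0} s \<partial>lborel) = (\<integral>\<^sup>+z. k z * ennreal (b z) * indicator {0..1} z \<partial>lborel)"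
    if [measurable]: "k \<in> borel_measurable borel" for k
  proof -
    have "(\<integral>\<^sup>+s. k (\<Theta> (F s)) * ennreal (d s) * indicator {0..s0} s \<partial>lborel) = (\<integral>\<^sup>+v. k (\<Theta> v) * indicator {F 0..F s0} v \<partial>lborel)"
      by (rule nn_integral_subst_primitive[where f = "\<lambda>v. k (\<Theta> v)"]) (use s0 Fcont Fmono Fprim in auto)
    thus ?thesis unfolding F0 Fs0 using \<Theta>sub[OF that] by simp
  qed
  define pp where "pp = p / (p - 1)"
  have pp: "0 < pp" "n / pp = A" using p n0 by (auto simp: pp_def A_def field_simps)
  \<comment> \<open>\<open>\<tau> s powr (1 / pp)\<close> is the radius on the side of the bubble
    that corresponds to the volume \<open>s\<close> on the side of \<open>f\<close>.\<close>
  define \<tau> where "\<tau> s = \<Theta> (F s) / (1 - \<Theta> (F s))" for s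
  have \<tau>m[measurable]: "\<tau> \<in> borel_measurable borel" unfolding \<tau>_def by measurable
  have th: "0 < \<Theta> (F s)" "\<Theta> (F s) < 1" if "0 < s" "s < s0" for s using \<Theta>i[OF Fi[OF that]] by auto
  have th0: "0 \<le> \<Theta> (F s)" "\<Theta> (F s) < 1" if "0 \<le> s" "s < s0" for s
    using th[of s] that F0 \<Theta>0 by (cases "s = 0"; simp)+
  have \<tau>0: "0 \<le> \<tau> s" if "0 \<le> s" "s < s0" for s using th0[OF that] by (simp add: \<tau>_def)
  have \<tau>00: "\<tau> 0 = 0" by (simp add: \<tau>_def F0 \<Theta>0)
  have \<tau>mono: "\<tau> x \<le> \<tau> y" if "0 \<le> x" "x \<le> y" "y < s0" for x y
  proof -
    have "\<Theta> (F x) \<le> \<Theta> (F y)" using that Fr Fmono by (intro \<Theta>mono) auto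
    thus ?thesis unfolding \<tau>_def using th0[of x] th0[of y] that by (intro frac_le) auto
  qed
  \<comment> \<open>Up to a constant, \<open>H\<close> is the flux of the radial transport map
    through the sphere enclosing volume \<open>s\<close>, its derivative is the divergence of that
    map, and \<open>hh\<close> is the \<open>n\<close>-th root of the Jacobian. The bound
    \<open>hh \<le> H'\<close> is therefore the inequality between trace and determinant; below it
    appears as the weighted mean of the two terms of the logarithmic derivative \<open>l\<close>,
    with weights \<open>1 - 1 / n\<close> and \<open>1 / n\<close>.\<close>
  define H where "H s = s powr (1 - 1 / n) * \<tau> s powr (1 / pp)" for s
  define hh where "hh s = (A * d s) powr (1 / n) / (1 - \<Theta> (F s))" for s
  have hhm[measurable]: "hh \<in> borel_measurable borel" unfolding hh_def by measurable
  \<comment> \<open>Proved first on \<open>{x..y}\<close> with \<open>x > 0\<close>, where the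
    logarithm of \<open>H\<close> is finite, and extended to \<open>{0<..y}\<close> by monotone
    convergence.\<close>
  have Hlow: "(\<integral>\<^sup>+s. ennreal (hh s) * indicator {0<..y} s \<partial>lborel) \<le> ennreal (H y)" if y: "0 < y" "y < s0" for y
  proof -
    \<comment> \<open>The logarithm of the bubble radius as a function of the transported
      mass.\<close>
    define Q where "Q v = (1 / pp) * ln (\<Theta> v / (1 - \<Theta> v))" for v
    define Q' where "Q' v = (1 / pp) * inverse (b (\<Theta> v)) / (\<Theta> v * (1 - \<Theta> v))" for v
    have [measurable]: "Q' \<in> borel_measurable borel" unfolding Q'_def by measurable
    have QD: "(Q has_real_derivative Q' v) (at v)" if "0 < v" "v < Bt" for v
    proof -
      have t: "0 < \<Theta> v" "0 < 1 - \<Theta> v" using \<Theta>i[OF that] by auto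
      have "(Q has_real_derivative (1 / pp) * ((inverse (b (\<Theta> v)) * (1 - \<Theta> v) - \<Theta> v * (- inverse (b (\<Theta> v)))) / ((1 - \<Theta> v) * (1 - \<Theta> v)) / (\<Theta> v / (1 - \<Theta> v)))) (at v)"
        unfolding Q_def using t pp(1) by (auto intro!: derivative_eq_intros \<Theta>D[OF that])
      moreover have "(1 / pp) * ((i * (1 - T) - T * (- i)) / ((1 - T) * (1 - T)) / (T / (1 - T))) = (1 / pp) * i / (T * (1 - T))"
        if "0 < T" "0 < 1 - T" for T i :: real
      proof -
        have "i * (1 - T) - T * (- i) = i" by (simp add: algebra_simps)
        thus ?thesis using that by (simp add: divide_simps)
      qed
      ultimately show ?thesis unfolding Q'_def using t by simp
    qed
    have Q'0: "0 \<le> Q' v" for v unfolding Q'_def using \<Theta>r[of v] pp by (auto simp: b_def)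
    have part: "(\<integral>\<^sup>+s. ennreal (hh s) * indicator {x..y} s \<partial>lborel) \<le> ennreal (H y)" if x: "0 < x" "x \<le> y" for x
    proof -
      have r: "0 < F u \<and> F u < Bt" if "x \<le> u" "u \<le> y" for u using Fi[of u] that x y by auto
      define LH where "LH s = (1 - 1 / n) * ln s + Q (F s)" for s
      define l where "l s = (1 - 1 / n) / s + Q' (F s) * d s" for s
      have [measurable]: "l \<in> borel_measurable borel" unfolding l_def by measurable
      have n1: "0 \<le> 1 - 1 / real n" using n by simp
      have Qc: "continuous_on {F x..F y} Q"
      proof (rule DERIV_continuous_on)
        fix v assume "v \<in> {F x..F y}"
        hence "0 < v" "v < Bt" using r[of x] r[of y] x by auto
        thus "(Q has_real_derivative Q' v) (at v within {F x..F y})" by (rule has_field_derivative_at_within[OF QD])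
      qed
      have Qint: "(Q' has_integral (Q v - Q u)) {u..v}" if "F x \<le> u" "u \<le> v" "v \<le> F y" for u v
      proof (rule fundamental_theorem_of_calculus[OF that(2)])
        fix z assume "z \<in> {u..v}"
        hence "0 < z" "z < Bt" using r[of x] r[of y] that x by auto
        thus "(Q has_vector_derivative Q' z) (at z within {u..v})"
          unfolding has_real_derivative_iff_has_vector_derivative[symmetric] by (rule has_field_derivative_at_within[OF QD])
      qed
      have Qm: "Q u \<le> Q v" if "F x \<le> u" "u \<le> v" "v \<le> F y" for u v
        using has_integral_nonneg[OF Qint[OF that]] Q'0 by simp
      have LHm: "LH u \<le> LH v" if "x \<le> u" "u \<le> v" "v \<le> y" for u v
        unfolding LH_def using that x n1 Fmono by (intro add_mono mult_left_mono Qm) auto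
      have "continuous_on {x..y} (\<lambda>s. (1 - 1 / n) * ln s)" using x by (intro continuous_intros) auto
      moreover have "continuous_on {x..y} (\<lambda>s. Q (F s))"
        by (rule continuous_on_compose2[OF Qc continuous_on_subset[OF Fcont]]) (use x y Fmono in auto)
      ultimately have LHc: "continuous_on {x..y} LH" unfolding LH_def by (rule continuous_on_add)
      have LHprim: "(\<integral>\<^sup>+t. ennreal (l t) * indicator {u..v} t \<partial>lborel) = ennreal (LH v - LH u)" if uv: "x \<le> u" "u \<le> v" "v \<le> y" for u v
      proof -
        have "(\<integral>\<^sup>+t. ennreal (l t) * indicator {u..v} t \<partial>lborel)
          = (\<integral>\<^sup>+t. ennreal ((1 - 1 / n) / t) * indicator {u..v} t + ennreal (Q' (F t)) * ennreal (d t) * indicator {u..v} t \<partial>lborel)"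
        proof (rule nn_integral_cong)
          fix t
          show "ennreal (l t) * indicator {u..v} t = ennreal ((1 - 1 / n) / t) * indicator {u..v} t + ennreal (Q' (F t)) * ennreal (d t) * indicator {u..v} t"
          proof (cases "t \<in> {u..v}")
            case True
            hence "0 < t" using uv x by auto
            thus ?thesis using True n1 Q'0 d0 by (simp add: l_def ennreal_plus ennreal_mult)
          qed simp
        qed
        also have "\<dots> = (\<integral>\<^sup>+t. ennreal ((1 - 1 / n) / t) * indicator {u..v} t \<partial>lborel) + (\<integral>\<^sup>+t. ennreal (Q' (F t)) * ennreal (d t) * indicator {u..v} t \<partial>lborel)"
          by (rule nn_integral_add) auto
        also have "(\<integral>\<^sup>+t. ennreal ((1 - 1 / n) / t) * indicator {u..v} t \<partial>lborel) = ennreal ((1 - 1 / n) * ln v - (1 - 1 / n) * ln u)"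
        proof (rule nn_integral_has_integral_Icc)
          show "((\<lambda>t. (1 - 1 / real n) / t) has_integral ((1 - 1 / n) * ln v - (1 - 1 / n) * ln u)) {u..v}"
            by (rule fundamental_theorem_of_calculus)
               (use uv x in \<open>auto intro!: derivative_eq_intros simp: has_real_derivative_iff_has_vector_derivative[symmetric]\<close>)
        qed (use uv x n1 in auto)
        also have "(\<integral>\<^sup>+t. ennreal (Q' (F t)) * ennreal (d t) * indicator {u..v} t \<partial>lborel) = (\<integral>\<^sup>+z. ennreal (Q' z) * indicator {F u..F v} z \<partial>lborel)"
          by (rule nn_integral_subst_primitive[where f = "\<lambda>z. ennreal (Q' z)"])
             (use uv x y Fmono Fprim in \<open>auto intro!: continuous_on_subset[OF Fcont]\<close>)
        also have "\<dots> = ennreal (Q (F v) - Q (F u))"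
          using uv Fmono Q'0 by (intro nn_integral_has_integral_Icc Qint) auto
        also have "ennreal ((1 - 1 / n) * ln v - (1 - 1 / n) * ln u) + ennreal (Q (F v) - Q (F u)) = ennreal (LH v - LH u)"
        proof -
          have e: "LH v - LH u = ((1 - 1 / n) * ln v - (1 - 1 / n) * ln u) + (Q (F v) - Q (F u))" by (simp add: LH_def)
          have "(1 - 1 / n) * ln u \<le> (1 - 1 / n) * ln v" using uv x n1 by (intro mult_left_mono) auto
          moreover have "Q (F u) \<le> Q (F v)" using uv Fmono by (intro Qm) auto
          ultimately show ?thesis unfolding e by (intro ennreal_plus[symmetric]) auto
        qed
        finally show ?thesis .
      qed
      have eLH: "exp (LH s) = H s" if "x \<le> s" "s \<le> y" for s
      proof -
        have s: "0 < s" "0 < \<tau> s" using that x y th[of s] by (auto simp: \<tau>_def)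
        have "exp (LH s) = exp ((1 - 1 / n) * ln s) * exp ((1 / pp) * ln (\<tau> s))" by (simp add: LH_def Q_def \<tau>_def exp_add)
        thus ?thesis using s by (simp add: H_def powr_def)
      qed
      have "(\<integral>\<^sup>+s. ennreal (hh s) * indicator {x..y} s \<partial>lborel) \<le> (\<integral>\<^sup>+s. ennreal (exp (LH s)) * ennreal (l s) * indicator {x..y} s \<partial>lborel)"
      proof (rule nn_integral_mono)
        fix s
        show "ennreal (hh s) * indicator {x..y} s \<le> ennreal (exp (LH s)) * ennreal (l s) * indicator {x..y} s"
        proof (cases "s \<in> {x..y}")
          case True
          hence s: "0 < s" "s < s0" using x y by auto
          define T where "T = \<Theta> (F s)"
          have T: "0 < T" "T < 1" using th[OF s] by (auto simp: T_def)
          have dp: "0 < d s" using dpos s by simp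
          define r where "r = Q' (F s) * d s"
          have bT: "b T * (T * (1 - T)) = T powr A * (1 - T) powr B"
            using T by (simp add: b_def powr_diff)
          have "Q' (F s) = (1 / pp) / (b T * (T * (1 - T)))" by (simp add: Q'_def T_def divide_inverse)
          hence r: "r = (1 / pp) * d s / (T powr A * (1 - T) powr B)" unfolding bT by (simp add: r_def)
          have r0: "0 < r" using dp T pp by (simp add: r)
          have nr: "n * r = A * d s / (T powr A * (1 - T) powr B)"
          proof -
            have "n * r = (n / pp) * d s / (T powr A * (1 - T) powr B)" by (simp add: r)
            thus ?thesis by (simp only: pp(2))
          qed
          have "(1 / s) powr (1 - 1 / n) * (n * r) powr (1 / n) \<le> (1 - 1 / n) * (1 / s) + (1 / n) * (n * r)"
            using s r0 n0 n1 by (intro Youngs_inequality_0) auto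
          also have "\<dots> = l s" using n0 by (simp add: l_def r_def)
          finally have yl: "(1 / s) powr (1 - 1 / n) * (n * r) powr (1 / n) \<le> l s" .
          have "hh s = H s * ((1 / s) powr (1 - 1 / n) * (n * r) powr (1 / n))"
          proof -
            have "H s * (1 / s) powr (1 - 1 / n) = \<tau> s powr (1 / pp)" using s by (simp add: H_def powr_divide)
            hence "H s * ((1 / s) powr (1 - 1 / n) * (n * r) powr (1 / n)) = \<tau> s powr (1 / pp) * (n * r) powr (1 / n)"
              by (metis mult.assoc)
            also have "\<tau> s powr (1 / pp) = (\<tau> s powr A) powr (1 / n)" using pp n0 by (simp add: powr_powr pp(2)[symmetric])
            also have "(\<tau> s powr A) powr (1 / n) * (n * r) powr (1 / n) = (\<tau> s powr A * (n * r)) powr (1 / n)"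
              by (simp only: powr_mult)
            also have "\<tau> s powr A * (n * r) = A * d s / (1 - T) powr n"
            proof -
              have "\<tau> s powr A = T powr A / (1 - T) powr A" using T by (simp add: \<tau>_def T_def[symmetric] powr_divide)
              moreover have "(1 - T) powr n = (1 - T) powr A * (1 - T) powr B" unfolding AB[symmetric] by (rule powr_add)
              ultimately show ?thesis unfolding nr using T by simp
            qed
            also have "(A * d s / (1 - T) powr n) powr (1 / n) = hh s"
              using T dp A n0 by (simp add: hh_def T_def[symmetric] powr_divide powr_powr)
            finally show ?thesis ..
          qed
          also have "\<dots> \<le> H s * l s" using yl by (intro mult_left_mono) (auto simp: H_def)
          finally have "hh s \<le> exp (LH s) * l s" using eLH True by simp
          thus ?thesis using True by (auto simp: ennreal_mult'[symmetric] intro!: ennreal_leI)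
        qed simp
      qed
      also have "\<dots> = (\<integral>\<^sup>+v. ennreal (exp v) * indicator {LH x..LH y} v \<partial>lborel)"
        by (rule nn_integral_subst_primitive[where f = "\<lambda>v. ennreal (exp v)"]) (use x LHc LHm LHprim in auto)
      also have "\<dots> = ennreal (exp (LH y) - exp (LH x))"
      proof (rule nn_integral_has_integral_Icc)
        show "(exp has_integral exp (LH y) - exp (LH x)) {LH x..LH y}"
          by (rule fundamental_theorem_of_calculus)
             (use LHm[of x y] x in \<open>auto intro!: derivative_eq_intros simp: has_real_derivative_iff_has_vector_derivative[symmetric]\<close>)
      qed auto
      also have "\<dots> \<le> ennreal (H y)" using eLH[of y] x by (intro ennreal_leI) simp
      finally show ?thesis .
    qed
    have "(\<integral>\<^sup>+s. ennreal (hh s) * indicator {0<..y} s \<partial>lborel) = (\<integral>\<^sup>+s. (SUP i::nat. ennreal (hh s) * indicator {y / (real i + 1)..y} s) \<partial>lborel)"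
    proof (rule nn_integral_cong)
      fix s
      show "ennreal (hh s) * indicator {0<..y} s = (SUP i::nat. ennreal (hh s) * indicator {y / (real i + 1)..y} s)"
      proof (cases "0 < s \<and> s \<le> y")
        case True
        obtain i where "y / s < real i" using reals_Archimedean2 by blast
        hence "y < s * real i" using True by (simp add: pos_divide_less_eq mult.commute)
        hence "y / (real i + 1) \<le> s" using True by (simp add: pos_divide_le_eq distrib_left)
        hence e: "ennreal (hh s) * indicator {y / (real i + 1)..y} s = ennreal (hh s)" using True by simp
        have "ennreal (hh s) * indicator {y / (real i + 1)..y} s \<le> (SUP i::nat. ennreal (hh s) * indicator {y / (real i + 1)..y} s)"
          by (rule SUP_upper) simp
        hence "ennreal (hh s) \<le> (SUP i::nat. ennreal (hh s) * indicator {y / (real i + 1)..y} s)" by (simp only: e)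
        moreover have "(SUP i::nat. ennreal (hh s) * indicator {y / (real i + 1)..y} s) \<le> ennreal (hh s)"
          by (intro SUP_least) (auto simp: indicator_def)
        ultimately show ?thesis using True by simp
      next
        case False
        have z: "ennreal (hh s) * indicator {y / (real i + 1)..y} s = 0" for i :: nat
        proof -
          have "0 < y / (real i + 1)" using y by simp
          thus ?thesis using False by (auto simp: indicator_def)
        qed
        show ?thesis unfolding z using False by (simp add: indicator_def)
      qed
    qed
    also have "\<dots> = (SUP i::nat. \<integral>\<^sup>+s. ennreal (hh s) * indicator {y / (real i + 1)..y} s \<partial>lborel)"
    proof (rule nn_integral_monotone_convergence_SUP)
      show "incseq (\<lambda>(i::nat) s. ennreal (hh s) * indicator {y / (real i + 1)..y} s)"
      proof (rule incseq_SucI, rule le_funI)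
        fix i :: nat and s
        have "y / (real (Suc i) + 1) \<le> y / (real i + 1)" using y by (intro divide_left_mono) auto
        thus "ennreal (hh s) * indicator {y / (real i + 1)..y} s \<le> ennreal (hh s) * indicator {y / (real (Suc i) + 1)..y} s"
          by (auto simp: indicator_def)
      qed
    qed measurable
    also have "\<dots> \<le> ennreal (H y)"
    proof (rule SUP_least)
      fix i :: nat
      have "y / (real i + 1) \<le> y" using y by (simp add: divide_le_eq distrib_left)
      thus "(\<integral>\<^sup>+s. ennreal (hh s) * indicator {y / (real i + 1)..y} s \<partial>lborel) \<le> ennreal (H y)" using y by (intro part) auto
    qed
    finally show ?thesis .
  qed

  have BetaN: "ennreal (1 / \<kappa>) * ennreal (Bt * x) = ennreal (N * x)" for x
    using \<kappa> Bt N by (subst ennreal_mult'[symmetric]) (auto simp: \<kappa>_def)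
  have Gamma_rec: "Gamma x = (x - 1) * Gamma (x - 1)" if "1 < x" for x :: real
  proof -
    have "x - 1 \<notin> \<int>\<^sub>\<le>\<^sub>0" using that by (auto elim!: nonpos_Ints_cases)
    thus ?thesis using Gamma_plus1[of "x - 1"] by simp
  qed
  \<comment> \<open>The Beta values that will occur arise from \<open>Bt\<close> by shifting
    arguments by one, hence differ from it by rational factors. They are finite because
    \<open>B > 1\<close>, that is \<open>p < n\<close>.\<close>
  have Beta1: "Beta A (B - 1) = Bt * q"
  proof -
    have q': "q = (A + B - 1) / (B - 1)" using p n unfolding AB by (auto simp: q_def B_def field_simps)
    have "g * h / k = g * (c * h) / (d * k) * (d / c)" if "c \<noteq> 0" "d \<noteq> 0" for g h k c d :: real using that by simp
    from this[of "B - 1" "A + B - 1" "Gamma A" "Gamma (B - 1)" "Gamma (A + B - 1)"]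
    have "Gamma A * Gamma (B - 1) / Gamma (A + B - 1) = Gamma A * Gamma B / Gamma (A + B) * q"
      using A B unfolding q' Gamma_rec[OF B] Gamma_rec[of "A + B"] by (subst Gamma_rec) auto
    thus ?thesis unfolding Bt_def Beta_def by (simp add: add_diff_eq)
  qed
  have Beta2: "Beta (A + 1) (B - 1) = Bt * (n * (p - 1) / (n - p))"
  proof -
    have q': "n * (p - 1) / (n - p) = A / (B - 1)" using p n by (auto simp: A_def B_def field_simps)
    have "a * g * h / k = g * (c * h) / k * (a / c)" if "c \<noteq> 0" for a g h k c :: real using that by simp
    from this[of "B - 1" A "Gamma A" "Gamma (B - 1)" "Gamma (A + B)"]
    have "Gamma (A + 1) * Gamma (B - 1) / Gamma (A + B) = Gamma A * Gamma B / Gamma (A + B) * (A / (B - 1))"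
      using A B Gamma_rec[OF B] Gamma_rec[of "A + 1"] by simp
    thus ?thesis unfolding q' Bt_def Beta_def by simp
  qed

  define D where "D = n * \<sigma> powr (1 / n) * (A * Bt) powr (1 / n)"
  define \<alpha> where "\<alpha> = n * (p - 1) / (n - p)"
  have D: "0 < D" using n0 \<sigma> A Bt by (simp add: D_def)
  have \<alpha>: "0 < \<alpha>" using p n0 by (simp add: \<alpha>_def)
  \<comment> \<open>Maximizes \<open>p * (x powr (p - 1) * (D * N powr (1 - 1 / n))) - (p - 1) * (x
    powr p * (N * \<alpha>))\<close>; the maximum is the Sobolev term.\<close>
  define x where "x = D * N powr (- 1 / n) / \<alpha>"
  have x: "0 < x" using D N \<alpha> by (simp add: x_def)
  \<comment> \<open>The exponents are such that \<open>a t powr (p - 1)\<close> is linear in the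
    bubble radius at volume \<open>\<nu> t\<close>, while \<open>a t powr p\<close> is linear in
    \<open>\<tau> (\<nu> t)\<close>.\<close>
  define a where "a t = (if 0 < t then x * (t powr (q - 1) * \<tau> (\<nu> t) powr (1 / pp)) powr (1 / (p - 1)) else 0)" for t
  have \<nu>m[measurable]: "(\<lambda>t. \<nu> (max 0 t)) \<in> borel_measurable borel"
  proof -
    have "mono (\<lambda>t. - \<nu> (max 0 t))" by (intro monoI) (auto intro!: \<nu>mono)
    hence "(\<lambda>t. - (- \<nu> (max 0 t))) \<in> borel_measurable borel" by (intro borel_measurable_uminus borel_measurable_mono)
    thus ?thesis by simp
  qed
  have am[measurable]: "a \<in> borel_measurable borel"
  proof -
    have "a = (\<lambda>t. if 0 < t then x * (t powr (q - 1) * \<tau> (\<nu> (max 0 t)) powr (1 / pp)) powr (1 / (p - 1)) else 0)"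
      by (auto simp: a_def fun_eq_iff)
    moreover have "\<dots> \<in> borel_measurable borel" by measurable
    ultimately show ?thesis by simp
  qed
  have a0: "0 \<le> a t" for t using x by (simp add: a_def)
  have \<nu>r: "0 \<le> \<nu> t" "\<nu> t < s0" if "0 < t" for t using \<nu>0 \<nu>less[OF that] by (auto simp: s0_def)
  have e1: "(q - 1) * (p / (p - 1)) = ps"
  proof -
    have "q - 1 = n * (p - 1) / (n - p)" using p by (simp add: q_def field_simps)
    thus ?thesis using p by (simp add: ps_def)
  qed
  have ap: "a t powr p = x powr p * (t powr ps * \<tau> (\<nu> t))" if "0 < t" for t
  proof -
    have "a t powr p = x powr p * (t powr (q - 1) * \<tau> (\<nu> t) powr (1 / pp)) powr (p / (p - 1))"
      using that x by (simp add: a_def powr_mult powr_powr)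
    also have "(t powr (q - 1) * \<tau> (\<nu> t) powr (1 / pp)) powr (p / (p - 1)) = t powr ((q - 1) * (p / (p - 1))) * \<tau> (\<nu> t) powr ((1 / pp) * (p / (p - 1)))"
      by (simp only: powr_mult powr_powr)
    also have "(1 / pp) * (p / (p - 1)) = 1" using p by (simp add: pp_def)
    finally show ?thesis using e1 \<tau>0[OF \<nu>r[OF that]] by simp
  qed
  have ap1: "a t powr (p - 1) = x powr (p - 1) * (t powr (q - 1) * \<tau> (\<nu> t) powr (1 / pp))" if "0 < t" for t
    using that x p by (simp add: a_def powr_mult powr_powr)
  \<comment> \<open>An inequality only: where \<open>f\<close> has plateaus,
    \<open>\<nu> (wb s)\<close> can be smaller than \<open>s\<close>.\<close>
  have I2: "(\<integral>\<^sup>+y. ennreal (a (f y) powr p) \<partial>M) \<le> ennreal (x powr p * (N * \<alpha>))"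
  proof -
    have "(\<integral>\<^sup>+y. ennreal (a (f y) powr p) \<partial>M) = (\<integral>\<^sup>+y. ennreal (a (f y) powr p) * indicator {0<..} (f y) \<partial>M)"
      by (intro nn_integral_cong) (auto simp: indicator_def a_def)
    also have "\<dots> = (\<integral>\<^sup>+s. ennreal (a (wb s) powr p) * indicator {0<..} (wb s) \<partial>lborel)" by (rule equi) measurable
    also have "\<dots> \<le> (\<integral>\<^sup>+s. ennreal (x powr p / \<kappa>) * (ennreal (\<Theta> (F s) / (1 - \<Theta> (F s))) * ennreal (d s) * indicator {0..s0} s) \<partial>lborel)"
    proof (rule nn_integral_mono)
      fix s
      show "ennreal (a (wb s) powr p) * indicator {0<..} (wb s) \<le> ennreal (x powr p / \<kappa>) * (ennreal (\<Theta> (F s) / (1 - \<Theta> (F s))) * ennreal (d s) * indicator {0..s0} s)"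
      proof (cases "0 < wb s")
        case True
        hence s: "0 \<le> s" "s < s0" by (auto simp: wb_def split: if_splits)
        have "\<nu> (wb s) \<le> s" using w_iff[OF s(1), of "w s"] wb_eq[OF s(1)] w0[OF s(1)] by simp
        hence "\<tau> (\<nu> (wb s)) \<le> \<tau> s" using \<nu>0 s by (intro \<tau>mono) auto
        hence "a (wb s) powr p \<le> x powr p * (wb s powr ps * \<tau> s)" unfolding ap[OF True] by (intro mult_left_mono) auto
        also have "\<dots> = x powr p / \<kappa> * (\<tau> s * d s)" using \<kappa> by (simp add: d_def)
        finally have "ennreal (a (wb s) powr p) \<le> ennreal (x powr p / \<kappa> * (\<tau> s * d s))" by (rule ennreal_leI)
        also have "\<dots> = ennreal (x powr p / \<kappa>) * (ennreal (\<tau> s) * ennreal (d s))"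
          using \<kappa> \<tau>0[OF s] d0[of s] by (subst ennreal_mult) (auto simp: ennreal_mult)
        finally show ?thesis using s True by (simp add: \<tau>_def)
      qed simp
    qed
    also have "\<dots> = ennreal (x powr p / \<kappa>) * (\<integral>\<^sup>+z. ennreal (z / (1 - z)) * ennreal (b z) * indicator {0..1} z \<partial>lborel)"
      by (subst nn_integral_cmult, simp, subst transp[where k = "\<lambda>z. ennreal (z / (1 - z))"]) auto
    also have "(\<integral>\<^sup>+z. ennreal (z / (1 - z)) * ennreal (b z) * indicator {0..1} z \<partial>lborel)
       = (\<integral>\<^sup>+z. ennreal (z powr A * (1 - z) powr (B - 1 - 1)) * indicator {0..1} z \<partial>lborel)"
    proof (rule nn_integral_cong_AE, rule AE_mp[OF AE_lborel_singleton[of 1]], rule AE_mp[OF AE_lborel_singleton[of 0]], intro AE_I2 impI)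
      fix z :: real assume z: "z \<noteq> 0" "z \<noteq> 1"
      show "ennreal (z / (1 - z)) * ennreal (b z) * indicator {0..1} z = ennreal (z powr A * (1 - z) powr (B - 1 - 1)) * indicator {0..1} z"
      proof (cases "z \<in> {0..1}")
        case True
        hence z': "0 < z" "0 < 1 - z" using z by auto
        have "z / (1 - z) * b z = z powr A * (1 - z) powr (B - 1 - 1)"
          unfolding b_def powr_diff[of "1 - z" "B - 1" 1] powr_diff[of z A 1] using z' by simp
        thus ?thesis using True z' by (simp add: ennreal_mult'[symmetric])
      qed simp
    qed
    also have "\<dots> = ennreal (Beta (A + 1) (B - 1))"
      by (rule nn_integral_has_integral_Icc) (use has_integral_Beta_real[of "A + 1" "B - 1"] A B in auto)
    also have "ennreal (x powr p / \<kappa>) * ennreal (Beta (A + 1) (B - 1)) = ennreal (x powr p * (N * \<alpha>))"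
      unfolding Beta2 \<alpha>_def[symmetric] using \<kappa> Bt \<alpha> N by (subst ennreal_mult[symmetric]) (auto simp: \<kappa>_def)
    finally show ?thesis .
  qed
  \<comment> \<open>The level integral becomes one over volumes: \<open>H (\<nu> t)\<close> is at
    least the integral of \<open>hh\<close> up to \<open>\<nu> t\<close>, and after exchanging the
    order of integration over \<open>t < wb s\<close> the inner integral of
    \<open>t powr (q - 1)\<close> is \<open>wb s powr q / q\<close>.\<close>
  have I1: "ennreal (x powr (p - 1) * (D * N powr (1 - 1 / n)))
    \<le> (\<integral>\<^sup>+t. ennreal (a t powr (p - 1) * (n * unit_ball_vol n powr (1 / n) * \<nu> t powr ((real n - 1) / n))) * indicator {0<..} t \<partial>lborel)"
  proof -
    let ?c = "x powr (p - 1) * (n * \<sigma> powr (1 / n))"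
    have c0: "0 \<le> ?c" using n0 by simp
    have ee: "1 - 1 / real n = (real n - 1) / n" using n0 by (simp add: field_simps)
    have "(\<integral>\<^sup>+t. ennreal ?c * (ennreal (t powr (q - 1)) * ennreal (H (\<nu> t)) * indicator {0<..} t) \<partial>lborel)
       = (\<integral>\<^sup>+t. ennreal (a t powr (p - 1) * (n * unit_ball_vol n powr (1 / n) * \<nu> t powr ((real n - 1) / n))) * indicator {0<..} t \<partial>lborel)"
    proof (rule nn_integral_cong)
      fix t
      show "ennreal ?c * (ennreal (t powr (q - 1)) * ennreal (H (\<nu> t)) * indicator {0<..} t)
         = ennreal (a t powr (p - 1) * (n * unit_ball_vol n powr (1 / n) * \<nu> t powr ((real n - 1) / n))) * indicator {0<..} t"
      proof (cases "0 < t")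
        case True
        have "?c * (t powr (q - 1) * H (\<nu> t)) = a t powr (p - 1) * (n * unit_ball_vol n powr (1 / n) * \<nu> t powr ((real n - 1) / n))"
          unfolding ap1[OF True] H_def ee \<sigma>_def by (simp add: mult_ac)
        thus ?thesis using True c0 by (simp add: ennreal_mult[symmetric] H_def)
      qed simp
    qed
    moreover have "ennreal (x powr (p - 1) * (D * N powr (1 - 1 / n)))
       \<le> (\<integral>\<^sup>+t. ennreal ?c * (ennreal (t powr (q - 1)) * ennreal (H (\<nu> t)) * indicator {0<..} t) \<partial>lborel)"
    proof -
            have hm: "(\<lambda>t. ennreal (t powr (q - 1)) * ennreal (H (\<nu> t)) * indicator {0<..} t) \<in> borel_measurable lborel"
      proof -
        have "(\<lambda>t. ennreal (t powr (q - 1)) * ennreal (H (\<nu> (max 0 t))) * indicator {0<..} t) \<in> borel_measurable lborel"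
          unfolding H_def by measurable
        moreover have "(\<lambda>t. ennreal (t powr (q - 1)) * ennreal (H (\<nu> (max 0 t))) * indicator {0<..} t) = (\<lambda>t. ennreal (t powr (q - 1)) * ennreal (H (\<nu> t)) * indicator {0<..} t)"
          by (auto simp: fun_eq_iff indicator_def)
        ultimately show ?thesis by simp
      qed
      have inner: "(\<integral>\<^sup>+t. ennreal (t powr (q - 1)) * indicator {0<..<u} t \<partial>lborel) = ennreal (u powr q / q)" if "0 \<le> u" for u
      proof -
        have "(\<integral>\<^sup>+t. ennreal (t powr (q - 1)) * indicator {0<..<u} t \<partial>lborel) = (\<integral>\<^sup>+t. ennreal (t powr (q - 1)) * indicator {0..u} t \<partial>lborel)"
          by (rule nn_integral_cong_AE, rule AE_mp[OF AE_lborel_singleton[of 0]], rule AE_mp[OF AE_lborel_singleton[of u]])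
             (auto simp: indicator_def)
        also have "\<dots> = ennreal (u powr q / q)"
        proof (rule nn_integral_has_integral_Icc)
          show "((\<lambda>t. t powr (q - 1)) has_integral u powr q / q) {0..u}"
            using has_integral_powr_from_0[of "q - 1" u] q that by simp
        qed auto
        finally show ?thesis .
      qed
      have "(\<integral>\<^sup>+s. ennreal (hh s) * ennreal (wb s powr q / q) * indicator {0<..<s0} s \<partial>lborel)
         = (\<integral>\<^sup>+s. (\<integral>\<^sup>+t. ennreal (hh s) * indicator {0<..<s0} s * (ennreal (t powr (q - 1)) * indicator {0<..<wb s} t) \<partial>lborel) \<partial>lborel)"
        by (intro nn_integral_cong, subst nn_integral_cmult, simp, subst inner[OF wb0]) (simp add: mult_ac)
      also have "\<dots> = (\<integral>\<^sup>+s. (\<integral>\<^sup>+t. ennreal (hh s) * indicator {0<..<s0} s * (ennreal (t powr (q - 1)) * (if 0 < t \<and> t < wb s then 1 else 0)) \<partial>lborel) \<partial>lborel)"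
        by (intro nn_integral_cong) (auto simp: indicator_def)
      also have "\<dots> = (\<integral>\<^sup>+t. (\<integral>\<^sup>+s. ennreal (hh s) * indicator {0<..<s0} s * (ennreal (t powr (q - 1)) * (if 0 < t \<and> t < wb s then 1 else 0)) \<partial>lborel) \<partial>lborel)"
        by (rule lborel_pair.Fubini') measurable
      also have "\<dots> \<le> (\<integral>\<^sup>+t. ennreal (t powr (q - 1)) * ennreal (H (\<nu> t)) * indicator {0<..} t \<partial>lborel)"
      proof (rule nn_integral_mono)
        fix t
        show "(\<integral>\<^sup>+s. ennreal (hh s) * indicator {0<..<s0} s * (ennreal (t powr (q - 1)) * (if 0 < t \<and> t < wb s then 1 else 0)) \<partial>lborel)
           \<le> ennreal (t powr (q - 1)) * ennreal (H (\<nu> t)) * indicator {0<..} t"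
        proof (cases "0 < t")
          case True
          have "(\<integral>\<^sup>+s. ennreal (hh s) * indicator {0<..<s0} s * (ennreal (t powr (q - 1)) * (if 0 < t \<and> t < wb s then 1 else 0)) \<partial>lborel)
             \<le> (\<integral>\<^sup>+s. ennreal (t powr (q - 1)) * (ennreal (hh s) * indicator {0<..\<nu> t} s) \<partial>lborel)"
          proof (rule nn_integral_mono)
            fix s
            show "ennreal (hh s) * indicator {0<..<s0} s * (ennreal (t powr (q - 1)) * (if 0 < t \<and> t < wb s then 1 else 0))
              \<le> ennreal (t powr (q - 1)) * (ennreal (hh s) * indicator {0<..\<nu> t} s)"
              using w_iff[of s t] wb_eq[of s] True by (auto simp: indicator_def mult.commute)
          qed
          also have "\<dots> = ennreal (t powr (q - 1)) * (\<integral>\<^sup>+s. ennreal (hh s) * indicator {0<..\<nu> t} s \<partial>lborel)"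
            by (rule nn_integral_cmult) simp
          also have "\<dots> \<le> ennreal (t powr (q - 1)) * ennreal (H (\<nu> t))"
          proof (rule mult_left_mono)
            show "(\<integral>\<^sup>+s. ennreal (hh s) * indicator {0<..\<nu> t} s \<partial>lborel) \<le> ennreal (H (\<nu> t))"
            proof (cases "\<nu> t = 0")
              case False
              thus ?thesis using \<nu>r[OF True] by (intro Hlow) auto
            qed simp
          qed simp
          finally show ?thesis using True by simp
        qed simp
      qed
      finally have 1: "(\<integral>\<^sup>+s. ennreal (hh s) * ennreal (wb s powr q / q) * indicator {0<..<s0} s \<partial>lborel)
         \<le> (\<integral>\<^sup>+t. ennreal (t powr (q - 1)) * ennreal (H (\<nu> t)) * indicator {0<..} t \<partial>lborel)" .
      \<comment> \<open>Collected constants: \<open>(A * \<kappa>) powr (1 / n)\<close> from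
        \<open>hh\<close>, \<open>1 / q\<close> from the level integral, \<open>1 / \<kappa>\<close>
        from expressing \<open>wb powr ps\<close> by \<open>d\<close>.\<close>
      let ?e = "(A * \<kappa>) powr (1 / n) / (\<kappa> * q)"
      have e0: "0 \<le> ?e" using \<kappa> q by simp
      have "(\<integral>\<^sup>+s. ennreal (hh s) * ennreal (wb s powr q / q) * indicator {0<..<s0} s \<partial>lborel)
         = (\<integral>\<^sup>+s. ennreal ?e * (ennreal (1 / (1 - \<Theta> (F s))) * ennreal (d s) * indicator {0..s0} s) \<partial>lborel)"
      proof (rule nn_integral_cong_AE, rule AE_mp[OF AE_lborel_singleton[of 0]], rule AE_mp[OF AE_lborel_singleton[of s0]], intro AE_I2 impI)
        fix s assume s': "s \<noteq> 0" "s \<noteq> s0"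
        show "ennreal (hh s) * ennreal (wb s powr q / q) * indicator {0<..<s0} s
          = ennreal ?e * (ennreal (1 / (1 - \<Theta> (F s))) * ennreal (d s) * indicator {0..s0} s)"
        proof (cases "s \<in> {0..s0}")
          case True
          hence s: "0 < s" "s < s0" using s' by auto
          have wp: "0 < wb s" using wpos[of s] wb_eq[of s] s by simp
          have "(A * d s) powr (1 / n) * wb s powr q = (A * \<kappa>) powr (1 / n) * (wb s powr (ps / n) * wb s powr q)"
            using A \<kappa> by (simp add: d_def powr_mult powr_powr)
          also have "wb s powr (ps / n) * wb s powr q = wb s powr ps" using qps by (simp add: powr_add[symmetric] add.commute)
          finally have "hh s * (wb s powr q / q) = ?e * (1 / (1 - \<Theta> (F s)) * d s)"
            using \<kappa> by (simp add: hh_def d_def)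
          moreover have "0 \<le> hh s" "0 \<le> 1 / (1 - \<Theta> (F s))" using th[OF s] by (auto simp: hh_def)
          ultimately show ?thesis using s e0 d0 q by (simp add: ennreal_mult[symmetric])
        qed auto
      qed
      also have "\<dots> = ennreal ?e * (\<integral>\<^sup>+z. ennreal (1 / (1 - z)) * ennreal (b z) * indicator {0..1} z \<partial>lborel)"
        by (subst nn_integral_cmult, simp, subst transp[where k = "\<lambda>z. ennreal (1 / (1 - z))"]) auto
      also have "(\<integral>\<^sup>+z. ennreal (1 / (1 - z)) * ennreal (b z) * indicator {0..1} z \<partial>lborel)
         = (\<integral>\<^sup>+z. ennreal (z powr (A - 1) * (1 - z) powr (B - 1 - 1)) * indicator {0..1} z \<partial>lborel)"
      proof (rule nn_integral_cong_AE, rule AE_mp[OF AE_lborel_singleton[of 1]], intro AE_I2 impI)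
        fix z :: real assume z: "z \<noteq> 1"
        show "ennreal (1 / (1 - z)) * ennreal (b z) * indicator {0..1} z = ennreal (z powr (A - 1) * (1 - z) powr (B - 1 - 1)) * indicator {0..1} z"
        proof (cases "z \<in> {0..1}")
          case True
          hence z': "0 < 1 - z" using z by auto
          have "1 / (1 - z) * b z = z powr (A - 1) * (1 - z) powr (B - 1 - 1)"
            unfolding b_def powr_diff[of "1 - z" "B - 1" 1] using z' by simp
          thus ?thesis using True z' by (simp add: ennreal_mult'[symmetric])
        qed simp
      qed
      also have "\<dots> = ennreal (Beta A (B - 1))"
        by (rule nn_integral_has_integral_Icc) (use has_integral_Beta_real[of A "B - 1"] A B in auto)
      also have "ennreal ?e * ennreal (Beta A (B - 1)) = ennreal (?e * (Bt * q))"
        unfolding Beta1 by (rule ennreal_mult'[OF e0, symmetric])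
      finally have 2: "ennreal (?e * (Bt * q)) \<le> (\<integral>\<^sup>+t. ennreal (t powr (q - 1)) * ennreal (H (\<nu> t)) * indicator {0<..} t \<partial>lborel)"
        using 1 by (simp only:)
      have ceq: "x powr (p - 1) * (D * N powr (1 - 1 / n)) = ?c * (?e * (Bt * q))"
      proof -
        have E1: "?e * (Bt * q) = (A * \<kappa>) powr (1 / n) * N" using q \<kappa> Bt N by (simp add: \<kappa>_def)
        have E2: "(A * Bt / N) powr (1 / n) * N = (A * Bt) powr (1 / n) * N powr (1 - 1 / n)"
          using N A Bt by (simp add: powr_divide powr_diff)
        have "A * \<kappa> = A * Bt / N" by (simp add: \<kappa>_def)
        hence E: "?e * (Bt * q) = (A * Bt) powr (1 / n) * N powr (1 - 1 / n)" using E1 E2 by (simp only:)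
        show ?thesis unfolding E D_def by (simp only: mult_ac)
      qed
      have "ennreal (x powr (p - 1) * (D * N powr (1 - 1 / n))) = ennreal ?c * ennreal (?e * (Bt * q))"
        unfolding ceq by (rule ennreal_mult'[OF c0])
      also have "\<dots> \<le> ennreal ?c * (\<integral>\<^sup>+t. ennreal (t powr (q - 1)) * ennreal (H (\<nu> t)) * indicator {0<..} t \<partial>lborel)"
        by (intro mult_left_mono 2) auto
      finally show ?thesis by (subst nn_integral_cmult[OF hm])
    qed
    ultimately show ?thesis by simp
  qed
  have val: "D powr p * \<alpha> powr (1 - p) * N powr ((n - p) / n) + (p - 1) * (x powr p * (N * \<alpha>)) = p * (x powr (p - 1) * (D * N powr (1 - 1 / n)))"
  proof -
    define Y where "Y = D powr p * \<alpha> powr (1 - p) * N powr ((n - p) / n)"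
    have 1: "x powr p * (N * \<alpha>) = Y"
    proof -
      have "x powr p = D powr p * N powr (- p / n) / \<alpha> powr p" using D N \<alpha> by (simp add: x_def powr_divide powr_mult powr_powr)
      hence "x powr p * (N * \<alpha>) = D powr p * (\<alpha> powr 1 / \<alpha> powr p) * (N powr (- p / n) * N powr 1)" using N \<alpha> by simp
      also have "\<alpha> powr 1 / \<alpha> powr p = \<alpha> powr (1 - p)" by (simp only: powr_diff)
      also have "N powr (- p / n) * N powr 1 = N powr (- p / n + 1)" by (simp only: powr_add)
      also have "- p / n + 1 = (n - p) / n" using n0 by (simp add: field_simps)
      finally show ?thesis by (simp add: Y_def)
    qed
    have "x powr (p - 1) * (D * N powr (1 - 1 / n)) = x powr (p - 1) * (x * (N * \<alpha>))"
    proof -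
      have "x * (N * \<alpha>) = D * (N powr (- 1 / n) * N powr 1)" using N \<alpha> by (simp add: x_def)
      also have "N powr (- 1 / n) * N powr 1 = N powr (- 1 / n + 1)" by (simp only: powr_add)
      also have "- 1 / real n + 1 = 1 - 1 / n" by simp
      finally show ?thesis by simp
    qed
    also have "\<dots> = x powr p * (N * \<alpha>)" using x by (simp add: powr_diff)
    finally show ?thesis using 1 by (simp add: Y_def algebra_simps)
  qed
  show ?thesis
  proof (rule that[of a, OF am a0])
    show "a 0 = 0" by (simp add: a_def)
    show "(\<integral>\<^sup>+y. ennreal (a (f y) powr p) \<partial>M) < \<infinity>" using I2 by (auto simp: le_less_trans)
    let ?Y = "D powr p * \<alpha> powr (1 - p) * N powr ((n - p) / n)"
    have "ennreal ?Y + ennreal (p - 1) * (\<integral>\<^sup>+y. ennreal (a (f y) powr p) \<partial>M) \<le> ennreal ?Y + ennreal (p - 1) * ennreal (x powr p * (N * \<alpha>))"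
      by (intro add_left_mono mult_left_mono I2) auto
    also have "\<dots> = ennreal (?Y + (p - 1) * (x powr p * (N * \<alpha>)))"
      using p N \<alpha> by (simp add: ennreal_mult[symmetric] ennreal_plus[symmetric] del: ennreal_plus)
    also have "\<dots> = ennreal p * ennreal (x powr (p - 1) * (D * N powr (1 - 1 / n)))"
      unfolding val using p by (simp add: ennreal_mult')
    also have "\<dots> \<le> ennreal p * (\<integral>\<^sup>+t. ennreal (a t powr (p - 1) * (n * unit_ball_vol n powr (1 / n) * \<nu> t powr ((real n - 1) / n))) * indicator {0<..} t \<partial>lborel)"
      by (intro mult_left_mono I1) auto
    finally show "ennreal ((n * unit_ball_vol n powr (1 / n) * ((n - n / p) * Beta (n - n / p) (n / p)) powr (1 / n)) powr p
        * (n * (p - 1) / (n - p)) powr (1 - p) * N powr ((n - p) / n))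
       + ennreal (p - 1) * (\<integral>\<^sup>+x. ennreal (a (f x) powr p) \<partial>M)
      \<le> ennreal p * (\<integral>\<^sup>+t. ennreal (a t powr (p - 1) * (n * unit_ball_vol n powr (1 / n) * \<nu> t powr ((real n - 1) / n))) * indicator {0<..} t \<partial>lborel)"
      by (simp add: D_def \<alpha>_def \<sigma>_def Bt_def A_def B_def)
  qed
qed

section \<open>Cayley map and hyperbolic volume\<close>

text \<open>The inversion in the sphere of radius \<open>sqrt 2\<close> about \<open>- e\<close>.
  For a unit vector \<open>e\<close> it exchanges the unit ball with the half-space where
  \<open>z \<bullet> e > 0\<close>; being an involution, it serves in both directions.\<close>

definition cayley :: "'a::euclidean_space \<Rightarrow> 'a \<Rightarrow> 'a" where
  "cayley e z = (2 / ((z + e) \<bullet> (z + e))) *\<^sub>R (z + e) - e"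

lemma cayley_add: "cayley e z + e = (2 / ((z + e) \<bullet> (z + e))) *\<^sub>R (z + e)" by (simp add: cayley_def)

lemma cayley_add_norm:
  assumes "z + e \<noteq> 0"
  shows "norm (cayley e z + e) = 2 / norm (z + e)"
  using assms unfolding cayley_add by (simp add: power2_norm_eq_inner[symmetric] power2_eq_square)

lemma cayley_cayley:
  assumes "z + e \<noteq> 0"
  shows "cayley e (cayley e z) = z"
proof -
  define y where "y = z + e"
  have y: "y \<bullet> y > 0" using assms by (simp add: y_def)
  have c: "cayley e z + e = (2 / (y \<bullet> y)) *\<^sub>R y" by (simp add: cayley_add y_def)
  have "cayley e (cayley e z) + e = (2 / ((cayley e z + e) \<bullet> (cayley e z + e))) *\<^sub>R (cayley e z + e)" by (rule cayley_add)
  also have "(cayley e z + e) \<bullet> (cayley e z + e) = 4 / (y \<bullet> y)"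
    unfolding c using y by simp
  also have "(2 / (4 / (y \<bullet> y))) *\<^sub>R (cayley e z + e) = y" unfolding c using y by simp
  finally show ?thesis by (simp add: y_def)
qed

text \<open>The distance formula of inversions. As an identity at finite distance it later gives the
  gradient comparison without derivatives of the map.\<close>

lemma cayley_dist:
  assumes "x + e \<noteq> 0" "z + e \<noteq> 0"
  shows "norm (cayley e x - cayley e z) = 2 * norm (x - z) / (norm (x + e) * norm (z + e))"
proof -
  define X where "X = x + e"
  define Z where "Z = z + e"
  have nz: "X \<noteq> 0" "Z \<noteq> 0" using assms by (auto simp: X_def Z_def)
  hence pos: "X \<bullet> X > 0" "Z \<bullet> Z > 0" by auto
  have "cayley e x - cayley e z = (2 / (X \<bullet> X)) *\<^sub>R X - (2 / (Z \<bullet> Z)) *\<^sub>R Z" by (simp add: cayley_def X_def Z_def)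
  hence "(norm (cayley e x - cayley e z))\<^sup>2 = ((2 / (X \<bullet> X)) *\<^sub>R X - (2 / (Z \<bullet> Z)) *\<^sub>R Z) \<bullet> ((2 / (X \<bullet> X)) *\<^sub>R X - (2 / (Z \<bullet> Z)) *\<^sub>R Z)"
    by (simp only: power2_norm_eq_inner)
  also have "\<dots> = 4 / (X \<bullet> X) - 8 * (X \<bullet> Z) / ((X \<bullet> X) * (Z \<bullet> Z)) + 4 / (Z \<bullet> Z)"
    using pos by (simp add: inner_simps inner_commute field_simps)
  also have "\<dots> = 4 * ((X - Z) \<bullet> (X - Z)) / ((X \<bullet> X) * (Z \<bullet> Z))"
    using pos by (simp add: inner_simps inner_commute field_simps)
  also have "\<dots> = (2 * norm (X - Z) / (norm X * norm Z))\<^sup>2"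
    by (simp add: power_divide power_mult_distrib power2_norm_eq_inner)
  finally have "norm (cayley e x - cayley e z) = 2 * norm (X - Z) / (norm X * norm Z)"
    by (rule power2_eq_imp_eq) auto
  thus ?thesis by (simp add: X_def Z_def)
qed

text \<open>This is the isometry property: it converts the conformal factor of the ball into that of
  the half-space.\<close>

lemma cayley_one_minus_norm:
  assumes "norm e = 1" "z + e \<noteq> 0"
  shows "1 - (norm (cayley e z))\<^sup>2 = 4 * (z \<bullet> e) / (norm (z + e))\<^sup>2"
proof -
  define y where "y = z + e"
  have y: "y \<bullet> y > 0" using assms by (simp add: y_def)
  have ee: "e \<bullet> e = 1" using assms by (simp add: norm_eq_1)
  have "(norm (cayley e z))\<^sup>2 = ((2 / (y \<bullet> y)) *\<^sub>R y - e) \<bullet> ((2 / (y \<bullet> y)) *\<^sub>R y - e)"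
    by (simp only: cayley_def y_def power2_norm_eq_inner)
  also have "\<dots> = 4 / (y \<bullet> y) - 4 * (y \<bullet> e) / (y \<bullet> y) + 1"
    using y ee by (simp add: inner_simps inner_commute field_simps)
  finally have "1 - (norm (cayley e z))\<^sup>2 = 4 * (y \<bullet> e - 1) / (y \<bullet> y)" by (simp add: diff_divide_distrib algebra_simps)
  also have "y \<bullet> e - 1 = z \<bullet> e" using ee by (simp add: y_def inner_simps)
  finally show ?thesis by (simp add: y_def power2_norm_eq_inner)
qed

lemma half_space_add_nz: "norm e = 1 \<Longrightarrow> 0 < z \<bullet> e \<Longrightarrow> z + e \<noteq> 0"
proof
  assume "norm e = 1" "0 < z \<bullet> e" "z + e = 0"
  moreover have "(z + e) \<bullet> e = z \<bullet> e + 1" using \<open>norm e = 1\<close> by (simp add: inner_simps norm_eq_1)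
  ultimately show False by simp
qed

lemma ball_add_nz: "norm e = 1 \<Longrightarrow> norm x < 1 \<Longrightarrow> x + e \<noteq> 0"
  by (metis add_eq_0_iff norm_minus_cancel order_less_irrefl)

lemma cayley_in_ball: "norm e = 1 \<Longrightarrow> 0 < z \<bullet> e \<Longrightarrow> norm (cayley e z) < 1"
proof -
  assume e: "norm e = 1" "0 < z \<bullet> e"
  have "0 < 4 * (z \<bullet> e) / (norm (z + e))\<^sup>2" using e half_space_add_nz[OF e] by simp
  hence "(norm (cayley e z))\<^sup>2 < 1" using cayley_one_minus_norm[OF e(1) half_space_add_nz[OF e]] by simp
  thus ?thesis by (simp add: abs_square_less_1)
qed

lemma cayley_in_half_space:
  assumes "norm e = 1" "norm x < 1"
  shows "0 < cayley e x \<bullet> e"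
proof -
  have nz: "x + e \<noteq> 0" by (rule ball_add_nz[OF assms])
  have n0: "0 < norm (cayley e x + e)" using nz unfolding cayley_add_norm[OF nz] by simp
  hence nz2: "cayley e x + e \<noteq> 0" by auto
  have "1 - (norm x)\<^sup>2 = 4 * (cayley e x \<bullet> e) / (norm (cayley e x + e))\<^sup>2"
    using cayley_one_minus_norm[OF assms(1) nz2] unfolding cayley_cayley[OF nz] .
  moreover have "(norm x)\<^sup>2 < 1" using assms by (simp add: abs_square_less_1)
  ultimately have "0 < 4 * (cayley e x \<bullet> e) / (norm (cayley e x + e))\<^sup>2" by simp
  thus ?thesis using n0 by (simp add: zero_less_divide_iff)
qed

text \<open>The library proves the change of variables formula only for vectors indexed by a well-ordered type,
  so the index type is replaced by a well-ordered copy.\<close>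

typedef 'a wo_copy = "UNIV :: 'a set" morphisms of_wo to_wo ..

instantiation wo_copy :: (finite) "{finite, wellorder}"
begin
definition less_eq_wo_copy :: "'a wo_copy \<Rightarrow> 'a wo_copy \<Rightarrow> bool" where
  "x \<le> y \<longleftrightarrow> to_nat (of_wo x) \<le> to_nat (of_wo y)"
definition less_wo_copy :: "'a wo_copy \<Rightarrow> 'a wo_copy \<Rightarrow> bool" where
  "x < y \<longleftrightarrow> to_nat (of_wo x) < to_nat (of_wo y)"
instance
proof
  show "finite (UNIV :: 'a wo_copy set)"
    by (rule finite_imageD[of of_wo]) (auto simp: inj_on_def of_wo_inject)
  fix P :: "'a wo_copy \<Rightarrow> bool" and a :: "'a wo_copy"
  assume *: "\<And>x. (\<And>y. y < x \<Longrightarrow> P y) \<Longrightarrow> P x"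
  show "P a"
  proof (induct "to_nat (of_wo a)" arbitrary: a rule: less_induct)
    case less
    show ?case by (rule *) (use less in \<open>auto simp: less_wo_copy_def\<close>)
  qed
qed (auto simp: less_eq_wo_copy_def less_wo_copy_def of_wo_inject)
end

lemma bij_of_wo: "bij of_wo"
proof (rule bijI)
  show "inj of_wo" by (simp add: inj_def of_wo_inject)
  show "surj of_wo" by (rule surjI[of _ to_wo]) (simp add: to_wo_inverse)
qed

lemma card_wo_copy: "CARD('a::finite wo_copy) = CARD('a)"
  by (rule bij_betw_same_card[OF bij_of_wo])

definition wo_vec :: "real^'n \<Rightarrow> real^('n::finite wo_copy)" where "wo_vec x = (\<chi> i. x $ of_wo i)"
definition un_wo_vec :: "real^('n::finite wo_copy) \<Rightarrow> real^'n" where "un_wo_vec y = (\<chi> i. y $ to_wo i)"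

lemma un_wo_vec_wo_vec [simp]: "un_wo_vec (wo_vec x) = x" "wo_vec (un_wo_vec y) = y"
  by (auto simp: un_wo_vec_def wo_vec_def vec_eq_iff to_wo_inverse of_wo_inverse)

lemma sum_wo_copy: "(\<Sum>i\<in>(UNIV::'a::finite wo_copy set). f (of_wo i)) = (\<Sum>i\<in>UNIV. f i)"
  by (rule sum.reindex_bij_betw[OF bij_of_wo])

lemma prod_wo_copy: "(\<Prod>i\<in>(UNIV::'a::finite wo_copy set). f (of_wo i)) = (\<Prod>i\<in>UNIV. f i)"
  by (rule prod.reindex_bij_betw[OF bij_of_wo])

lemma wo_vec_inner: "wo_vec x \<bullet> wo_vec y = x \<bullet> y"
  unfolding inner_vec_def wo_vec_def by (simp add: sum_wo_copy[of "\<lambda>i. x $ i * y $ i"])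

lemma wo_vec_linear: "wo_vec (x + y) = wo_vec x + wo_vec y" "wo_vec (x - y) = wo_vec x - wo_vec y" "wo_vec (c *\<^sub>R x) = c *\<^sub>R wo_vec x"
  by (auto simp: wo_vec_def vec_eq_iff)

lemma norm_wo_vec: "norm (wo_vec x) = norm x" by (simp add: norm_eq_sqrt_inner wo_vec_inner)

lemma cayley_wo_vec: "cayley (wo_vec e) (wo_vec z) = wo_vec (cayley e z)"
  by (simp only: cayley_def wo_vec_linear(1)[symmetric] wo_vec_inner wo_vec_linear(2,3))

lemma wo_vec_measurable[measurable]: "wo_vec \<in> borel_measurable borel"
proof -
  have "linear (wo_vec :: real^'n \<Rightarrow> _)" by (rule linearI) (auto simp: wo_vec_linear)
  thus ?thesis by (intro borel_measurable_continuous_onI linear_continuous_on) (simp add: linear_conv_bounded_linear)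
qed

lemma prod_Basis_cart: "(\<Prod>b\<in>Basis. (x::real^'n::finite) \<bullet> b) = (\<Prod>i\<in>UNIV. x $ i)"
proof -
  have B: "(Basis :: (real^'n) set) = (\<lambda>i. axis i 1) ` UNIV" by (auto simp: Basis_vec_def)
  have "inj (\<lambda>i. axis i (1::real) :: real^'n)" by (auto simp: inj_def axis_eq_axis)
  thus ?thesis unfolding B by (subst prod.reindex) (auto simp: cart_eq_inner_axis[symmetric])
qed

lemma distr_lborel_wo_vec: "distr lborel borel (wo_vec :: real^'n::finite \<Rightarrow> _) = lborel"
proof (rule lborel_eqI[symmetric])
  fix l u :: "real^('n wo_copy)" assume lu: "\<And>b. b \<in> Basis \<Longrightarrow> l \<bullet> b \<le> u \<bullet> b"
  have le: "un_wo_vec l $ i \<le> un_wo_vec u $ i" for i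
  proof -
    have "axis (to_wo i) 1 \<in> (Basis :: (real^('n wo_copy)) set)" by (auto simp: Basis_vec_def)
    from lu[OF this] show ?thesis by (simp add: un_wo_vec_def cart_eq_inner_axis[symmetric])
  qed
  have "emeasure (distr lborel borel (wo_vec :: real^'n \<Rightarrow> _)) (box l u) = emeasure lborel (wo_vec -` box l u \<inter> space (lborel :: (real^'n) measure))"
    by (rule emeasure_distr) auto
  also have "wo_vec -` box l u \<inter> space (lborel :: (real^'n) measure) = box (un_wo_vec l) (un_wo_vec u)"
  proof -
    have "(\<forall>i. l $ i < x $ of_wo i \<and> x $ of_wo i < u $ i) \<longleftrightarrow> (\<forall>i. l $ to_wo i < x $ i \<and> x $ i < u $ to_wo i)" for x :: "real^'n"
      by (metis of_wo_inverse to_wo_inverse UNIV_I)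
    thus ?thesis by (auto simp: mem_box_cart wo_vec_def un_wo_vec_def)
  qed
  also have "emeasure lborel (box (un_wo_vec l) (un_wo_vec u)) = ennreal (\<Prod>b\<in>Basis. (un_wo_vec u - un_wo_vec l) \<bullet> b)"
  proof -
    have "\<forall>b\<in>Basis. un_wo_vec l \<bullet> b \<le> un_wo_vec u \<bullet> b"
      using le by (auto simp: Basis_vec_def cart_eq_inner_axis[symmetric])
    thus ?thesis by (simp add: emeasure_lborel_box_eq)
  qed
  also have "(\<Prod>b\<in>Basis. (un_wo_vec u - un_wo_vec l) \<bullet> b) = (\<Prod>b\<in>Basis. (u - l) \<bullet> b)"
    unfolding prod_Basis_cart by (subst prod_wo_copy[symmetric]) (simp add: un_wo_vec_def of_wo_inverse)
  finally show "emeasure (distr lborel borel (wo_vec :: real^'n \<Rightarrow> _)) (box l u) = ennreal (\<Prod>b\<in>Basis. (u - l) \<bullet> b)" .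
qed simp

text \<open>The derivative is \<open>2 / (y \<bullet> y)\<close> times the reflection in the
  hyperplane orthogonal to \<open>y\<close>.\<close>

lemma cayley_has_derivative:
  fixes e :: "'a::euclidean_space"
  assumes "z + e \<noteq> 0"
  defines "y \<equiv> z + e"
  shows "(cayley e has_derivative (\<lambda>v. (2 / (y \<bullet> y)) *\<^sub>R (v - (2 * (y \<bullet> v) / (y \<bullet> y)) *\<^sub>R y))) (at z within S)"
proof -
  have y: "y \<bullet> y \<noteq> 0" using assms by simp
  have "(cayley e has_derivative (\<lambda>v. (2 / (y \<bullet> y)) *\<^sub>R v + (- (2 * (2 * (y \<bullet> v))) / ((y \<bullet> y) * (y \<bullet> y))) *\<^sub>R y)) (at z within S)"
  proof -
    have d0: "((\<lambda>z. z + e) has_derivative (\<lambda>v. v)) (at z within S)" by (auto intro!: derivative_eq_intros)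
    have "((\<lambda>z. (z + e) \<bullet> (z + e)) has_derivative (\<lambda>v. y \<bullet> v + v \<bullet> y)) (at z within S)"
      using has_derivative_inner[OF d0 d0] by (simp only: y_def)
    moreover have "(\<lambda>v. y \<bullet> v + v \<bullet> y) = (\<lambda>v. 2 * (y \<bullet> v))" by (simp add: fun_eq_iff inner_commute)
    ultimately have d1: "((\<lambda>z. (z + e) \<bullet> (z + e)) has_derivative (\<lambda>v. 2 * (y \<bullet> v))) (at z within S)" by simp
    have d2: "((\<lambda>z. 2 / ((z + e) \<bullet> (z + e))) has_derivative (\<lambda>v. - (2 * (2 * (y \<bullet> v))) / ((y \<bullet> y) * (y \<bullet> y)))) (at z within S)"
      using has_derivative_divide'[OF has_derivative_const d1, of 2] y by (simp add: y_def)
    have "((\<lambda>z. (2 / ((z + e) \<bullet> (z + e))) *\<^sub>R (z + e) - e) has_derivative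
        (\<lambda>v. ((2 / (y \<bullet> y)) *\<^sub>R v + (- (2 * (2 * (y \<bullet> v))) / ((y \<bullet> y) * (y \<bullet> y))) *\<^sub>R y) - 0)) (at z within S)"
      unfolding y_def by (rule has_derivative_diff[OF has_derivative_scaleR[OF d2[unfolded y_def] d0] has_derivative_const])
    thus ?thesis unfolding cayley_def[abs_def] by simp
  qed
  moreover have "(2 / (y \<bullet> y)) *\<^sub>R v + (- (2 * (2 * (y \<bullet> v))) / ((y \<bullet> y) * (y \<bullet> y))) *\<^sub>R y
     = (2 / (y \<bullet> y)) *\<^sub>R (v - (2 * (y \<bullet> v) / (y \<bullet> y)) *\<^sub>R y)" for v
    by (simp add: scaleR_diff_right)
  ultimately show ?thesis by simp
qed

text \<open>Reflections are orthogonal, so only the scalar factor contributes to the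
  determinant.\<close>

lemma cayley_jacobian:
  fixes y :: "real^'m::{finite,wellorder}"
  assumes "y \<noteq> 0"
  shows "\<bar>det (matrix (\<lambda>v. (2 / (y \<bullet> y)) *\<^sub>R (v - (2 * (y \<bullet> v) / (y \<bullet> y)) *\<^sub>R y)))\<bar> = (2 / (y \<bullet> y)) ^ CARD('m)"
proof -
  define R where "R v = v - (2 * (y \<bullet> v) / (y \<bullet> y)) *\<^sub>R y" for v
  have y: "y \<bullet> y > 0" using assms by simp
  have lin: "linear R" by (rule linearI) (auto simp: R_def inner_simps algebra_simps add_divide_distrib)
  have "R v \<bullet> R v = v \<bullet> v" for v
    unfolding R_def using y by (simp add: inner_simps inner_commute field_simps power2_eq_square)
  hence "orthogonal_transformation R" using lin by (simp add: orthogonal_transformation norm_eq_sqrt_inner)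
  hence "orthogonal_matrix (matrix R)" by (simp add: orthogonal_transformation_matrix)
  hence d: "\<bar>det (matrix R)\<bar> = 1" using det_orthogonal_matrix by fastforce
  have "matrix (\<lambda>v. (2 / (y \<bullet> y)) *\<^sub>R R v) = matrix ((*\<^sub>R) (2 / (y \<bullet> y))) ** matrix R"
    using matrix_compose[OF lin, of "(*\<^sub>R) (2 / (y \<bullet> y))"] by (simp add: o_def linear_scale_self)
  hence "\<bar>det (matrix (\<lambda>v. (2 / (y \<bullet> y)) *\<^sub>R R v))\<bar> = \<bar>(2 / (y \<bullet> y)) ^ CARD('m)\<bar>"
    using d by (simp add: det_mul abs_mult det_matrix_scaleR)
  thus ?thesis using y by (simp add: R_def)
qed

lemma cayley_measurable[measurable]: "cayley e \<in> borel_measurable borel"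
  unfolding cayley_def[abs_def] by measurable

lemma emeasure_cayley_wo:
  fixes e :: "real^'m::{finite,wellorder}"
  assumes e: "norm e = 1" and B[measurable]: "B \<in> sets borel" and Bb: "B \<subseteq> ball 0 1"
  shows "emeasure lborel B = (\<integral>\<^sup>+z. ennreal ((2 / ((z + e) \<bullet> (z + e))) ^ CARD('m)) * indicator {z. 0 < z \<bullet> e \<and> cayley e z \<in> B} z \<partial>lborel)"
proof -
  define S where "S = {z. 0 < z \<bullet> e \<and> cayley e z \<in> B}"
  have Sm[measurable]: "S \<in> sets borel" unfolding S_def by measurable
  have nz: "z + e \<noteq> 0" if "z \<in> S" for z using that half_space_add_nz[OF e] by (auto simp: S_def)
  have im: "cayley e ` S = B"
  proof (intro equalityI subsetI)
    fix x assume x: "x \<in> B"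
    hence "norm x < 1" using Bb by auto
    hence "cayley e (cayley e x) = x" "0 < cayley e x \<bullet> e" using cayley_cayley[OF ball_add_nz[OF e]] cayley_in_half_space[OF e] by auto
    thus "x \<in> cayley e ` S" using x by (auto simp: S_def intro!: image_eqI[of _ _ "cayley e x"])
  qed (auto simp: S_def)
  have inj: "inj_on (cayley e) S" by (rule inj_on_inverseI[of _ "cayley e"]) (use cayley_cayley nz in auto)
  let ?J = "\<lambda>z. (2 / ((z + e) \<bullet> (z + e))) ^ CARD('m)"
  have bb: "bounded B" using Bb bounded_ball bounded_subset by blast
  have Bl: "B \<in> lmeasurable" using bb B by (intro bounded_set_imp_lmeasurable) auto
  let ?f' = "\<lambda>z v. (2 / ((z + e) \<bullet> (z + e))) *\<^sub>R (v - (2 * ((z + e) \<bullet> v) / ((z + e) \<bullet> (z + e))) *\<^sub>R (z + e))"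
  have "((\<lambda>x. \<bar>det (matrix (?f' x))\<bar>) has_integral measure lebesgue B) S"
  proof (rule has_measure_differentiable_image[THEN iffD1])
    show "S \<in> sets lebesgue" using Sm by auto
    show "(cayley e has_derivative ?f' x) (at x within S)" if "x \<in> S" for x by (rule cayley_has_derivative[OF nz[OF that]])
  qed (use inj im Bl in auto)
  hence "(?J has_integral measure lebesgue B) S"
    by (rule has_integral_eq[rotated]) (use cayley_jacobian[OF nz] in simp)
  hence hi: "((\<lambda>z. if z \<in> S then ?J z else 0) has_integral measure lebesgue B) UNIV" by (simp only: has_integral_restrict_UNIV)
  have "(\<integral>\<^sup>+z. ennreal (if z \<in> S then ?J z else 0) \<partial>lborel) = ennreal (measure lebesgue B)"
  proof (rule nn_integral_has_integral_lborel[OF _ _ hi])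
    show "(\<lambda>z. if z \<in> S then ?J z else 0) \<in> borel_measurable borel" by measurable
  qed auto
  also have "(\<integral>\<^sup>+z. ennreal (if z \<in> S then ?J z else 0) \<partial>lborel) = (\<integral>\<^sup>+z. ennreal (?J z) * indicator S z \<partial>lborel)"
    by (intro nn_integral_cong) (auto simp: indicator_def)
  also have "ennreal (measure lebesgue B) = emeasure lborel B"
  proof -
    have "ennreal (measure lebesgue B) = emeasure lebesgue B" by (rule emeasure_eq_measure2[OF Bl, symmetric])
    also have "\<dots> = emeasure lborel B" using B by simp
    finally show ?thesis .
  qed
  finally show ?thesis by (simp add: S_def)
qed

text \<open>The renaming of coordinates \<open>wo_vec\<close> is an isometry that preserves Lebesgue
  measure and commutes with the Cayley map, so the formula carries over.\<close>

lemma emeasure_cayley: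
  fixes e :: "real^'n::finite"
  assumes e: "norm e = 1" and B[measurable]: "B \<in> sets borel" and Bb: "B \<subseteq> ball 0 1"
  shows "emeasure lborel B = (\<integral>\<^sup>+z. ennreal ((2 / ((z + e) \<bullet> (z + e))) ^ CARD('n)) * indicator {z. 0 < z \<bullet> e \<and> cayley e z \<in> B} z \<partial>lborel)"
proof -
  define B' where "B' = un_wo_vec -` B"
  have um[measurable]: "un_wo_vec \<in> borel_measurable (borel :: (real^('n wo_copy)) measure)"
  proof -
    have "linear (un_wo_vec :: _ \<Rightarrow> real^'n)" by (rule linearI) (auto simp: un_wo_vec_def vec_eq_iff)
    thus ?thesis by (intro borel_measurable_continuous_onI linear_continuous_on) (simp add: linear_conv_bounded_linear)
  qed
  have B'm[measurable]: "B' \<in> sets borel" unfolding B'_def using measurable_sets_borel[OF um B] by simp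
  have B'b: "B' \<subseteq> ball 0 1" using Bb by (auto simp: B'_def) (metis norm_wo_vec un_wo_vec_wo_vec(2) mem_ball_0 subsetD)
  have eq: "wo_vec x \<in> B' \<longleftrightarrow> x \<in> B" for x by (simp add: B'_def)
  have "emeasure lborel B = emeasure lborel (wo_vec -` B' \<inter> space (lborel :: (real^'n) measure))"
    by (rule arg_cong[where f = "emeasure lborel"]) (auto simp: eq)
  also have "\<dots> = emeasure (distr lborel borel wo_vec) B'" by (rule emeasure_distr[symmetric]) auto
  also have "\<dots> = emeasure lborel B'" by (simp add: distr_lborel_wo_vec)
  also have "\<dots> = (\<integral>\<^sup>+z. ennreal ((2 / ((z + wo_vec e) \<bullet> (z + wo_vec e))) ^ CARD('n wo_copy)) * indicator {z. 0 < z \<bullet> wo_vec e \<and> cayley (wo_vec e) z \<in> B'} z \<partial>lborel)"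
    by (rule emeasure_cayley_wo[OF _ B'm B'b]) (simp add: norm_wo_vec e)
  also have "\<dots> = (\<integral>\<^sup>+z. ennreal ((2 / ((z + wo_vec e) \<bullet> (z + wo_vec e))) ^ CARD('n wo_copy)) * indicator {z. 0 < z \<bullet> wo_vec e \<and> cayley (wo_vec e) z \<in> B'} z \<partial>distr lborel borel (wo_vec :: real^'n \<Rightarrow> _))"
    by (simp add: distr_lborel_wo_vec)
  also have "\<dots> = (\<integral>\<^sup>+z. ennreal ((2 / ((wo_vec z + wo_vec e) \<bullet> (wo_vec z + wo_vec e))) ^ CARD('n wo_copy)) * indicator {z. 0 < z \<bullet> wo_vec e \<and> cayley (wo_vec e) z \<in> B'} (wo_vec z) \<partial>lborel)"
    by (rule nn_integral_distr) measurable
  also have "\<dots> = (\<integral>\<^sup>+z. ennreal ((2 / ((z + e) \<bullet> (z + e))) ^ CARD('n)) * indicator {z. 0 < z \<bullet> e \<and> cayley e z \<in> B} z \<partial>lborel)"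
    by (intro nn_integral_cong) (simp add: wo_vec_linear(1)[symmetric] wo_vec_inner cayley_wo_vec eq card_wo_copy indicator_def)
  finally show ?thesis .
qed

lemma nn_integral_cayley:
  fixes e :: "real^'n::finite" and f :: "real^'n \<Rightarrow> ennreal"
  assumes e: "norm e = 1" and f[measurable]: "f \<in> borel_measurable borel"
  shows "(\<integral>\<^sup>+x. f x * indicator (ball 0 1) x \<partial>lborel)
     = (\<integral>\<^sup>+z. f (cayley e z) * ennreal ((2 / ((z + e) \<bullet> (z + e))) ^ CARD('n)) * indicator {z. 0 < z \<bullet> e} z \<partial>lborel)"
proof -
  let ?J = "\<lambda>z. ennreal ((2 / ((z + e) \<bullet> (z + e))) ^ CARD('n)) * indicator {z. 0 < z \<bullet> e} z"
  let ?M1 = "density lborel (indicator (ball 0 1)) :: (real^'n) measure"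
  let ?M2 = "distr (density lborel ?J) borel (cayley e)"
  have [measurable]: "ball (0::real^'n) 1 \<in> sets borel" by simp
  have im: "(indicator (ball 0 1) :: real^'n \<Rightarrow> ennreal) \<in> borel_measurable lborel" by measurable
  have "?M1 = ?M2"
  proof (rule measure_eqI)
    fix A assume "A \<in> sets ?M1"
    hence A[measurable]: "A \<in> sets borel" by simp
    have "emeasure ?M1 A = (\<integral>\<^sup>+x. indicator (ball 0 1) x * indicator A x \<partial>lborel)"
      by (rule emeasure_density[OF im]) simp
    also have "\<dots> = (\<integral>\<^sup>+x. indicator (A \<inter> ball 0 1) x \<partial>lborel)"
      by (intro nn_integral_cong) (auto simp: indicator_def)
    also have "\<dots> = emeasure lborel (A \<inter> ball 0 1)" by simp
    also have "\<dots> = (\<integral>\<^sup>+z. ennreal ((2 / ((z + e) \<bullet> (z + e))) ^ CARD('n)) * indicator {z. 0 < z \<bullet> e \<and> cayley e z \<in> A \<inter> ball 0 1} z \<partial>lborel)"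
      by (rule emeasure_cayley[OF e]) auto
    also have "\<dots> = (\<integral>\<^sup>+z. ?J z * indicator (cayley e -` A \<inter> space (density lborel ?J)) z \<partial>lborel)"
      by (intro nn_integral_cong) (auto simp: indicator_def cayley_in_ball[OF e])
    also have "\<dots> = emeasure (density lborel ?J) (cayley e -` A \<inter> space (density lborel ?J))"
      by (rule emeasure_density[symmetric]) (auto intro!: measurable_sets_borel[OF cayley_measurable])
    also have "\<dots> = emeasure ?M2 A" by (rule emeasure_distr[symmetric]) auto
    finally show "emeasure ?M1 A = emeasure ?M2 A" .
  qed simp
  hence "integral\<^sup>N ?M1 f = integral\<^sup>N ?M2 f" by simp
  also have "\<dots> = (\<integral>\<^sup>+z. f (cayley e z) \<partial>density lborel ?J)" by (rule nn_integral_distr) measurable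
  also have "\<dots> = (\<integral>\<^sup>+z. ?J z * f (cayley e z) \<partial>lborel)" by (rule nn_integral_density) measurable
  also have "integral\<^sup>N ?M1 f = (\<integral>\<^sup>+x. indicator (ball 0 1) x * f x \<partial>lborel)" by (rule nn_integral_density[OF im]) simp
  finally show ?thesis by (simp add: mult_ac)
qed

text \<open>The density of the ball at \<open>cayley e z\<close> times the Jacobian collapses to
  \<open>1 / (z \<bullet> e) ^ n\<close>. Since \<open>f\<close> is Borel, the integral against the
  completed measure equals the Borel one.\<close>

lemma nn_integral_hyp_vol:
  fixes e :: "real^'n::finite" and f :: "real^'n \<Rightarrow> ennreal"
  assumes e: "norm e = 1" and f[measurable]: "f \<in> borel_measurable borel"
  shows "(\<integral>\<^sup>+x. f x \<partial>hyp_vol TYPE('n)) = (\<integral>\<^sup>+z. f (cayley e z) \<partial>half_vol e)"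
proof -
  let ?r = "\<lambda>x::real^'n. ennreal ((2 / (1 - (norm x)\<^sup>2)) ^ CARD('n))"
  have [measurable]: "ball (0::real^'n) 1 \<in> sets borel" by simp
  have "(\<integral>\<^sup>+x. f x \<partial>hyp_vol TYPE('n)) = (\<integral>\<^sup>+x. (indicator (ball 0 1) x * ?r x) * f x \<partial>lebesgue)"
    unfolding hyp_vol_def by (rule nn_integral_density) (rule measurable_completion, measurable)+
  also have "\<dots> = (\<integral>\<^sup>+x. (indicator (ball 0 1) x * ?r x) * f x \<partial>lborel)"
    by (rule nn_integral_completion) measurable
  also have "\<dots> = (\<integral>\<^sup>+x. (?r x * f x) * indicator (ball 0 1) x \<partial>lborel)" by (intro nn_integral_cong) (simp add: mult_ac)
  also have "\<dots> = (\<integral>\<^sup>+z. (?r (cayley e z) * f (cayley e z)) * ennreal ((2 / ((z + e) \<bullet> (z + e))) ^ CARD('n)) * indicator {z. 0 < z \<bullet> e} z \<partial>lborel)"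
    by (rule nn_integral_cayley[OF e, of "\<lambda>x. ?r x * f x"]) measurable
  also have "\<dots> = (\<integral>\<^sup>+z. (indicator {z. 0 < z \<bullet> e} z * ennreal (1 / (z \<bullet> e) ^ DIM(real^'n))) * f (cayley e z) \<partial>lborel)"
  proof (rule nn_integral_cong)
    fix z :: "real^'n"
    show "(?r (cayley e z) * f (cayley e z)) * ennreal ((2 / ((z + e) \<bullet> (z + e))) ^ CARD('n)) * indicator {z. 0 < z \<bullet> e} z
       = (indicator {z. 0 < z \<bullet> e} z * ennreal (1 / (z \<bullet> e) ^ DIM(real^'n))) * f (cayley e z)"
    proof (cases "0 < z \<bullet> e")
      case True
      have y: "(z + e) \<bullet> (z + e) > 0" using half_space_add_nz[OF e True] by simp
      have o: "1 - (norm (cayley e z))\<^sup>2 = 4 * (z \<bullet> e) / ((z + e) \<bullet> (z + e))"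
        using cayley_one_minus_norm[OF e half_space_add_nz[OF e True]] by (simp add: power2_norm_eq_inner)
      have "ennreal ((2 / (1 - (norm (cayley e z))\<^sup>2)) ^ CARD('n)) * ennreal ((2 / ((z + e) \<bullet> (z + e))) ^ CARD('n))
         = ennreal ((2 / (4 * (z \<bullet> e) / ((z + e) \<bullet> (z + e))) * (2 / ((z + e) \<bullet> (z + e)))) ^ CARD('n))"
        unfolding o power_mult_distrib using True y by (intro ennreal_mult[symmetric]) auto
      also have "2 / (4 * (z \<bullet> e) / ((z + e) \<bullet> (z + e))) * (2 / ((z + e) \<bullet> (z + e))) = 1 / (z \<bullet> e)"
        using True y by (simp add: field_simps)
      finally have "?r (cayley e z) * ennreal ((2 / ((z + e) \<bullet> (z + e))) ^ CARD('n)) = ennreal (1 / (z \<bullet> e) ^ CARD('n))"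
        by (simp add: power_divide)
      thus ?thesis using True by (simp add: mult_ac)
    qed simp
  qed
  also have "\<dots> = (\<integral>\<^sup>+z. f (cayley e z) \<partial>half_vol e)"
    unfolding half_vol_def by (rule nn_integral_density[symmetric]) measurable
  finally show ?thesis .
qed

section \<open>Energy bounds by weights on the levels\<close>

text \<open>The weight from \<open>bliss_dual\<close> is merely Borel, so the Lipschitz restriction
  has to go. Both sides are integrals of \<open>h\<close> against measures on the line; these are
  compared on open sets through Lipschitz functions increasing to the indicator, on Borel sets by
  outer regularity, and on functions by the layer cake formula. \<open>gfin\<close> makes the
  measures finite, as regularity requires.\<close>

lemma coarea_half_space:
  fixes k :: "'a::euclidean_space" and w g :: "'a \<Rightarrow> real" and h :: "real \<Rightarrow> real"
  assumes k: "k \<in> Basis" and n2: "2 \<le> DIM('a)" and p: "2 * real DIM('a) / (real DIM('a) - 1) \<le> p"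
    and w: "continuous_on UNIV w" "\<And>x. 0 \<le> w x" and w0: "\<And>x. w x \<noteq> 0 \<Longrightarrow> c \<le> x \<bullet> k \<and> norm x \<le> R" and c: "0 < c"
    and g[measurable]: "g \<in> borel_measurable borel" and g0: "\<And>x. 0 \<le> g x" and gG: "\<And>x. g x \<le> G"
    and gfin: "(\<integral>\<^sup>+x. ennreal (g x) \<partial>half_vol k) < \<infinity>"
    and grad: "\<And>\<eta>. 0 < \<eta> \<Longrightarrow> \<exists>\<epsilon>0>0. \<forall>\<epsilon> x z. 0 < \<epsilon> \<longrightarrow> \<epsilon> < \<epsilon>0 \<longrightarrow> 0 < x \<bullet> k \<longrightarrow> norm (z - x) \<le> \<epsilon> * (x \<bullet> k)
         \<longrightarrow> w x - w z \<le> \<epsilon> * (g z + \<eta>)"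
    and h[measurable]: "h \<in> borel_measurable borel" and h0: "\<And>t. 0 \<le> h t"
  defines "\<nu> \<equiv> \<lambda>t. enn2real (emeasure (half_vol k) {x. t < w x})"
  shows "(\<integral>\<^sup>+t. ennreal (h t) * ennreal (iso_profile DIM('a) p (\<nu> t)) * indicator {0..} t \<partial>lborel)
     \<le> (\<integral>\<^sup>+x. ennreal (h (w x)) * ennreal (g x) \<partial>half_vol k)"
proof -
  interpret S: sigma_finite_measure "half_vol k" by (rule sigma_finite_half_vol)
  have sh[measurable_cong, simp]: "sets (half_vol k) = sets borel" by (simp add: half_vol_def)
  have sp[simp]: "space (half_vol k) = UNIV" by (simp add: half_vol_def)
  have wm[measurable]: "w \<in> borel_measurable borel" by (rule borel_measurable_continuous_onI[OF w(1)])
  have em: "(\<lambda>t. emeasure (half_vol k) {x\<in>space (half_vol k). t < w x}) \<in> borel_measurable borel" by measurable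
  have \<nu>m[measurable]: "\<nu> \<in> borel_measurable borel" unfolding \<nu>_def using measurable_compose[OF em, of enn2real borel] by simp
  have [measurable]: "(\<lambda>t. iso_profile DIM('a) p (\<nu> t)) \<in> borel_measurable borel" unfolding iso_profile_def by measurable
  define M1 where "M1 = distr (density (half_vol k) (\<lambda>x. ennreal (g x))) borel w"
  define M2 where "M2 = density lborel (\<lambda>t. ennreal (iso_profile DIM('a) p (\<nu> t)) * indicator {0..} t)"
  have s1[measurable_cong, simp]: "sets M1 = sets borel" "sets M2 = sets borel" by (auto simp: M1_def M2_def)
  have sp1[simp]: "space M1 = UNIV" "space M2 = UNIV" by (auto simp: M1_def M2_def)
  have i1: "integral\<^sup>N M1 f = (\<integral>\<^sup>+x. f (w x) * ennreal (g x) \<partial>half_vol k)" if [measurable]: "f \<in> borel_measurable borel" for f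
    unfolding M1_def by (subst nn_integral_distr, simp, simp, subst nn_integral_density) (auto simp: mult.commute)
  have i2: "integral\<^sup>N M2 f = (\<integral>\<^sup>+t. f t * ennreal (iso_profile DIM('a) p (\<nu> t)) * indicator {0..} t \<partial>lborel)" if [measurable]: "f \<in> borel_measurable borel" for f
    unfolding M2_def by (subst nn_integral_density) (auto simp: mult_ac)
  have lip: "integral\<^sup>N M2 (\<lambda>t. ennreal (f t)) \<le> integral\<^sup>N M1 (\<lambda>t. ennreal (f t))"
    if [measurable]: "f \<in> borel_measurable borel" and f: "\<And>t. 0 \<le> f t" "\<And>t. f t \<le> 1" "\<And>s t. \<bar>f s - f t\<bar> \<le> L * \<bar>s - t\<bar>" for f L
  proof -
    have "(\<integral>\<^sup>+t. ennreal (f t) * ennreal (iso_profile DIM('a) p (\<nu> t)) * indicator {0..} t \<partial>lborel) \<le> (\<integral>\<^sup>+x. ennreal (f (w x) * g x) \<partial>half_vol k)"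
      unfolding \<nu>_def by (rule coarea_half_space_lipschitz[OF k n2 p w w0 c g g0 gG grad that(1) f])
    also have "\<dots> = (\<integral>\<^sup>+x. ennreal (f (w x)) * ennreal (g x) \<partial>half_vol k)"
      using f g0 by (intro nn_integral_cong) (auto simp: ennreal_mult)
    finally show ?thesis by (simp add: i1 i2)
  qed
  have op: "emeasure M2 U \<le> emeasure M1 U" if U: "open U" for U
  proof (cases "U = UNIV")
    case True
    have "integral\<^sup>N M2 (\<lambda>t. ennreal 1) \<le> integral\<^sup>N M1 (\<lambda>t. ennreal 1)" by (rule lip[of _ 0]) auto
    thus ?thesis using True by simp
  next
    case False
    define f where "f i t = min 1 (real i * infdist t (- U))" for i :: nat and t
    have cl: "closed (- U)" "- U \<noteq> {}" using U False by auto
    have "continuous_on UNIV (f i)" for i unfolding f_def by (intro continuous_intros continuous_on_infdist)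
    hence fm[measurable]: "f i \<in> borel_measurable borel" for i by (rule borel_measurable_continuous_onI)
    have lf: "\<bar>f i s - f i t\<bar> \<le> real i * \<bar>s - t\<bar>" for i s t
    proof -
      have "\<bar>f i s - f i t\<bar> \<le> \<bar>real i * infdist s (- U) - real i * infdist t (- U)\<bar>" by (auto simp: f_def min_def abs_if)
      also have "\<dots> = real i * \<bar>infdist s (- U) - infdist t (- U)\<bar>" by (simp add: right_diff_distrib[symmetric] abs_mult)
      also have "\<dots> \<le> real i * \<bar>s - t\<bar>"
        using infdist_triangle_abs[of s "- U" t] by (intro mult_left_mono) (auto simp: dist_real_def)
      finally show ?thesis .
    qed
    have sup: "(SUP i. ennreal (f i t)) = indicator U t" for t
    proof (cases "t \<in> U")
      case True
      hence "infdist t (- U) > 0" using in_closed_iff_infdist_zero[OF cl] infdist_nonneg[of t "- U"] by fastforce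
      then obtain i where "1 < real i * infdist t (- U)" using reals_Archimedean3 by blast
      hence "ennreal (f i t) = 1" by (simp add: f_def)
      hence "1 \<le> (SUP i. ennreal (f i t))" by (metis SUP_upper UNIV_I)
      moreover have "(SUP i. ennreal (f i t)) \<le> 1" by (intro SUP_least) (auto simp: f_def)
      ultimately show ?thesis using True by simp
    next
      case False
      hence "infdist t (- U) = 0" by simp
      thus ?thesis using False by (simp add: f_def)
    qed
    have inc: "incseq (\<lambda>i t. ennreal (f i t))"
      unfolding f_def by (intro incseq_SucI le_funI ennreal_leI min.mono order_refl mult_right_mono infdist_nonneg) simp
    have "emeasure M2 U = (\<integral>\<^sup>+t. (SUP i. ennreal (f i t)) \<partial>M2)" using U by (simp add: sup)
    also have "\<dots> = (SUP i. \<integral>\<^sup>+t. ennreal (f i t) \<partial>M2)"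
      by (rule nn_integral_monotone_convergence_SUP[OF inc]) measurable
    also have "\<dots> \<le> emeasure M1 U"
    proof (rule SUP_least)
      fix i
      have "(\<integral>\<^sup>+t. ennreal (f i t) \<partial>M2) \<le> (\<integral>\<^sup>+t. ennreal (f i t) \<partial>M1)"
        by (rule lip[of _ "real i", OF fm]) (auto simp: f_def infdist_nonneg lf[unfolded f_def])
      also have "\<dots> \<le> (\<integral>\<^sup>+t. indicator U t \<partial>M1)"
      proof (rule nn_integral_mono)
        fix t show "ennreal (f i t) \<le> indicator U t" unfolding sup[symmetric] by (rule SUP_upper) simp
      qed
      also have "\<dots> = emeasure M1 U" using U by simp
      finally show "(\<integral>\<^sup>+t. ennreal (f i t) \<partial>M2) \<le> emeasure M1 U" .
    qed
    finally show ?thesis .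
  qed
  have fin1: "emeasure M1 (space M1) \<noteq> \<infinity>"
  proof -
    have "emeasure M1 (space M1) = (\<integral>\<^sup>+t. indicator UNIV t \<partial>M1)" by (subst nn_integral_indicator) auto
    also have "\<dots> = (\<integral>\<^sup>+x. ennreal (g x) \<partial>half_vol k)" by (subst i1) auto
    finally show ?thesis using gfin by simp
  qed
  have fin2: "emeasure M2 (space M2) \<noteq> \<infinity>" using op[of UNIV] fin1 by (auto simp: top_unique)
  have bo: "emeasure M2 B \<le> emeasure M1 B" if B: "B \<in> sets borel" for B
  proof -
    have "emeasure M1 B = (INF U \<in> {U. B \<subseteq> U \<and> open U}. emeasure M1 U)"
      by (rule outer_regular) (use fin1 B in auto)
    moreover have "emeasure M2 B \<le> (INF U \<in> {U. B \<subseteq> U \<and> open U}. emeasure M1 U)"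
    proof (rule INF_greatest)
      fix U assume "U \<in> {U. B \<subseteq> U \<and> open U}"
      hence "emeasure M2 B \<le> emeasure M2 U" "open U" by (auto intro!: emeasure_mono)
      thus "emeasure M2 B \<le> emeasure M1 U" using op[of U] by simp
    qed
    ultimately show ?thesis by simp
  qed
  have "integral\<^sup>N M2 (\<lambda>t. ennreal (h t)) \<le> integral\<^sup>N M1 (\<lambda>t. ennreal (h t))"
  proof -
    interpret F1: finite_measure M1 by (rule finite_measureI[OF fin1])
    interpret F2: finite_measure M2 by (rule finite_measureI[OF fin2])
    note sf = F1.sigma_finite_measure_axioms F2.sigma_finite_measure_axioms
    have "integral\<^sup>N M2 (\<lambda>t. ennreal (h t)) = (\<integral>\<^sup>+t. indicator {0..} t * emeasure M2 {x\<in>space M2. t < h x} \<partial>lborel)"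
      by (rule nn_integral_eq_superlevel[OF sf(2) _ h0]) simp
    also have "\<dots> \<le> (\<integral>\<^sup>+t. indicator {0..} t * emeasure M1 {x\<in>space M1. t < h x} \<partial>lborel)"
      by (intro nn_integral_mono mult_left_mono) (auto intro!: bo)
    also have "\<dots> = integral\<^sup>N M1 (\<lambda>t. ennreal (h t))"
      by (rule nn_integral_eq_superlevel[OF sf(1) _ h0, symmetric]) simp
    finally show ?thesis .
  qed
  thus ?thesis by (simp add: i1 i2)
qed

text \<open>Linearization of \<open>g powr p\<close>: for each \<open>a\<close> a lower bound that
  is linear in \<open>g\<close>, with equality at \<open>g = a\<close>.\<close>

lemma young_powr:
  fixes a g p :: real
  assumes "1 < p" "0 \<le> a" "0 \<le> g"
  shows "p * (a powr (p - 1) * g) \<le> g powr p + (p - 1) * a powr p"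
proof (cases "a = 0 \<or> g = 0")
  case False
  hence pos: "0 < a" "0 < g" using assms by auto
  have "(a powr p) powr ((p - 1) / p) * (g powr p) powr (1 / p) \<le> (p - 1) / p * (a powr p) + 1 / p * (g powr p)"
    using assms pos by (intro Youngs_inequality_0) (auto simp: field_simps)
  hence "a powr (p - 1) * g \<le> (p - 1) / p * (a powr p) + 1 / p * (g powr p)" using pos assms by (simp add: powr_powr)
  hence "p * (a powr (p - 1) * g) \<le> p * ((p - 1) / p * (a powr p) + 1 / p * (g powr p))" using assms by (intro mult_left_mono) auto
  also have "\<dots> = g powr p + (p - 1) * a powr p" using assms by (simp add: distrib_left)
  finally show ?thesis .
qed (use assms in auto)

text \<open>Both pairs are normalized by their \<open>l^p\<close> norms; then Young's inequality in
  each coordinate adds up to the claim.\<close>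

lemma holder_two:
  fixes a b x y p :: real
  assumes p: "1 < p" and nn: "0 \<le> a" "0 \<le> b" "0 \<le> x" "0 \<le> y"
  shows "a powr (p - 1) * x + b powr (p - 1) * y
     \<le> ((a powr p + b powr p) powr (1 / p)) powr (p - 1) * (x powr p + y powr p) powr (1 / p)"
proof -
  define A where "A = (a powr p + b powr p) powr (1 / p)"
  define X where "X = (x powr p + y powr p) powr (1 / p)"
  have A: "A powr p = a powr p + b powr p" and X: "X powr p = x powr p + y powr p"
    using p by (auto simp: A_def X_def powr_powr)
  show ?thesis
  proof (cases "A = 0 \<or> X = 0")
    case True
    have "a powr p + b powr p = 0 \<or> x powr p + y powr p = 0" using True A X p by auto
    hence "(a powr p = 0 \<and> b powr p = 0) \<or> (x powr p = 0 \<and> y powr p = 0)"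
      using powr_ge_zero[of a p] powr_ge_zero[of b p] powr_ge_zero[of x p] powr_ge_zero[of y p] by linarith
    hence "(a = 0 \<and> b = 0) \<or> (x = 0 \<and> y = 0)" by auto
    thus ?thesis by auto
  next
    case False
    hence pos: "0 < A" "0 < X" by (auto simp: A_def X_def order.strict_iff_order)
    have "p * ((a / A) powr (p - 1) * (x / X)) \<le> (x / X) powr p + (p - 1) * (a / A) powr p"
      "p * ((b / A) powr (p - 1) * (y / X)) \<le> (y / X) powr p + (p - 1) * (b / A) powr p"
      by (rule young_powr; use p nn pos in simp)+
    hence "p * ((a / A) powr (p - 1) * (x / X) + (b / A) powr (p - 1) * (y / X))
      \<le> (x powr p + y powr p) / X powr p + (p - 1) * ((a powr p + b powr p) / A powr p)"
      using pos nn by (simp add: powr_divide add_divide_distrib algebra_simps)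
    also have "\<dots> = p" unfolding A[symmetric] X[symmetric] using pos by simp
    finally have "(a / A) powr (p - 1) * (x / X) + (b / A) powr (p - 1) * (y / X) \<le> 1" using p by simp
    hence "(a powr (p - 1) * x + b powr (p - 1) * y) / (A powr (p - 1) * X) \<le> 1"
      using pos nn by (simp add: powr_divide add_divide_distrib)
    thus ?thesis using pos by (simp add: A_def[symmetric] X_def[symmetric] pos_divide_le_eq)
  qed
qed

text \<open>Young's inequality with \<open>a = (a1 powr p + a2 powr p) powr (1 / p)\<close>, coarea,
  and \<open>holder_two\<close>, which pairs \<open>a1\<close> and \<open>a2\<close> with the two
  parts of \<open>iso_profile\<close>. \<open>a1\<close> is the weight of \<open>bliss_dual\<close>,
  whereas \<open>a2\<close> stays free for Hardy's inequality. The energy of \<open>a1\<close>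
  occurs on both sides and cancels because it is finite.\<close>

lemma half_space_sobolev:
  fixes k :: "'a::euclidean_space" and w g :: "'a \<Rightarrow> real" and a2 :: "real \<Rightarrow> real" and p :: real
  defines "n \<equiv> DIM('a)"
  assumes k: "k \<in> Basis" and n2: "2 \<le> n" and p: "2 * real n / (real n - 1) \<le> p" "p < n"
    and w: "continuous_on UNIV w" "\<And>x. 0 \<le> w x" and wU: "\<And>x. w x \<le> U" and w0: "\<And>x. w x \<noteq> 0 \<Longrightarrow> c \<le> x \<bullet> k \<and> norm x \<le> R" and c: "0 < c"
    and g[measurable]: "g \<in> borel_measurable borel" and g0: "\<And>x. 0 \<le> g x" and gG: "\<And>x. g x \<le> G"
    and gfin: "(\<integral>\<^sup>+x. ennreal (g x) \<partial>half_vol k) < \<infinity>"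
    and grad: "\<And>\<eta>. 0 < \<eta> \<Longrightarrow> \<exists>\<epsilon>0>0. \<forall>\<epsilon> x z. 0 < \<epsilon> \<longrightarrow> \<epsilon> < \<epsilon>0 \<longrightarrow> 0 < x \<bullet> k \<longrightarrow> norm (z - x) \<le> \<epsilon> * (x \<bullet> k)
         \<longrightarrow> w x - w z \<le> \<epsilon> * (g z + \<eta>)"
    and wfin: "emeasure (half_vol k) {x. 0 < w x} < \<infinity>"
  defines "\<nu> \<equiv> \<lambda>t. enn2real (emeasure (half_vol k) {x. t < w x})"
  assumes \<nu>less: "\<And>t. 0 < t \<Longrightarrow> \<nu> t < \<nu> 0"
    and N: "(\<integral>\<^sup>+x. ennreal (w x powr (n * p / (n - p))) \<partial>half_vol k) = ennreal N" "0 < N"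
    and a2[measurable]: "a2 \<in> borel_measurable borel" and a20: "\<And>t. 0 \<le> a2 t"
  shows "ennreal ((n * unit_ball_vol n powr (1 / n) * ((n - n / p) * Beta (n - n / p) (n / p)) powr (1 / n)) powr p
        * (n * (p - 1) / (n - p)) powr (1 - p) * N powr ((n - p) / n))
      + ennreal p * (\<integral>\<^sup>+t. ennreal (a2 t powr (p - 1) * ((real n - 1) * \<nu> t)) * indicator {0<..} t \<partial>lborel)
    \<le> (\<integral>\<^sup>+x. ennreal (g x powr p) \<partial>half_vol k) + ennreal (p - 1) * (\<integral>\<^sup>+x. ennreal (a2 (w x) powr p) \<partial>half_vol k)"
proof -
  have sh[measurable_cong, simp]: "sets (half_vol k) = sets borel" by (simp add: half_vol_def)
  have sp[simp]: "space (half_vol k) = UNIV" by (simp add: half_vol_def)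
  have wm[measurable]: "w \<in> borel_measurable borel" by (rule borel_measurable_continuous_onI[OF w(1)])
  have p2: "2 < p"
  proof -
    have "2 * (real n - 1) < 2 * real n" by simp
    hence "2 < 2 * real n / (real n - 1)" using n2 by (simp add: less_divide_eq)
    thus ?thesis using p by simp
  qed
  have pA: "1 < n - n / p"
  proof -
    have "real n / p < real n / 2" using p2 n2 by (intro divide_strict_left_mono) auto
    thus ?thesis using n2 by simp
  qed
  interpret S: sigma_finite_measure "half_vol k" by (rule sigma_finite_half_vol)
  have \<nu>eq: "\<nu> = (\<lambda>t. enn2real (emeasure (half_vol k) {x \<in> space (half_vol k). t < w x}))" by (simp add: \<nu>_def)
  let ?P = "\<lambda>t. n * unit_ball_vol n powr (1 / n) * \<nu> t powr ((real n - 1) / n)"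
  let ?S = "ennreal ((n * unit_ball_vol n powr (1 / n) * ((n - n / p) * Beta (n - n / p) (n / p)) powr (1 / n)) powr p
        * (n * (p - 1) / (n - p)) powr (1 - p) * N powr ((n - p) / n))"
  have wm': "w \<in> borel_measurable (half_vol k)" by simp
  have wfin': "emeasure (half_vol k) {x \<in> space (half_vol k). 0 < w x} < \<infinity>" using wfin by simp
  have p1: "1 < p" using p2 by simp
  obtain a1 :: "real \<Rightarrow> real" where a1[measurable]: "a1 \<in> borel_measurable borel" and a10: "\<And>t. 0 \<le> a1 t" and a1z: "a1 0 = 0"
    and I1: "(\<integral>\<^sup>+x. ennreal (a1 (w x) powr p) \<partial>half_vol k) < \<infinity>"
    and B: "?S + ennreal (p - 1) * (\<integral>\<^sup>+x. ennreal (a1 (w x) powr p) \<partial>half_vol k)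
      \<le> ennreal p * (\<integral>\<^sup>+t. ennreal (a1 t powr (p - 1) * ?P t) * indicator {0<..} t \<partial>lborel)"
    using bliss_dual[OF sigma_finite_half_vol wm' w(2) wU n2 p1 p(2) pA wfin' \<nu>less[unfolded \<nu>eq] N] unfolding \<nu>eq by blast
  have \<nu>0: "0 \<le> \<nu> t" for t by (simp add: \<nu>_def)
  define a where "a t = (a1 t powr p + a2 t powr p) powr (1 / p)" for t
  have am[measurable]: "a \<in> borel_measurable borel" unfolding a_def by measurable
  have a0: "0 \<le> a t" for t by (simp add: a_def)
  have ap: "a t powr p = a1 t powr p + a2 t powr p" for t using p2 by (simp add: a_def powr_powr)
  have em: "(\<lambda>t. emeasure (half_vol k) {x\<in>space (half_vol k). t < w x}) \<in> borel_measurable borel" by measurable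
  have \<nu>m[measurable]: "\<nu> \<in> borel_measurable borel" unfolding \<nu>_def using measurable_compose[OF em, of enn2real borel] by simp
  let ?I1 = "\<integral>\<^sup>+x. ennreal (a1 (w x) powr p) \<partial>half_vol k" and ?I2 = "\<integral>\<^sup>+x. ennreal (a2 (w x) powr p) \<partial>half_vol k"
  let ?X = "\<integral>\<^sup>+x. ennreal (g x powr p) \<partial>half_vol k"
  let ?Y = "ennreal p * (\<integral>\<^sup>+t. ennreal (a2 t powr (p - 1) * ((real n - 1) * \<nu> t)) * indicator {0<..} t \<partial>lborel)"
  have "(?S + ennreal (p - 1) * ?I1) + ?Y \<le> ennreal p * (\<integral>\<^sup>+t. ennreal (a1 t powr (p - 1) * ?P t) * indicator {0<..} t \<partial>lborel) + ?Y"
    by (intro add_right_mono B)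
  also have "\<dots> = ennreal p * (\<integral>\<^sup>+t. ennreal (a1 t powr (p - 1) * ?P t) * indicator {0<..} t
        + ennreal (a2 t powr (p - 1) * ((real n - 1) * \<nu> t)) * indicator {0<..} t \<partial>lborel)"
    unfolding distrib_left[symmetric] by (subst nn_integral_add) auto
  also have "\<dots> \<le> ennreal p * (\<integral>\<^sup>+t. ennreal (a t powr (p - 1)) * ennreal (iso_profile n p (\<nu> t)) * indicator {0..} t \<partial>lborel)"
  proof (intro mult_left_mono nn_integral_mono)
    fix t
    have "a1 t powr (p - 1) * ?P t + a2 t powr (p - 1) * ((real n - 1) * \<nu> t) \<le> a t powr (p - 1) * iso_profile n p (\<nu> t)"
      unfolding a_def iso_profile_def by (rule holder_two) (use p2 a10 a20 n2 \<nu>0 in auto)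
    hence "ennreal (a1 t powr (p - 1) * ?P t) + ennreal (a2 t powr (p - 1) * ((real n - 1) * \<nu> t)) \<le> ennreal (a t powr (p - 1)) * ennreal (iso_profile n p (\<nu> t))"
      using n2 \<nu>0[of t] iso_profile_nonneg[of n p "\<nu> t"]
      by (subst ennreal_plus[symmetric], simp, simp, subst ennreal_mult[symmetric], simp, simp, intro ennreal_leI)
    thus "ennreal (a1 t powr (p - 1) * ?P t) * indicator {0<..} t + ennreal (a2 t powr (p - 1) * ((real n - 1) * \<nu> t)) * indicator {0<..} t
       \<le> ennreal (a t powr (p - 1)) * ennreal (iso_profile n p (\<nu> t)) * indicator {0..} t"
      by (cases "0 < t") (auto simp: indicator_def)
  qed simp
  also have "\<dots> \<le> ennreal p * (\<integral>\<^sup>+x. ennreal (a (w x) powr (p - 1)) * ennreal (g x) \<partial>half_vol k)"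
    unfolding \<nu>_def n_def
    by (intro mult_left_mono coarea_half_space[OF k _ _ w w0 c g g0 gG gfin grad]) (use n2 p in \<open>auto simp: n_def\<close>)
  also have "\<dots> = (\<integral>\<^sup>+x. ennreal (p * (a (w x) powr (p - 1) * g x)) \<partial>half_vol k)"
    using p2 g0 by (subst nn_integral_cmult[symmetric]) (auto simp: ennreal_mult)
  also have "\<dots> \<le> (\<integral>\<^sup>+x. ennreal (g x powr p) + ennreal (p - 1) * (ennreal (a1 (w x) powr p) + ennreal (a2 (w x) powr p)) \<partial>half_vol k)"
  proof (rule nn_integral_mono)
    fix x
    have "ennreal (p * (a (w x) powr (p - 1) * g x)) \<le> ennreal (g x powr p + (p - 1) * a (w x) powr p)"
      by (intro ennreal_leI young_powr) (use p2 a0 g0 in auto)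
    also have "\<dots> = ennreal (g x powr p) + ennreal (p - 1) * (ennreal (a1 (w x) powr p) + ennreal (a2 (w x) powr p))"
      unfolding ap using p2 by (simp add: ennreal_plus ennreal_mult)
    finally show "ennreal (p * (a (w x) powr (p - 1) * g x)) \<le> ennreal (g x powr p) + ennreal (p - 1) * (ennreal (a1 (w x) powr p) + ennreal (a2 (w x) powr p))" .
  qed
  also have "\<dots> = ?X + ennreal (p - 1) * (?I1 + ?I2)"
    by (simp add: nn_integral_add nn_integral_cmult)
  finally have fin: "(?S + ennreal (p - 1) * ?I1) + ?Y \<le> ?X + ennreal (p - 1) * (?I1 + ?I2)" .
  have "ennreal (p - 1) * ?I1 \<noteq> top" using I1 by (simp add: ennreal_mult_eq_top_iff)
  moreover have "ennreal (p - 1) * ?I1 + (?S + ?Y) \<le> ennreal (p - 1) * ?I1 + (?X + ennreal (p - 1) * ?I2)"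
    using fin by (simp add: distrib_left add_ac)
  ultimately show ?thesis by (simp add: ennreal_add_left_cancel_le)
qed

section \<open>Smooth functions and their gradients\<close>

lemma smooth_fun_differentiable: "smooth_fun \<phi> \<Longrightarrow> \<phi> differentiable (at x)"
  unfolding smooth_fun_def by (metis iter_partial.simps(1))

lemma iter_partial_append: "iter_partial (is @ js) f = iter_partial is (iter_partial js f)"
  by (induction "is") auto

lemma smooth_fun_iter_partial: "smooth_fun \<phi> \<Longrightarrow> smooth_fun (iter_partial js \<phi>)"
  unfolding smooth_fun_def iter_partial_append[symmetric] by blast

lemma smooth_fun_continuous: "smooth_fun \<phi> \<Longrightarrow> continuous_on UNIV \<phi>"
  by (auto simp: continuous_on_eq_continuous_at intro!: differentiable_imp_continuous_within smooth_fun_differentiable)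

lemma egrad_nth: "egrad \<phi> x $ i = iter_partial [i] \<phi> x" by (simp add: egrad_def)

lemma egrad_continuous:
  assumes "smooth_fun \<phi>"
  shows "continuous_on UNIV (egrad \<phi>)"
proof -
  have c: "continuous_on UNIV (\<lambda>x. iter_partial [i] \<phi> x)" for i
    using smooth_fun_continuous[OF smooth_fun_iter_partial[OF assms, of "[i]"]] by simp
  have e: "egrad \<phi> = (\<lambda>x. \<chi> i. iter_partial [i] \<phi> x)" by (auto simp: fun_eq_iff vec_eq_iff egrad_nth)
  show ?thesis unfolding e by (intro continuous_on_vec_lambda c)
qed

lemma frechet_derivative_egrad:
  assumes "\<phi> differentiable (at x)"
  shows "frechet_derivative \<phi> (at x) v = egrad \<phi> x \<bullet> v"
proof -
  let ?D = "frechet_derivative \<phi> (at x)"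
  have lin: "linear ?D" using assms by (rule linear_frechet_derivative)
  have "?D v = ?D (\<Sum>i\<in>UNIV. (v $ i) *\<^sub>R axis i 1)"
    using basis_expansion[of v] by (simp add: scalar_mult_eq_scaleR)
  also have "\<dots> = (\<Sum>i\<in>UNIV. (v $ i) * ?D (axis i 1))" by (simp add: linear_sum[OF lin] linear_cmul[OF lin])
  also have "\<dots> = egrad \<phi> x \<bullet> v" by (simp add: inner_vec_def egrad_def mult.commute)
  finally show ?thesis .
qed

lemma egrad_has_derivative:
  assumes "\<phi> differentiable (at x)"
  shows "(\<phi> has_derivative (\<lambda>v. egrad \<phi> x \<bullet> v)) (at x)"
proof -
  have "(\<phi> has_derivative frechet_derivative \<phi> (at x)) (at x)" using assms frechet_derivative_works by blast
  thus ?thesis using frechet_derivative_egrad[OF assms] by (simp add: has_derivative_eq_rhs fun_eq_iff)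
qed

lemma egrad_outside_support:
  assumes "x \<notin> closure {x. \<phi> x \<noteq> 0}"
  shows "egrad \<phi> x = 0"
proof -
  have "(\<phi> has_derivative (\<lambda>_. 0)) (at x)"
    by (rule has_derivative_transform_within_open[of "\<lambda>_. 0" "\<lambda>_. 0" x UNIV "- closure {x. \<phi> x \<noteq> 0}"])
       (use assms closure_subset[of "{x. \<phi> x \<noteq> 0}"] in auto)
  hence "frechet_derivative \<phi> (at x) = (\<lambda>_. 0)" by (rule frechet_derivative_at[symmetric])
  thus ?thesis by (simp add: egrad_def vec_eq_iff)
qed

text \<open>Mean value inequality on the segment; uniform continuity replaces the gradients along it
  by the one at \<open>b\<close>, at the cost of \<open>\<eta>\<close>. The end point
  \<open>b\<close> is singled out because in the coarea hypothesis \<open>g\<close> is evaluated at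
  \<open>z\<close>, the point with the smaller value.\<close>

lemma smooth_fun_uniform_gradient:
  assumes \<phi>: "smooth_fun \<phi>" and \<eta>: "0 < \<eta>"
  shows "\<exists>\<delta>>0. \<forall>a\<in>cball 0 1. \<forall>b\<in>cball 0 1. norm (a - b) < \<delta> \<longrightarrow> \<bar>\<phi> a - \<phi> b\<bar> \<le> (norm (egrad \<phi> b) + \<eta>) * norm (a - b)"
proof -
  have "uniformly_continuous_on (cball 0 1) (egrad \<phi>)"
    by (rule compact_uniformly_continuous[OF continuous_on_subset[OF egrad_continuous[OF \<phi>]]]) auto
  then obtain \<delta> where \<delta>: "0 < \<delta>" "\<And>a b. a \<in> cball 0 1 \<Longrightarrow> b \<in> cball 0 1 \<Longrightarrow> dist a b < \<delta> \<Longrightarrow> dist (egrad \<phi> a) (egrad \<phi> b) < \<eta>"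
    unfolding uniformly_continuous_on_def using \<eta> by metis
  have "\<bar>\<phi> a - \<phi> b\<bar> \<le> (norm (egrad \<phi> b) + \<eta>) * norm (a - b)" if ab: "a \<in> cball 0 1" "b \<in> cball 0 1" "norm (a - b) < \<delta>" for a b
  proof -
    have seg: "closed_segment a b \<subseteq> cball 0 1" using ab by (intro closed_segment_subset) auto
    have "norm (\<phi> a - \<phi> b) \<le> (norm (egrad \<phi> b) + \<eta>) * norm (a - b)"
    proof (rule differentiable_bound[of "closed_segment a b" \<phi> "\<lambda>x v. egrad \<phi> x \<bullet> v"])
      fix x assume x: "x \<in> closed_segment a b"
      show "(\<phi> has_derivative (\<lambda>v. egrad \<phi> x \<bullet> v)) (at x within closed_segment a b)"
        by (rule has_derivative_at_withinI[OF egrad_has_derivative[OF smooth_fun_differentiable[OF \<phi>]]])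
      have "dist x b \<le> dist a b" using x segment_bound(2)[OF x] by (simp add: dist_norm norm_minus_commute)
      hence "dist x b < \<delta>" using ab by (simp add: dist_norm)
      hence "dist (egrad \<phi> x) (egrad \<phi> b) < \<eta>" using x seg ab by (intro \<delta>(2)) auto
      hence n: "norm (egrad \<phi> x) \<le> norm (egrad \<phi> b) + \<eta>"
        using norm_triangle_ineq[of "egrad \<phi> x - egrad \<phi> b" "egrad \<phi> b"] by (simp add: dist_norm)
      show "onorm (\<lambda>v. egrad \<phi> x \<bullet> v) \<le> norm (egrad \<phi> b) + \<eta>"
      proof (rule onorm_le)
        fix v
        have "norm (egrad \<phi> x \<bullet> v) \<le> norm (egrad \<phi> x) * norm v" by (simp add: Cauchy_Schwarz_ineq2)
        also have "\<dots> \<le> (norm (egrad \<phi> b) + \<eta>) * norm v" using n by (intro mult_right_mono) auto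
        finally show "norm (egrad \<phi> x \<bullet> v) \<le> (norm (egrad \<phi> b) + \<eta>) * norm v" .
      qed
    qed auto
    thus ?thesis by simp
  qed
  thus ?thesis using \<delta>(1) by blast
qed

lemma half_vol_open_pos:
  fixes S :: "'a::euclidean_space set"
  assumes S: "open S" "S \<noteq> {}" "\<And>z. z \<in> S \<Longrightarrow> 0 < z \<bullet> k"
  shows "0 < emeasure (half_vol k) S"
proof (rule ccontr)
  assume "\<not> ?thesis"
  hence "S \<in> null_sets (half_vol k)" using S by (auto simp: null_sets_def half_vol_def)
  hence "AE x\<in>S in lborel. indicator {x. 0 < x \<bullet> k} x * ennreal (1 / (x \<bullet> k) ^ DIM('a)) = 0"
    unfolding half_vol_def by (subst (asm) null_sets_density_iff) auto
  hence "AE x in lborel. x \<notin> S"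
  proof eventually_elim
    case (elim x)
    show ?case using elim S(3)[of x] by (auto simp: indicator_def)
  qed
  hence "S \<in> null_sets lborel" using S(1) by (subst (asm) AE_iff_null_sets[symmetric]) auto
  hence "negligible S" by (simp add: negligible_iff_null_sets null_sets_completionI)
  thus False using open_not_negligible S by blast
qed

lemma AE_half_vol: "AE z in half_vol k. 0 < z \<bullet> k"
  unfolding half_vol_def by (subst AE_density) (auto simp: indicator_def split: if_splits)

section \<open>Hardy's inequality with remainder and the half-space inequality\<close>

text \<open>The weight \<open>s + \<tau> * s / (1 + s)\<close> perturbs the optimal one in Hardy's inequality; the first order gain in \<open>\<tau>\<close>
  excludes equality.\<close>

lemma hardy_gain:
  fixes p \<tau> t :: real
  assumes p: "2 < p" and \<tau>: "0 \<le> \<tau>" "(p - 1) * \<tau> \<le> 1" and t: "0 \<le> t"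
  defines "\<alpha> \<equiv> \<lambda>s. s + \<tau> * s / (1 + s)"
  shows "(p - 1) * \<alpha> t powr p + ((1 - ((p - 1) * \<tau>)\<^sup>2) * t powr p + \<tau> * (p * (p - 1) / (p + 1)) * (t powr (p + 1) / (1 + t)\<^sup>2))
     \<le> p\<^sup>2 * integral {0..t} (\<lambda>s. \<alpha> s powr (p - 1))"
proof (cases "t = 0")
  case False
  hence t0: "0 < t" using t by simp
  have \<alpha>pos: "0 < \<alpha> s" if "0 < s" for s using that \<tau> by (auto simp: \<alpha>_def intro!: add_pos_nonneg)
  have \<alpha>c: "continuous_on {0..t} (\<lambda>s. \<alpha> s powr (p - 1))" unfolding \<alpha>_def
    by (rule continuous_on_powr') (use p \<tau> in \<open>auto intro!: continuous_intros\<close>)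
  define A where "A x = integral {0..x} (\<lambda>s. \<alpha> s powr (p - 1))" for x
  \<comment> \<open>Chosen so that \<open>\<kappa> * (p + 1) = p * (p - 1)\<close>, the first order
    gain found in the derivative below.\<close>
  define \<kappa> where "\<kappa> = p * (p - 1) / (p + 1)"
  define T where "T x = p\<^sup>2 * A x - (p - 1) * \<alpha> x powr p - (1 - ((p - 1) * \<tau>)\<^sup>2) * x powr p - \<tau> * \<kappa> * (x powr (p + 1) / (1 + x)\<^sup>2)" for x
  have Ac: "continuous_on {0..t} A" unfolding A_def
    by (rule indefinite_integral_continuous_1[OF integrable_continuous_interval[OF \<alpha>c]])
  have Tc: "continuous_on {0..t} T" unfolding T_def
  proof (intro continuous_on_diff continuous_on_mult_left Ac)
    show "continuous_on {0..t} (\<lambda>x. \<alpha> x powr p)" unfolding \<alpha>_def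
      by (rule continuous_on_powr') (use p \<tau> in \<open>auto intro!: continuous_intros\<close>)
    show "continuous_on {0..t} (\<lambda>x. x powr p)" by (rule continuous_on_powr') (use p in \<open>auto intro!: continuous_intros\<close>)
    show "continuous_on {0..t} (\<lambda>x. x powr (p + 1) / (1 + x)\<^sup>2)"
      by (intro continuous_on_divide continuous_on_powr') (use p in \<open>auto intro!: continuous_intros\<close>)
  qed
  have "T 0 \<le> T t"
  proof (rule DERIV_nonneg_imp_increasing_open[OF t])
    fix x assume x: "0 < x" "x < t"
    define y where "y = 1 / (1 + x)"
    have y: "0 < y" "y \<le> 1" using x by (auto simp: y_def)
    have DA: "(A has_real_derivative \<alpha> x powr (p - 1)) (at x)"
      using integral_has_real_derivative[OF \<alpha>c, of x] x unfolding A_def by (simp add: at_within_Icc_at)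
    have D\<alpha>: "(\<alpha> has_real_derivative 1 + \<tau> * y\<^sup>2) (at x)"
    proof -
      have "(\<alpha> has_real_derivative 1 + (\<tau> * (1 + x) - \<tau> * x) / ((1 + x) * (1 + x))) (at x)"
        unfolding \<alpha>_def using x by (auto intro!: derivative_eq_intros)
      moreover have "\<tau> * (1 + x) - \<tau> * x = \<tau>" by (simp add: algebra_simps)
      ultimately show ?thesis by (simp add: y_def power2_eq_square)
    qed
    have D\<alpha>p: "((\<lambda>x. \<alpha> x powr p) has_real_derivative p * \<alpha> x powr (p - 1) * (1 + \<tau> * y\<^sup>2)) (at x)"
      using \<alpha>pos[OF x(1)] by (auto intro!: derivative_eq_intros D\<alpha>)
    have Dk: "((\<lambda>x. x powr (p + 1) / (1 + x)\<^sup>2) has_real_derivative (p + 1) * x powr p * y\<^sup>2 - 2 * x powr (p + 1) * y ^ 3) (at x)"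
    proof (rule DERIV_cong)
      show "((\<lambda>x. x powr (p + 1) / (1 + x)\<^sup>2) has_real_derivative
         ((p + 1) * x powr (p + 1 - 1) * (1 + x)\<^sup>2 - x powr (p + 1) * (2 * (1 + x))) / ((1 + x)\<^sup>2 * (1 + x)\<^sup>2)) (at x)"
        using x by (auto intro!: derivative_eq_intros)
      show "((p + 1) * x powr (p + 1 - 1) * (1 + x)\<^sup>2 - x powr (p + 1) * (2 * (1 + x))) / ((1 + x)\<^sup>2 * (1 + x)\<^sup>2)
         = (p + 1) * x powr p * y\<^sup>2 - 2 * x powr (p + 1) * y ^ 3"
      proof -
        have "(a * Y\<^sup>2 - b * (2 * Y)) / (Y\<^sup>2 * Y\<^sup>2) = a * (1 / Y)\<^sup>2 - 2 * b * (1 / Y) ^ 3" if "0 < Y" for a b Y :: real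
          using that by (simp add: field_simps power2_eq_square power3_eq_cube)
        from this[of "1 + x"] show ?thesis using x by (simp add: y_def)
      qed
    qed
    let ?D = "p\<^sup>2 * \<alpha> x powr (p - 1) - (p - 1) * (p * \<alpha> x powr (p - 1) * (1 + \<tau> * y\<^sup>2)) - (1 - ((p - 1) * \<tau>)\<^sup>2) * (p * x powr (p - 1))
       - \<tau> * \<kappa> * ((p + 1) * x powr p * y\<^sup>2 - 2 * x powr (p + 1) * y ^ 3)"
    have Dxp: "((\<lambda>x. x powr p) has_real_derivative p * x powr (p - 1)) (at x)" using x by (auto intro!: derivative_eq_intros)
    have "(T has_real_derivative ?D) (at x)" unfolding T_def by (intro DERIV_diff DERIV_cmult DA D\<alpha>p Dk Dxp)
    moreover have "0 \<le> ?D"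
    proof -
      define P where "P = p - 1"
      have P: "1 \<le> P" "P * \<tau> \<le> 1" using p \<tau> by (auto simp: P_def)
      \<comment> \<open>The source of the gain. For \<open>\<tau> = 0\<close> the derivative of
        \<open>T\<close> is zero, as the linear weight is optimal. To first order in
        \<open>\<tau>\<close> and relative to \<open>p * x powr P\<close> it grows by
        \<open>P * \<tau> * (y - y\<^sup>2)\<close>, and
        \<open>y - y\<^sup>2 = x * y\<^sup>2\<close> is positive. The second order loss is bounded
        by \<open>(P * \<tau>)\<^sup>2\<close>, which explains the coefficient in front of
        \<open>t powr p\<close>.\<close>
      have xy: "x * y\<^sup>2 = y - y\<^sup>2"
      proof -
        have "y * (1 + x) = 1" using x by (simp add: y_def)
        hence "y - y\<^sup>2 = y * (y * (1 + x)) - y\<^sup>2" by simp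
        also have "\<dots> = x * y\<^sup>2" by (simp add: algebra_simps power2_eq_square)
        finally show ?thesis ..
      qed
      have "\<alpha> x = x * (1 + \<tau> * y)" by (simp add: \<alpha>_def y_def algebra_simps)
      hence "\<alpha> x powr P = x powr P * (1 + \<tau> * y) powr P" using x y \<tau> by (simp add: powr_mult)
      moreover have "1 + P * (\<tau> * y) \<le> (1 + \<tau> * y) powr P"
      proof -
        have "0 \<le> \<tau> * y" using y \<tau> by simp
        hence "P * (1 powr (P - 1) * (1 + \<tau> * y)) \<le> (1 + \<tau> * y) powr P + (P - 1) * 1 powr P"
          using p by (intro young_powr) (auto simp: P_def)
        thus ?thesis by (simp add: algebra_simps)
      qed
      ultimately have a: "x powr P * (1 + P * (\<tau> * y)) \<le> \<alpha> x powr P" by (simp add: mult_left_mono)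
      have Pty: "P * \<tau> * y\<^sup>2 \<le> 1"
      proof -
        have "y\<^sup>2 \<le> 1" using y by (simp add: power_le_one)
        hence "P * \<tau> * y\<^sup>2 \<le> P * \<tau> * 1" using P \<tau> by (intro mult_left_mono) auto
        thus ?thesis using P(2) by linarith
      qed
      have "x powr P * (1 + P * (\<tau> * y)) * (1 - P * \<tau> * y\<^sup>2) \<le> \<alpha> x powr P * (1 - P * \<tau> * y\<^sup>2)"
        using a Pty by (intro mult_right_mono) auto
      moreover have "(1 - (P * \<tau>)\<^sup>2) + P * \<tau> * (x * y\<^sup>2) \<le> (1 + P * (\<tau> * y)) * (1 - P * \<tau> * y\<^sup>2)"
      proof -
        have "(1 + P * (\<tau> * y)) * (1 - P * \<tau> * y\<^sup>2) = 1 + P * \<tau> * (y - y\<^sup>2) - (P * \<tau>)\<^sup>2 * y ^ 3"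
          by (simp add: algebra_simps power2_eq_square power3_eq_cube)
        moreover have "(P * \<tau>)\<^sup>2 * y ^ 3 \<le> (P * \<tau>)\<^sup>2 * 1" using y by (intro mult_left_mono power_le_one) auto
        ultimately show ?thesis unfolding xy by simp
      qed
      hence "x powr P * ((1 - (P * \<tau>)\<^sup>2) + P * \<tau> * (x * y\<^sup>2)) \<le> x powr P * ((1 + P * (\<tau> * y)) * (1 - P * \<tau> * y\<^sup>2))"
        by (intro mult_left_mono) auto
      ultimately have "x powr P * ((1 - (P * \<tau>)\<^sup>2) + P * \<tau> * (x * y\<^sup>2)) \<le> \<alpha> x powr P * (1 - P * \<tau> * y\<^sup>2)"
        by (simp add: mult.assoc)
      hence main: "p * (x powr P * ((1 - (P * \<tau>)\<^sup>2) + P * \<tau> * (x * y\<^sup>2))) \<le> p * (\<alpha> x powr P * (1 - P * \<tau> * y\<^sup>2))"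
        using p by (intro mult_left_mono) auto
      have xp: "x powr p = x powr P * x" using x by (simp add: P_def powr_diff)
      have "\<tau> * \<kappa> * ((p + 1) * x powr p * y\<^sup>2 - 2 * x powr (p + 1) * y ^ 3) \<le> \<tau> * \<kappa> * ((p + 1) * x powr p * y\<^sup>2)"
        using \<tau> p y by (intro mult_left_mono) (auto simp: \<kappa>_def)
      also have "\<dots> = \<tau> * (p * P) * x powr P * (x * y\<^sup>2)" unfolding xp \<kappa>_def P_def using p by (simp add: field_simps)
      finally have k: "\<tau> * \<kappa> * ((p + 1) * x powr p * y\<^sup>2 - 2 * x powr (p + 1) * y ^ 3) \<le> \<tau> * (p * P) * x powr P * (x * y\<^sup>2)" .
      have "p\<^sup>2 * \<alpha> x powr (p - 1) - (p - 1) * (p * \<alpha> x powr (p - 1) * (1 + \<tau> * y\<^sup>2)) = p * (\<alpha> x powr P * (1 - P * \<tau> * y\<^sup>2))"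
        unfolding P_def by (simp add: algebra_simps power2_eq_square)
      moreover have "p * (x powr P * ((1 - (P * \<tau>)\<^sup>2) + P * \<tau> * (x * y\<^sup>2))) = (1 - (P * \<tau>)\<^sup>2) * (p * x powr P) + \<tau> * (p * P) * x powr P * (x * y\<^sup>2)"
        by (simp add: algebra_simps)
      ultimately show ?thesis using main k unfolding P_def by linarith
    qed
    ultimately show "\<exists>y. (T has_real_derivative y) (at x) \<and> 0 \<le> y" by blast
  qed (rule Tc)
  moreover have "T 0 = 0" by (simp add: T_def A_def \<alpha>_def)
  ultimately have "0 \<le> T t" by linarith
  thus ?thesis unfolding T_def A_def \<kappa>_def by linarith
qed (simp add: \<alpha>_def)

text \<open>\<open>Gamma (A + 1) = A * Gamma A\<close> turns the Gamma quotient into the Beta value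
  that arises from the bubble.\<close>

lemma sobolev_const_powr:
  fixes n :: nat and p :: real
  assumes n: "2 \<le> n" and p: "1 < p" "p < n"
  shows "sobolev_const n p powr p = (n * unit_ball_vol n powr (1 / n) * ((n - n / p) * Beta (n - n / p) (n / p)) powr (1 / n)) powr p
      * (n * (p - 1) / (n - p)) powr (1 - p)"
proof -
  define A where "A = n - n / p"
  define B where "B = n / p"
  define \<alpha> where "\<alpha> = n * (p - 1) / (n - p)"
  have n0: "0 < real n" using n by simp
  have "real n / p < real n" using p n0 by (simp add: divide_less_eq)
  hence A: "0 < A" by (simp add: A_def)
  have B: "0 < B" using p n0 by (simp add: B_def)
  have \<alpha>: "0 < \<alpha>" using p n0 by (simp add: \<alpha>_def)
  have G: "0 < Gamma A" "0 < Gamma B" "0 < Gamma (real n)" "0 < Gamma (A + 1)" using A B n0 by (auto intro!: Gamma_real_pos)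
  define Q where "Q = A * Beta A B * unit_ball_vol n"
  have AB: "A + B = n" by (simp add: A_def B_def)
  have Beta0: "0 < Beta A B" using G AB by (simp add: Beta_def)
  have Q: "0 < Q" using A Beta0 by (simp add: Q_def)
  have "Gamma (A + 1) = A * Gamma A" by (rule Gamma_plus1) (use A in \<open>auto elim!: nonpos_Ints_cases\<close>)
  hence g: "Gamma n / (Gamma B * Gamma (A + 1) * unit_ball_vol n) = 1 / Q"
    using G A unfolding Q_def Beta_def AB by (simp add: field_simps)
  have e: "real n + 1 - real n / p = A + 1" by (simp add: A_def)
  have "sobolev_const n p = inverse (1 / n * \<alpha> powr (1 - 1 / p) * (Gamma n / (Gamma B * Gamma (A + 1) * unit_ball_vol n)) powr (1 / n))"
    by (simp only: sobolev_const_def e \<alpha>_def B_def)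
  also have "\<dots> = inverse (1 / n * \<alpha> powr (1 - 1 / p) * (1 / Q) powr (1 / n))" unfolding g ..
  also have "\<dots> = n * Q powr (1 / n) / \<alpha> powr (1 - 1 / p)" using n0 Q \<alpha> by (simp add: powr_divide field_simps)
  finally have "sobolev_const n p powr p = (n * Q powr (1 / n)) powr p / (\<alpha> powr (1 - 1 / p)) powr p"
    using n0 Q \<alpha> by (simp add: powr_divide)
  also have "(\<alpha> powr (1 - 1 / p)) powr p = \<alpha> powr (p - 1)" using p by (simp add: powr_powr algebra_simps)
  also have "(n * Q powr (1 / n)) powr p / \<alpha> powr (p - 1) = (n * Q powr (1 / n)) powr p * \<alpha> powr (1 - p)"
    using powr_minus_divide[of \<alpha> "p - 1"] by simp
  also have "Q powr (1 / n) = unit_ball_vol n powr (1 / n) * (A * Beta A B) powr (1 / n)"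
    using A Beta0 by (simp add: Q_def powr_mult)
  finally show ?thesis by (simp add: A_def B_def \<alpha>_def mult.assoc)
qed

text \<open>The free weight is \<open>a2 = cp * \<alpha>\<close> with
  \<open>cp = (n - 1) / p\<close>, which for \<open>\<tau> = 0\<close> is proportional to the level.
  The layer cake formula turns its level integral into an integral of the primitive of
  \<open>\<alpha> powr (p - 1)\<close> at \<open>w\<close>, and \<open>hardy_gain\<close> leaves
  \<open>Rem\<close> after subtraction of the energy of \<open>a2\<close>.\<close>

lemma poincare_sobolev_half_space:
  fixes k :: "'a::euclidean_space" and w g :: "'a \<Rightarrow> real" and p \<tau> :: real
  defines "n \<equiv> DIM('a)"
  assumes k: "k \<in> Basis" and n2: "2 \<le> n" and p: "2 * real n / (real n - 1) \<le> p" "p < n"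
    and w: "continuous_on UNIV w" "\<And>x. 0 \<le> w x" and wU: "\<And>x. w x \<le> U" and w0: "\<And>x. w x \<noteq> 0 \<Longrightarrow> c \<le> x \<bullet> k \<and> norm x \<le> R" and c: "0 < c"
    and g[measurable]: "g \<in> borel_measurable borel" and g0: "\<And>x. 0 \<le> g x" and gG: "\<And>x. g x \<le> G"
    and gfin: "(\<integral>\<^sup>+x. ennreal (g x) \<partial>half_vol k) < \<infinity>"
    and grad: "\<And>\<eta>. 0 < \<eta> \<Longrightarrow> \<exists>\<epsilon>0>0. \<forall>\<epsilon> x z. 0 < \<epsilon> \<longrightarrow> \<epsilon> < \<epsilon>0 \<longrightarrow> 0 < x \<bullet> k \<longrightarrow> norm (z - x) \<le> \<epsilon> * (x \<bullet> k)
         \<longrightarrow> w x - w z \<le> \<epsilon> * (g z + \<eta>)"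
    and \<tau>: "0 \<le> \<tau>" "(p - 1) * \<tau> \<le> 1"
  defines "Rem \<equiv> \<lambda>t. (1 - ((p - 1) * \<tau>)\<^sup>2) * t powr p + \<tau> * (p * (p - 1) / (p + 1)) * (t powr (p + 1) / (1 + t)\<^sup>2)"
  shows "ennreal (sobolev_const n p powr p * enn2real (\<integral>\<^sup>+x. ennreal (w x powr (n * p / (n - p))) \<partial>half_vol k) powr ((n - p) / n))
      + (\<integral>\<^sup>+x. ennreal (((real n - 1) / p) powr p * Rem (w x)) \<partial>half_vol k)
    \<le> (\<integral>\<^sup>+x. ennreal (g x powr p) \<partial>half_vol k)"
proof -
  have sh[measurable_cong, simp]: "sets (half_vol k) = sets borel" by (simp add: half_vol_def)
  have sp[simp]: "space (half_vol k) = UNIV" by (simp add: half_vol_def)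
  have wm[measurable]: "w \<in> borel_measurable borel" by (rule borel_measurable_continuous_onI[OF w(1)])
  have p2: "2 < p"
  proof -
    have "2 * (real n - 1) < 2 * real n" by simp
    hence "2 < 2 * real n / (real n - 1)" using n2 by (simp add: less_divide_eq)
    thus ?thesis using p by simp
  qed
  have ps: "0 < n * p / (n - p)" using p p2 by simp
  have Remm[measurable]: "Rem \<in> borel_measurable borel" unfolding Rem_def by measurable
  show ?thesis
  proof (cases "\<forall>x. w x = 0")
    case True
    hence "w = (\<lambda>_. 0)" by auto
    thus ?thesis using p p2 by (simp add: Rem_def)
  next
    case False
    then obtain z1 where z1: "0 < w z1" using w(2) by (metis order.not_eq_order_implies_strict)
    have wfin: "emeasure (half_vol k) {x. 0 < w x} < \<infinity>"
    proof -
      have "emeasure (half_vol k) {x. 0 < w x} \<le> emeasure (half_vol k) {z. c \<le> z \<bullet> k \<and> norm z \<le> R}"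
        using w0 by (intro emeasure_mono) auto
      thus ?thesis using half_vol_bounded_finite[OF c, of k R] by (auto simp: le_less_trans)
    qed
    have pow_fin: "(\<integral>\<^sup>+x. ennreal (w x powr q) \<partial>half_vol k) < \<infinity>" if "0 < q" for q
    proof -
      have "(\<integral>\<^sup>+x. ennreal (w x powr q) \<partial>half_vol k) \<le> (\<integral>\<^sup>+x. ennreal (U powr q) * indicator {x. 0 < w x} x \<partial>half_vol k)"
      proof (rule nn_integral_mono)
        fix x
        have "w x powr q \<le> U powr q" using w(2)[of x] wU[of x] that by (intro powr_mono2) auto
        thus "ennreal (w x powr q) \<le> ennreal (U powr q) * indicator {x. 0 < w x} x"
          using w(2)[of x] by (cases "w x = 0") (auto intro!: ennreal_leI)
      qed
      also have "\<dots> = ennreal (U powr q) * emeasure (half_vol k) {x. 0 < w x}" by (rule nn_integral_cmult_indicator) simp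
      also have "\<dots> < \<infinity>" using wfin by (simp add: ennreal_mult_less_top)
      finally show ?thesis .
    qed
    define \<nu> where "\<nu> t = enn2real (emeasure (half_vol k) {x. t < w x})" for t
    have \<nu>e: "emeasure (half_vol k) {x. t < w x} = ennreal (\<nu> t)" if "0 \<le> t" for t
    proof -
      have "emeasure (half_vol k) {x. t < w x} \<le> emeasure (half_vol k) {x. 0 < w x}" using that by (intro emeasure_mono) auto
      hence "emeasure (half_vol k) {x. t < w x} < top" using wfin by (auto simp: le_less_trans)
      thus ?thesis by (simp add: \<nu>_def)
    qed
    have \<nu>0: "0 \<le> \<nu> t" for t by (simp add: \<nu>_def)
    have hpos: "0 < z \<bullet> k" if "0 < w z" for z using w0[of z] that c by auto
    have w00: "w 0 = 0" using hpos[of 0] w(2)[of 0] by (cases "w 0 = 0") auto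
    \<comment> \<open>\<open>bliss_dual\<close> asks for strictness. \<open>w\<close> is continuous,
      vanishes at the origin and is positive somewhere, so it takes small positive values on a
      nonempty open set, which has positive volume.\<close>
    have \<nu>less: "\<nu> t < \<nu> 0" if t: "0 < t" for t
    proof -
      define S where "S = {z. 0 < w z \<and> w z < t}"
      have So: "open S" unfolding S_def
        by (intro open_Collect_conj open_Collect_less) (use w(1) in \<open>auto intro!: continuous_intros\<close>)
      have "connected (range w)" by (rule connected_continuous_image[OF w(1) convex_connected[OF convex_UNIV]])
      hence "min t (w z1) / 2 \<in> range w"
        by (rule connectedD_interval[of _ "w 0" "w z1"]) (use t z1 w00 in \<open>auto simp: min_def\<close>)
      then obtain z where "w z = min t (w z1) / 2" by auto
      hence "z \<in> S" using t z1 by (cases "t \<le> w z1") (auto simp: S_def min_def)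
      hence "0 < emeasure (half_vol k) S" using So hpos by (intro half_vol_open_pos) (auto simp: S_def)
      have "ennreal (\<nu> t) < ennreal (\<nu> t) + emeasure (half_vol k) S"
        using \<open>0 < emeasure (half_vol k) S\<close> by (metis add.right_neutral ennreal_add_left_cancel_less ennreal_neq_top infinity_ennreal_def)
      also have "\<dots> = emeasure (half_vol k) ({x. t < w x} \<union> S)"
        unfolding \<nu>e[OF less_imp_le[OF t], symmetric] by (rule plus_emeasure) (use So in \<open>auto simp: S_def\<close>)
      also have "\<dots> \<le> emeasure (half_vol k) {x. 0 < w x}" using t by (intro emeasure_mono) (auto simp: S_def)
      also have "\<dots> = ennreal (\<nu> 0)" by (simp add: \<nu>e)
      finally show ?thesis using \<nu>0 by (simp add: ennreal_less_iff)
    qed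
    define N where "N = enn2real (\<integral>\<^sup>+x. ennreal (w x powr (n * p / (n - p))) \<partial>half_vol k)"
    have N: "(\<integral>\<^sup>+x. ennreal (w x powr (n * p / (n - p))) \<partial>half_vol k) = ennreal N"
      using pow_fin[OF ps] by (simp add: N_def)
    have N0: "0 < N"
    proof (rule ccontr)
      assume "\<not> ?thesis"
      hence "(\<integral>\<^sup>+x. ennreal (w x powr (n * p / (n - p))) \<partial>half_vol k) = 0" using N by (simp add: ennreal_neg)
      hence "AE x in half_vol k. ennreal (w x powr (n * p / (n - p))) = 0" by (subst (asm) nn_integral_0_iff_AE) auto
      hence "AE x in half_vol k. x \<notin> {x. 0 < w x}" by eventually_elim auto
      hence "emeasure (half_vol k) {x. 0 < w x} = 0" by (subst (asm) AE_iff_measurable[of "{x. 0 < w x}"]) auto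
      thus False using \<nu>e[of 0] \<nu>less[of 1] \<nu>0[of 1] by simp
    qed
    define m where "m = real n - 1"
    define cp where "cp = m / p"
    have m: "0 < m" using n2 by (simp add: m_def)
    have cp: "0 < cp" using m p2 by (simp add: cp_def)
    define \<alpha> where "\<alpha> s = s + \<tau> * s / (1 + s)" for s :: real
    define a2 where "a2 t = (if 0 \<le> t then cp * \<alpha> t else 0)" for t
    have \<alpha>0: "0 \<le> \<alpha> s" if "0 \<le> s" for s using that \<tau> by (simp add: \<alpha>_def)
    have a2m[measurable]: "a2 \<in> borel_measurable borel" unfolding a2_def \<alpha>_def by measurable
    have a20: "0 \<le> a2 t" for t using \<alpha>0 cp by (simp add: a2_def)
    \<comment> \<open>\<open>\<alpha>\<close> is comparable to the identity; hence the energy of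
      \<open>a2\<close> is finite and may be cancelled in the end.\<close>
    have \<alpha>le: "\<alpha> s \<le> 2 * s" if "0 \<le> s" for s
    proof -
      have "\<tau> \<le> 1" using \<tau> p2 mult_right_mono[of 1 "p - 1" \<tau>] by simp
      have "\<tau> * s / (1 + s) \<le> \<tau> * s" using that \<tau> by (simp add: divide_le_eq algebra_simps)
      also have "\<dots> \<le> 1 * s" using that \<open>\<tau> \<le> 1\<close> by (intro mult_right_mono) auto
      finally show ?thesis by (simp add: \<alpha>_def)
    qed
    define I where "I t = integral {0..t} (\<lambda>s. \<alpha> s powr (p - 1))" for t
    have Iint: "((\<lambda>s. \<alpha> s powr (p - 1)) has_integral I t) {0..t}" for t
    proof -
      have "continuous_on {0..t} (\<lambda>s. \<alpha> s powr (p - 1))" unfolding \<alpha>_def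
        by (rule continuous_on_powr') (use p2 \<tau> in \<open>auto intro!: continuous_intros\<close>)
      thus ?thesis unfolding I_def by (intro integrable_integral integrable_continuous_interval)
    qed
    have I0: "0 \<le> I t" for t using has_integral_nonneg[OF Iint] by simp
    have main: "ennreal (sobolev_const n p powr p * N powr ((n - p) / n))
      + ennreal p * (\<integral>\<^sup>+t. ennreal (a2 t powr (p - 1) * ((real n - 1) * \<nu> t)) * indicator {0<..} t \<partial>lborel)
      \<le> (\<integral>\<^sup>+x. ennreal (g x powr p) \<partial>half_vol k) + ennreal (p - 1) * (\<integral>\<^sup>+x. ennreal (a2 (w x) powr p) \<partial>half_vol k)"
    proof -
      have p1: "1 < p" using p2 by simp
      show ?thesis unfolding sobolev_const_powr[OF n2 p1 p(2)] unfolding \<nu>_def n_def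
        by (rule half_space_sobolev[OF k _ _ _ w wU w0 c g g0 gG gfin grad wfin _ _ N0 a2m a20])
           (use n2 p \<nu>less N in \<open>auto simp: n_def \<nu>_def\<close>)
    qed
    have layer: "ennreal p * (\<integral>\<^sup>+t. ennreal (a2 t powr (p - 1) * ((real n - 1) * \<nu> t)) * indicator {0<..} t \<partial>lborel)
      = (\<integral>\<^sup>+x. ennreal (cp powr p * (p\<^sup>2 * I (w x))) \<partial>half_vol k)"
    proof -
      have ac: "p * m * cp powr (p - 1) = cp powr p * p\<^sup>2"
        using cp p2 by (simp add: powr_diff) (simp add: cp_def power2_eq_square)
      have "ennreal p * (\<integral>\<^sup>+t. ennreal (a2 t powr (p - 1) * ((real n - 1) * \<nu> t)) * indicator {0<..} t \<partial>lborel)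
        = (\<integral>\<^sup>+t. ennreal p * (ennreal (a2 t powr (p - 1) * ((real n - 1) * \<nu> t)) * indicator {0<..} t) \<partial>lborel)"
      proof (rule nn_integral_cmult[symmetric])
        interpret S: sigma_finite_measure "half_vol k" by (rule sigma_finite_half_vol)
        have em: "(\<lambda>t. emeasure (half_vol k) {x\<in>space (half_vol k). t < w x}) \<in> borel_measurable borel" by measurable
        have [measurable]: "\<nu> \<in> borel_measurable borel" unfolding \<nu>_def using measurable_compose[OF em, of enn2real borel] by simp
        show "(\<lambda>t. ennreal (a2 t powr (p - 1) * ((real n - 1) * \<nu> t)) * indicator {0<..} t) \<in> borel_measurable lborel" by measurable
      qed
      also have "\<dots> = (\<integral>\<^sup>+t. ennreal (p * m * a2 t powr (p - 1)) * indicator {0..} t * emeasure (half_vol k) {x\<in>space (half_vol k). t < w x} \<partial>lborel)"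
      proof (rule nn_integral_cong_AE, rule AE_mp[OF AE_lborel_singleton[of 0]], intro AE_I2 impI)
        fix t :: real assume t: "t \<noteq> 0"
        show "ennreal p * (ennreal (a2 t powr (p - 1) * ((real n - 1) * \<nu> t)) * indicator {0<..} t)
          = ennreal (p * m * a2 t powr (p - 1)) * indicator {0..} t * emeasure (half_vol k) {x\<in>space (half_vol k). t < w x}"
        proof (cases "0 < t")
          case True
          have "ennreal p * ennreal (a2 t powr (p - 1) * (m * \<nu> t)) = ennreal (p * m * a2 t powr (p - 1)) * ennreal (\<nu> t)"
            using p2 m \<nu>0[of t] by (simp add: ennreal_mult[symmetric] mult_ac)
          thus ?thesis using True \<nu>e[of t] by (simp add: m_def)
        qed (use t in auto)
      qed
      also have "\<dots> = (\<integral>\<^sup>+x. (\<integral>\<^sup>+t. ennreal (p * m * a2 t powr (p - 1)) * indicator {0..<w x} t \<partial>lborel) \<partial>half_vol k)"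
        by (rule nn_integral_layer_cake[OF sigma_finite_half_vol, symmetric]) measurable
      also have "\<dots> = (\<integral>\<^sup>+x. ennreal (cp powr p * (p\<^sup>2 * I (w x))) \<partial>half_vol k)"
      proof (rule nn_integral_cong)
        fix x
        have "(\<integral>\<^sup>+t. ennreal (p * m * a2 t powr (p - 1)) * indicator {0..<w x} t \<partial>lborel)
           = (\<integral>\<^sup>+t. ennreal (cp powr p * p\<^sup>2 * \<alpha> t powr (p - 1)) * indicator {0..w x} t \<partial>lborel)"
        proof (rule nn_integral_cong_AE, rule AE_mp[OF AE_lborel_singleton[of "w x"]], intro AE_I2 impI)
          fix t assume "t \<noteq> w x"
          moreover have "p * m * a2 t powr (p - 1) = cp powr p * p\<^sup>2 * \<alpha> t powr (p - 1)" if "0 \<le> t"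
            unfolding ac[symmetric] using that cp \<alpha>0[OF that] by (simp add: a2_def powr_mult)
          ultimately show "ennreal (p * m * a2 t powr (p - 1)) * indicator {0..<w x} t = ennreal (cp powr p * p\<^sup>2 * \<alpha> t powr (p - 1)) * indicator {0..w x} t"
            by (auto simp: indicator_def)
        qed
        also have "\<dots> = ennreal (cp powr p * p\<^sup>2 * I (w x))"
        proof (rule nn_integral_has_integral_Icc)
          show "((\<lambda>t. cp powr p * p\<^sup>2 * \<alpha> t powr (p - 1)) has_integral cp powr p * p\<^sup>2 * I (w x)) {0..w x}"
            by (rule has_integral_mult_right[OF Iint])
        qed (auto simp: \<alpha>_def)
        finally show "(\<integral>\<^sup>+t. ennreal (p * m * a2 t powr (p - 1)) * indicator {0..<w x} t \<partial>lborel) = ennreal (cp powr p * (p\<^sup>2 * I (w x)))"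
          by (simp add: mult.assoc)
      qed
      finally show ?thesis .
    qed
    let ?J = "\<integral>\<^sup>+x. ennreal (a2 (w x) powr p) \<partial>half_vol k"
    have Jfin: "ennreal (p - 1) * ?J < \<infinity>"
    proof -
      have "?J \<le> (\<integral>\<^sup>+x. ennreal ((cp * 2) powr p) * ennreal (w x powr p) \<partial>half_vol k)"
      proof (rule nn_integral_mono)
        fix x
        have "a2 (w x) \<le> cp * 2 * w x" using \<alpha>le[OF w(2)[of x]] cp w(2)[of x] by (simp add: a2_def)
        hence "a2 (w x) powr p \<le> (cp * 2 * w x) powr p" using a20 p2 by (intro powr_mono2) auto
        also have "\<dots> = (cp * 2) powr p * w x powr p" using cp w(2)[of x] by (simp add: powr_mult)
        finally show "ennreal (a2 (w x) powr p) \<le> ennreal ((cp * 2) powr p) * ennreal (w x powr p)"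
          by (subst ennreal_mult[symmetric]) (auto intro!: ennreal_leI)
      qed
      also have "\<dots> = ennreal ((cp * 2) powr p) * (\<integral>\<^sup>+x. ennreal (w x powr p) \<partial>half_vol k)" by (rule nn_integral_cmult) simp
      also have "\<dots> < \<infinity>" using pow_fin[of p] p2 by (simp add: ennreal_mult_less_top)
      finally show ?thesis by (simp add: ennreal_mult_less_top)
    qed
    have Rem0: "0 \<le> Rem t" if "0 \<le> t" for t
    proof -
      have "((p - 1) * \<tau>)\<^sup>2 \<le> 1" using \<tau> p2 by (intro power_le_one) auto
      thus ?thesis using \<tau> p2 by (simp add: Rem_def)
    qed
    have "ennreal (p - 1) * ?J + (\<integral>\<^sup>+x. ennreal (cp powr p * Rem (w x)) \<partial>half_vol k)
       = (\<integral>\<^sup>+x. ennreal (cp powr p * ((p - 1) * \<alpha> (w x) powr p + Rem (w x))) \<partial>half_vol k)"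
    proof -
      have "ennreal (p - 1) * ?J = (\<integral>\<^sup>+x. ennreal (p - 1) * ennreal (a2 (w x) powr p) \<partial>half_vol k)"
        by (rule nn_integral_cmult[symmetric]) simp
      hence "ennreal (p - 1) * ?J + (\<integral>\<^sup>+x. ennreal (cp powr p * Rem (w x)) \<partial>half_vol k)
        = (\<integral>\<^sup>+x. ennreal (p - 1) * ennreal (a2 (w x) powr p) + ennreal (cp powr p * Rem (w x)) \<partial>half_vol k)"
        by (simp add: nn_integral_add)
      also have "\<dots> = (\<integral>\<^sup>+x. ennreal (cp powr p * ((p - 1) * \<alpha> (w x) powr p + Rem (w x))) \<partial>half_vol k)"
      proof (rule nn_integral_cong)
        fix x
        have "(p - 1) * a2 (w x) powr p + cp powr p * Rem (w x) = cp powr p * ((p - 1) * \<alpha> (w x) powr p + Rem (w x))"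
          using w(2)[of x] cp \<alpha>0[OF w(2)[of x]] by (simp add: a2_def powr_mult algebra_simps)
        moreover have "ennreal ((p - 1) * a2 (w x) powr p + cp powr p * Rem (w x)) = ennreal (p - 1) * ennreal (a2 (w x) powr p) + ennreal (cp powr p * Rem (w x))"
          using p2 Rem0[OF w(2)[of x]] by (subst ennreal_plus) (auto simp: ennreal_mult)
        ultimately show "ennreal (p - 1) * ennreal (a2 (w x) powr p) + ennreal (cp powr p * Rem (w x)) = ennreal (cp powr p * ((p - 1) * \<alpha> (w x) powr p + Rem (w x)))"
          by simp
      qed
      finally show ?thesis .
    qed
    also have "\<dots> \<le> (\<integral>\<^sup>+x. ennreal (cp powr p * (p\<^sup>2 * I (w x))) \<partial>half_vol k)"
    proof (intro nn_integral_mono ennreal_leI mult_left_mono)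
      fix x
      show "(p - 1) * \<alpha> (w x) powr p + Rem (w x) \<le> p\<^sup>2 * I (w x)"
        using hardy_gain[OF _ \<tau> w(2)[of x]] p2 unfolding Rem_def I_def \<alpha>_def by simp
    qed simp
    finally have "ennreal (p - 1) * ?J + (ennreal (sobolev_const n p powr p * N powr ((n - p) / n)) + (\<integral>\<^sup>+x. ennreal (cp powr p * Rem (w x)) \<partial>half_vol k))
        \<le> ennreal (sobolev_const n p powr p * N powr ((n - p) / n)) + (\<integral>\<^sup>+x. ennreal (cp powr p * (p\<^sup>2 * I (w x))) \<partial>half_vol k)"
      by (simp add: add.left_commute add_left_mono)
    also have "\<dots> \<le> ennreal (p - 1) * ?J + (\<integral>\<^sup>+x. ennreal (g x powr p) \<partial>half_vol k)"
      using main unfolding layer by (simp add: add.commute)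
    finally have "ennreal (sobolev_const n p powr p * N powr ((n - p) / n)) + (\<integral>\<^sup>+x. ennreal (cp powr p * Rem (w x)) \<partial>half_vol k)
        \<le> (\<integral>\<^sup>+x. ennreal (g x powr p) \<partial>half_vol k)"
      using Jfin by (auto simp: ennreal_add_left_cancel_le)
    thus ?thesis by (simp add: N_def cp_def m_def)
  qed
qed

section \<open>From the half-space back to the ball\<close>

text \<open>\<open>\<phi>\<close> is carried over by the Cayley map and extended by 0 outside the
  open half-space; compact support in the ball keeps \<open>w\<close> away from the boundary and
  from infinity. The work lies in the hypothesis \<open>grad\<close>: a Euclidean displacement of
  size \<open>\<epsilon> * (x \<bullet> e)\<close> becomes one of size at most
  \<open>\<epsilon>\<close> times the factor \<open>lm\<close>, which converts the Euclidean
  gradient at the image of \<open>z\<close> into the hyperbolic one, up to a relative error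
  \<open>4 * \<epsilon>\<close>.\<close>

lemma poincare_sobolev_test_fun:
  fixes \<phi> :: "real^'n::finite \<Rightarrow> real" and p \<tau> :: real
  defines "n \<equiv> CARD('n)"
  assumes n2: "2 \<le> n" and p: "2 * real n / (real n - 1) \<le> p" "p < n" and \<phi>: "test_fun \<phi>"
    and \<tau>: "0 \<le> \<tau>" "(p - 1) * \<tau> \<le> 1"
  defines "Rem \<equiv> \<lambda>t. (1 - ((p - 1) * \<tau>)\<^sup>2) * t powr p + \<tau> * (p * (p - 1) / (p + 1)) * (t powr (p + 1) / (1 + t)\<^sup>2)"
  shows "ennreal (sobolev_const n p powr p * enn2real (\<integral>\<^sup>+x. ennreal (\<bar>\<phi> x\<bar> powr (n * p / (n - p))) \<partial>hyp_vol TYPE('n)) powr ((n - p) / n))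
      + (\<integral>\<^sup>+x. ennreal (((real n - 1) / p) powr p * Rem \<bar>\<phi> x\<bar>) \<partial>hyp_vol TYPE('n))
    \<le> (\<integral>\<^sup>+x. ennreal (hyp_grad_norm (egrad \<phi>) x powr p) \<partial>hyp_vol TYPE('n))"
    and "(\<integral>\<^sup>+x. ennreal (hyp_grad_norm (egrad \<phi>) x powr p) \<partial>hyp_vol TYPE('n)) < \<infinity>"
    and "\<And>q. 0 < q \<Longrightarrow> (\<integral>\<^sup>+x. ennreal (\<bar>\<phi> x\<bar> powr q) \<partial>hyp_vol TYPE('n)) < \<infinity>"
proof -
  obtain i0 :: 'n where True by simp
  define e :: "real^'n" where "e = axis i0 1"
  have k: "e \<in> Basis" by (auto simp: e_def Basis_vec_def)
  have e: "norm e = 1" using k by simp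
  have dim: "DIM(real^'n) = n" by (simp add: n_def)
  have sm: "smooth_fun \<phi>" using \<phi> by (simp add: test_fun_def)
  define K where "K = closure {x. \<phi> x \<noteq> 0}"
  have K: "compact K" "K \<subseteq> ball 0 1" using \<phi> by (auto simp: test_fun_def K_def)
  have \<phi>K: "x \<in> K" if "\<phi> x \<noteq> 0" for x using that closure_subset[of "{x. \<phi> x \<noteq> 0}"] by (auto simp: K_def)
  have gK: "egrad \<phi> x = 0" if "x \<notin> K" for x using egrad_outside_support[of x \<phi>] that by (simp add: K_def)
  have \<phi>c: "continuous_on UNIV \<phi>" by (rule smooth_fun_continuous[OF sm])
  have gc: "continuous_on UNIV (egrad \<phi>)" by (rule egrad_continuous[OF sm])
  have \<phi>m[measurable]: "\<phi> \<in> borel_measurable borel" by (rule borel_measurable_continuous_onI[OF \<phi>c])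
  have gm[measurable]: "egrad \<phi> \<in> borel_measurable borel" by (rule borel_measurable_continuous_onI[OF gc])
  have hm[measurable]: "hyp_grad_norm (egrad \<phi>) \<in> borel_measurable borel" unfolding hyp_grad_norm_def by measurable
  have p0: "0 < p"
  proof -
    have "0 < 2 * real n / (real n - 1)" using n2 by simp
    thus ?thesis using p by simp
  qed
  obtain U where U: "\<And>x. \<bar>\<phi> x\<bar> \<le> U"
  proof -
    have "bounded (\<phi> ` K)" by (intro compact_imp_bounded compact_continuous_image continuous_on_subset[OF \<phi>c] K) auto
    then obtain U where "\<And>x. x \<in> K \<Longrightarrow> \<bar>\<phi> x\<bar> \<le> U" "0 < U" unfolding bounded_pos by auto
    hence "\<bar>\<phi> x\<bar> \<le> U" for x using \<phi>K[of x] by (cases "\<phi> x = 0") auto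
    thus ?thesis by (rule that)
  qed
  obtain G where G: "\<And>x. norm (egrad \<phi> x) \<le> G" "0 < G"
  proof -
    have "bounded (egrad \<phi> ` K)" by (intro compact_imp_bounded compact_continuous_image continuous_on_subset[OF gc] K) auto
    then obtain G where "\<And>x. x \<in> K \<Longrightarrow> norm (egrad \<phi> x) \<le> G" "0 < G" unfolding bounded_pos by auto
    moreover have "norm (egrad \<phi> x) \<le> G" for x using calculation gK[of x] by (cases "x \<in> K") auto
    ultimately show ?thesis using that by blast
  qed
  define \<Psi> where "\<Psi> = cayley e"
  define K' where "K' = \<Psi> ` K"
  have \<Psi>c: "continuous_on S \<Psi>" if "\<And>z. z \<in> S \<Longrightarrow> z + e \<noteq> 0" for S
    unfolding \<Psi>_def cayley_def[abs_def] using that by (intro continuous_intros) auto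
  have K'c: "compact K'" unfolding K'_def
    by (intro compact_continuous_image \<Psi>c K) (use K ball_add_nz[OF e] in auto)
  have K'H: "0 < z \<bullet> e" if "z \<in> K'" for z
    using that K cayley_in_half_space[OF e] by (auto simp: K'_def \<Psi>_def)
  obtain c where c: "0 < c" "\<And>z. z \<in> K' \<Longrightarrow> c \<le> z \<bullet> e"
  proof (cases "K' = {}")
    case True thus ?thesis using that[of 1] by auto
  next
    case False
    have "continuous_on K' (\<lambda>z. z \<bullet> e)" by (intro continuous_intros)
    from continuous_attains_inf[OF K'c False this] obtain z0 where "z0 \<in> K'" "\<forall>z\<in>K'. z0 \<bullet> e \<le> z \<bullet> e" by blast
    thus ?thesis using that[of "z0 \<bullet> e"] K'H by auto
  qed
  obtain R where R: "\<And>z. z \<in> K' \<Longrightarrow> norm z \<le> R" using compact_imp_bounded[OF K'c] by (auto simp: bounded_iff)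
  have inK': "z \<in> K'" if "0 < z \<bullet> e" "\<Psi> z \<in> K" for z
  proof -
    have "\<Psi> (\<Psi> z) = z" unfolding \<Psi>_def by (rule cayley_cayley[OF half_space_add_nz[OF e that(1)]])
    thus ?thesis using that unfolding K'_def by (metis imageI)
  qed
  define w where "w z = (if 0 < z \<bullet> e then \<bar>\<phi> (\<Psi> z)\<bar> else 0)" for z
  define g where "g z = (if 0 < z \<bullet> e then hyp_grad_norm (egrad \<phi>) (\<Psi> z) else 0)" for z
  have \<Psi>m[measurable]: "\<Psi> \<in> borel_measurable borel" by (simp add: \<Psi>_def)
  have gm'[measurable]: "g \<in> borel_measurable borel" unfolding g_def by measurable
  have wK: "z \<in> K'" if "w z \<noteq> 0" for z using that inK'[of z] \<phi>K[of "\<Psi> z"] by (auto simp: w_def split: if_splits)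
  have gK': "z \<in> K'" if "g z \<noteq> 0" for z
    using that inK'[of z] gK[of "\<Psi> z"] by (auto simp: g_def hyp_grad_norm_def split: if_splits)
  \<comment> \<open>Continuity is glued from two open sets: the half-space, and the complement of
    the compact set \<open>K'\<close>, on which \<open>w\<close> vanishes.\<close>
  have wc: "continuous_on UNIV w"
  proof -
    have H: "open {z::real^'n. 0 < z \<bullet> e}" by (intro open_Collect_less continuous_intros)
    have "continuous_on {z. 0 < z \<bullet> e} (\<lambda>z. \<bar>\<phi> (\<Psi> z)\<bar>)"
      by (intro continuous_on_rabs continuous_on_compose2[OF \<phi>c \<Psi>c]) (use half_space_add_nz[OF e] in auto)
    hence 1: "continuous_on {z. 0 < z \<bullet> e} w" by (rule continuous_on_eq) (simp add: w_def)
    have "continuous_on (- K') (\<lambda>_. 0::real)" by simp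
    hence 2: "continuous_on (- K') w" by (rule continuous_on_eq) (use wK in force)
    have "continuous_on ({z. 0 < z \<bullet> e} \<union> - K') w"
      by (rule continuous_on_open_Un[OF H _ 1 2]) (use K'c in \<open>auto intro: compact_imp_closed\<close>)
    moreover have "{z. 0 < z \<bullet> e} \<union> - K' = UNIV" using K'H by auto
    ultimately show ?thesis by simp
  qed
  have lam: "(1 - (norm (\<Psi> z))\<^sup>2) / 2 = 2 * (z \<bullet> e) / (norm (z + e))\<^sup>2" if "0 < z \<bullet> e" for z
    using cayley_one_minus_norm[OF e half_space_add_nz[OF e that]] by (simp add: \<Psi>_def)
  have g0: "0 \<le> g z" for z
  proof (cases "0 < z \<bullet> e")
    case True
    have "(norm (\<Psi> z))\<^sup>2 \<le> 1" using cayley_in_ball[OF e True] by (simp add: \<Psi>_def power_le_one)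
    thus ?thesis by (simp add: g_def hyp_grad_norm_def)
  qed (simp add: g_def)
  have gG: "g z \<le> G" for z
  proof (cases "0 < z \<bullet> e")
    case True
    have "(norm (\<Psi> z))\<^sup>2 \<le> 1" using cayley_in_ball[OF e True] by (simp add: \<Psi>_def power_le_one)
    moreover have "(1 - (norm (\<Psi> z))\<^sup>2) / 2 \<le> 1" by (rule order_trans[of _ "1 / 2"]) simp_all
    ultimately have "(1 - (norm (\<Psi> z))\<^sup>2) / 2 * norm (egrad \<phi> (\<Psi> z)) \<le> 1 * G" using G by (intro mult_mono) auto
    thus ?thesis using True by (simp add: g_def hyp_grad_norm_def)
  qed (use G in \<open>simp add: g_def\<close>)
  let ?B = "{z. c \<le> z \<bullet> e \<and> norm z \<le> R}"
  have sh[measurable_cong, simp]: "sets (half_vol e) = sets borel" by (simp add: half_vol_def)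
  have Bfin: "emeasure (half_vol e) ?B < \<infinity>" by (rule half_vol_bounded_finite[OF c(1)])
  have bfin: "(\<integral>\<^sup>+z. ennreal (f z) \<partial>half_vol e) < \<infinity>" if "\<And>z. f z \<noteq> 0 \<Longrightarrow> z \<in> K'" "\<And>z. f z \<le> C" for f C
  proof -
    have "(\<integral>\<^sup>+z. ennreal (f z) \<partial>half_vol e) \<le> (\<integral>\<^sup>+z. ennreal C * indicator ?B z \<partial>half_vol e)"
    proof (rule nn_integral_mono)
      fix z
      show "ennreal (f z) \<le> ennreal C * indicator ?B z"
      proof (cases "f z = 0")
        case False
        thus ?thesis using that(1)[of z] that(2)[of z] c(2) R by (auto intro!: ennreal_leI)
      qed simp
    qed
    also have "\<dots> = ennreal C * emeasure (half_vol e) ?B" by (rule nn_integral_cmult_indicator) simp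
    also have "\<dots> < \<infinity>" using Bfin by (simp add: ennreal_mult_less_top)
    finally show ?thesis .
  qed
  have gfin: "(\<integral>\<^sup>+z. ennreal (g z) \<partial>half_vol e) < \<infinity>" by (rule bfin[OF gK' gG])
  have grad: "\<exists>\<epsilon>0>0. \<forall>\<epsilon> x z. 0 < \<epsilon> \<longrightarrow> \<epsilon> < \<epsilon>0 \<longrightarrow> 0 < x \<bullet> e \<longrightarrow> norm (z - x) \<le> \<epsilon> * (x \<bullet> e) \<longrightarrow> w x - w z \<le> \<epsilon> * (g z + \<eta>)"
    if \<eta>: "0 < \<eta>" for \<eta>
  proof -
    obtain \<delta> where \<delta>: "0 < \<delta>" "\<And>a b. a \<in> cball 0 1 \<Longrightarrow> b \<in> cball 0 1 \<Longrightarrow> norm (a - b) < \<delta> \<Longrightarrow>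
        \<bar>\<phi> a - \<phi> b\<bar> \<le> (norm (egrad \<phi> b) + \<eta> / 3) * norm (a - b)"
      using smooth_fun_uniform_gradient[OF sm, of "\<eta> / 3"] \<eta> by auto
    \<comment> \<open>The three bounds serve, in turn, the comparison of heights, the range of the
      uniform gradient estimate, and the absorption of the relative error
      \<open>4 * \<epsilon>\<close> into \<open>\<eta>\<close>.\<close>
    define \<epsilon>0 where "\<epsilon>0 = min (1 / 2) (min (\<delta> / 4) (\<eta> / (8 * (G + 1))))"
    have "w x - w z \<le> \<epsilon> * (g z + \<eta>)" if \<epsilon>: "0 < \<epsilon>" "\<epsilon> < \<epsilon>0" and x: "0 < x \<bullet> e" and z: "norm (z - x) \<le> \<epsilon> * (x \<bullet> e)" for \<epsilon> x z
    proof -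
      have \<epsilon>': "\<epsilon> < 1 / 2" "\<epsilon> < \<delta> / 4" "\<epsilon> < \<eta> / (8 * (G + 1))" using \<epsilon> by (auto simp: \<epsilon>0_def)
      have zx: "\<bar>z \<bullet> e - x \<bullet> e\<bar> \<le> \<epsilon> * (x \<bullet> e)"
        using Basis_le_norm[OF k, of "z - x"] z by (simp add: inner_simps)
      hence ze: "(1 - \<epsilon>) * (x \<bullet> e) \<le> z \<bullet> e" by (simp add: algebra_simps)
      have zp: "0 < z \<bullet> e" using less_le_trans[OF _ ze] x \<epsilon>' by simp
      define X where "X = norm (x + e)"
      define Z where "Z = norm (z + e)"
      have pXZ: "0 < X" "0 < Z" using half_space_add_nz[OF e x] half_space_add_nz[OF e zp] by (auto simp: X_def Z_def)
      have xX: "x \<bullet> e + 1 \<le> X" "z \<bullet> e + 1 \<le> Z"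
        using Basis_le_norm[OF k, of "x + e"] Basis_le_norm[OF k, of "z + e"] k
        by (auto simp: X_def Z_def inner_simps)
      have "Z \<le> X + norm (z - x)" unfolding X_def Z_def using norm_triangle_ineq[of "x + e" "z - x"] by (simp add: algebra_simps)
      also have "\<dots> \<le> X + \<epsilon> * X"
      proof -
        have "\<epsilon> * (x \<bullet> e) \<le> \<epsilon> * X" using xX(1) \<epsilon> by (intro mult_left_mono) auto
        thus ?thesis using z by simp
      qed
      finally have ZX: "Z \<le> (1 + \<epsilon>) * X" by (simp add: algebra_simps)
      define D where "D = norm (\<Psi> x - \<Psi> z)"
      have D: "D = 2 * norm (x - z) / (X * Z)"
        unfolding D_def \<Psi>_def X_def Z_def by (rule cayley_dist[OF half_space_add_nz[OF e x] half_space_add_nz[OF e zp]])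
      have D1: "D \<le> \<epsilon> * (2 * (x \<bullet> e) / (X * Z))"
      proof -
        have "2 * norm (x - z) / (X * Z) \<le> 2 * (\<epsilon> * (x \<bullet> e)) / (X * Z)"
          using z pXZ by (intro divide_right_mono mult_left_mono) (auto simp: norm_minus_commute)
        thus ?thesis unfolding D by (simp add: mult_ac)
      qed
      have "2 * (x \<bullet> e) / (X * Z) \<le> 2"
      proof -
        have "2 * (x \<bullet> e) \<le> 2 * (X * Z)" using xX x zp pXZ mult_mono[of "x \<bullet> e" X 1 Z] by simp
        thus ?thesis using pXZ by (simp add: divide_le_eq)
      qed
      hence "D \<le> \<epsilon> * 2" using D1 \<epsilon> mult_left_mono[of "2 * (x \<bullet> e) / (X * Z)" 2 \<epsilon>] by linarith
      hence Dd: "D < \<delta>" using \<epsilon>' \<epsilon> by linarith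
      define lm where "lm = 2 * (z \<bullet> e) / Z\<^sup>2"
      have lm0: "0 \<le> lm" using zp by (simp add: lm_def)
      have lme: "(1 - (norm (\<Psi> z))\<^sup>2) / 2 = lm" using lam[OF zp] by (simp add: lm_def Z_def)
      have lm1: "lm \<le> 1 / 2" unfolding lme[symmetric] by simp
      \<comment> \<open>Replaces the mixed quotient, with one factor at \<open>x\<close> and one at
        \<open>z\<close>, by \<open>lm\<close>, which is taken at \<open>z\<close> alone.\<close>
      have D2: "2 * (x \<bullet> e) / (X * Z) \<le> (1 + 4 * \<epsilon>) * lm"
      proof -
        have "(x \<bullet> e) * Z \<le> ((1 + 4 * \<epsilon>) * (z \<bullet> e)) * X"
        proof -
          have "(x \<bullet> e) * Z \<le> (x \<bullet> e) * ((1 + \<epsilon>) * X)" using ZX x by (intro mult_left_mono) auto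
          also have "\<dots> = ((1 + \<epsilon>) * (x \<bullet> e)) * X" by simp
          also have "(1 + \<epsilon>) * (x \<bullet> e) \<le> (1 + 4 * \<epsilon>) * (z \<bullet> e)"
          proof -
            have "1 + \<epsilon> \<le> (1 + 4 * \<epsilon>) * (1 - \<epsilon>)"
            proof -
              have "\<epsilon> * \<epsilon> \<le> \<epsilon> * (1 / 2)" using \<epsilon> \<epsilon>' by (intro mult_left_mono) auto
              thus ?thesis by (simp add: algebra_simps)
            qed
            hence "(1 + \<epsilon>) * (x \<bullet> e) \<le> (1 + 4 * \<epsilon>) * (1 - \<epsilon>) * (x \<bullet> e)" using x by (intro mult_right_mono) auto
            also have "\<dots> = (1 + 4 * \<epsilon>) * ((1 - \<epsilon>) * (x \<bullet> e))" by simp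
            also have "\<dots> \<le> (1 + 4 * \<epsilon>) * (z \<bullet> e)" using ze \<epsilon> by (intro mult_left_mono) auto
            finally show ?thesis .
          qed
          finally show ?thesis using pXZ by (simp add: mult_right_mono)
        qed
        hence "2 * (x \<bullet> e) * Z \<le> 2 * ((1 + 4 * \<epsilon>) * (z \<bullet> e)) * X" by simp
        hence "2 * (x \<bullet> e) / X \<le> 2 * ((1 + 4 * \<epsilon>) * (z \<bullet> e)) / Z" using pXZ by (simp add: field_simps)
        hence "2 * (x \<bullet> e) / X / Z \<le> 2 * ((1 + 4 * \<epsilon>) * (z \<bullet> e)) / Z / Z" using pXZ by (intro divide_right_mono) auto
        thus ?thesis by (simp add: lm_def power2_eq_square mult_ac)
      qed
      have "w x - w z \<le> \<bar>\<phi> (\<Psi> x) - \<phi> (\<Psi> z)\<bar>" using x zp by (simp add: w_def)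
      also have "\<dots> \<le> (norm (egrad \<phi> (\<Psi> z)) + \<eta> / 3) * D"
        unfolding D_def
        by (rule \<delta>(2)) (use cayley_in_ball[OF e x] cayley_in_ball[OF e zp] Dd in \<open>auto simp: \<Psi>_def D_def\<close>)
      also have "\<dots> \<le> (norm (egrad \<phi> (\<Psi> z)) + \<eta> / 3) * (\<epsilon> * ((1 + 4 * \<epsilon>) * lm))"
      proof (rule mult_left_mono)
        show "D \<le> \<epsilon> * ((1 + 4 * \<epsilon>) * lm)" using D1 D2 \<epsilon> mult_left_mono[OF D2, of \<epsilon>] by linarith
      qed (use \<eta> in simp)
      also have "\<dots> = \<epsilon> * ((1 + 4 * \<epsilon>) * (lm * norm (egrad \<phi> (\<Psi> z)) + \<eta> / 3 * lm))" by (simp add: algebra_simps)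
      also have "\<dots> \<le> \<epsilon> * (g z + \<eta>)"
      proof (rule mult_left_mono)
        have gz: "g z = lm * norm (egrad \<phi> (\<Psi> z))" using zp lme by (simp add: g_def hyp_grad_norm_def)
        have "\<eta> / 3 * lm \<le> \<eta> / 3 * (1 / 2)" using lm1 \<eta> by (intro mult_left_mono) auto
        hence "(1 + 4 * \<epsilon>) * (g z + \<eta> / 3 * lm) \<le> (1 + 4 * \<epsilon>) * (g z + \<eta> / 6)" using \<epsilon> by (intro mult_left_mono) auto
        also have "\<dots> = g z + 4 * \<epsilon> * g z + (1 + 4 * \<epsilon>) * (\<eta> / 6)" by (simp add: algebra_simps)
        also have "\<dots> \<le> g z + \<eta> / 2 + 3 * (\<eta> / 6)"
        proof (intro add_mono mult_right_mono order_refl)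
          have "4 * \<epsilon> * g z \<le> 4 * \<epsilon> * (G + 1)" using gG[of z] \<epsilon> by (intro mult_left_mono) auto
          also have "\<dots> \<le> \<eta> / 2" using \<epsilon>'(3) G by (simp add: field_simps)
          finally show "4 * \<epsilon> * g z \<le> \<eta> / 2" .
        qed (use \<epsilon>' \<eta> in auto)
        finally show "(1 + 4 * \<epsilon>) * (lm * norm (egrad \<phi> (\<Psi> z)) + \<eta> / 3 * lm) \<le> g z + \<eta>" unfolding gz by simp
      qed (use \<epsilon> in simp)
      finally show ?thesis .
    qed
    moreover have "0 < \<epsilon>0" using \<delta> \<eta> G by (simp add: \<epsilon>0_def)
    ultimately show ?thesis by blast
  qed
  have tr: "(\<integral>\<^sup>+x. f x \<partial>hyp_vol TYPE('n)) = (\<integral>\<^sup>+z. f (\<Psi> z) \<partial>half_vol e)" if "f \<in> borel_measurable borel" for f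
    unfolding \<Psi>_def by (rule nn_integral_hyp_vol[OF e that])
  have AEw: "AE z in half_vol e. \<bar>\<phi> (\<Psi> z)\<bar> = w z" using AE_half_vol[of e] by eventually_elim (simp add: w_def)
  have AEg: "AE z in half_vol e. hyp_grad_norm (egrad \<phi>) (\<Psi> z) = g z" using AE_half_vol[of e] by eventually_elim (simp add: g_def)
  have trw: "(\<integral>\<^sup>+x. ennreal (f \<bar>\<phi> x\<bar>) \<partial>hyp_vol TYPE('n)) = (\<integral>\<^sup>+z. ennreal (f (w z)) \<partial>half_vol e)" if [measurable]: "f \<in> borel_measurable borel" for f
  proof -
    have "(\<integral>\<^sup>+x. ennreal (f \<bar>\<phi> x\<bar>) \<partial>hyp_vol TYPE('n)) = (\<integral>\<^sup>+z. ennreal (f \<bar>\<phi> (\<Psi> z)\<bar>) \<partial>half_vol e)" by (rule tr) measurable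
    also have "\<dots> = (\<integral>\<^sup>+z. ennreal (f (w z)) \<partial>half_vol e)"
      by (rule nn_integral_cong_AE) (use AEw in \<open>eventually_elim, simp\<close>)
    finally show ?thesis .
  qed
  have trg: "(\<integral>\<^sup>+x. ennreal (hyp_grad_norm (egrad \<phi>) x powr p) \<partial>hyp_vol TYPE('n)) = (\<integral>\<^sup>+z. ennreal (g z powr p) \<partial>half_vol e)"
  proof -
    have "(\<integral>\<^sup>+x. ennreal (hyp_grad_norm (egrad \<phi>) x powr p) \<partial>hyp_vol TYPE('n)) = (\<integral>\<^sup>+z. ennreal (hyp_grad_norm (egrad \<phi>) (\<Psi> z) powr p) \<partial>half_vol e)"
      by (rule tr) measurable
    also have "\<dots> = (\<integral>\<^sup>+z. ennreal (g z powr p) \<partial>half_vol e)"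
      by (rule nn_integral_cong_AE) (use AEg in \<open>eventually_elim, simp\<close>)
    finally show ?thesis .
  qed
  have wU: "w z \<le> U" for z using U[of "\<Psi> z"] by (auto simp: w_def intro: order_trans[OF abs_ge_zero])
  have w0: "0 \<le> w z" for z by (simp add: w_def)
  have wcR: "c \<le> x \<bullet> e \<and> norm x \<le> R" if "w x \<noteq> 0" for x using wK[OF that] c(2) R by auto
  have Remm: "(\<lambda>t. ((real n - 1) / p) powr p * Rem t) \<in> borel_measurable borel" unfolding Rem_def by measurable
  show "ennreal (sobolev_const n p powr p * enn2real (\<integral>\<^sup>+x. ennreal (\<bar>\<phi> x\<bar> powr (n * p / (n - p))) \<partial>hyp_vol TYPE('n)) powr ((n - p) / n))
      + (\<integral>\<^sup>+x. ennreal (((real n - 1) / p) powr p * Rem \<bar>\<phi> x\<bar>) \<partial>hyp_vol TYPE('n))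
    \<le> (\<integral>\<^sup>+x. ennreal (hyp_grad_norm (egrad \<phi>) x powr p) \<partial>hyp_vol TYPE('n))"
    unfolding trg trw[OF Remm] trw[of "\<lambda>t. t powr (n * p / (n - p))", simplified]
    using poincare_sobolev_half_space[OF k _ _ _ wc w0 wU wcR c(1) gm' g0 gG gfin grad \<tau>, unfolded dim] n2 p
    unfolding Rem_def by blast
  show "(\<integral>\<^sup>+x. ennreal (hyp_grad_norm (egrad \<phi>) x powr p) \<partial>hyp_vol TYPE('n)) < \<infinity>"
    unfolding trg by (rule bfin[of _ "G powr p"]) (use gK' gG g0 p0 in \<open>auto intro!: powr_mono2\<close>)
  show "(\<integral>\<^sup>+x. ennreal (\<bar>\<phi> x\<bar> powr q) \<partial>hyp_vol TYPE('n)) < \<infinity>" if "0 < q" for q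
    unfolding trw[of "\<lambda>t. t powr q", simplified]
    by (rule bfin[of _ "U powr q"]) (use wK wU w0 that in \<open>auto intro!: powr_mono2\<close>)
qed

section \<open>Integrals over the ball and closability of the gradient\<close>

lemma sets_hyp_vol [simp, measurable_cong]: "sets (hyp_vol TYPE('n::finite)) = sets lebesgue"
  by (simp add: hyp_vol_def)

lemma space_hyp_vol [simp]: "space (hyp_vol TYPE('n::finite)) = UNIV"
  by (simp add: hyp_vol_def)

lemma ball_weight_ge_1:
  fixes x :: "real^'n::finite"
  assumes "x \<in> ball 0 1"
  shows "1 \<le> 2 / (1 - (norm x)\<^sup>2)" "0 < 1 - (norm x)\<^sup>2"
proof -
  have "(norm x)\<^sup>2 < 1" using assms by (simp add: abs_square_less_1)
  thus pos: "0 < 1 - (norm x)\<^sup>2" by simp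
  have "1 - (norm x)\<^sup>2 \<le> 2" using zero_le_power2[of "norm x"] by linarith
  thus "1 \<le> 2 / (1 - (norm x)\<^sup>2)" using pos by (simp add: le_divide_eq)
qed

lemma hyp_vol_density_measurable:
  "(\<lambda>x::real^'n::finite. indicator (ball 0 1) x * ennreal ((2 / (1 - (norm x)\<^sup>2)) ^ CARD('n))) \<in> borel_measurable lebesgue"
proof -
  have [measurable]: "ball (0::real^'n) 1 \<in> sets borel" by simp
  have "(\<lambda>x::real^'n. indicator (ball 0 1) x * ennreal ((2 / (1 - (norm x)\<^sup>2)) ^ CARD('n))) \<in> borel_measurable lborel" by measurable
  thus ?thesis by (rule measurable_completion)
qed

lemma AE_hyp_vol_iff:
  assumes "{x. \<not> P x} \<in> sets lebesgue"
  shows "(AE x in hyp_vol TYPE('n::finite). P x) \<longleftrightarrow> (AE x::real^'n in lebesgue. x \<in> ball 0 1 \<longrightarrow> P x)"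
proof -
  have "(0 < indicator (ball 0 1) x * ennreal ((2 / (1 - (norm x)\<^sup>2)) ^ CARD('n))) \<longleftrightarrow> x \<in> ball 0 1" for x :: "real^'n"
    using ball_weight_ge_1[of x] by (auto simp: indicator_def intro!: zero_less_power less_le_trans[OF zero_less_one])
  thus ?thesis unfolding hyp_vol_def by (subst AE_density[OF hyp_vol_density_measurable]) simp
qed

lemma AE_hyp_vol_ball: "AE x in hyp_vol TYPE('n::finite). x \<in> ball 0 1"
  unfolding hyp_vol_def by (subst AE_density[OF hyp_vol_density_measurable]) (auto simp: indicator_def)

lemma nn_integral_ball_le_hyp_vol:
  fixes f h :: "real^'n::finite \<Rightarrow> ennreal"
  assumes h: "h \<in> borel_measurable lebesgue"
    and le: "\<And>x. x \<in> ball 0 1 \<Longrightarrow> f x \<le> ennreal ((2 / (1 - (norm x)\<^sup>2)) ^ CARD('n)) * h x"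
  shows "(\<integral>\<^sup>+x. f x * indicator (ball 0 1) x \<partial>lebesgue) \<le> (\<integral>\<^sup>+x. h x \<partial>hyp_vol TYPE('n))"
proof -
  have "(\<integral>\<^sup>+x. h x \<partial>hyp_vol TYPE('n)) = (\<integral>\<^sup>+x. (indicator (ball 0 1) x * ennreal ((2 / (1 - (norm x)\<^sup>2)) ^ CARD('n))) * h x \<partial>lebesgue)"
    unfolding hyp_vol_def by (rule nn_integral_density[OF hyp_vol_density_measurable h])
  moreover have "(\<integral>\<^sup>+x. f x * indicator (ball 0 1) x \<partial>lebesgue) \<le> \<dots>"
    by (intro nn_integral_mono) (use le in \<open>auto simp: indicator_def\<close>)
  ultimately show ?thesis by simp
qed

text \<open>If \<open>t powr q\<close> exceeds \<open>s\<close>, the factor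
  \<open>(t powr q / s) powr (p / q - 1)\<close> is at least 1 and raises the exponent to
  \<open>p\<close>. The two-term bound takes the part of Hoelder's inequality on sets of finite
  measure.\<close>

lemma powr_le_interpolate:
  fixes t s q p :: real
  assumes "0 \<le> t" "0 < q" "q \<le> p" "0 < s"
  shows "t powr q \<le> s + s powr (1 - p / q) * t powr p"
proof (cases "t powr q \<le> s")
  case True
  thus ?thesis by (simp add: add_increasing2)
next
  case False
  hence t: "s < t powr q" "0 < t" using assms by (auto simp: less_le)
  have "s powr (p / q - 1) \<le> (t powr q) powr (p / q - 1)" using t assms by (intro powr_mono2) (auto simp: field_simps)
  hence "t powr q * s powr (p / q - 1) \<le> t powr q * (t powr q) powr (p / q - 1)" by (intro mult_left_mono) auto
  also have "\<dots> = t powr p" using t assms by (simp add: powr_powr powr_add[symmetric] algebra_simps)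
  finally have "s powr (1 - p / q) * (t powr q * s powr (p / q - 1)) \<le> s powr (1 - p / q) * t powr p" by (intro mult_left_mono) auto
  also have "s powr (1 - p / q) * (t powr q * s powr (p / q - 1)) = t powr q"
    using assms by (simp add: mult.left_commute powr_add[symmetric])
  finally show ?thesis using assms by linarith
qed

text \<open>The ball has finite volume \<open>v\<close>: the constant term of
  \<open>powr_le_interpolate\<close> contributes \<open>s * v\<close>, half of the prescribed bound,
  and the other term is small for large \<open>k\<close>.\<close>

lemma Lp_ball_tendsto_0_mono:
  fixes f :: "nat \<Rightarrow> real^'n::finite \<Rightarrow> real" and p q :: real
  assumes f[measurable]: "\<And>k. f k \<in> borel_measurable lebesgue" and q: "0 < q" "q \<le> p"
    and lim: "(\<lambda>k. \<integral>\<^sup>+x. ennreal (\<bar>f k x\<bar> powr p) * indicator (ball 0 1) x \<partial>lebesgue) \<longlonglongrightarrow> 0"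
  shows "(\<lambda>k. \<integral>\<^sup>+x. ennreal (\<bar>f k x\<bar> powr q) * indicator (ball 0 1) x \<partial>lebesgue) \<longlonglongrightarrow> 0"
proof (rule order_tendstoI)
  fix e :: ennreal assume "0 < e"
  then obtain e' :: real where e': "0 < e'" "ennreal e' \<le> e"
  proof -
    have "0 < min e 1" using \<open>0 < e\<close> by simp
    moreover have "min e 1 < top" by (simp add: min.strict_coboundedI2)
    ultimately have "0 < enn2real (min e 1)" "ennreal (enn2real (min e 1)) = min e 1" by (auto simp: enn2real_positive_iff)
    thus ?thesis using that[of "enn2real (min e 1)"] by simp
  qed
  have [measurable]: "ball (0::real^'n) 1 \<in> sets lebesgue" by (rule sets_completionI_sets) simp
  define v where "v = unit_ball_vol (real CARD('n))"
  have v: "0 < v" by (simp add: v_def)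
  have vol: "emeasure lebesgue (ball 0 1 :: (real^'n) set) = ennreal v"
    using emeasure_ball[of 1 "0::real^'n"] by (simp add: v_def)
  define s where "s = e' / (2 * v)"
  have s: "0 < s" using e' v by (simp add: s_def)
  define C where "C = s powr (1 - p / q)"
  have C: "0 < C" using s by (simp add: C_def)
  let ?I = "\<lambda>k. \<integral>\<^sup>+x. ennreal (\<bar>f k x\<bar> powr p) * indicator (ball 0 1) x \<partial>lebesgue"
  have "\<forall>\<^sub>F k in sequentially. ?I k < ennreal (e' / (2 * C))"
    using order_tendstoD(2)[OF lim, of "ennreal (e' / (2 * C))"] e' C by simp
  thus "\<forall>\<^sub>F k in sequentially. (\<integral>\<^sup>+x. ennreal (\<bar>f k x\<bar> powr q) * indicator (ball 0 1) x \<partial>lebesgue) < e"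
  proof eventually_elim
    case (elim k)
    have "(\<integral>\<^sup>+x. ennreal (\<bar>f k x\<bar> powr q) * indicator (ball 0 1) x \<partial>lebesgue)
       \<le> (\<integral>\<^sup>+x. ennreal s * indicator (ball 0 1) x + ennreal C * (ennreal (\<bar>f k x\<bar> powr p) * indicator (ball 0 1) x) \<partial>lebesgue)"
    proof (rule nn_integral_mono)
      fix x :: "real^'n"
      have "\<bar>f k x\<bar> powr q \<le> s + C * \<bar>f k x\<bar> powr p" unfolding C_def using q s by (intro powr_le_interpolate) auto
      hence "ennreal (\<bar>f k x\<bar> powr q) \<le> ennreal s + ennreal C * ennreal (\<bar>f k x\<bar> powr p)"
        using s C by (subst ennreal_mult[symmetric], simp, simp, subst ennreal_plus[symmetric], simp, simp, intro ennreal_leI)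
      thus "ennreal (\<bar>f k x\<bar> powr q) * indicator (ball 0 1) x \<le> ennreal s * indicator (ball 0 1) x + ennreal C * (ennreal (\<bar>f k x\<bar> powr p) * indicator (ball 0 1) x)"
        by (auto simp: indicator_def)
    qed
    also have "\<dots> = (\<integral>\<^sup>+x. ennreal s * indicator (ball (0::real^'n) 1) x \<partial>lebesgue) + (\<integral>\<^sup>+x. ennreal C * (ennreal (\<bar>f k x\<bar> powr p) * indicator (ball 0 1) x) \<partial>lebesgue)"
      by (rule nn_integral_add) measurable
    also have "(\<integral>\<^sup>+x. ennreal s * indicator (ball (0::real^'n) 1) x \<partial>lebesgue) = ennreal s * ennreal v"
      unfolding vol[symmetric] by (rule nn_integral_cmult_indicator) measurable
    also have "(\<integral>\<^sup>+x. ennreal C * (ennreal (\<bar>f k x\<bar> powr p) * indicator (ball 0 1) x) \<partial>lebesgue) = ennreal C * ?I k"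
      by (rule nn_integral_cmult) measurable
    also have "ennreal s * ennreal v + ennreal C * ?I k < ennreal s * ennreal v + ennreal C * ennreal (e' / (2 * C))"
      using elim C by (intro ennreal_add_left_cancel_less[THEN iffD2] conjI ennreal_mult_strict_left_mono) (auto simp: ennreal_mult_eq_top_iff)
    also have "\<dots> = ennreal e'"
      using s v C e' by (simp add: ennreal_mult[symmetric] ennreal_plus[symmetric] del: ennreal_plus) (simp add: s_def)
    also have "\<dots> \<le> e" by fact
    finally show ?case .
  qed
qed simp

text \<open>Difference quotients have integral 0 by translation invariance. The Lipschitz bound and
  the bounded support dominate them, so the limit has integral 0 as well.\<close>

lemma integral_directional_derivative_zero:
  fixes F F' :: "'a::euclidean_space \<Rightarrow> real" and e :: 'a
  assumes F: "continuous_on UNIV F" and supp: "\<And>x. F x \<noteq> 0 \<Longrightarrow> norm x \<le> 1"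
    and lip: "\<And>x y. \<bar>F x - F y\<bar> \<le> L * norm (x - y)" and e: "norm e = 1"
    and der: "\<And>x. ((\<lambda>t. F (x + t *\<^sub>R e)) has_real_derivative F' x) (at 0)"
    and F'm[measurable]: "F' \<in> borel_measurable borel"
  shows "integrable lborel F'" "(\<integral>x. F' x \<partial>lborel) = 0"
proof -
  have Fm[measurable]: "F \<in> borel_measurable borel" by (rule borel_measurable_continuous_onI[OF F])
  define h where "h j = 1 / (real j + 1)" for j
  have h: "0 < h j" "h j \<le> 1" for j by (auto simp: h_def)
  have hl: "filterlim h (at 0) sequentially"
  proof -
    have "h \<longlonglongrightarrow> 0" unfolding h_def by real_asymp
    thus ?thesis by (auto simp: filterlim_at h_def eventually_sequentially)
  qed
  have L: "0 \<le> L" using order_trans[OF abs_ge_zero lip[of e 0]] e by simp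
  define q where "q j x = (F (x + h j *\<^sub>R e) - F x) / h j" for j x
  have [measurable]: "q j \<in> borel_measurable borel" for j unfolding q_def by measurable
  have bound: "norm (q j x) \<le> L * indicator (cball 0 2) x" for j x
  proof (cases "norm x \<le> 2")
    case True
    have "\<bar>F (x + h j *\<^sub>R e) - F x\<bar> \<le> L * h j" using lip[of "x + h j *\<^sub>R e" x] e h[of j] by simp
    thus ?thesis using True h[of j] by (simp add: q_def field_simps)
  next
    case False
    have "norm (x + h j *\<^sub>R e) \<ge> norm x - norm (h j *\<^sub>R e)" by (rule norm_diff_ineq)
    hence "norm (x + h j *\<^sub>R e) > 1" using False h[of j] e by simp
    hence "F (x + h j *\<^sub>R e) = 0" "F x = 0" using supp[of "x + h j *\<^sub>R e"] supp[of x] False by (auto simp: not_le)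
    thus ?thesis using L by (simp add: q_def indicator_def)
  qed
  have lim: "(\<lambda>j. q j x) \<longlonglongrightarrow> F' x" for x
  proof -
    have "((\<lambda>t. (F (x + t *\<^sub>R e) - F (x + 0 *\<^sub>R e)) / (t - 0)) \<longlongrightarrow> F' x) (at 0)"
      using der[of x] by (simp add: has_field_derivative_iff)
    from filterlim_compose[OF this hl] show ?thesis by (simp add: q_def)
  qed
  have wint: "integrable lborel (\<lambda>x::'a. L * indicator (cball 0 2) x)"
    by (intro integrable_mult_right integrable_real_indicator) (auto simp: emeasure_lborel_cball_finite[unfolded infinity_ennreal_def] emeasure_lborel_ball_finite[unfolded infinity_ennreal_def])
  note dc = integral_dominated_convergence[of F' lborel q "\<lambda>x. L * indicator (cball 0 2) x"]
      integrable_dominated_convergence[of F' lborel q "\<lambda>x. L * indicator (cball 0 2) x"]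
  show "integrable lborel F'" by (rule dc(2)) (use wint lim bound in auto)
  have Fi: "integrable lborel F"
  proof -
    have b: "norm (F x) \<le> L * 3 * indicator (cball 0 1) x" for x
    proof (cases "norm x \<le> 1")
      case True
      have "F (2 *\<^sub>R e) = 0" using supp[of "2 *\<^sub>R e"] e by auto
      hence "\<bar>F x\<bar> \<le> L * norm (x - 2 *\<^sub>R e)" using lip[of x "2 *\<^sub>R e"] by simp
      also have "norm (x - 2 *\<^sub>R e) \<le> 3" using norm_triangle_ineq4[of x "2 *\<^sub>R e"] True e by simp
      finally show ?thesis using True L by (simp add: mult_left_mono)
    qed (use supp[of x] in auto)
    have i: "integrable lborel (\<lambda>x::'a. L * 3 * indicator (cball 0 1) x)"
      by (intro integrable_mult_right integrable_real_indicator) (auto simp: emeasure_lborel_cball_finite[unfolded infinity_ennreal_def] emeasure_lborel_ball_finite[unfolded infinity_ennreal_def])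
    show ?thesis
    proof (rule Bochner_Integration.integrable_bound[OF i])
      show "AE x in lborel. norm (F x) \<le> norm (L * 3 * indicator (cball 0 1) x)"
      proof (rule AE_I2)
        fix x show "norm (F x) \<le> norm (L * 3 * indicator (cball 0 1) x)"
          using b[of x] abs_ge_self[of "L * 3 * indicator (cball 0 1) x"] unfolding real_norm_def by linarith
      qed
    qed simp
  qed
  have tr: "integrable lborel (\<lambda>x. F (x + v)) \<and> (\<integral>x. F (x + v) \<partial>lborel) = (\<integral>x. F x \<partial>lborel)" for v
  proof -
    have "integrable (distr lborel borel ((+) v)) F" using Fi by (simp add: lborel_distr_plus)
    hence "integrable lborel (\<lambda>x. F (v + x))" by (subst (asm) integrable_distr_eq) auto
    moreover have "(\<integral>x. F x \<partial>lborel) = (\<integral>x. F x \<partial>distr lborel borel ((+) v))" by (simp add: lborel_distr_plus)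
    moreover have "\<dots> = (\<integral>x. F (v + x) \<partial>lborel)" by (rule integral_distr) auto
    ultimately show ?thesis by (simp add: add.commute)
  qed
  have "(\<integral>x. q j x \<partial>lborel) = 0" for j
    unfolding q_def using tr[of "h j *\<^sub>R e"] Fi by simp
  moreover have "(\<lambda>j. \<integral>x. q j x \<partial>lborel) \<longlonglongrightarrow> (\<integral>x. F' x \<partial>lborel)" by (rule dc(1)) (use wint lim bound in auto)
  ultimately show "(\<integral>x. F' x \<partial>lborel) = 0" by (simp add: LIMSEQ_const_iff)
qed

lemma test_fun_lipschitz:
  assumes "test_fun \<phi>"
  obtains L U where "\<And>x y. \<bar>\<phi> x - \<phi> y\<bar> \<le> L * norm (x - y)" "\<And>x. \<bar>\<phi> x\<bar> \<le> U" "0 \<le> L" "0 \<le> U"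
proof -
  define K where "K = closure {x. \<phi> x \<noteq> 0}"
  have sm: "smooth_fun \<phi>" and K: "compact K" using assms by (auto simp: test_fun_def K_def)
  have \<phi>c: "continuous_on UNIV \<phi>" by (rule smooth_fun_continuous[OF sm])
  have gc: "continuous_on UNIV (egrad \<phi>)" by (rule egrad_continuous[OF sm])
  have "bounded (\<phi> ` K)" by (intro compact_imp_bounded compact_continuous_image continuous_on_subset[OF \<phi>c] K) auto
  then obtain U where U: "\<And>x. x \<in> K \<Longrightarrow> \<bar>\<phi> x\<bar> \<le> U" "0 < U" unfolding bounded_pos by auto
  have "\<bar>\<phi> x\<bar> \<le> U" for x using U closure_subset[of "{x. \<phi> x \<noteq> 0}"] by (cases "\<phi> x = 0") (auto simp: K_def)
  moreover have "bounded (egrad \<phi> ` K)" by (intro compact_imp_bounded compact_continuous_image continuous_on_subset[OF gc] K) auto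
  then obtain L where L: "\<And>x. x \<in> K \<Longrightarrow> norm (egrad \<phi> x) \<le> L" "0 < L" unfolding bounded_pos by auto
  have L': "norm (egrad \<phi> x) \<le> L" for x using L egrad_outside_support[of x \<phi>] by (cases "x \<in> K") (auto simp: K_def)
  have "\<bar>\<phi> x - \<phi> y\<bar> \<le> L * norm (x - y)" for x y
  proof -
    have "norm (\<phi> x - \<phi> y) \<le> L * norm (x - y)"
    proof (rule differentiable_bound[of UNIV \<phi> "\<lambda>x v. egrad \<phi> x \<bullet> v"])
      fix z
      show "(\<phi> has_derivative (\<lambda>v. egrad \<phi> z \<bullet> v)) (at z within UNIV)"
        using egrad_has_derivative[OF smooth_fun_differentiable[OF sm]] by simp
      show "onorm (\<lambda>v. egrad \<phi> z \<bullet> v) \<le> L"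
      proof (rule onorm_le)
        fix v
        have "norm (egrad \<phi> z \<bullet> v) \<le> norm (egrad \<phi> z) * norm v" by (simp add: Cauchy_Schwarz_ineq2)
        also have "\<dots> \<le> L * norm v" using L' by (intro mult_right_mono) auto
        finally show "norm (egrad \<phi> z \<bullet> v) \<le> L * norm v" .
      qed
    qed auto
    thus ?thesis by simp
  qed
  ultimately show ?thesis using that[of L U] L(2) U(2) by simp
qed

lemma test_fun_partial:
  assumes "test_fun \<phi>"
  shows "test_fun (iter_partial [i] \<phi>)"
proof -
  have "{x. iter_partial [i] \<phi> x \<noteq> 0} \<subseteq> closure {x. \<phi> x \<noteq> 0}"
  proof (rule subsetI, rule ccontr)
    fix x assume x: "x \<in> {x. iter_partial [i] \<phi> x \<noteq> 0}" and n: "x \<notin> closure {x. \<phi> x \<noteq> 0}"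
    have "iter_partial [i] \<phi> x = 0" unfolding egrad_nth[symmetric] egrad_outside_support[OF n] by (rule zero_index)
    with x show False by blast
  qed
  hence s: "closure {x. iter_partial [i] \<phi> x \<noteq> 0} \<subseteq> closure {x. \<phi> x \<noteq> 0}" by (simp add: closure_minimal)
  have c: "compact (closure {x. \<phi> x \<noteq> 0})" "closure {x. \<phi> x \<noteq> 0} \<subseteq> ball 0 1" using assms by (auto simp: test_fun_def)
  have cc: "compact (closure {x. iter_partial [i] \<phi> x \<noteq> 0})"
    using compact_Int_closed[OF c(1) closed_closure[of "{x. iter_partial [i] \<phi> x \<noteq> 0}"]] s by (simp add: Int_absorb1)
  have "smooth_fun (iter_partial [i] \<phi>)" by (rule smooth_fun_iter_partial) (use assms in \<open>simp add: test_fun_def\<close>)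
  thus ?thesis unfolding test_fun_def using cc order_trans[OF s c(2)] by blast
qed

lemma test_fun_outside:
  assumes "test_fun \<phi>" "x \<notin> ball 0 1"
  shows "\<phi> x = 0"
proof (rule ccontr)
  assume "\<phi> x \<noteq> 0"
  hence "x \<in> closure {x. \<phi> x \<noteq> 0}" using closure_subset[of "{x. \<phi> x \<noteq> 0}"] by auto
  thus False using assms unfolding test_fun_def by blast
qed

lemma partial_directional_derivative:
  assumes "smooth_fun \<phi>"
  shows "((\<lambda>t. \<phi> (x + t *\<^sub>R axis i 1)) has_real_derivative iter_partial [i] \<phi> x) (at 0)"
proof -
  have "(\<phi> has_derivative (\<lambda>v. egrad \<phi> x \<bullet> v)) (at (x + 0 *\<^sub>R axis i 1))"
    using egrad_has_derivative[OF smooth_fun_differentiable[OF assms]] by simp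
  hence "((\<lambda>t. \<phi> (x + t *\<^sub>R axis i 1)) has_derivative (\<lambda>t. egrad \<phi> x \<bullet> (t *\<^sub>R axis i 1))) (at 0)"
    by (rule has_derivative_compose[rotated]) (auto intro!: derivative_eq_intros)
  moreover have "egrad \<phi> x \<bullet> (t *\<^sub>R axis i 1) = iter_partial [i] \<phi> x * t" for t
    unfolding egrad_nth[symmetric] cart_eq_inner_axis by (simp add: mult.commute)
  ultimately have "((\<lambda>t. \<phi> (x + t *\<^sub>R axis i 1)) has_derivative (\<lambda>t. iter_partial [i] \<phi> x * t)) (at 0)" by (simp only:)
  thus ?thesis unfolding has_field_derivative_def .
qed

lemma test_fun_integration_by_parts:
  assumes a: "test_fun a" and b: "test_fun b"
  shows "integrable lborel (\<lambda>x. iter_partial [i] a x * b x)" "integrable lborel (\<lambda>x. a x * iter_partial [i] b x)"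
    "(\<integral>x. iter_partial [i] a x * b x \<partial>lborel) = - (\<integral>x. a x * iter_partial [i] b x \<partial>lborel)"
proof -
  have int: "integrable lborel (\<lambda>x. f x * g x)" if fg: "test_fun f" "test_fun g" for f g :: "real^'a \<Rightarrow> real"
  proof -
    obtain U1 U2 where U: "\<And>x. \<bar>f x\<bar> \<le> U1" "\<And>x. \<bar>g x\<bar> \<le> U2" "0 \<le> U1" "0 \<le> U2"
      using test_fun_lipschitz[OF fg(1)] test_fun_lipschitz[OF fg(2)] by metis
    have c: "continuous_on UNIV f" "continuous_on UNIV g" using fg smooth_fun_continuous by (auto simp: test_fun_def)
    hence m: "(\<lambda>x. f x * g x) \<in> borel_measurable lborel"
      by (intro borel_measurable_times) (auto intro!: borel_measurable_continuous_onI)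
    have w: "integrable lborel (\<lambda>x::real^'a. U1 * U2 * indicator (ball 0 1) x)"
      by (intro integrable_mult_right integrable_real_indicator) (auto simp: emeasure_lborel_cball_finite[unfolded infinity_ennreal_def] emeasure_lborel_ball_finite[unfolded infinity_ennreal_def])
    have "norm (f x * g x) \<le> norm (U1 * U2 * indicator (ball 0 1) x)" for x
      using test_fun_outside[OF fg(1), of x] U(1)[of x] U(2)[of x] U(3,4)
      by (cases "x \<in> ball 0 1") (auto simp: abs_mult intro!: mult_mono)
    thus ?thesis by (intro Bochner_Integration.integrable_bound[OF w m] AE_I2) auto
  qed
  show i1: "integrable lborel (\<lambda>x. iter_partial [i] a x * b x)" by (rule int[OF test_fun_partial[OF a] b])
  show i2: "integrable lborel (\<lambda>x. a x * iter_partial [i] b x)" by (rule int[OF a test_fun_partial[OF b]])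
  obtain L1 U1 where 1: "\<And>x y. \<bar>a x - a y\<bar> \<le> L1 * norm (x - y)" "\<And>x. \<bar>a x\<bar> \<le> U1" "0 \<le> L1" "0 \<le> U1" using test_fun_lipschitz[OF a] by blast
  obtain L2 U2 where 2: "\<And>x y. \<bar>b x - b y\<bar> \<le> L2 * norm (x - y)" "\<And>x. \<bar>b x\<bar> \<le> U2" "0 \<le> L2" "0 \<le> U2" using test_fun_lipschitz[OF b] by blast
  have sm: "smooth_fun a" "smooth_fun b" using a b by (auto simp: test_fun_def)
  have c: "continuous_on UNIV a" "continuous_on UNIV b" "continuous_on UNIV (iter_partial [i] a)" "continuous_on UNIV (iter_partial [i] b)"
    by (intro smooth_fun_continuous smooth_fun_iter_partial sm)+
  have "(\<integral>x. iter_partial [i] a x * b x + a x * iter_partial [i] b x \<partial>lborel) = 0"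
  proof (rule integral_directional_derivative_zero(2)[where F = "\<lambda>x. a x * b x" and e = "axis i 1" and L = "L1 * U2 + U1 * L2"])
    show "continuous_on UNIV (\<lambda>x. a x * b x)" by (intro continuous_intros c)
    show "norm x \<le> 1" if "a x * b x \<noteq> 0" for x using test_fun_outside[OF a, of x] that by (cases "x \<in> ball 0 1") auto
    show "\<bar>a x * b x - a y * b y\<bar> \<le> (L1 * U2 + U1 * L2) * norm (x - y)" for x y
    proof -
      have "\<bar>a x * b x - a y * b y\<bar> = \<bar>(a x - a y) * b x + a y * (b x - b y)\<bar>" by (simp add: algebra_simps)
      also have "\<dots> \<le> \<bar>a x - a y\<bar> * \<bar>b x\<bar> + \<bar>a y\<bar> * \<bar>b x - b y\<bar>" unfolding abs_mult[symmetric] by (rule abs_triangle_ineq)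
      also have "\<dots> \<le> (L1 * norm (x - y)) * U2 + U1 * (L2 * norm (x - y))"
        using 1 2 by (intro add_mono mult_mono) auto
      finally show ?thesis by (simp add: algebra_simps)
    qed
    show "((\<lambda>t. a (x + t *\<^sub>R axis i 1) * b (x + t *\<^sub>R axis i 1)) has_real_derivative iter_partial [i] a x * b x + a x * iter_partial [i] b x) (at 0)" for x
      using DERIV_mult[OF partial_directional_derivative[OF sm(1), of x i] partial_directional_derivative[OF sm(2), of x i]]
      by (simp add: algebra_simps)
    show "(\<lambda>x. iter_partial [i] a x * b x + a x * iter_partial [i] b x) \<in> borel_measurable borel"
      by (intro borel_measurable_continuous_onI continuous_intros c)
  qed simp
  thus "(\<integral>x. iter_partial [i] a x * b x \<partial>lborel) = - (\<integral>x. a x * iter_partial [i] b x \<partial>lborel)"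
    using i1 i2 by simp
qed

lemma hyp_grad_norm_measurable:
  fixes G :: "real^'n::finite \<Rightarrow> real^'n"
  assumes [measurable]: "G \<in> borel_measurable lebesgue"
  shows "hyp_grad_norm G \<in> borel_measurable lebesgue"
proof -
  have "(\<lambda>x::real^'n. (1 - (norm x)\<^sup>2) / 2) \<in> borel_measurable lborel" by measurable
  hence [measurable]: "(\<lambda>x::real^'n. (1 - (norm x)\<^sup>2) / 2) \<in> borel_measurable lebesgue" by (rule measurable_completion)
  show ?thesis unfolding hyp_grad_norm_def[abs_def] by measurable
qed

lemma test_fun_measurable:
  assumes "test_fun \<phi>"
  shows "\<phi> \<in> borel_measurable borel" "\<phi> \<in> borel_measurable lebesgue" "egrad \<phi> \<in> borel_measurable lebesgue"
proof -
  have sm: "smooth_fun \<phi>" using assms by (simp add: test_fun_def)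
  show m: "\<phi> \<in> borel_measurable borel" by (rule borel_measurable_continuous_onI[OF smooth_fun_continuous[OF sm]])
  thus "\<phi> \<in> borel_measurable lebesgue" by (intro measurable_completion) simp
  have "egrad \<phi> \<in> borel_measurable borel" by (rule borel_measurable_continuous_onI[OF egrad_continuous[OF sm]])
  thus "egrad \<phi> \<in> borel_measurable lebesgue" by (intro measurable_completion) simp
qed

lemma W1pE:
  fixes u :: "real^'n::finite \<Rightarrow> real"
  assumes "(u, G) \<in> W1p p"
  obtains \<phi> where "u \<in> borel_measurable lebesgue" "G \<in> borel_measurable lebesgue" "\<And>k. test_fun (\<phi> k)"
    "(\<lambda>k. \<integral>\<^sup>+x. ennreal (\<bar>\<phi> k x - u x\<bar> powr p) \<partial>hyp_vol TYPE('n)) \<longlonglongrightarrow> 0"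
    "(\<lambda>k. \<integral>\<^sup>+x. ennreal (hyp_grad_norm (\<lambda>y. egrad (\<phi> k) y - G y) x powr p) \<partial>hyp_vol TYPE('n)) \<longlonglongrightarrow> 0"
  using assms unfolding W1p_def by blast

text \<open>Here \<open>p \<le> n\<close> enters: with
  \<open>r = (1 - (norm x)\<^sup>2) / 2 \<le> 1\<close>, the volume weight
  \<open>(1 / r) ^ n\<close> outweighs the factor \<open>r powr p\<close> hidden in the hyperbolic
  gradient norm. Thus convergence in the hyperbolic norm implies Euclidean convergence on the
  ball.\<close>

lemma powr_le_weighted_hyp_grad_norm:
  fixes x :: "real^'n::finite" and p :: real
  assumes x: "x \<in> ball 0 1" and p: "1 \<le> p" "p \<le> CARD('n)" and t: "0 \<le> t" "t \<le> norm (H x)"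
  shows "t powr p \<le> (2 / (1 - (norm x)\<^sup>2)) ^ CARD('n) * hyp_grad_norm H x powr p"
proof -
  define r where "r = (1 - (norm x)\<^sup>2) / 2"
  have r: "0 < r" using ball_weight_ge_1(2)[OF x] by (simp add: r_def)
  have r1: "r \<le> 1" unfolding r_def by (rule order_trans[of _ "1 / 2"]) simp_all
  have e: "2 / (1 - (norm x)\<^sup>2) = 1 / r" by (simp add: r_def)
  have "t powr p \<le> norm (H x) powr p" using p t by (intro powr_mono2) auto
  also have "\<dots> = (1 / r) ^ CARD('n) * (r ^ CARD('n) * norm (H x) powr p)" using r by (simp add: power_divide)
  also have "\<dots> \<le> (1 / r) ^ CARD('n) * (r powr p * norm (H x) powr p)"
  proof (intro mult_left_mono mult_right_mono)
    have "r powr real CARD('n) \<le> r powr p" using r r1 p by (intro powr_mono') auto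
    thus "r ^ CARD('n) \<le> r powr p" using r by (simp add: powr_realpow)
  qed (use r in auto)
  also have "r powr p * norm (H x) powr p = hyp_grad_norm H x powr p"
    unfolding hyp_grad_norm_def r_def[symmetric] using r by (simp add: powr_mult)
  finally show ?thesis by (simp only: e)
qed

text \<open>Closability: integrating by parts, the \<open>L\<^sup>2\<close> products of the partial derivatives of the approximants tend to zero.\<close>

lemma W1p_gradient_zero:
  fixes u :: "real^'n::finite \<Rightarrow> real" and G :: "real^'n \<Rightarrow> real^'n" and p :: real
  assumes W: "(u, G) \<in> W1p p" and p: "2 \<le> p" "p \<le> CARD('n)" and u0: "AE x in hyp_vol TYPE('n). u x = 0"
  shows "AE x in hyp_vol TYPE('n). G x = 0"
proof -
  obtain \<phi> where um[measurable]: "u \<in> borel_measurable lebesgue" and Gm[measurable]: "G \<in> borel_measurable lebesgue"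
    and \<phi>: "\<And>k. test_fun (\<phi> k)"
    and c1: "(\<lambda>k. \<integral>\<^sup>+x. ennreal (\<bar>\<phi> k x - u x\<bar> powr p) \<partial>hyp_vol TYPE('n)) \<longlonglongrightarrow> 0"
    and c2: "(\<lambda>k. \<integral>\<^sup>+x. ennreal (hyp_grad_norm (\<lambda>y. egrad (\<phi> k) y - G y) x powr p) \<partial>hyp_vol TYPE('n)) \<longlonglongrightarrow> 0"
    by (rule W1pE[OF W]) blast
  have [measurable]: "ball (0::real^'n) 1 \<in> sets lebesgue" by (rule sets_completionI_sets) simp
  have \<phi>m[measurable]: "\<phi> k \<in> borel_measurable lebesgue" "egrad (\<phi> k) \<in> borel_measurable lebesgue" for k
    using test_fun_measurable[OF \<phi>] by auto
  have w1: "1 \<le> (2 / (1 - (norm x)\<^sup>2)) ^ CARD('n)" if "x \<in> ball 0 1" for x :: "real^'n"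
    using ball_weight_ge_1(1)[OF that] by (rule one_le_power)
  have c1': "(\<lambda>k. \<integral>\<^sup>+x. ennreal (\<bar>\<phi> k x\<bar> powr p) * indicator (ball 0 1) x \<partial>lebesgue) \<longlonglongrightarrow> 0"
  proof (rule tendsto_sandwich[OF _ _ tendsto_const c1])
    show "\<forall>\<^sub>F k in sequentially. (\<integral>\<^sup>+x. ennreal (\<bar>\<phi> k x\<bar> powr p) * indicator (ball 0 1) x \<partial>lebesgue)
        \<le> (\<integral>\<^sup>+x. ennreal (\<bar>\<phi> k x - u x\<bar> powr p) \<partial>hyp_vol TYPE('n))"
    proof (rule always_eventually, rule allI)
      fix k
      have "(\<integral>\<^sup>+x. ennreal (\<bar>\<phi> k x\<bar> powr p) * indicator (ball 0 1) x \<partial>lebesgue) \<le> (\<integral>\<^sup>+x. ennreal (\<bar>\<phi> k x\<bar> powr p) \<partial>hyp_vol TYPE('n))"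
      proof (rule nn_integral_ball_le_hyp_vol)
        fix x :: "real^'n" assume "x \<in> ball 0 1"
        hence "1 * \<bar>\<phi> k x\<bar> powr p \<le> (2 / (1 - (norm x)\<^sup>2)) ^ CARD('n) * \<bar>\<phi> k x\<bar> powr p" by (intro mult_right_mono w1) auto
        hence "ennreal (\<bar>\<phi> k x\<bar> powr p) \<le> ennreal ((2 / (1 - (norm x)\<^sup>2)) ^ CARD('n) * \<bar>\<phi> k x\<bar> powr p)" by (intro ennreal_leI) simp
        thus "ennreal (\<bar>\<phi> k x\<bar> powr p) \<le> ennreal ((2 / (1 - (norm x)\<^sup>2)) ^ CARD('n)) * ennreal (\<bar>\<phi> k x\<bar> powr p)"
          by (simp only: ennreal_mult'' powr_ge_zero)
      qed measurable
      also have "\<dots> = (\<integral>\<^sup>+x. ennreal (\<bar>\<phi> k x - u x\<bar> powr p) \<partial>hyp_vol TYPE('n))"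
      proof (rule nn_integral_cong_AE)
        show "AE x in hyp_vol TYPE('n). ennreal (\<bar>\<phi> k x\<bar> powr p) = ennreal (\<bar>\<phi> k x - u x\<bar> powr p)"
          using u0 by eventually_elim simp
      qed
      finally show "(\<integral>\<^sup>+x. ennreal (\<bar>\<phi> k x\<bar> powr p) * indicator (ball 0 1) x \<partial>lebesgue)
          \<le> (\<integral>\<^sup>+x. ennreal (\<bar>\<phi> k x - u x\<bar> powr p) \<partial>hyp_vol TYPE('n))" .
    qed
  qed simp
  have L1: "(\<lambda>k. \<integral>\<^sup>+x. ennreal \<bar>\<phi> k x\<bar> * indicator (ball 0 1) x \<partial>lebesgue) \<longlonglongrightarrow> 0"
    using Lp_ball_tendsto_0_mono[of \<phi> 1 p, OF \<phi>m(1) _ _ c1'] p by simp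
  have G0: "AE x in lebesgue. x \<in> ball 0 1 \<longrightarrow> G x $ i = 0" for i
  proof -
    define f where "f k = iter_partial [i] (\<phi> k)" for k
    define gi where "gi x = G x $ i" for x
    have ft: "test_fun (f k)" for k unfolding f_def by (rule test_fun_partial[OF \<phi>])
    have fm[measurable]: "f k \<in> borel_measurable lebesgue" "f k \<in> borel_measurable borel" for k using test_fun_measurable[OF ft] by auto
    have gim[measurable]: "gi \<in> borel_measurable lebesgue"
    proof -
      have "gi = (\<lambda>x. G x \<bullet> axis i 1)" by (simp add: gi_def fun_eq_iff cart_eq_inner_axis)
      thus ?thesis by simp
    qed
    \<comment> \<open>The squared distance in the Euclidean \<open>L^2\<close> space of the ball,
      available because \<open>2 \<le> p\<close> and the ball has finite volume.\<close>
    define D where "D a b = (\<integral>\<^sup>+x. ennreal ((a x - b x)\<^sup>2) * indicator (ball 0 1) x \<partial>lebesgue)" for a b :: "real^'n \<Rightarrow> real"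
    have c2': "(\<lambda>k. \<integral>\<^sup>+x. ennreal (\<bar>f k x - gi x\<bar> powr p) * indicator (ball 0 1) x \<partial>lebesgue) \<longlonglongrightarrow> 0"
    proof (rule tendsto_sandwich[OF _ _ tendsto_const c2])
      show "\<forall>\<^sub>F k in sequentially. (\<integral>\<^sup>+x. ennreal (\<bar>f k x - gi x\<bar> powr p) * indicator (ball 0 1) x \<partial>lebesgue)
        \<le> (\<integral>\<^sup>+x. ennreal (hyp_grad_norm (\<lambda>y. egrad (\<phi> k) y - G y) x powr p) \<partial>hyp_vol TYPE('n))"
      proof (rule always_eventually, rule allI, rule nn_integral_ball_le_hyp_vol)
        fix k
        have [measurable]: "hyp_grad_norm (\<lambda>y. egrad (\<phi> k) y - G y) \<in> borel_measurable lebesgue"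
          by (rule hyp_grad_norm_measurable) measurable
        show "(\<lambda>x. ennreal (hyp_grad_norm (\<lambda>y. egrad (\<phi> k) y - G y) x powr p)) \<in> borel_measurable lebesgue" by measurable
      next
        fix k and x :: "real^'n" assume x: "x \<in> ball 0 1"
        have "\<bar>f k x - gi x\<bar> = \<bar>(egrad (\<phi> k) x - G x) $ i\<bar>" by (simp only: f_def gi_def egrad_nth vector_minus_component)
        also have "\<dots> \<le> norm (egrad (\<phi> k) x - G x)" by (rule component_le_norm_cart)
        finally have "\<bar>f k x - gi x\<bar> powr p \<le> (2 / (1 - (norm x)\<^sup>2)) ^ CARD('n) * hyp_grad_norm (\<lambda>y. egrad (\<phi> k) y - G y) x powr p"
          using p by (intro powr_le_weighted_hyp_grad_norm[OF x]) auto
        hence "ennreal (\<bar>f k x - gi x\<bar> powr p) \<le> ennreal ((2 / (1 - (norm x)\<^sup>2)) ^ CARD('n) * hyp_grad_norm (\<lambda>y. egrad (\<phi> k) y - G y) x powr p)"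
          by (rule ennreal_leI)
        thus "ennreal (\<bar>f k x - gi x\<bar> powr p) \<le> ennreal ((2 / (1 - (norm x)\<^sup>2)) ^ CARD('n)) * ennreal (hyp_grad_norm (\<lambda>y. egrad (\<phi> k) y - G y) x powr p)"
          by (simp only: ennreal_mult'' powr_ge_zero)
      qed
    qed simp
    have "(\<lambda>k. \<integral>\<^sup>+x. ennreal (\<bar>f k x - gi x\<bar> powr 2) * indicator (ball 0 1) x \<partial>lebesgue) \<longlonglongrightarrow> 0"
      by (rule Lp_ball_tendsto_0_mono[of "\<lambda>k x. f k x - gi x" 2 p, OF _ _ _ c2']) (use p in auto)
    hence L2: "(\<lambda>k. D (f k) gi) \<longlonglongrightarrow> 0" unfolding D_def by simp
    have tri: "D a b \<le> 2 * D a c + 2 * D b c"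
      if [measurable]: "a \<in> borel_measurable lebesgue" "b \<in> borel_measurable lebesgue" "c \<in> borel_measurable lebesgue" for a b c
    proof -
      have "D a b \<le> (\<integral>\<^sup>+x. 2 * (ennreal ((a x - c x)\<^sup>2) * indicator (ball 0 1) x) + 2 * (ennreal ((b x - c x)\<^sup>2) * indicator (ball 0 1) x) \<partial>lebesgue)"
        unfolding D_def
      proof (rule nn_integral_mono)
        fix x
        have "0 \<le> ((a x - c x) + (b x - c x))\<^sup>2" by simp
        hence "(a x - b x)\<^sup>2 \<le> 2 * (a x - c x)\<^sup>2 + 2 * (b x - c x)\<^sup>2" by (simp add: power2_eq_square algebra_simps)
        hence "ennreal ((a x - b x)\<^sup>2) \<le> ennreal (2 * (a x - c x)\<^sup>2 + 2 * (b x - c x)\<^sup>2)" by (rule ennreal_leI)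
        also have "\<dots> = 2 * ennreal ((a x - c x)\<^sup>2) + 2 * ennreal ((b x - c x)\<^sup>2)" by (simp add: ennreal_plus ennreal_mult)
        finally show "ennreal ((a x - b x)\<^sup>2) * indicator (ball 0 1) x
          \<le> 2 * (ennreal ((a x - c x)\<^sup>2) * indicator (ball 0 1) x) + 2 * (ennreal ((b x - c x)\<^sup>2) * indicator (ball 0 1) x)"
          by (cases "x \<in> ball 0 1") simp_all
      qed
      also have "\<dots> = (\<integral>\<^sup>+x. 2 * (ennreal ((a x - c x)\<^sup>2) * indicator (ball 0 1) x) \<partial>lebesgue) + (\<integral>\<^sup>+x. 2 * (ennreal ((b x - c x)\<^sup>2) * indicator (ball 0 1) x) \<partial>lebesgue)"
        by (rule nn_integral_add) measurable
      also have "(\<integral>\<^sup>+x. 2 * (ennreal ((a x - c x)\<^sup>2) * indicator (ball 0 1) x) \<partial>lebesgue) = 2 * D a c"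
        unfolding D_def by (rule nn_integral_cmult) measurable
      also have "(\<integral>\<^sup>+x. 2 * (ennreal ((b x - c x)\<^sup>2) * indicator (ball 0 1) x) \<partial>lebesgue) = 2 * D b c"
        unfolding D_def by (rule nn_integral_cmult) measurable
      finally show ?thesis .
    qed
    have sq: "ennreal (\<integral>x. h x \<partial>lborel) = (\<integral>\<^sup>+x. ennreal (h x) * indicator (ball 0 1) x \<partial>lebesgue)"
      if h: "integrable lborel h" "\<And>x. 0 \<le> h x" "\<And>x. x \<notin> ball 0 1 \<Longrightarrow> h x = 0" for h :: "real^'n \<Rightarrow> real"
    proof -
      have "ennreal (\<integral>x. h x \<partial>lborel) = (\<integral>\<^sup>+x. ennreal (h x) \<partial>lborel)"
        by (rule nn_integral_eq_integral[symmetric]) (use h in auto)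
      also have "\<dots> = (\<integral>\<^sup>+x. ennreal (h x) \<partial>lebesgue)"
        by (rule nn_integral_completion[symmetric])
      also have "\<dots> = (\<integral>\<^sup>+x. ennreal (h x) * indicator (ball 0 1) x \<partial>lebesgue)"
        by (intro nn_integral_cong) (use h(3) in \<open>auto simp: indicator_def\<close>)
      finally show ?thesis .
    qed
    define c where "c j k = (\<integral>x. f k x * f j x \<partial>lborel)" for j k
    have ci: "integrable lborel (\<lambda>x. f k x * f j x)" for j k
      unfolding f_def[of k] by (rule test_fun_integration_by_parts(1)[OF \<phi> ft])
    \<comment> \<open>For fixed \<open>j\<close> the derivative is moved from
      \<open>\<phi> k\<close> to the test function \<open>f j\<close>. As \<open>k\<close> grows,
      \<open>\<phi> k\<close> tends to 0 in \<open>L^1\<close>, while the other factor is bounded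
      and fixed.\<close>
    have c0: "(\<lambda>k. c j k) \<longlonglongrightarrow> 0" for j
    proof -
      let ?h = "iter_partial [i] (f j)"
      obtain U where U: "\<And>x. \<bar>?h x\<bar> \<le> U" "0 \<le> U" using test_fun_lipschitz[OF test_fun_partial[OF ft]] by metis
      have hi: "integrable lborel (\<lambda>x. \<phi> k x * ?h x)" for k by (rule test_fun_integration_by_parts(2)[OF \<phi> ft])
      have le: "ennreal (\<integral>x. \<bar>\<phi> k x * ?h x\<bar> \<partial>lborel) \<le> ennreal U * (\<integral>\<^sup>+x. ennreal \<bar>\<phi> k x\<bar> * indicator (ball 0 1) x \<partial>lebesgue)" for k
      proof -
        have "ennreal (\<integral>x. \<bar>\<phi> k x * ?h x\<bar> \<partial>lborel) = (\<integral>\<^sup>+x. ennreal \<bar>\<phi> k x * ?h x\<bar> * indicator (ball 0 1) x \<partial>lebesgue)"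
        proof (rule sq)
          show "integrable lborel (\<lambda>x. \<bar>\<phi> k x * ?h x\<bar>)" by (rule integrable_abs[OF hi])
          show "\<bar>\<phi> k x * ?h x\<bar> = 0" if "x \<notin> ball 0 1" for x unfolding test_fun_outside[OF \<phi> that] by simp
        qed simp
        also have "\<dots> \<le> (\<integral>\<^sup>+x. ennreal U * (ennreal \<bar>\<phi> k x\<bar> * indicator (ball 0 1) x) \<partial>lebesgue)"
        proof (rule nn_integral_mono)
          fix x
          have "\<bar>\<phi> k x * ?h x\<bar> \<le> U * \<bar>\<phi> k x\<bar>" unfolding abs_mult mult.commute[of U] using U(1)[of x] by (rule mult_left_mono) simp
          hence "ennreal \<bar>\<phi> k x * ?h x\<bar> \<le> ennreal (U * \<bar>\<phi> k x\<bar>)" by (rule ennreal_leI)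
          hence "ennreal \<bar>\<phi> k x * ?h x\<bar> \<le> ennreal U * ennreal \<bar>\<phi> k x\<bar>" by (simp only: ennreal_mult'[OF U(2)])
          thus "ennreal \<bar>\<phi> k x * ?h x\<bar> * indicator (ball 0 1) x \<le> ennreal U * (ennreal \<bar>\<phi> k x\<bar> * indicator (ball 0 1) x)"
            by (cases "x \<in> ball 0 1") simp_all
        qed
        also have "\<dots> = ennreal U * (\<integral>\<^sup>+x. ennreal \<bar>\<phi> k x\<bar> * indicator (ball 0 1) x \<partial>lebesgue)"
          by (rule nn_integral_cmult) measurable
        finally show ?thesis .
      qed
      have ub: "(\<lambda>k. ennreal U * (\<integral>\<^sup>+x. ennreal \<bar>\<phi> k x\<bar> * indicator (ball 0 1) x \<partial>lebesgue)) \<longlonglongrightarrow> 0"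
        using ennreal_tendsto_cmult[OF _ L1, of "ennreal U"] by simp
      have "(\<lambda>k. ennreal (\<integral>x. \<bar>\<phi> k x * ?h x\<bar> \<partial>lborel)) \<longlonglongrightarrow> 0"
        by (rule tendsto_sandwich[OF _ _ tendsto_const ub]) (simp, rule always_eventually, rule allI, rule le)
      hence "(\<lambda>k. ennreal (\<integral>x. \<bar>\<phi> k x * ?h x\<bar> \<partial>lborel)) \<longlonglongrightarrow> ennreal 0" by (simp only: ennreal_0)
      hence b: "(\<lambda>k. \<integral>x. \<bar>\<phi> k x * ?h x\<bar> \<partial>lborel) \<longlonglongrightarrow> 0" by (subst (asm) tendsto_ennreal_iff) auto
      show ?thesis
      proof (rule Lim_null_comparison[OF always_eventually b], rule allI)
        fix k
        have "c j k = - (\<integral>x. \<phi> k x * ?h x \<partial>lborel)"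
          unfolding c_def f_def[of k] by (rule test_fun_integration_by_parts(3)[OF \<phi> ft])
        thus "norm (c j k) \<le> (\<integral>x. \<bar>\<phi> k x * ?h x\<bar> \<partial>lborel)"
          using integral_abs_bound[of lborel "\<lambda>x. \<phi> k x * ?h x"] by simp
      qed
    qed
    \<comment> \<open>Expanding the square of \<open>f j - f k\<close> and dropping
      \<open>c k k \<ge> 0\<close> leaves \<open>c j j - 2 * c j k\<close>. As \<open>k\<close>
      grows the cross term disappears, so the norm of \<open>f j\<close> is controlled by its
      distance to the limit \<open>gi\<close>.\<close>
    have Ej: "ennreal (c j j) \<le> 2 * D (f j) gi" for j
    proof -
      have "ennreal (c j j - 2 * c j k) \<le> 2 * D (f j) gi + 2 * D (f k) gi" for k
      proof -
        have h: "(f j x - f k x)\<^sup>2 = f j x * f j x - 2 * (f k x * f j x) + f k x * f k x" for x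
          by (simp add: power2_eq_square algebra_simps)
        have hi: "integrable lborel (\<lambda>x. (f j x - f k x)\<^sup>2)" unfolding h
          by (intro Bochner_Integration.integrable_add Bochner_Integration.integrable_diff integrable_mult_right ci)
        have "(\<integral>x. (f j x - f k x)\<^sup>2 \<partial>lborel) = c j j - 2 * c j k + c k k"
          unfolding h c_def using ci[of j j] ci[of k j] ci[of k k] by simp
        moreover have "0 \<le> c k k" unfolding c_def by (rule integral_nonneg_AE) auto
        ultimately have "ennreal (c j j - 2 * c j k) \<le> ennreal (\<integral>x. (f j x - f k x)\<^sup>2 \<partial>lborel)" by (intro ennreal_leI) simp
        also have "\<dots> = D (f j) (f k)" unfolding D_def
          by (rule sq[OF hi]) (use test_fun_outside[OF ft] in auto)
        also have "\<dots> \<le> 2 * D (f j) gi + 2 * D (f k) gi" by (rule tri) measurable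
        finally show ?thesis .
      qed
      moreover have "(\<lambda>k. ennreal (c j j - 2 * c j k)) \<longlonglongrightarrow> ennreal (c j j - 2 * 0)"
        by (intro tendsto_ennrealI tendsto_intros c0)
      moreover have "(\<lambda>k. 2 * D (f j) gi + 2 * D (f k) gi) \<longlonglongrightarrow> 2 * D (f j) gi + 2 * 0"
        by (intro tendsto_add tendsto_const ennreal_tendsto_cmult L2) simp
      ultimately have "ennreal (c j j - 2 * 0) \<le> 2 * D (f j) gi + 2 * 0" by (intro LIMSEQ_le) auto
      thus ?thesis by simp
    qed
    \<comment> \<open>\<open>6 = 2 + 2 * 2\<close>: the factor 2 of \<open>tri\<close>, once for the
      distance of \<open>gi\<close> to \<open>f j\<close> and once for the bound \<open>Ej\<close>.
      Then \<open>j\<close> tends to infinity.\<close>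
    have "D gi (\<lambda>_. 0) \<le> 6 * D (f j) gi" for j
    proof -
      have sym: "D gi (f j) = D (f j) gi" unfolding D_def by (simp add: power2_commute)
      have "D (\<lambda>_. 0) (f j) = ennreal (c j j)" unfolding c_def D_def
        by (subst sq[OF ci]) (use test_fun_outside[OF ft] in \<open>auto simp: power2_eq_square\<close>)
      hence "D (\<lambda>_. 0) (f j) \<le> 2 * D (f j) gi" using Ej by simp
      hence "2 * D gi (f j) + 2 * D (\<lambda>_. 0) (f j) \<le> 2 * D (f j) gi + 2 * (2 * D (f j) gi)"
        unfolding sym by (intro add_mono mult_left_mono) auto
      moreover have "D gi (\<lambda>_. 0) \<le> 2 * D gi (f j) + 2 * D (\<lambda>_. 0) (f j)" by (rule tri) measurable
      moreover have "2 * D (f j) gi + 2 * (2 * D (f j) gi) = 6 * D (f j) gi"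
        unfolding mult.assoc[symmetric] distrib_right[symmetric] by simp
      ultimately show ?thesis by (simp only:)
    qed
    moreover have "(\<lambda>j. 6 * D (f j) gi) \<longlonglongrightarrow> 6 * 0" by (intro ennreal_tendsto_cmult L2) simp
    ultimately have "D gi (\<lambda>_. 0) \<le> 6 * 0" by (intro LIMSEQ_le_const) auto
    hence "(\<integral>\<^sup>+x. ennreal ((gi x)\<^sup>2) * indicator (ball 0 1) x \<partial>lebesgue) = 0" by (simp add: D_def)
    hence "AE x in lebesgue. ennreal ((gi x)\<^sup>2) * indicator (ball 0 1) x = 0" by (subst (asm) nn_integral_0_iff_AE) auto
    thus ?thesis by eventually_elim (auto simp: gi_def indicator_def split: if_splits)
  qed
  have "AE x in lebesgue. \<forall>i\<in>UNIV. x \<in> ball 0 1 \<longrightarrow> G x $ i = 0"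
    by (rule AE_finite_allI, simp, rule G0)
  hence "AE x in lebesgue. x \<in> ball 0 1 \<longrightarrow> G x = 0" by eventually_elim (simp add: vec_eq_iff)
  moreover have "{x. \<not> G x = 0} \<in> sets lebesgue"
  proof -
    have "{x \<in> space lebesgue. G x \<noteq> 0} \<in> sets lebesgue" by measurable
    thus ?thesis by simp
  qed
  ultimately show ?thesis by (subst AE_hyp_vol_iff) auto
qed

section \<open>Passage to the completion\<close>

text \<open>Convexity of the power at \<open>a + b = (1 - s) * (a / (1 - s)) + s * (b / s)\<close>,
  by the tangent at \<open>c = a + b\<close>. The coefficient of \<open>a powr p\<close> tends to 1
  as \<open>s\<close> tends to 0, so a small perturbation \<open>b\<close> costs nothing in the
  limit.\<close>

lemma powr_add_le:
  fixes a b s p :: real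
  assumes p: "1 < p" and s: "0 < s" "s < 1" and ab: "0 \<le> a" "0 \<le> b"
  shows "(a + b) powr p \<le> (1 - s) powr (1 - p) * a powr p + s powr (1 - p) * b powr p"
proof -
  define c where "c = a + b"
  have c: "0 \<le> c" using ab by (simp add: c_def)
  have sc: "t * (x / t) powr p = t powr (1 - p) * x powr p" if "0 < t" "0 \<le> x" for t x :: real
    using that by (simp add: powr_divide powr_diff)
  have y1: "p * (c powr (p - 1) * (a / (1 - s))) \<le> (a / (1 - s)) powr p + (p - 1) * c powr p"
    by (rule young_powr) (use p s ab c in auto)
  have y2: "p * (c powr (p - 1) * (b / s)) \<le> (b / s) powr p + (p - 1) * c powr p"
    by (rule young_powr) (use p s ab c in auto)
  have "(1 - s) * (p * (c powr (p - 1) * (a / (1 - s)))) + s * (p * (c powr (p - 1) * (b / s)))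
     \<le> (1 - s) * ((a / (1 - s)) powr p + (p - 1) * c powr p) + s * ((b / s) powr p + (p - 1) * c powr p)"
    using s by (intro add_mono mult_left_mono y1 y2) auto
  moreover have "(1 - s) * (p * (c powr (p - 1) * (a / (1 - s)))) = p * (c powr (p - 1) * a)" using s by simp
  moreover have "s * (p * (c powr (p - 1) * (b / s))) = p * (c powr (p - 1) * b)" using s by simp
  moreover have "c powr (p - 1) * a + c powr (p - 1) * b = c powr p"
  proof (cases "c = 0")
    case False
    hence "c powr (p - 1) * c = c powr p" using c by (simp add: powr_diff)
    thus ?thesis unfolding distrib_left[symmetric] c_def[symmetric] .
  qed simp
  ultimately have "p * c powr p \<le> (1 - s) * ((a / (1 - s)) powr p + (p - 1) * c powr p) + s * ((b / s) powr p + (p - 1) * c powr p)"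
    by (simp only: distrib_left[symmetric])
  also have "\<dots> = (1 - s) * (a / (1 - s)) powr p + s * (b / s) powr p + (p - 1) * c powr p" by (simp add: algebra_simps)
  finally have "c powr p \<le> (1 - s) * (a / (1 - s)) powr p + s * (b / s) powr p" by (simp add: algebra_simps)
  thus ?thesis using sc[of "1 - s" a] sc[of s b] s ab by (simp only: c_def)
qed

lemma nn_integral_powr_le_add:
  fixes a b f :: "'a \<Rightarrow> real" and p s :: real
  assumes p: "1 < p" and s: "0 < s" "s < 1"
    and [measurable]: "a \<in> borel_measurable M" "b \<in> borel_measurable M"
    and ae: "AE x in M. 0 \<le> a x \<and> 0 \<le> b x \<and> 0 \<le> f x \<and> f x \<le> a x + b x"
  shows "(\<integral>\<^sup>+x. ennreal (f x powr p) \<partial>M)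
    \<le> ennreal ((1 - s) powr (1 - p)) * (\<integral>\<^sup>+x. ennreal (a x powr p) \<partial>M) + ennreal (s powr (1 - p)) * (\<integral>\<^sup>+x. ennreal (b x powr p) \<partial>M)"
proof -
  have "(\<integral>\<^sup>+x. ennreal (f x powr p) \<partial>M)
    \<le> (\<integral>\<^sup>+x. ennreal ((1 - s) powr (1 - p)) * ennreal (a x powr p) + ennreal (s powr (1 - p)) * ennreal (b x powr p) \<partial>M)"
  proof (rule nn_integral_mono_AE)
    show "AE x in M. ennreal (f x powr p) \<le> ennreal ((1 - s) powr (1 - p)) * ennreal (a x powr p) + ennreal (s powr (1 - p)) * ennreal (b x powr p)"
      using ae
    proof eventually_elim
      case (elim x)
      have "f x powr p \<le> (a x + b x) powr p" using elim p by (intro powr_mono2) auto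
      also have "\<dots> \<le> (1 - s) powr (1 - p) * a x powr p + s powr (1 - p) * b x powr p" using elim by (intro powr_add_le p s) auto
      finally have "ennreal (f x powr p) \<le> ennreal ((1 - s) powr (1 - p) * a x powr p + s powr (1 - p) * b x powr p)" by (rule ennreal_leI)
      thus ?case by (simp add: ennreal_plus ennreal_mult)
    qed
  qed
  also have "\<dots> = (\<integral>\<^sup>+x. ennreal ((1 - s) powr (1 - p)) * ennreal (a x powr p) \<partial>M) + (\<integral>\<^sup>+x. ennreal (s powr (1 - p)) * ennreal (b x powr p) \<partial>M)"
    by (rule nn_integral_add) measurable
  also have "(\<integral>\<^sup>+x. ennreal ((1 - s) powr (1 - p)) * ennreal (a x powr p) \<partial>M) = ennreal ((1 - s) powr (1 - p)) * (\<integral>\<^sup>+x. ennreal (a x powr p) \<partial>M)"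
    by (rule nn_integral_cmult) measurable
  also have "(\<integral>\<^sup>+x. ennreal (s powr (1 - p)) * ennreal (b x powr p) \<partial>M) = ennreal (s powr (1 - p)) * (\<integral>\<^sup>+x. ennreal (b x powr p) \<partial>M)"
    by (rule nn_integral_cmult) measurable
  finally show ?thesis .
qed

lemma nn_integral_le_limit:
  fixes f :: "nat \<Rightarrow> 'a \<Rightarrow> ennreal"
  assumes m: "\<And>k. f k \<in> borel_measurable M" and ae: "AE x in M. (\<lambda>k. f k x) \<longlonglongrightarrow> g x"
    and lim: "(\<lambda>k. \<integral>\<^sup>+x. f k x \<partial>M) \<longlonglongrightarrow> L"
  shows "(\<integral>\<^sup>+x. g x \<partial>M) \<le> L"
proof -
  have "(\<integral>\<^sup>+x. g x \<partial>M) = (\<integral>\<^sup>+x. liminf (\<lambda>k. f k x) \<partial>M)"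
  proof (rule nn_integral_cong_AE)
    show "AE x in M. g x = liminf (\<lambda>k. f k x)"
      using ae by eventually_elim (simp add: lim_imp_Liminf)
  qed
  also have "\<dots> \<le> liminf (\<lambda>k. \<integral>\<^sup>+x. f k x \<partial>M)" by (rule nn_integral_liminf[OF m])
  also have "\<dots> = L" by (rule lim_imp_Liminf[OF _ lim]) simp
  finally show ?thesis .
qed

lemma sobolev_const_pos:
  fixes n :: nat and p :: real
  assumes "1 < p" "p < n"
  shows "0 < sobolev_const n p"
proof -
  have n: "0 < real n" using assms by simp
  have "real n / p < real n" using assms n by (simp add: divide_less_eq)
  hence g: "0 < Gamma (real n)" "0 < Gamma (real n / p)" "0 < Gamma (real n + 1 - real n / p)"
    using n assms by (auto intro!: Gamma_real_pos)
  have a: "0 < real n * (p - 1) / (real n - p)" using assms n by simp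
  have q: "0 < Gamma (real n) / (Gamma (real n / p) * Gamma (real n + 1 - real n / p) * unit_ball_vol (real n))"
    using g by (intro divide_pos_pos mult_pos_pos) auto
  have pw: "0 < x powr t" if "0 < x" for x t :: real using that by simp
  show ?thesis unfolding sobolev_const_def by (intro positive_imp_inverse_positive mult_pos_pos pw a q) (use n in simp)
qed

text \<open>The terms behave differently in the limit: the energies are bounded above through
  convergence in norm, whereas the Sobolev term and the remainder are only lower semicontinuous
  along an almost everywhere convergent subsequence. To combine both, the real sequences
  \<open>Nr\<close> and \<open>Rr\<close> are bounded by the energies and made convergent along a
  further subsequence before Fatou's lemma is applied.\<close>

lemma W1p_inequality:
  fixes u :: "real^'n::finite \<Rightarrow> real" and G :: "real^'n \<Rightarrow> real^'n" and p \<tau> :: real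
  defines "n \<equiv> CARD('n)"
  assumes n2: "2 \<le> n" and p: "2 * real n / (real n - 1) \<le> p" "p < n" and W: "(u, G) \<in> W1p p"
    and \<tau>: "0 \<le> \<tau>" "(p - 1) * \<tau> \<le> 1"
  defines "Rem \<equiv> \<lambda>t. (1 - ((p - 1) * \<tau>)\<^sup>2) * t powr p + \<tau> * (p * (p - 1) / (p + 1)) * (t powr (p + 1) / (1 + t)\<^sup>2)"
  shows "(\<integral>\<^sup>+x. ennreal (hyp_grad_norm G x powr p) \<partial>hyp_vol TYPE('n)) < \<infinity>"
    and "(\<integral>\<^sup>+x. ennreal (\<bar>u x\<bar> powr p) \<partial>hyp_vol TYPE('n)) < \<infinity>"
    and "(\<integral>\<^sup>+x. ennreal (\<bar>u x\<bar> powr (n * p / (n - p))) \<partial>hyp_vol TYPE('n)) < \<infinity>"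
    and "ennreal (sobolev_const n p powr p * enn2real (\<integral>\<^sup>+x. ennreal (\<bar>u x\<bar> powr (n * p / (n - p))) \<partial>hyp_vol TYPE('n)) powr ((n - p) / n))
      + (\<integral>\<^sup>+x. ennreal (((real n - 1) / p) powr p * Rem \<bar>u x\<bar>) \<partial>hyp_vol TYPE('n))
    \<le> (\<integral>\<^sup>+x. ennreal (hyp_grad_norm G x powr p) \<partial>hyp_vol TYPE('n))"
proof -
  let ?M = "hyp_vol TYPE('n)"
  define ps where "ps = n * p / (n - p)"
  define \<theta> where "\<theta> = (real n - p) / n"
  define S where "S = sobolev_const n p powr p"
  define cp where "cp = ((real n - 1) / p) powr p"
  have p2: "2 < p"
  proof -
    have "2 * (real n - 1) < 2 * real n" by simp
    hence "2 < 2 * real n / (real n - 1)" using n2 by (simp add: less_divide_eq)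
    thus ?thesis using p by simp
  qed
  have p1: "1 < p" using p2 by simp
  have ps: "0 < ps" using p p2 n2 by (simp add: ps_def)
  have \<theta>: "0 < \<theta>" using p n2 by (simp add: \<theta>_def)
  have S: "0 < S" using sobolev_const_pos[OF p1 p(2)] by (simp add: S_def)
  obtain \<phi>0 where um[measurable]: "u \<in> borel_measurable lebesgue" and Gm[measurable]: "G \<in> borel_measurable lebesgue"
    and \<phi>0: "\<And>k. test_fun (\<phi>0 k)"
    and c1: "(\<lambda>k. \<integral>\<^sup>+x. ennreal (\<bar>\<phi>0 k x - u x\<bar> powr p) \<partial>?M) \<longlonglongrightarrow> 0"
    and c2: "(\<lambda>k. \<integral>\<^sup>+x. ennreal (hyp_grad_norm (\<lambda>y. egrad (\<phi>0 k) y - G y) x powr p) \<partial>?M) \<longlonglongrightarrow> 0"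
    by (rule W1pE[OF W]) blast
  have "\<forall>\<^sub>F k in sequentially. (\<integral>\<^sup>+x. ennreal (\<bar>\<phi>0 k x - u x\<bar> powr p) \<partial>?M) < 1
      \<and> (\<integral>\<^sup>+x. ennreal (hyp_grad_norm (\<lambda>y. egrad (\<phi>0 k) y - G y) x powr p) \<partial>?M) < 1"
    by (intro eventually_conj order_tendstoD(2)[OF c1] order_tendstoD(2)[OF c2]) simp_all
  then obtain k0 where k0: "\<And>k. k0 \<le> k \<Longrightarrow> (\<integral>\<^sup>+x. ennreal (\<bar>\<phi>0 k x - u x\<bar> powr p) \<partial>?M) < 1"
      "\<And>k. k0 \<le> k \<Longrightarrow> (\<integral>\<^sup>+x. ennreal (hyp_grad_norm (\<lambda>y. egrad (\<phi>0 k) y - G y) x powr p) \<partial>?M) < 1"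
    unfolding eventually_sequentially by blast
  have \<phi>0m: "\<phi>0 k \<in> borel_measurable lebesgue" for k by (rule test_fun_measurable(2)[OF \<phi>0])
  \<comment> \<open>Convergence in \<open>L^p\<close> is read as \<open>L^1\<close> convergence of
    the powers, which yields an almost everywhere convergent subsequence. Discarding the first
    \<open>k0\<close> terms makes these powers integrable.\<close>
  have "\<exists>r::nat\<Rightarrow>nat. strict_mono r \<and> (AE x in ?M. (\<lambda>k. \<bar>\<phi>0 (r k + k0) x - u x\<bar> powr p) \<longlonglongrightarrow> 0)"
  proof (rule tendsto_L1_AE_subseq)
    have [measurable]: "\<phi>0 k \<in> borel_measurable lebesgue" for k by (rule \<phi>0m)
    show i: "integrable ?M (\<lambda>x. \<bar>\<phi>0 (k + k0) x - u x\<bar> powr p)" for k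
    proof (rule integrableI_nonneg)
      show "(\<integral>\<^sup>+x. ennreal (\<bar>\<phi>0 (k + k0) x - u x\<bar> powr p) \<partial>?M) < \<infinity>"
        using less_trans[OF k0(1)[of "k + k0"] ennreal_one_less_top] by simp
    qed auto
    have "(\<lambda>k. \<integral>\<^sup>+x. ennreal (\<bar>\<phi>0 (k + k0) x - u x\<bar> powr p) \<partial>?M) \<longlonglongrightarrow> ennreal 0"
      using LIMSEQ_ignore_initial_segment[OF c1, of k0] by simp
    moreover have "(\<integral>\<^sup>+x. ennreal (\<bar>\<phi>0 (k + k0) x - u x\<bar> powr p) \<partial>?M) = ennreal (\<integral>x. \<bar>\<phi>0 (k + k0) x - u x\<bar> powr p \<partial>?M)" for k
      by (rule nn_integral_eq_integral[OF i]) simp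
    ultimately have "(\<lambda>k. ennreal (\<integral>x. \<bar>\<phi>0 (k + k0) x - u x\<bar> powr p \<partial>?M)) \<longlonglongrightarrow> ennreal 0" by simp
    thus "(\<lambda>k. \<integral>x. norm (\<bar>\<phi>0 (k + k0) x - u x\<bar> powr p) \<partial>?M) \<longlonglongrightarrow> 0"
      by (subst (asm) tendsto_ennreal_iff) auto
  qed
  then obtain r where r: "strict_mono (r :: nat \<Rightarrow> nat)" and rAE: "AE x in ?M. (\<lambda>k. \<bar>\<phi>0 (r k + k0) x - u x\<bar> powr p) \<longlonglongrightarrow> 0" by blast
  define \<phi> where "\<phi> k = \<phi>0 (r k + k0)" for k
  have \<phi>: "test_fun (\<phi> k)" for k by (simp add: \<phi>_def \<phi>0)
  have \<phi>m[measurable]: "\<phi> k \<in> borel_measurable lebesgue" "egrad (\<phi> k) \<in> borel_measurable lebesgue" for k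
    using test_fun_measurable[OF \<phi>] by auto
  define d where "d k = (\<integral>\<^sup>+x. ennreal (hyp_grad_norm (\<lambda>y. egrad (\<phi> k) y - G y) x powr p) \<partial>?M)" for k
  have d1: "d k \<le> 1" for k unfolding d_def \<phi>_def using k0(2)[of "r k + k0"] by simp
  have d0: "d \<longlonglongrightarrow> 0"
    using LIMSEQ_subseq_LIMSEQ[OF LIMSEQ_ignore_initial_segment[OF c2, of k0] r] by (simp add: d_def[abs_def] \<phi>_def o_def)
  have conv: "AE x in ?M. (\<lambda>k. \<bar>\<phi> k x\<bar>) \<longlonglongrightarrow> \<bar>u x\<bar>" using rAE
  proof eventually_elim
    case (elim x)
    have "(\<lambda>k. (\<bar>\<phi> k x - u x\<bar> powr p) powr (1 / p)) \<longlonglongrightarrow> 0 powr (1 / p)"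
      using elim p1 unfolding \<phi>_def by (intro tendsto_powr2 tendsto_const) auto
    hence "(\<lambda>k. \<bar>\<phi> k x - u x\<bar>) \<longlonglongrightarrow> 0" using p1 by (simp add: powr_powr)
    hence "(\<lambda>k. \<phi> k x) \<longlonglongrightarrow> u x" by (simp add: tendsto_rabs_zero_iff LIM_zero_iff)
    thus ?case by (rule tendsto_rabs)
  qed
  have Hm[measurable]: "hyp_grad_norm G \<in> borel_measurable lebesgue" "hyp_grad_norm (egrad (\<phi> k)) \<in> borel_measurable lebesgue"
    "hyp_grad_norm (\<lambda>y. egrad (\<phi> k) y - G y) \<in> borel_measurable lebesgue" for k
    by (intro hyp_grad_norm_measurable; measurable)+
  let ?X = "\<integral>\<^sup>+x. ennreal (hyp_grad_norm G x powr p) \<partial>?M" and ?Xk = "\<lambda>k. \<integral>\<^sup>+x. ennreal (hyp_grad_norm (egrad (\<phi> k)) x powr p) \<partial>?M"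
  let ?N = "\<integral>\<^sup>+x. ennreal (\<bar>u x\<bar> powr ps) \<partial>?M" and ?Nk = "\<lambda>k. \<integral>\<^sup>+x. ennreal (\<bar>\<phi> k x\<bar> powr ps) \<partial>?M"
  let ?R = "\<integral>\<^sup>+x. ennreal (cp * Rem \<bar>u x\<bar>) \<partial>?M" and ?Rk = "\<lambda>k. \<integral>\<^sup>+x. ennreal (cp * Rem \<bar>\<phi> k x\<bar>) \<partial>?M"
  have hn: "0 \<le> hyp_grad_norm H x" if "x \<in> ball 0 1" for H and x :: "real^'n"
    using ball_weight_ge_1(2)[OF that] by (simp add: hyp_grad_norm_def)
  have htri: "hyp_grad_norm A x \<le> hyp_grad_norm B x + hyp_grad_norm (\<lambda>y. A y - B y) x" if "x \<in> ball 0 1" for A B and x :: "real^'n"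
  proof -
    have "norm (A x) \<le> norm (B x) + norm (A x - B x)" using norm_triangle_sub by blast
    hence "(1 - (norm x)\<^sup>2) / 2 * norm (A x) \<le> (1 - (norm x)\<^sup>2) / 2 * (norm (B x) + norm (A x - B x))"
      using ball_weight_ge_1(2)[OF that] by (intro mult_left_mono) auto
    thus ?thesis by (simp only: hyp_grad_norm_def distrib_left)
  qed
  have Xk: "?Xk k \<le> ennreal ((1 - s) powr (1 - p)) * ?X + ennreal (s powr (1 - p)) * d k" if "0 < s" "s < 1" for s k
    unfolding d_def
  proof (rule nn_integral_powr_le_add[OF p1 that])
    show "AE x in ?M. 0 \<le> hyp_grad_norm G x \<and> 0 \<le> hyp_grad_norm (\<lambda>y. egrad (\<phi> k) y - G y) x \<and> 0 \<le> hyp_grad_norm (egrad (\<phi> k)) x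
        \<and> hyp_grad_norm (egrad (\<phi> k)) x \<le> hyp_grad_norm G x + hyp_grad_norm (\<lambda>y. egrad (\<phi> k) y - G y) x"
      using AE_hyp_vol_ball by eventually_elim (intro conjI hn htri)
  qed measurable
  note test = poincare_sobolev_test_fun[OF n2[unfolded n_def] p[unfolded n_def] \<phi> \<tau>]
  have main: "ennreal (S * enn2real (?Nk k) powr \<theta>) + ?Rk k \<le> ?Xk k" for k
    using test(1)[of k] unfolding S_def \<theta>_def cp_def ps_def Rem_def n_def .
  have Xkfin: "?Xk k < \<infinity>" for k by (rule test(2))
  show Xfin: "?X < \<infinity>"
  proof -
    \<comment> \<open>The same bound with the roles of \<open>G\<close> and the gradient of
      \<open>\<phi> 0\<close> exchanged; for finiteness any \<open>s\<close> in between 0 and 1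
      would do.\<close>
    have "?X \<le> ennreal ((1 - 1/2) powr (1 - p)) * ?Xk 0 + ennreal ((1/2) powr (1 - p)) * d 0"
      unfolding d_def
    proof (rule nn_integral_powr_le_add[OF p1])
      have eq: "hyp_grad_norm (\<lambda>y. G y - egrad (\<phi> 0) y) x = hyp_grad_norm (\<lambda>y. egrad (\<phi> 0) y - G y) x" for x
        by (simp add: hyp_grad_norm_def norm_minus_commute)
      show "AE x in ?M. 0 \<le> hyp_grad_norm (egrad (\<phi> 0)) x \<and> 0 \<le> hyp_grad_norm (\<lambda>y. egrad (\<phi> 0) y - G y) x \<and> 0 \<le> hyp_grad_norm G x
        \<and> hyp_grad_norm G x \<le> hyp_grad_norm (egrad (\<phi> 0)) x + hyp_grad_norm (\<lambda>y. egrad (\<phi> 0) y - G y) x"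
        using AE_hyp_vol_ball
      proof eventually_elim
        case (elim x) show ?case using hn[OF elim] htri[OF elim, of G "egrad (\<phi> 0)"] eq[of x] by simp
      qed
    qed (simp_all, measurable)
    also have "\<dots> < \<infinity>" using Xkfin[of 0] le_less_trans[OF d1[of 0] ennreal_one_less_top] by (simp add: ennreal_mult_less_top)
    finally show ?thesis .
  qed
  show "(\<integral>\<^sup>+x. ennreal (\<bar>u x\<bar> powr p) \<partial>?M) < \<infinity>"
  proof -
    have "(\<integral>\<^sup>+x. ennreal (\<bar>u x\<bar> powr p) \<partial>?M) \<le> ennreal ((1 - 1/2) powr (1 - p)) * (\<integral>\<^sup>+x. ennreal (\<bar>\<phi> 0 x\<bar> powr p) \<partial>?M)
       + ennreal ((1/2) powr (1 - p)) * (\<integral>\<^sup>+x. ennreal (\<bar>\<phi> 0 x - u x\<bar> powr p) \<partial>?M)"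
      by (rule nn_integral_powr_le_add[OF p1]) (auto intro!: AE_I2)
    also have "\<dots> < \<infinity>"
      using test(3)[of p 0] p1 less_trans[OF k0(1)[of "r 0 + k0"] ennreal_one_less_top] by (simp add: ennreal_mult_less_top \<phi>_def)
    finally show ?thesis .
  qed
  define Xr where "Xr = enn2real ?X"
  have X: "?X = ennreal Xr" "0 \<le> Xr" using Xfin by (auto simp: Xr_def)
  define Nr where "Nr k = enn2real (?Nk k)" for k
  define Rr where "Rr k = enn2real (?Rk k)" for k
  have N: "?Nk k = ennreal (Nr k)" "0 \<le> Nr k" for k using test(3)[of ps k] ps by (auto simp: Nr_def)
  have R: "?Rk k = ennreal (Rr k)" "0 \<le> Rr k" for k
  proof -
    have "?Rk k \<le> ennreal (S * enn2real (?Nk k) powr \<theta>) + ?Rk k" by simp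
    hence "?Rk k < \<infinity>" using main[of k] Xkfin[of k] by (meson le_less_trans order_trans)
    thus "?Rk k = ennreal (Rr k)" "0 \<le> Rr k" by (auto simp: Rr_def)
  qed
  have Xs: "ennreal (S * Nr k powr \<theta> + Rr k) \<le> ennreal ((1 - s) powr (1 - p)) * ennreal Xr + ennreal (s powr (1 - p)) * d k" if "0 < s" "s < 1" for s k
  proof -
    have "ennreal (S * Nr k powr \<theta> + Rr k) = ennreal (S * enn2real (?Nk k) powr \<theta>) + ?Rk k"
      unfolding R(1) using S R(2)[of k] by (simp add: ennreal_plus Nr_def)
    also have "\<dots> \<le> ?Xk k" by (rule main)
    also have "\<dots> \<le> ennreal ((1 - s) powr (1 - p)) * ennreal Xr + ennreal (s powr (1 - p)) * d k"
      using Xk[OF that, of k] unfolding X(1) .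
    finally show ?thesis .
  qed
  \<comment> \<open>The bound on the energies for \<open>s = 1 / 2\<close> and
    \<open>d k \<le> 1\<close>.\<close>
  define C where "C = (1 - 1/2) powr (1 - p) * Xr + (1/2) powr (1 - p)"
  have bC: "S * Nr k powr \<theta> + Rr k \<le> C" for k
  proof -
    have "ennreal (S * Nr k powr \<theta> + Rr k) \<le> ennreal ((1 - 1/2) powr (1 - p)) * ennreal Xr + ennreal ((1/2) powr (1 - p)) * d k"
      by (rule Xs) auto
    also have "\<dots> \<le> ennreal ((1 - 1/2) powr (1 - p)) * ennreal Xr + ennreal ((1/2) powr (1 - p)) * 1"
      by (intro add_left_mono mult_left_mono d1) simp
    also have "\<dots> = ennreal C" unfolding C_def using X(2) by (simp add: ennreal_plus ennreal_mult)
    finally show ?thesis using X(2) by (subst (asm) ennreal_le_iff) (auto simp: C_def)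
  qed
  have bN: "Nr k \<le> (C / S) powr (1 / \<theta>)" for k
  proof -
    have "S * Nr k powr \<theta> \<le> C" using bC[of k] R(2)[of k] by linarith
    hence "Nr k powr \<theta> \<le> C / S" using S by (simp add: le_divide_eq mult.commute)
    hence "(Nr k powr \<theta>) powr (1 / \<theta>) \<le> (C / S) powr (1 / \<theta>)" using \<theta> by (intro powr_mono2) auto
    thus ?thesis using \<theta> N(2)[of k] by (simp add: powr_powr)
  qed
  have bR: "Rr k \<le> C" for k
  proof -
    have "0 \<le> S * Nr k powr \<theta>" using S by simp
    thus ?thesis using bC[of k] by linarith
  qed
  have "bounded (range (\<lambda>k. (Nr k, Rr k)))"
  proof (rule bounded_subset)
    show "bounded ({0..(C / S) powr (1 / \<theta>)} \<times> {0..C})" by (intro bounded_Times bounded_closed_interval)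
    show "range (\<lambda>k. (Nr k, Rr k)) \<subseteq> {0..(C / S) powr (1 / \<theta>)} \<times> {0..C}" using bN bR N(2) R(2) by auto
  qed
  then obtain l q where q: "strict_mono (q :: nat \<Rightarrow> nat)" and "((\<lambda>k. (Nr k, Rr k)) \<circ> q) \<longlonglongrightarrow> l"
    using bounded_imp_convergent_subsequence by blast
  hence lim: "(\<lambda>k. (Nr (q k), Rr (q k))) \<longlonglongrightarrow> l" by (simp add: o_def)
  define NI where "NI = fst l"
  define RI where "RI = snd l"
  have Nlim: "(\<lambda>k. Nr (q k)) \<longlonglongrightarrow> NI" using tendsto_fst[OF lim] by (simp add: NI_def)
  have Rlim: "(\<lambda>k. Rr (q k)) \<longlonglongrightarrow> RI" using tendsto_snd[OF lim] by (simp add: RI_def)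
  have NI: "0 \<le> NI" by (rule LIMSEQ_le_const[OF Nlim]) (use N(2) in auto)
  have RI: "0 \<le> RI" by (rule LIMSEQ_le_const[OF Rlim]) (use R(2) in auto)
  have convq: "AE x in ?M. (\<lambda>k. \<bar>\<phi> (q k) x\<bar>) \<longlonglongrightarrow> \<bar>u x\<bar>" using conv
  proof eventually_elim
    case (elim x) show ?case using LIMSEQ_subseq_LIMSEQ[OF elim q] by (simp add: o_def)
  qed
  have pwlim: "(\<lambda>k. f k powr a) \<longlonglongrightarrow> t powr a" if "f \<longlonglongrightarrow> t" "\<And>k. 0 \<le> f k" "0 < a" for f :: "nat \<Rightarrow> real" and t a
    using that by (intro tendsto_powr2 tendsto_const) auto
  have FN: "?N \<le> ennreal NI"
  proof (rule nn_integral_le_limit)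
    show "(\<lambda>k. \<integral>\<^sup>+x. ennreal (\<bar>\<phi> (q k) x\<bar> powr ps) \<partial>?M) \<longlonglongrightarrow> ennreal NI" unfolding N(1) by (rule tendsto_ennrealI[OF Nlim])
    show "AE x in ?M. (\<lambda>k. ennreal (\<bar>\<phi> (q k) x\<bar> powr ps)) \<longlonglongrightarrow> ennreal (\<bar>u x\<bar> powr ps)"
      using convq by eventually_elim (rule tendsto_ennrealI, rule pwlim, use ps in auto)
  qed measurable
  have Remm[measurable]: "Rem \<in> borel_measurable borel" unfolding Rem_def by measurable
  have FR: "?R \<le> ennreal RI"
  proof (rule nn_integral_le_limit)
    show "(\<lambda>k. \<integral>\<^sup>+x. ennreal (cp * Rem \<bar>\<phi> (q k) x\<bar>) \<partial>?M) \<longlonglongrightarrow> ennreal RI" unfolding R(1) by (rule tendsto_ennrealI[OF Rlim])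
    show "AE x in ?M. (\<lambda>k. ennreal (cp * Rem \<bar>\<phi> (q k) x\<bar>)) \<longlonglongrightarrow> ennreal (cp * Rem \<bar>u x\<bar>)"
      using convq
    proof eventually_elim
      case (elim x)
      have a: "(\<lambda>k. \<bar>\<phi> (q k) x\<bar> powr a) \<longlonglongrightarrow> \<bar>u x\<bar> powr a" if "0 < a" for a by (rule pwlim[OF elim]) (use that in auto)
      have "1 + \<bar>u x\<bar> \<noteq> 0" by linarith
      hence "(1 + \<bar>u x\<bar>)\<^sup>2 \<noteq> 0" by simp
      thus ?case unfolding Rem_def using p1
        by (intro tendsto_ennrealI tendsto_mult tendsto_add tendsto_const tendsto_divide tendsto_power a elim) auto
    qed
  qed measurable
  \<comment> \<open>For fixed \<open>s\<close> the index tends to infinity first, which removes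
    \<open>d\<close>; then \<open>s = 1 / (k + 2)\<close> tends to 0 and the factor in front of
    \<open>Xr\<close> tends to 1.\<close>
  have key: "S * NI powr \<theta> + RI \<le> Xr"
  proof -
    have s: "S * NI powr \<theta> + RI \<le> (1 - s) powr (1 - p) * Xr" if s: "0 < s" "s < 1" for s
    proof -
      have "(\<lambda>k. ennreal (S * Nr (q k) powr \<theta> + Rr (q k))) \<longlonglongrightarrow> ennreal (S * NI powr \<theta> + RI)"
        by (intro tendsto_ennrealI tendsto_add tendsto_mult tendsto_const Rlim pwlim Nlim N(2) \<theta>)
      moreover have "(\<lambda>k. ennreal ((1 - s) powr (1 - p)) * ennreal Xr + ennreal (s powr (1 - p)) * d (q k)) \<longlonglongrightarrow> ennreal ((1 - s) powr (1 - p)) * ennreal Xr + ennreal (s powr (1 - p)) * 0"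
        using LIMSEQ_subseq_LIMSEQ[OF d0 q] by (intro tendsto_add tendsto_const ennreal_tendsto_cmult) (auto simp: o_def)
      ultimately have "ennreal (S * NI powr \<theta> + RI) \<le> ennreal ((1 - s) powr (1 - p)) * ennreal Xr + ennreal (s powr (1 - p)) * 0"
        by (rule LIMSEQ_le) (use Xs[OF s] in blast)
      hence "ennreal (S * NI powr \<theta> + RI) \<le> ennreal ((1 - s) powr (1 - p) * Xr)" using X(2) by (simp add: ennreal_mult)
      thus ?thesis using X(2) by (subst (asm) ennreal_le_iff) auto
    qed
    have "(\<lambda>k. 1 - 1 / real (k + 2)) \<longlonglongrightarrow> 1" by real_asymp
    hence "(\<lambda>k. (1 - 1 / real (k + 2)) powr (1 - p)) \<longlonglongrightarrow> 1 powr (1 - p)" by (intro tendsto_powr tendsto_const) auto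
    hence "(\<lambda>k. (1 - 1 / real (k + 2)) powr (1 - p) * Xr) \<longlonglongrightarrow> 1 * Xr" by (intro tendsto_mult tendsto_const) simp
    moreover have "S * NI powr \<theta> + RI \<le> (1 - 1 / real (k + 2)) powr (1 - p) * Xr" for k by (rule s) auto
    ultimately have "S * NI powr \<theta> + RI \<le> 1 * Xr" by (intro LIMSEQ_le_const) auto
    thus ?thesis by simp
  qed
  have Nfin: "?N < \<infinity>" using FN by (auto simp: le_less_trans)
  thus "(\<integral>\<^sup>+x. ennreal (\<bar>u x\<bar> powr (n * p / (n - p))) \<partial>?M) < \<infinity>" by (simp add: ps_def)
  have "enn2real ?N \<le> NI" using enn2real_mono[OF FN] NI by simp
  hence "S * enn2real ?N powr \<theta> \<le> S * NI powr \<theta>" using S \<theta> by (intro mult_left_mono powr_mono2) auto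
  hence "ennreal (S * enn2real ?N powr \<theta>) + ?R \<le> ennreal (S * NI powr \<theta>) + ennreal RI" by (intro add_mono ennreal_leI FR)
  also have "\<dots> = ennreal (S * NI powr \<theta> + RI)" using S RI by (intro ennreal_plus[symmetric]) auto
  also have "\<dots> \<le> ?X" unfolding X(1) by (rule ennreal_leI[OF key])
  finally show "ennreal (sobolev_const n p powr p * enn2real (\<integral>\<^sup>+x. ennreal (\<bar>u x\<bar> powr (n * p / (n - p))) \<partial>?M) powr ((n - p) / n))
      + (\<integral>\<^sup>+x. ennreal (((real n - 1) / p) powr p * Rem \<bar>u x\<bar>) \<partial>?M) \<le> ?X"
    by (simp only: S_def \<theta>_def cp_def ps_def)
qed

section \<open>The inequality and its equality case\<close>

text \<open>Integrability belongs to the conclusion because the Bochner integral of a non-integrable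
  function is 0, which would make the right side meaningless. In the equality case a gain of order
  \<open>\<tau>\<close> stands against a loss of order \<open>\<tau>\<close> squared.\<close>

theorem theorem1p1:
  fixes p :: real and u :: "real^'n::finite \<Rightarrow> real" and G :: "real^'n \<Rightarrow> real^'n"
  defines "n \<equiv> CARD('n)"
  assumes "n \<ge> 4"
    and "2 * real n / (real n - 1) \<le> p" and "p < real n"
    and "(u, G) \<in> W1p p"
  shows "integrable (hyp_vol TYPE('n)) (\<lambda>x. \<bar>u x\<bar> powr (real n * p / (real n - p)))
    \<and> (\<integral>x. hyp_grad_norm G x powr p \<partial>hyp_vol TYPE('n))
        - ((real n - 1) / p) powr p * (\<integral>x. \<bar>u x\<bar> powr p \<partial>hyp_vol TYPE('n))
      \<ge> sobolev_const n p powr p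
        * (\<integral>x. \<bar>u x\<bar> powr (real n * p / (real n - p)) \<partial>hyp_vol TYPE('n))
            powr ((real n - p) / real n)
    \<and> ((\<integral>x. hyp_grad_norm G x powr p \<partial>hyp_vol TYPE('n))
        - ((real n - 1) / p) powr p * (\<integral>x. \<bar>u x\<bar> powr p \<partial>hyp_vol TYPE('n))
      = sobolev_const n p powr p
        * (\<integral>x. \<bar>u x\<bar> powr (real n * p / (real n - p)) \<partial>hyp_vol TYPE('n))
            powr ((real n - p) / real n)
      \<longleftrightarrow> (AE x in hyp_vol TYPE('n). u x = 0))"
proof -
  let ?M = "hyp_vol TYPE('n)"
  define ps where "ps = real n * p / (real n - p)"
  define \<theta> where "\<theta> = (real n - p) / real n"
  define S where "S = sobolev_const n p powr p"
  define cp where "cp = ((real n - 1) / p) powr p"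
  define \<kappa> where "\<kappa> = p * (p - 1) / (p + 1)"
  have n2: "2 \<le> n" using assms by simp
  have p2: "2 < p"
  proof -
    have "2 * (real n - 1) < 2 * real n" by simp
    hence "2 < 2 * real n / (real n - 1)" using n2 by (simp add: less_divide_eq)
    thus ?thesis using assms by simp
  qed
  have cp: "0 < cp" using n2 p2 by (simp add: cp_def)
  have \<kappa>: "0 < \<kappa>" using p2 by (simp add: \<kappa>_def)
  have um[measurable]: "u \<in> borel_measurable lebesgue" and Gm: "G \<in> borel_measurable lebesgue"
    using assms(5) unfolding W1p_def by auto
  have Hm[measurable]: "hyp_grad_norm G \<in> borel_measurable lebesgue" by (rule hyp_grad_norm_measurable[OF Gm])
  note ineq = W1p_inequality[OF n2[unfolded n_def] assms(3,4)[unfolded n_def] assms(5), folded n_def, folded ps_def \<theta>_def S_def cp_def \<kappa>_def]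
  define X where "X = (\<integral>x. hyp_grad_norm G x powr p \<partial>?M)"
  define Y where "Y = (\<integral>x. \<bar>u x\<bar> powr p \<partial>?M)"
  define N where "N = (\<integral>x. \<bar>u x\<bar> powr ps \<partial>?M)"
  define K where "K = (\<integral>x. \<bar>u x\<bar> powr (p + 1) / (1 + \<bar>u x\<bar>)\<^sup>2 \<partial>?M)"
  have Xi: "integrable ?M (\<lambda>x. hyp_grad_norm G x powr p)" by (rule integrableI_nonneg) (use ineq(1)[of 0] in auto)
  have Yi: "integrable ?M (\<lambda>x. \<bar>u x\<bar> powr p)" by (rule integrableI_nonneg) (use ineq(2)[of 0] in auto)
  have Ni: "integrable ?M (\<lambda>x. \<bar>u x\<bar> powr ps)" by (rule integrableI_nonneg) (use ineq(3)[of 0] in auto)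
  \<comment> \<open>Dominates the remainder by \<open>\<bar>u x\<bar> powr p\<close>, so that all
    integrals are finite and may be subtracted.\<close>
  have Kle: "t powr (p + 1) / (1 + t)\<^sup>2 \<le> t powr p" if "0 \<le> t" for t :: real
  proof -
    have "t \<le> (1 + t)\<^sup>2" using that by (simp add: power2_eq_square algebra_simps)
    hence "t powr p * t \<le> t powr p * (1 + t)\<^sup>2" by (intro mult_left_mono) auto
    moreover have "t powr (p + 1) = t powr p * t" using that by (simp add: powr_add)
    moreover have "0 < (1 + t)\<^sup>2" using that by simp
    ultimately show ?thesis by (simp add: pos_divide_le_eq)
  qed
  have Ki: "integrable ?M (\<lambda>x. \<bar>u x\<bar> powr (p + 1) / (1 + \<bar>u x\<bar>)\<^sup>2)"
    by (rule Bochner_Integration.integrable_bound[OF Yi]) (auto intro!: AE_I2 Kle)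
  have Y0: "0 \<le> Y" and K0: "0 \<le> K" and N0: "0 \<le> N" and X0: "0 \<le> X"
    unfolding Y_def K_def N_def X_def by (auto intro!: integral_nonneg_AE)
  have Nn: "enn2real (\<integral>\<^sup>+x. ennreal (\<bar>u x\<bar> powr ps) \<partial>?M) = N"
    unfolding nn_integral_eq_integral[OF Ni AE_I2[OF powr_ge_zero]] N_def[symmetric] using N0 by simp
  have Xn: "(\<integral>\<^sup>+x. ennreal (hyp_grad_norm G x powr p) \<partial>?M) = ennreal X"
    unfolding X_def by (rule nn_integral_eq_integral[OF Xi]) simp
  \<comment> \<open>A family of inequalities in \<open>\<tau>\<close>; \<open>\<tau> = 0\<close> is
    the inequality to be proved.\<close>
  have F: "S * N powr \<theta> + cp * ((1 - ((p - 1) * \<tau>)\<^sup>2) * Y + \<tau> * \<kappa> * K) \<le> X" if \<tau>: "0 \<le> \<tau>" "(p - 1) * \<tau> \<le> 1" for \<tau>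
  proof -
    let ?R = "\<lambda>t. (1 - ((p - 1) * \<tau>)\<^sup>2) * t powr p + \<tau> * \<kappa> * (t powr (p + 1) / (1 + t)\<^sup>2)"
    have t1: "0 \<le> 1 - ((p - 1) * \<tau>)\<^sup>2"
    proof -
      have "((p - 1) * \<tau>)\<^sup>2 \<le> 1" using \<tau> p2 by (intro power_le_one) auto
      thus ?thesis by simp
    qed
    have R0: "0 \<le> cp * ?R \<bar>u x\<bar>" for x using cp \<tau> \<kappa> t1 by simp
    have Ri: "integrable ?M (\<lambda>x. cp * ?R \<bar>u x\<bar>)"
      by (intro integrable_mult_right Bochner_Integration.integrable_add Yi Ki)
    have "(\<integral>\<^sup>+x. ennreal (cp * ?R \<bar>u x\<bar>) \<partial>?M) = ennreal (\<integral>x. cp * ?R \<bar>u x\<bar> \<partial>?M)"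
      by (rule nn_integral_eq_integral[OF Ri AE_I2[OF R0]])
    also have "(\<integral>x. cp * ?R \<bar>u x\<bar> \<partial>?M) = cp * ((1 - ((p - 1) * \<tau>)\<^sup>2) * Y + \<tau> * \<kappa> * K)"
    proof -
      have "(\<integral>x. ?R \<bar>u x\<bar> \<partial>?M) = (\<integral>x. (1 - ((p - 1) * \<tau>)\<^sup>2) * \<bar>u x\<bar> powr p \<partial>?M) + (\<integral>x. \<tau> * \<kappa> * (\<bar>u x\<bar> powr (p + 1) / (1 + \<bar>u x\<bar>)\<^sup>2) \<partial>?M)"
        by (intro Bochner_Integration.integral_add integrable_mult_right Yi Ki)
      thus ?thesis by (simp only: integral_mult_right_zero Y_def K_def)
    qed
    finally have Rn: "(\<integral>\<^sup>+x. ennreal (cp * ?R \<bar>u x\<bar>) \<partial>?M) = ennreal (cp * ((1 - ((p - 1) * \<tau>)\<^sup>2) * Y + \<tau> * \<kappa> * K))" .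
    have nn: "0 \<le> cp * ((1 - ((p - 1) * \<tau>)\<^sup>2) * Y + \<tau> * \<kappa> * K)" using cp \<tau> \<kappa> t1 Y0 K0 by simp
    have SN: "0 \<le> S * N powr \<theta>" by (simp add: S_def)
    have "ennreal (S * N powr \<theta>) + ennreal (cp * ((1 - ((p - 1) * \<tau>)\<^sup>2) * Y + \<tau> * \<kappa> * K)) \<le> ennreal X"
      using ineq(4)[OF \<tau>] unfolding Nn Xn Rn .
    hence "ennreal (S * N powr \<theta> + cp * ((1 - ((p - 1) * \<tau>)\<^sup>2) * Y + \<tau> * \<kappa> * K)) \<le> ennreal X"
      by (simp only: ennreal_plus[OF SN nn])
    thus ?thesis using X0 by (simp only: ennreal_le_iff)
  qed
  have base: "S * N powr \<theta> + cp * Y \<le> X" using F[of 0] by simp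
  have "X - cp * Y = S * N powr \<theta> \<longleftrightarrow> (AE x in ?M. u x = 0)"
  proof
    assume eq: "X - cp * Y = S * N powr \<theta>"
    \<comment> \<open>Under equality the gain \<open>\<tau> * \<kappa> * K\<close> is at most the
      loss \<open>((p - 1) * \<tau>)\<^sup>2 * Y\<close>. Division by \<open>\<tau>\<close> and the
      choice \<open>(p - 1) * \<tau> = 1 / Suc j\<close> give a bound that tends to 0, hence
      \<open>K = 0\<close>.\<close>
    have small: "\<kappa> * K \<le> (p - 1) * Y / real (Suc j)" for j
    proof -
      define \<tau> where "\<tau> = 1 / ((p - 1) * real (Suc j))"
      have \<tau>: "0 < \<tau>" "(p - 1) * \<tau> = 1 / real (Suc j)" using p2 by (auto simp: \<tau>_def)
      have "(p - 1) * \<tau> \<le> 1" unfolding \<tau>(2) by simp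
      hence "S * N powr \<theta> + cp * ((1 - ((p - 1) * \<tau>)\<^sup>2) * Y + \<tau> * \<kappa> * K) \<le> X" using \<tau>(1) by (intro F) auto
      hence "cp * ((1 - ((p - 1) * \<tau>)\<^sup>2) * Y + \<tau> * \<kappa> * K) \<le> cp * Y" using eq by linarith
      hence "(1 - ((p - 1) * \<tau>)\<^sup>2) * Y + \<tau> * \<kappa> * K \<le> Y" using cp by simp
      hence "\<tau> * (\<kappa> * K) \<le> \<tau> * ((p - 1) * ((p - 1) * \<tau>) * Y)" by (simp add: power2_eq_square algebra_simps)
      hence "\<kappa> * K \<le> (p - 1) * ((p - 1) * \<tau>) * Y" using \<tau>(1) by simp
      thus ?thesis unfolding \<tau>(2) by simp
    qed
    have "(\<lambda>j. (p - 1) * Y / real (Suc j)) \<longlonglongrightarrow> 0" by (rule LIMSEQ_Suc[OF lim_const_over_n])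
    hence "\<kappa> * K \<le> 0" by (rule LIMSEQ_le_const) (use small in blast)
    hence "K \<le> 0" using \<kappa> by (simp add: mult_le_0_iff)
    hence "K = 0" using K0 by simp
    hence "AE x in ?M. \<bar>u x\<bar> powr (p + 1) / (1 + \<bar>u x\<bar>)\<^sup>2 = 0"
      unfolding K_def by (subst (asm) integral_nonneg_eq_0_iff_AE[OF Ki]) auto
    thus "AE x in ?M. u x = 0"
    proof eventually_elim
      case (elim x)
      have "(1 + \<bar>u x\<bar>)\<^sup>2 > 0" by (rule zero_less_power) simp
      thus ?case using elim by simp
    qed
  next
    assume u0: "AE x in ?M. u x = 0"
    \<comment> \<open>\<open>G\<close> is a separate component of the pair, so closability is what
      makes the energy vanish.\<close>
    have "AE x in ?M. G x = 0"
      by (rule W1p_gradient_zero[OF assms(5) _ _ u0]) (use p2 assms(4) in \<open>auto simp: n_def\<close>)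
    hence "X = 0" unfolding X_def
      by (intro integral_eq_zero_AE) (auto elim!: eventually_mono simp: hyp_grad_norm_def)
    moreover have "Y = 0" unfolding Y_def using u0 by (intro integral_eq_zero_AE) (auto elim!: eventually_mono)
    moreover have "N = 0" unfolding N_def using u0 by (intro integral_eq_zero_AE) (auto elim!: eventually_mono)
    ultimately show "X - cp * Y = S * N powr \<theta>" by simp
  qed
  moreover have "S * N powr \<theta> \<le> X - cp * Y" using base by linarith
  ultimately show ?thesis unfolding ps_def[symmetric] \<theta>_def[symmetric] S_def[symmetric] cp_def[symmetric]
      X_def[symmetric] Y_def[symmetric] N_def[symmetric] using Ni by blast
qed

end
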